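(* Suppose there is a constant $\gamma\in[0,1/2)$ with $k_u\lesssim p^\gamma$. There exists a constant $c>0$ such that if $n\ge c\,k_u\log p$, then for any $1\le k\le k_u$ and any $\Sigma_0\in\mathbb R^{p\times p}$ satisfying $1/M_1\le\lambda_{\min}(\Sigma_0)\le\lambda_{\max}(\Sigma_0)\le M_1$, with the convention $\xi_{p+1}=0$, $$\tau_{\mathrm{adap}}(k_u,k,\Sigma_0;\xi)\ \lesssim\ \min_{0\le m\le p}\left(H(m;\xi)\frac1{\sqrt n}+|\xi_{m+1}|\,k_u\sqrt{\frac{\log p}{n}}\right).$$ Furthermore, when $\Sigma_0$ is diagonal, $$\tau_{\mathrm{adap}}(k_u,k,\Sigma_0;\xi)\ \asymp_{\log}\ \frac{\nu_1}{\sqrt n}.$$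
   Context: Model: one observes $n$ i.i.d. pairs $Z_i=(Y_i,X_{i\cdot})\in\mathbb R\times\mathbb R^p$, with $X_{i\cdot}\sim\mathcal N(0,\Sigma)$, $Y_i=X_{i\cdot}^\top\beta+\varepsilon_i$, $\varepsilon_i\sim\mathcal N(0,\sigma^2)$ independent of the $X$'s. Write $\theta=(\beta,\Sigma,\sigma)$, and $\mathbb E_\theta$ for expectation under the law of the data $\mathcal Z=(Z_1,\dots,Z_n)$. Here $\Sigma=\Sigma_0$ is known and symmetric. $M_1>1$, $M_2>0$ are fixed constants. For $t_0\in\mathbb R$, $\tau>0$, $$\Theta(k,\Sigma_0;\xi,t_0)=\{(\beta,\Sigma_0,\sigma):\|\beta\|_0\le k,\ 0<\sigma\le M_2,\ \xi^\top\beta=t_0\},$$ $$\Theta_{\pm\tau}(k,\Sigma_0;\xi,t_0)=\{(\beta,\Sigma_0,\sigma):\|\beta\|_0\le k,\ 0<\sigma\le M_2,\ |\xi^\top\beta-t_0|\ge\tau\}.$$ $\Psi_\alpha(\Theta)$ is the set of tests $\psi=\psi(\mathcal Z)\in[0,1]$ (which may depend on the known $\Sigma_0$) with $\sup_{\theta\in\Theta}\mathbb E_\theta\psi\le\alpha$. For fixed $\alpha,\eta\in(0,1)$ with $\alpha+\eta<1$, $$\tau_{\mathrm{adap}}(k_u,k,\Sigma_0;\xi)=\inf\Big\{\tau:\ \sup_{\psi\in\Psi_\alpha(\Theta(k_u,\Sigma_0;\xi,t_0))}\ \inf_{\theta\in\Theta_{\pm\tau}(k,\Sigma_0;\xi,t_0)}\mathbb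 E_\theta\psi\ge1-\eta\Big\}.$$ Loading quantities: $\xi\in\mathbb R^p$ is nonzero, ordered so that $|\xi_1|\ge\dots\ge|\xi_p|$, $k_\xi=\|\xi\|_0$. For $t>0$, $H(t;\xi)=\big(\sum_{j\le\lceil t\rceil\wedge p}\xi_j^2\big)^{1/2}$, and $H(0;\xi)=0$. Let $\zeta\in\mathbb R$ be the unique solution of $$\frac{\sum_{j=1}^{k_\xi}|\xi_j|\exp(-\zeta/\xi_j^2)}{\sqrt{\sum_{j=1}^{k_\xi}\xi_j^2\exp(-\zeta/\xi_j^2)}}=\frac{k_u}{2},$$ $\lambda=\sqrt{\max(\zeta,0)}$, and $\nu_1=\lambda k_u+\sqrt{\sum_{j=1}^{k_\xi}\xi_j^2\exp(-\lambda^2/\xi_j^2)}$. Asymptotics: $n,p,k_u\to\infty$ along a sequence; $M_1,M_2,\alpha,\eta,\gamma$ are fixed; $k,\xi,t_0,\Sigma_0$ may vary along the sequence. $a\lesssim b$ means $a\le Cb$ for a constant $C>0$ along the sequence (for all sufficiently large $n$); $a\asymp_{\log}b$ means that $a\lesssim b$ and $b\lesssim a$ hold up to logarithmic factors in $p$ (multiplicative factors that are powers of $\log p$). *)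

theory Defs
  imports
    "HOL-Probability.Probability"
    "Jordan_Normal_Form.Gauss_Jordan_Elimination"
    "Jordan_Normal_Form.Spectral_Radius"
begin

unbundle no vec_syntax and no inner_syntax
no_notation lepoll (infixl \<open>\<lesssim>\<close> 50)

text \<open>
  The dimension \<open>p\<close> varies along the sequence, so coefficient and loading vectors and the covariance
  matrix are dimension-carrying vectors and matrices; their indices start at 0, so the entry
  \<open>\<xi>\<^sub>j\<close> of the mathematical text is \<^term>\<open>(\<xi> :: real Matrix.vec) $ (j - 1)\<close>.  Random covariate rows live
  in the product space over \<^term>\<open>{..<p}\<close> and are converted by \<^const>\<open>Matrix.vec\<close>.
\<close>

subsection \<open>The Gaussian linear model\<close>

text \<open>
  The law \<open>N(0, S)\<close> on \<open>\<real>\<^sup>p\<close>, given by its Lebesgue density; only used for positive definite \<open>S\<close>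
  (otherwise the value has no meaning).
\<close>
definition mvn_density :: "nat \<Rightarrow> real mat \<Rightarrow> (nat \<Rightarrow> real) \<Rightarrow> real" where
  "mvn_density p S x =
     exp (- (vec p x \<bullet> (the (mat_inverse S) *\<^sub>v vec p x)) / 2) / sqrt ((2 * pi) ^ p * Determinant.det S)"

definition mvn :: "nat \<Rightarrow> real mat \<Rightarrow> (nat \<Rightarrow> real) measure" where
  "mvn p S = density (Pi\<^sub>M {..<p} (\<lambda>_. lborel)) (\<lambda>x. ennreal (mvn_density p S x))"

text \<open>A parameter is a triple \<open>(\<beta>, \<Sigma>, \<sigma>)\<close>; \<open>\<sigma>\<close> is the standard deviation of the noise.\<close>
type_synonym param = "real Matrix.vec \<times> real mat \<times> real"

type_synonym obs = "real \<times> (nat \<Rightarrow> real)"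

definition obs_space :: "nat \<Rightarrow> obs measure" where
  "obs_space p = borel \<Otimes>\<^sub>M Pi\<^sub>M {..<p} (\<lambda>_. borel)"

definition obs_law :: "nat \<Rightarrow> param \<Rightarrow> obs measure" where
  "obs_law p = (\<lambda>(\<beta>, S, \<sigma>).
     distr (mvn p S \<Otimes>\<^sub>M density lborel (\<lambda>e. ennreal (normal_density 0 \<sigma> e))) (obs_space p)
       (\<lambda>(x, e). (vec p x \<bullet> \<beta> + e, x)))"

definition data_space :: "nat \<Rightarrow> nat \<Rightarrow> (nat \<Rightarrow> obs) measure" where
  "data_space n p = Pi\<^sub>M {..<n} (\<lambda>_. obs_space p)"

definition data_law :: "nat \<Rightarrow> nat \<Rightarrow> param \<Rightarrow> (nat \<Rightarrow> obs) measure" where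
  "data_law n p \<theta> = Pi\<^sub>M {..<n} (\<lambda>_. obs_law p \<theta>)"

text \<open>Extended reals are used so that suprema and infima, including those over empty sets, have
  their usual meaning (\<open>inf {} = \<infinity>\<close>).\<close>
definition expect :: "nat \<Rightarrow> nat \<Rightarrow> param \<Rightarrow> ((nat \<Rightarrow> obs) \<Rightarrow> real) \<Rightarrow> ereal" where
  "expect n p \<theta> \<psi> = ereal (\<integral>z. \<psi> z \<partial>data_law n p \<theta>)"

subsection \<open>Parameter spaces, tests and the adaptive detection boundary\<close>

definition l0norm :: "real Matrix.vec \<Rightarrow> nat" where
  "l0norm v = card {j. j < dim_vec v \<and> v $ j \<noteq> 0}"

definition Theta_null :: "real \<Rightarrow> nat \<Rightarrow> real mat \<Rightarrow> real Matrix.vec \<Rightarrow> real \<Rightarrow> param set" where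
  "Theta_null M\<^sub>2 k \<Sigma>\<^sub>0 \<xi> t\<^sub>0 =
     {(\<beta>, \<Sigma>\<^sub>0, \<sigma>) | \<beta> \<sigma>. \<beta> \<in> carrier_vec (dim_vec \<xi>) \<and> l0norm \<beta> \<le> k \<and> 0 < \<sigma> \<and> \<sigma> \<le> M\<^sub>2 \<and> \<xi> \<bullet> \<beta> = t\<^sub>0}"

definition Theta_alt :: "real \<Rightarrow> nat \<Rightarrow> real mat \<Rightarrow> real Matrix.vec \<Rightarrow> real \<Rightarrow> real \<Rightarrow> param set" where
  "Theta_alt M\<^sub>2 k \<Sigma>\<^sub>0 \<xi> t\<^sub>0 \<tau> =
     {(\<beta>, \<Sigma>\<^sub>0, \<sigma>) | \<beta> \<sigma>. \<beta> \<in> carrier_vec (dim_vec \<xi>) \<and> l0norm \<beta> \<le> k \<and> 0 < \<sigma> \<and> \<sigma> \<le> M\<^sub>2 \<and> \<bar>\<xi> \<bullet> \<beta> - t\<^sub>0\<bar> \<ge> \<tau>}"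

definition tests :: "nat \<Rightarrow> nat \<Rightarrow> real \<Rightarrow> param set \<Rightarrow> ((nat \<Rightarrow> obs) \<Rightarrow> real) set" where
  "tests n p \<alpha> \<Theta> =
     {\<psi> \<in> borel_measurable (data_space n p).
        (\<forall>z \<in> space (data_space n p). 0 \<le> \<psi> z \<and> \<psi> z \<le> 1) \<and> (SUP \<theta>\<in>\<Theta>. expect n p \<theta> \<psi>) \<le> ereal \<alpha>}"

definition tau_adap ::
  "real \<Rightarrow> real \<Rightarrow> real \<Rightarrow> nat \<Rightarrow> nat \<Rightarrow> real \<Rightarrow> nat \<Rightarrow> nat \<Rightarrow> real mat \<Rightarrow> real Matrix.vec \<Rightarrow> ereal" where
  "tau_adap M\<^sub>2 \<alpha> \<eta> n p t\<^sub>0 k\<^sub>u k \<Sigma>\<^sub>0 \<xi> =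
     Inf {ereal \<tau> | \<tau>. \<tau> > 0 \<and>
       (SUP \<psi> \<in> tests n p \<alpha> (Theta_null M\<^sub>2 k\<^sub>u \<Sigma>\<^sub>0 \<xi> t\<^sub>0).
          INF \<theta> \<in> Theta_alt M\<^sub>2 k \<Sigma>\<^sub>0 \<xi> t\<^sub>0 \<tau>. expect n p \<theta> \<psi>) \<ge> ereal (1 - \<eta>)}"

subsection \<open>Extreme eigenvalues\<close>

text \<open>Only used for real symmetric matrices of positive dimension, whose set of (real) eigenvalues
  is finite and nonempty.\<close>
definition lambda_min :: "real mat \<Rightarrow> real" where
  "lambda_min S = Min (spectrum S)"

definition lambda_max :: "real mat \<Rightarrow> real" where
  "lambda_max S = Max (spectrum S)"

subsection \<open>Loading quantities\<close>

definition is_loading :: "nat \<Rightarrow> real Matrix.vec \<Rightarrow> bool" where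
  "is_loading p \<xi> \<longleftrightarrow> \<xi> \<in> carrier_vec p \<and> \<xi> \<noteq> 0\<^sub>v p \<and> (\<forall>i j. i \<le> j \<and> j < p \<longrightarrow> \<bar>\<xi> $ j\<bar> \<le> \<bar>\<xi> $ i\<bar>)"

text \<open>The case \<open>t = 0\<close> (empty sum) gives \<open>H(0; \<xi>) = 0\<close>.\<close>
definition H_load :: "real \<Rightarrow> real Matrix.vec \<Rightarrow> real" where
  "H_load t \<xi> = sqrt (\<Sum>j < min (nat \<lceil>t\<rceil>) (dim_vec \<xi>). (\<xi> $ j)\<^sup>2)"

text \<open>The absolute value of the entry following the first \<open>m\<close> ones, that is \<open>\<bar>\<xi>\<^sub>m\<^sub>+\<^sub>1\<bar>\<close> in 1-based
  numbering, with \<open>\<xi>\<^sub>p\<^sub>+\<^sub>1 = 0\<close>.\<close>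
definition next_abs :: "real Matrix.vec \<Rightarrow> nat \<Rightarrow> real" where
  "next_abs \<xi> m = (if m < dim_vec \<xi> then \<bar>\<xi> $ m\<bar> else 0)"

definition upper_rate :: "nat \<Rightarrow> nat \<Rightarrow> nat \<Rightarrow> real Matrix.vec \<Rightarrow> real" where
  "upper_rate n p k\<^sub>u \<xi> =
     (MIN m\<in>{0..p}. H_load (real m) \<xi> * (1 / sqrt (real n))
        + next_abs \<xi> m * real k\<^sub>u * sqrt (ln (real p) / real n))"

text \<open>By the ordering of \<open>\<xi>\<close> the first \<^term>\<open>l0norm \<xi>\<close> entries are exactly the nonzero ones, so no
  division by zero occurs below.\<close>
definition zeta :: "nat \<Rightarrow> real Matrix.vec \<Rightarrow> real" where
  "zeta k\<^sub>u \<xi> = (THE z.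
     (\<Sum>j < l0norm \<xi>. \<bar>\<xi> $ j\<bar> * exp (- z / (\<xi> $ j)\<^sup>2))
       / sqrt (\<Sum>j < l0norm \<xi>. (\<xi> $ j)\<^sup>2 * exp (- z / (\<xi> $ j)\<^sup>2)) = real k\<^sub>u / 2)"

definition lam :: "nat \<Rightarrow> real Matrix.vec \<Rightarrow> real" where
  "lam k\<^sub>u \<xi> = sqrt (max (zeta k\<^sub>u \<xi>) 0)"

definition nu1 :: "nat \<Rightarrow> real Matrix.vec \<Rightarrow> real" where
  "nu1 k\<^sub>u \<xi> = lam k\<^sub>u \<xi> * real k\<^sub>u
     + sqrt (\<Sum>j < l0norm \<xi>. (\<xi> $ j)\<^sup>2 * exp (- (lam k\<^sub>u \<xi>)\<^sup>2 / (\<xi> $ j)\<^sup>2))"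

subsection \<open>Asymptotic comparison along a sequence\<close>

definition lesssim :: "(nat \<Rightarrow> ereal) \<Rightarrow> (nat \<Rightarrow> ereal) \<Rightarrow> bool" (infix \<open>\<lesssim>\<close> 50) where
  "a \<lesssim> b \<longleftrightarrow> (\<exists>C::real. C > 0 \<and> (\<forall>\<^sub>F i in sequentially. a i \<le> ereal C * b i))"

definition asymp_log :: "(nat \<Rightarrow> nat) \<Rightarrow> (nat \<Rightarrow> ereal) \<Rightarrow> (nat \<Rightarrow> ereal) \<Rightarrow> bool" where
  "asymp_log p a b \<longleftrightarrow> (\<exists>r::real. r \<ge> 0 \<and>
     a \<lesssim> (\<lambda>i. ereal (ln (real (p i)) powr r) * b i) \<and>
     b \<lesssim> (\<lambda>i. ereal (ln (real (p i)) powr r) * a i))"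

end

theory Submission
  imports Defs
begin

text \<open>
  Upper bound.  The first half of the sample selects a \<open>k\<^sub>u\<close>-sparse vector \<open>b\<close> for which
  \<open>X\<^sup>T (Y - X b)\<close> is uniformly of the order of the noise.  Since \<open>n\<close> exceeds a large multiple of
  \<open>k\<^sub>u log p\<close>, the smallest \<open>2 k\<^sub>u\<close>-sparse eigenvalue of the design is bounded below, so \<open>b\<close> has bounded
  Euclidean error and \<open>\<ell>\<^sub>1\<close>-error of order \<open>k\<^sub>u sqrt (log p / n)\<close>, however large \<open>\<beta>\<close> is.  As \<open>\<Sigma>\<^sub>0\<close> is known,
  the contribution of the first \<open>m\<close> loadings can be debiased on the second half with direction
  \<open>u = \<Sigma>\<^sub>0\<^sup>-\<^sup>1 \<xi>\<^sub>[\<^sub>m\<^sub>]\<close>; conditionally on \<open>b\<close> this is an average of independent variables, with error of order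
  \<open>H(m; \<xi>) / sqrt n\<close>, while the remaining loadings cost at most \<open>\<bar>\<xi>\<^sub>m\<^sub>+\<^sub>1\<bar>\<close> times the \<open>\<ell>\<^sub>1\<close>-error.

  Lower bound.  A one-sparse alternative is compared with a mixture of null parameters which perturb one
  coordinate in each of at most \<open>k\<^sub>u - 1\<close> blocks among the first \<open>m\<close> coordinates.  Lowering the noise
  variance so that \<open>Y\<close> keeps its law makes the product of two likelihood ratios integrate to
  \<open>(1 - w / \<sigma>\<^sup>2)\<^sup>-\<^sup>n\<close>, where \<open>w\<close> is the variance of the overlap, and the overlap is a sum of independent
  indicators.  This gives the rate \<open>min (sqrt m) k\<^sub>u \<bar>\<xi>\<^sub>m\<bar> / sqrt n\<close> for every \<open>m\<close>; both this bound and
  the upper bound agree with \<open>\<nu>\<^sub>1 / sqrt n\<close> up to a factor \<open>log p\<close>.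
\<close>

section \<open>Quadratic forms and extreme eigenvalues\<close>

text \<open>Why the noise variance is lowered: with the variance kept fixed, the product of two
  likelihood ratios would integrate, per observation and in units of the noise variance, to ((1 -
  w)^2 - A B)^(-1/2), where A and B are the variances of the two perturbations. With s perturbed
  coordinates of squared size of order 1 / n, the quantity n A B is of order s^2 / n, which need not
  stay bounded when s is of order k_u and n of order k_u log p. Keeping the law of Y removes A B and
  leaves only the overlap w. The rates of the two bounds are compared through a hub,
  \<open>trade\<close>, which is H(m) + |xi_(m+1)| k_u. At one well chosen m it is at most 2 nu_1;
  at every m, nu_1 is at most 5 sqrt (log p) times it; at m = min (k_u^2) p it is at most 3 sqrt
  (log p) times the largest level reached by the lower bound. Since the upper bound is
  \<open>trade\<close> / sqrt n up to a factor log p, all these quantities agree up to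
  logarithms.\<close>

definition qf :: "nat \<Rightarrow> real mat \<Rightarrow> (nat \<Rightarrow> real) \<Rightarrow> (nat \<Rightarrow> real) \<Rightarrow> real" where
  "qf p S u v = (\<Sum>i<p. \<Sum>j<p. u i * S $$ (i, j) * v j)"

definition sqn :: "nat \<Rightarrow> (nat \<Rightarrow> real) \<Rightarrow> real" where
  "sqn p v = (\<Sum>j<p. (v j)\<^sup>2)"

definition sdot :: "nat \<Rightarrow> (nat \<Rightarrow> real) \<Rightarrow> (nat \<Rightarrow> real) \<Rightarrow> real" where
  "sdot p u v = (\<Sum>j<p. u j * v j)"

definition pos_def :: "nat \<Rightarrow> real mat \<Rightarrow> bool" where
  "pos_def p S \<longleftrightarrow> S \<in> carrier_mat p p \<and> (\<forall>i<p. \<forall>j<p. S $$ (i, j) = S $$ (j, i)) \<and>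
     (\<forall>v. (\<exists>j<p. v j \<noteq> 0) \<longrightarrow> 0 < qf p S v v)"

lemma qf_add_left: "qf p S (\<lambda>i. u i + u' i) v = qf p S u v + qf p S u' v"
  by (simp add: qf_def algebra_simps sum.distrib)

lemma qf_add_right: "qf p S u (\<lambda>i. v i + v' i) = qf p S u v + qf p S u v'"
  by (simp add: qf_def algebra_simps sum.distrib)

lemma qf_scale_left: "qf p S (\<lambda>i. c * u i) v = c * qf p S u v"
  by (simp add: qf_def sum_distrib_left mult.assoc)

lemma qf_scale_right: "qf p S u (\<lambda>i. c * v i) = c * qf p S u v"
  by (simp add: qf_def sum_distrib_left mult_ac)

lemma qf_diff_left: "qf p S (\<lambda>i. u i - u' i) v = qf p S u v - qf p S u' v"
  by (simp add: qf_def algebra_simps sum_subtractf)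

lemma qf_diff_right: "qf p S u (\<lambda>i. v i - v' i) = qf p S u v - qf p S u v'"
  by (simp add: qf_def algebra_simps sum_subtractf)

lemma qf_commute:
  assumes "\<forall>i<p. \<forall>j<p. S $$ (i, j) = S $$ (j, i)"
  shows "qf p S u v = qf p S v u"
  unfolding qf_def by (subst sum.swap) (use assms in \<open>auto intro!: sum.cong simp: mult_ac\<close>)

lemma qf_mult_vec:
  assumes "S \<in> carrier_mat p p"
  shows "qf p S u v = (\<Sum>i<p. u i * (S *\<^sub>v vec p v) $ i)"
  using assms by (auto simp: qf_def scalar_prod_def sum_distrib_left mult.assoc lessThan_atLeast0 intro!: sum.cong)

lemma qf_unit:
  assumes "i < p" "j < p"
  shows "qf p S (\<lambda>l. if l = i then a else 0) (\<lambda>l. if l = j then b else 0) = a * S $$ (i, j) * b"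
proof -
  have "qf p S (\<lambda>l. if l = i then a else 0) (\<lambda>l. if l = j then b else 0) =
    (\<Sum>k<p. if k = i then \<Sum>l<p. if l = j then a * S $$ (i, j) * b else 0 else 0)"
    unfolding qf_def using assms
    by (intro sum.cong refl) (auto simp: if_distrib[where f="\<lambda>x. _ * x"] sum.delta cong: if_cong)
  also have "\<dots> = a * S $$ (i, j) * b"
    using assms by (simp add: sum.delta)
  finally show ?thesis .
qed

lemma sqn_nonneg: "0 \<le> sqn p v"
  by (simp add: sqn_def sum_nonneg)

lemma sqn_pos: "j < p \<Longrightarrow> v j \<noteq> 0 \<Longrightarrow> 0 < sqn p v"
  unfolding sqn_def by (rule sum_pos2[of _ j]) auto

lemma vec_scalar_prod: "v \<in> carrier_vec p \<Longrightarrow> vec p x \<bullet> v = (\<Sum>j<p. x j * v $ j)"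
  by (auto simp: scalar_prod_def lessThan_atLeast0)

text \<open>A minimiser of the Rayleigh quotient is an eigenvector.\<close>
lemma rayleigh_min:
  assumes S: "S \<in> carrier_mat p p" and sym: "\<forall>i<p. \<forall>j<p. S $$ (i, j) = S $$ (j, i)" and p: "0 < p"
  shows "\<exists>t\<in>spectrum S. \<forall>v. t * sqn p v \<le> qf p S v v"
proof -
  \<comment> \<open>A cube in the first \<open>p\<close> coordinates and zero elsewhere is compact
    for the product topology, although the space of all functions is infinite-dimensional.
    \<open>K\<close> is the unit sphere inside it.\<close>
  define B where "B = (\<Pi>\<^sub>E i\<in>UNIV::nat set. if i < p then {-1..1::real} else {0})"
  have "compactin (product_topology (\<lambda>i::nat. euclidean) UNIV) B"
    unfolding B_def by (subst compactin_PiE) auto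
  then have cB: "compact B"
    unfolding euclidean_product_topology compactin_euclidean_iff .
  have cont_j: "continuous_on UNIV (\<lambda>v::nat\<Rightarrow>real. v j)" for j
    by (rule continuous_on_product_coordinates)
  have cont_sqn: "continuous_on UNIV (sqn p)"
    unfolding sqn_def by (intro continuous_intros cont_j)
  have cont_q: "continuous_on UNIV (\<lambda>v. qf p S v v)"
    unfolding qf_def by (intro continuous_intros cont_j)
  define K where "K = B \<inter> {v. sqn p v = 1}"
  have "closed {v. sqn p v = 1}"
    by (intro closed_Collect_eq cont_sqn continuous_on_const)
  then have cK: "compact K" unfolding K_def using cB by (rule compact_Int_closed[rotated])
  have "(\<lambda>i. if i = 0 then 1 else 0) \<in> K"
    using p by (auto simp: K_def B_def sqn_def PiE_def Pi_def if_distrib[where f="\<lambda>x. x^2"] cong: if_cong)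
  then have "K \<noteq> {}" by auto
  from continuous_attains_inf[OF cK this continuous_on_subset[OF cont_q]]
  obtain v where v: "v \<in> K" and vmin: "\<And>w. w \<in> K \<Longrightarrow> qf p S v v \<le> qf p S w w" by auto
  define t where "t = qf p S v v"
  have v1: "sqn p v = 1" using v by (simp add: K_def)
  have min: "t * sqn p w \<le> qf p S w w" for w
  proof (cases "sqn p w = 0")
    case True
    then have "w j = 0" if "j < p" for j using that sqn_pos[of j p w] by auto
    then have "qf p S w w = 0" unfolding qf_def by (intro sum.neutral ballI) auto
    with True show ?thesis by simp
  next
    case False
    with sqn_nonneg[of p w] have w: "0 < sqn p w" by simp
    define c where "c = sqrt (sqn p w)"
    have c: "0 < c" "c\<^sup>2 = sqn p w" using w by (auto simp: c_def)
    define w' where "w' = (\<lambda>i. if i < p then (1/c) * w i else 0)"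
    have le: "\<bar>w i\<bar> \<le> c" if "i < p" for i
    proof -
      have "(w i)\<^sup>2 \<le> sqn p w" unfolding sqn_def using that by (intro member_le_sum) auto
      then show ?thesis unfolding c_def by (metis real_sqrt_abs real_sqrt_le_iff)
    qed
    have s: "sqn p w' = 1"
    proof -
      have "sqn p w' = (\<Sum>i<p. (1/c)\<^sup>2 * (w i)\<^sup>2)" unfolding sqn_def w'_def by (intro sum.cong) (auto simp: power_mult_distrib power_divide)
      also have "\<dots> = (1/c)\<^sup>2 * sqn p w" by (simp add: sqn_def sum_distrib_left)
      finally show ?thesis using c(1) unfolding c(2)[symmetric] by (simp add: power_divide)
    qed
    have "\<bar>w' i\<bar> \<le> 1" for i
      using le[of i] c(1) by (auto simp: w'_def abs_mult divide_le_eq)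
    then have "- 1 \<le> w' i \<and> w' i \<le> 1" for i
      by (meson abs_le_iff minus_le_iff)
    then have "w' \<in> K" unfolding K_def B_def using s by (auto simp: PiE_def Pi_def) (simp add: w'_def)
    from vmin[OF this] have "t \<le> qf p S w' w'" by (simp add: t_def)
    also have "qf p S w' w' = qf p S (\<lambda>i. (1/c) * w i) (\<lambda>i. (1/c) * w i)"
      unfolding qf_def w'_def by (intro sum.cong) auto
    also have "\<dots> = qf p S w w / c\<^sup>2"
      unfolding qf_scale_left qf_scale_right by (simp add: power2_eq_square)
    finally show ?thesis using c w by (simp add: field_simps)
  qed
  \<comment> \<open>Half the derivative, at the minimiser \<open>v\<close> in direction
    \<open>w\<close>, of the form minus \<open>t\<close> times the squared norm. Its vanishing is
    the eigenvalue equation tested against \<open>w\<close>.\<close>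
  define g where "g w = qf p S v w - t * sdot p v w" for w
  have g0: "g w = 0" for w
  proof (rule ccontr)
    assume ne: "g w \<noteq> 0"
    define D where "D = qf p S w w - t * sqn p w"
    have D: "0 \<le> D" using min[of w] by (simp add: D_def)
    have ineq: "0 \<le> 2 * x * g w + x\<^sup>2 * D" for x
    proof -
      have "sqn p (\<lambda>i. v i + x * w i) = sqn p v + 2 * x * sdot p v w + x\<^sup>2 * sqn p w"
        by (simp add: sqn_def sdot_def power2_sum sum.distrib sum_distrib_left power_mult_distrib mult_ac)
      moreover have "qf p S (\<lambda>i. v i + x * w i) (\<lambda>i. v i + x * w i) = qf p S v v + 2 * x * qf p S v w + x\<^sup>2 * qf p S w w"
        unfolding qf_add_left qf_add_right qf_scale_left qf_scale_right qf_commute[OF sym, of w v]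
        by (simp add: power2_eq_square algebra_simps)
      ultimately show ?thesis using min[of "\<lambda>i. v i + x * w i"] v1
        by (simp add: g_def D_def t_def algebra_simps)
    qed
    \<comment> \<open>A step against the sign of \<open>g w\<close>; dividing by
      \<open>D + 1\<close> instead of \<open>D\<close> keeps it defined when \<open>D\<close> is
      0.\<close>
    have "0 \<le> 2 * (- g w / (D + 1)) * g w + (- g w / (D + 1))\<^sup>2 * D" by (rule ineq)
    also have "\<dots> = - ((g w)\<^sup>2 * (D + 2)) / (D + 1)\<^sup>2"
    proof -
      have "2 * (- y / d) * y + (- y / d)\<^sup>2 * (d - 1) = - (y\<^sup>2 * (d + 1)) / d\<^sup>2" if "d \<noteq> 0" for y d :: real
        using that by (simp add: divide_simps power2_eq_square) (simp add: algebra_simps)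
      from this[of "D + 1" "g w"] D show ?thesis by (simp add: algebra_simps)
    qed
    also have "\<dots> < 0" using D ne by (simp add: divide_less_0_iff zero_less_mult_iff mult_less_0_iff add_pos_pos add_nonneg_pos)
    finally show False by simp
  qed
  have "S *\<^sub>v vec p v = t \<cdot>\<^sub>v vec p v"
  proof (rule eq_vecI)
    fix i assume "i < dim_vec (t \<cdot>\<^sub>v vec p v)"
    then have i: "i < p" by simp
    have "qf p S v (\<lambda>l. if l = i then 1 else 0) = t * sdot p v (\<lambda>l. if l = i then 1 else 0)"
      using g0 by (simp add: g_def)
    also have "sdot p v (\<lambda>l. if l = i then 1 else 0) = v i"
      using i by (simp add: sdot_def if_distrib[where f="\<lambda>x. _ * x"] sum.delta cong: if_cong)
    also have "qf p S v (\<lambda>l. if l = i then 1 else 0) = (S *\<^sub>v vec p v) $ i"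
    proof -
      have "qf p S v (\<lambda>l. if l = i then 1 else 0) = qf p S (\<lambda>l. if l = i then 1 else 0) v"
        by (rule qf_commute[OF sym])
      also have "\<dots> = (\<Sum>k<p. if k = i then (S *\<^sub>v vec p v) $ i else 0)"
        unfolding qf_mult_vec[OF S] by (intro sum.cong) auto
      finally show ?thesis using i by simp
    qed
    finally show "(S *\<^sub>v vec p v) $ i = (t \<cdot>\<^sub>v vec p v) $ i" using i by simp
  qed (use S in auto)
  moreover have "vec p v \<noteq> 0\<^sub>v p"
  proof
    assume "vec p v = 0\<^sub>v p"
    then have "v j = 0" if "j < p" for j using that by (metis index_vec index_zero_vec(1))
    then show False using v1 by (simp add: sqn_def)
  qed
  ultimately have "eigenvalue S t"
    unfolding eigenvalue_def eigenvector_def using S by (intro exI[of _ "vec p v"]) auto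
  then show ?thesis using min by (auto simp: spectrum_def)
qed

lemma qf_uminus: "S \<in> carrier_mat p p \<Longrightarrow> qf p (- S) u v = - qf p S u v"
  by (auto simp: qf_def sum_negf intro!: sum.cong)

text \<open>The lower bound is the Rayleigh minimum of \<open>S\<close>. The upper one is the
  Rayleigh minimum of \<open>- S\<close>, whose eigenvalue \<open>s\<close> makes \<open>- s\<close>
  an eigenvalue of \<open>S\<close>.\<close>

lemma eigen_bounds:
  assumes S: "S \<in> carrier_mat p p" and sym: "transpose_mat S = S" and p: "0 < p"
    and lo: "a \<le> lambda_min S" and hi: "lambda_max S \<le> b"
  shows "a * sqn p v \<le> qf p S v v" "qf p S v v \<le> b * sqn p v"
proof -
  have sym': "\<forall>i<p. \<forall>j<p. S $$ (i, j) = S $$ (j, i)"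
    using S sym by (metis carrier_matD index_transpose_mat(1))
  have fin: "finite (spectrum S)" using S by (rule card_finite_spectrum(1))
  obtain t where t: "t \<in> spectrum S" "\<And>v. t * sqn p v \<le> qf p S v v"
    using rayleigh_min[OF S sym' p] by blast
  have "a \<le> t" using lo Min_le[OF fin t(1)] unfolding lambda_min_def by simp
  then show "a * sqn p v \<le> qf p S v v"
    using t(2)[of v] mult_right_mono[of a t "sqn p v"] sqn_nonneg[of p v] by linarith
  obtain s where s: "s \<in> spectrum (- S)" "\<And>v. s * sqn p v \<le> qf p (- S) v v"
    using rayleigh_min[of "- S" p] S sym' p by auto
  from s(1) obtain w where w: "w \<in> carrier_vec p" "w \<noteq> 0\<^sub>v p" "(- S) *\<^sub>v w = s \<cdot>\<^sub>v w"
    using S by (auto simp: spectrum_def eigenvalue_def eigenvector_def)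
  have "S *\<^sub>v w = (- s) \<cdot>\<^sub>v w"
  proof (rule eq_vecI)
    fix i assume "i < dim_vec ((- s) \<cdot>\<^sub>v w)"
    then have i: "i < p" using w by simp
    have "((- S) *\<^sub>v w) $ i = - ((S *\<^sub>v w) $ i)"
      using i S w(1) by (auto simp: scalar_prod_def sum_negf)
    with w(3) i w(1) show "(S *\<^sub>v w) $ i = ((- s) \<cdot>\<^sub>v w) $ i" by auto
  qed (use S w in auto)
  then have "- s \<in> spectrum S"
    using S w by (auto simp: spectrum_def eigenvalue_def eigenvector_def)
  then have "- s \<le> b" using hi Max_ge[OF fin] unfolding lambda_max_def by (meson order_trans)
  then have "- (b * sqn p v) \<le> s * sqn p v"
    using mult_right_mono[of "-s" b "sqn p v"] sqn_nonneg[of p v] by simp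
  with s(2)[of v] S show "qf p S v v \<le> b * sqn p v" by (simp add: qf_uminus)
qed

section \<open>The standard normal distribution\<close>

definition gau :: "real measure" where
  "gau = density lborel (\<lambda>x. ennreal (std_normal_density x))"

lemma sets_gau[measurable_cong, simp]: "sets gau = sets borel"
  by (simp add: gau_def)

lemma space_gau[simp]: "space gau = UNIV"
  by (simp add: gau_def)

lemma prob_space_gau: "prob_space gau"
  unfolding gau_def by (rule prob_space_normal_density) simp

interpretation gau: prob_space gau
  by (rule prob_space_gau)

lemma emeasure_gau_UNIV[simp]: "emeasure gau UNIV = 1"
  using gau.emeasure_space_1 by simp

lemma nn_integral_gau_const: "(\<integral>\<^sup>+x. c \<partial>gau) = c"
  using gau.emeasure_space_1 by simp

lemma nn_integral_gau:
  "f \<in> borel_measurable borel \<Longrightarrow> (\<integral>\<^sup>+x. f x \<partial>gau) = (\<integral>\<^sup>+x. ennreal (std_normal_density x) * f x \<partial>lborel)"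
  unfolding gau_def by (subst nn_integral_density) auto

lemma normal_density_scale:
  "0 < s \<Longrightarrow> s * normal_density m s (m + s * x) = std_normal_density x"
  by (simp add: normal_density_def real_sqrt_mult power_mult_distrib)

lemma nn_integral_normal_eq_gau:
  assumes f[measurable]: "f \<in> borel_measurable borel" and s: "0 < s"
  shows "(\<integral>\<^sup>+y. ennreal (normal_density m s y) * f y \<partial>lborel) = (\<integral>\<^sup>+h. f (m + s * h) \<partial>gau)"
proof -
  have "(\<integral>\<^sup>+y. ennreal (normal_density m s y) * f y \<partial>lborel) =
      ennreal s * (\<integral>\<^sup>+x. ennreal (normal_density m s (m + s * x)) * f (m + s * x) \<partial>lborel)"
    using nn_integral_real_affine[of "\<lambda>y. ennreal (normal_density m s y) * f y" s m] s by simp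
  also have "\<dots> = (\<integral>\<^sup>+x. ennreal (s * normal_density m s (m + s * x)) * f (m + s * x) \<partial>lborel)"
    using s by (subst nn_integral_cmult[symmetric]) (auto simp: ennreal_mult mult.assoc)
  also have "\<dots> = (\<integral>\<^sup>+h. f (m + s * h) \<partial>gau)"
    using s by (subst nn_integral_gau) (simp_all add: normal_density_scale)
  finally show ?thesis .
qed

lemma nn_integral_gau_uminus:
  assumes [measurable]: "f \<in> borel_measurable borel"
  shows "(\<integral>\<^sup>+h. f (- h) \<partial>gau) = (\<integral>\<^sup>+h. f h \<partial>gau)"
proof -
  have "(\<integral>\<^sup>+h. f h \<partial>gau) = (\<integral>\<^sup>+x. ennreal (std_normal_density (0 + (-1) * x)) * f (0 + (-1) * x) \<partial>lborel)"
    unfolding nn_integral_gau[OF assms]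
    by (subst nn_integral_real_affine[of _ "-1" 0]) simp_all
  also have "\<dots> = (\<integral>\<^sup>+h. f (- h) \<partial>gau)"
    by (subst nn_integral_gau) (simp_all add: normal_density_def)
  finally show ?thesis by simp
qed

lemma nn_integral_gau_abs:
  assumes [measurable]: "f \<in> borel_measurable borel"
  shows "(\<integral>\<^sup>+h. f (b * h) \<partial>gau) = (\<integral>\<^sup>+h. f (\<bar>b\<bar> * h) \<partial>gau)"
  using nn_integral_gau_uminus[of "\<lambda>h. f (b * h)"] by (auto simp: abs_if)

lemma nn_integral_gau_merge_pos:
  assumes f[measurable]: "f \<in> borel_measurable borel" and a: "0 < a" and b: "0 < b"
  shows "(\<integral>\<^sup>+g. (\<integral>\<^sup>+h. f (a * g + b * h) \<partial>gau) \<partial>gau) = (\<integral>\<^sup>+g. f (sqrt (a\<^sup>2 + b\<^sup>2) * g) \<partial>gau)"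
proof -
  let ?c = "sqrt (a\<^sup>2 + b\<^sup>2)"
  have c: "0 < ?c" using a b by (simp add: sum_power2_gt_zero_iff)
  have "(\<integral>\<^sup>+g. (\<integral>\<^sup>+h. f (a * g + b * h) \<partial>gau) \<partial>gau) =
      (\<integral>\<^sup>+g. (\<integral>\<^sup>+z. ennreal (normal_density (a * g) b z) * f z \<partial>lborel) \<partial>gau)"
    using nn_integral_normal_eq_gau[OF f b] by simp
  also have "\<dots> = (\<integral>\<^sup>+g. (\<integral>\<^sup>+z. ennreal (normal_density 0 b (z - a * g)) * f z \<partial>lborel) \<partial>gau)"
    by (simp add: normal_density_def)
  also have "\<dots> = (\<integral>\<^sup>+x. (\<integral>\<^sup>+z. ennreal (normal_density 0 a x) * (ennreal (normal_density 0 b (z - x)) * f z) \<partial>lborel) \<partial>lborel)"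
    using nn_integral_normal_eq_gau[OF _ a, of "\<lambda>x. \<integral>\<^sup>+z. ennreal (normal_density 0 b (z - x)) * f z \<partial>lborel" 0]
    by (simp add: nn_integral_cmult)
  also have "\<dots> = (\<integral>\<^sup>+z. (\<integral>\<^sup>+x. ennreal (normal_density 0 a x) * (ennreal (normal_density 0 b (z - x)) * f z) \<partial>lborel) \<partial>lborel)"
    by (rule lborel_pair.Fubini') measurable
  also have "\<dots> = (\<integral>\<^sup>+z. (\<integral>\<^sup>+x. ennreal (normal_density 0 b (z - x) * normal_density 0 a x) \<partial>lborel) * f z \<partial>lborel)"
    by (subst nn_integral_multc[symmetric]) (auto simp: ennreal_mult mult_ac)
  also have "\<dots> = (\<integral>\<^sup>+z. ennreal (normal_density 0 ?c z) * f z \<partial>lborel)"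
    using fun_cong[OF conv_normal_density_zero_mean[OF b a]] by (simp add: add.commute)
  also have "\<dots> = (\<integral>\<^sup>+g. f (?c * g) \<partial>gau)"
    using nn_integral_normal_eq_gau[OF f c, of 0] by simp
  finally show ?thesis .
qed

text \<open>Positive coefficients are covered by the convolution of normal densities. Signs are
  removed by the symmetry of the law, and a zero coefficient, which has no density, leaves a single
  Gaussian.\<close>

lemma nn_integral_gau_merge:
  assumes f[measurable]: "f \<in> borel_measurable borel"
  shows "(\<integral>\<^sup>+g. (\<integral>\<^sup>+h. f (a * g + b * h) \<partial>gau) \<partial>gau) = (\<integral>\<^sup>+g. f (sqrt (a\<^sup>2 + b\<^sup>2) * g) \<partial>gau)"
proof (cases "a = 0 \<or> b = 0")
  case True
  then show ?thesis
    using nn_integral_gau_abs[OF f, of a] nn_integral_gau_abs[OF f, of b] by auto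
next
  case False
  have "(\<integral>\<^sup>+g. (\<integral>\<^sup>+h. f (a * g + b * h) \<partial>gau) \<partial>gau) = (\<integral>\<^sup>+g. (\<integral>\<^sup>+h. f (a * g + \<bar>b\<bar> * h) \<partial>gau) \<partial>gau)"
    by (intro nn_integral_cong nn_integral_gau_abs) measurable
  also have "\<dots> = (\<integral>\<^sup>+g. (\<integral>\<^sup>+h. f (\<bar>a\<bar> * g + \<bar>b\<bar> * h) \<partial>gau) \<partial>gau)"
    by (rule nn_integral_gau_abs) measurable
  also have "\<dots> = (\<integral>\<^sup>+g. f (sqrt (\<bar>a\<bar>\<^sup>2 + \<bar>b\<bar>\<^sup>2) * g) \<partial>gau)"
    using False by (intro nn_integral_gau_merge_pos f) auto
  finally show ?thesis by simp
qed

text \<open>Combining the exponents turns the integrand into a multiple of a centred normal density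
  of variance 1 / (1 - 2 a).\<close>

lemma nn_integral_gau_exp_sq:
  assumes a: "a < 1 / 2"
  shows "(\<integral>\<^sup>+g. ennreal (exp (a * g\<^sup>2)) \<partial>gau) = ennreal (1 / sqrt (1 - 2 * a))"
proof -
  define s where "s = 1 / sqrt (1 - 2 * a)"
  have s: "0 < s" "s\<^sup>2 = 1 / (1 - 2 * a)" using a by (auto simp: s_def power_divide)
  have "std_normal_density g * exp (a * g\<^sup>2) = s * normal_density 0 s g" for g
  proof -
    have "- (g\<^sup>2) / 2 + a * g\<^sup>2 = - (g\<^sup>2) / (2 * s\<^sup>2)"
      using a unfolding s(2) by (simp add: field_simps)
    then have "exp (- (g\<^sup>2) / 2) * exp (a * g\<^sup>2) = exp (- (g\<^sup>2) / (2 * s\<^sup>2))"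
      by (simp flip: exp_add)
    then show ?thesis using s(1)
      by (simp add: normal_density_def real_sqrt_mult)
  qed
  then have "(\<integral>\<^sup>+g. ennreal (exp (a * g\<^sup>2)) \<partial>gau) = (\<integral>\<^sup>+g. ennreal s * ennreal (normal_density 0 s g) \<partial>lborel)"
    using s(1) by (subst nn_integral_gau) (simp_all flip: ennreal_mult')
  also have "\<dots> = ennreal s * (\<integral>\<^sup>+g. ennreal (normal_density 0 s g) \<partial>lborel)"
    by (rule nn_integral_cmult) simp
  also have "(\<integral>\<^sup>+g. ennreal (normal_density 0 s g) \<partial>lborel) = 1"
    using s(1) by (subst nn_integral_eq_integral) auto
  finally show ?thesis by (simp add: s_def)
qed

lemma nn_integral_gau_even_moment:
  "(\<integral>\<^sup>+g. ennreal (g ^ (2 * k)) \<partial>gau) = ennreal (fact (2 * k) / (2 ^ k * fact k))"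
proof -
  have "(\<integral>\<^sup>+g. ennreal (g ^ (2 * k)) \<partial>gau) = (\<integral>\<^sup>+g. ennreal (std_normal_density g * g ^ (2 * k)) \<partial>lborel)"
    by (subst nn_integral_gau) (simp_all add: ennreal_mult')
  also have "\<dots> = ennreal (fact (2 * k) / (2 ^ k * fact k))"
    using std_normal_moment_even[of k]
    by (subst nn_integral_eq_integral) (auto simp: has_bochner_integral_iff zero_le_even_power)
  finally show ?thesis .
qed

section \<open>Gaussian vectors with a density\<close>

lemma sets_mvn[measurable_cong, simp]: "sets (mvn p S) = sets (Pi\<^sub>M {..<p} (\<lambda>_. borel))"
  unfolding mvn_def sets_density by (rule sets_PiM_cong) auto

lemma space_mvn[simp]: "space (mvn p S) = space (Pi\<^sub>M {..<p} (\<lambda>_. borel))"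
  by (rule sets_eq_imp_space_eq) simp

section \<open>Schur complements and recursion on the dimension\<close>

definition top_block :: "nat \<Rightarrow> real mat \<Rightarrow> real mat" where
  "top_block p S = mat p p (\<lambda>(i, j). S $$ (i, j))"

lemma qf_top_block: "qf p (top_block p S) u v = (\<Sum>i<p. \<Sum>j<p. u i * S $$ (i, j) * v j)"
  by (auto simp: qf_def top_block_def)

lemma pos_defD:
  assumes "pos_def p S" "j < p" "v j \<noteq> 0"
  shows "0 < qf p S v v"
proof -
  have "\<forall>v. (\<exists>j<p. v j \<noteq> 0) \<longrightarrow> 0 < qf p S v v"
    using assms(1) unfolding pos_def_def by (elim conjE)
  with assms(2,3) show ?thesis by blast
qed

lemma pos_def_det_nz:
  assumes "pos_def p S"
  shows "Determinant.det S \<noteq> 0"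
proof
  assume "Determinant.det S = 0"
  moreover have S: "S \<in> carrier_mat p p" using assms by (simp add: pos_def_def)
  ultimately obtain v where v: "v \<in> carrier_vec p" "v \<noteq> 0\<^sub>v p" "S *\<^sub>v v = 0\<^sub>v p"
    using det_0_iff_vec_prod_zero_field[of S p] by auto
  have eq: "vec p (\<lambda>j. v $ j) = v" using v(1) by auto
  from v(1,2) obtain j where "j < p" "v $ j \<noteq> 0"
    by (metis carrier_vecD eq_vecI index_zero_vec)
  then have "0 < qf p S (\<lambda>j. v $ j) (\<lambda>j. v $ j)"
    using assms by (auto simp: pos_def_def)
  also have "\<dots> = 0" unfolding qf_mult_vec[OF S] eq v(3) by simp
  finally show False by simp
qed

lemma solve_linear:
  fixes S :: "real mat"
  assumes S: "S \<in> carrier_mat p p" and d: "Determinant.det S \<noteq> 0"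
  shows "\<exists>B \<in> carrier_mat p p. mat_inverse S = Some B \<and> S * B = 1\<^sub>m p \<and> B * S = 1\<^sub>m p"
proof -
  have "S \<in> Units (ring_mat TYPE(real) p ())"
    using det_non_zero_imp_unit[OF S d] .
  then obtain B where "mat_inverse S = Some B"
    using mat_inverse(1)[OF S, of "()"] by (cases "mat_inverse S") auto
  with mat_inverse(2)[OF S this] show ?thesis by auto
qed

lemma solve_linear_fun:
  fixes S :: "real mat"
  assumes S: "S \<in> carrier_mat p p" and d: "Determinant.det S \<noteq> 0"
  shows "\<exists>w. \<forall>i<p. (\<Sum>j<p. S $$ (i, j) * w j) = c i"
proof -
  obtain B where B: "B \<in> carrier_mat p p" "S * B = 1\<^sub>m p" using solve_linear[OF S d] by auto
  define w where "w = B *\<^sub>v vec p c"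
  have w: "w \<in> carrier_vec p" using B by (simp add: w_def)
  have "S *\<^sub>v w = vec p c"
    unfolding w_def using B S by (simp add: assoc_mult_mat_vec[symmetric, OF S B(1)])
  then have "(S *\<^sub>v w) $ i = c i" if "i < p" for i using that by simp
  then have "(\<Sum>j<p. S $$ (i, j) * w $ j) = c i" if "i < p" for i
    using that S w by (auto simp: scalar_prod_def lessThan_atLeast0 dest!: meta_spec[of _ i])
  then show ?thesis by blast
qed

text \<open>Completing the square in the last coordinate: \<open>w\<close> solves the system of the
  leading block with the last column as right-hand side, and the coefficient left over is the Schur
  complement.\<close>

lemma qf_Suc:
  assumes sym: "\<forall>i<Suc p. \<forall>j<Suc p. S $$ (i, j) = S $$ (j, i)"
    and w: "\<forall>i<p. (\<Sum>j<p. S $$ (i, j) * w j) = S $$ (i, p)"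
  shows "qf (Suc p) S u v =
    qf p (top_block p S) (\<lambda>j. u j + u p * w j) (\<lambda>j. v j + v p * w j) +
    u p * v p * (S $$ (p, p) - (\<Sum>j<p. w j * S $$ (j, p)))"
proof -
  let ?T = "top_block p S"
  have symT: "\<forall>i<p. \<forall>j<p. ?T $$ (i, j) = ?T $$ (j, i)" using sym by (auto simp: top_block_def)
  have r: "qf p ?T a w = (\<Sum>i<p. a i * S $$ (i, p))" for a
    unfolding qf_top_block using w by (auto simp: mult.assoc sum_distrib_left[symmetric] intro!: sum.cong)
  have l: "qf p ?T w a = (\<Sum>i<p. a i * S $$ (i, p))" for a
    using r[of a] qf_commute[OF symT, of w a] by simp
  have "qf p ?T (\<lambda>j. u j + u p * w j) (\<lambda>j. v j + v p * w j) =
     qf p ?T u v + u p * qf p ?T w v + v p * qf p ?T u w + u p * v p * qf p ?T w w"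
    unfolding qf_add_left qf_add_right qf_scale_left qf_scale_right by (simp add: algebra_simps)
  moreover have "qf (Suc p) S u v = qf p ?T u v + u p * (\<Sum>i<p. v i * S $$ (i, p)) +
      v p * (\<Sum>i<p. u i * S $$ (i, p)) + u p * v p * S $$ (p, p)"
  proof -
    have "(\<Sum>j<p. u p * S $$ (p, j) * v j) = u p * (\<Sum>i<p. v i * S $$ (i, p))"
      using sym by (auto simp: sum_distrib_left mult_ac intro!: sum.cong)
    then show ?thesis
      by (simp add: qf_def[of "Suc p"] qf_top_block sum.distrib sum_distrib_left mult_ac)
  qed
  ultimately show ?thesis
    unfolding r l by (simp add: algebra_simps)
qed

lemma pos_def_top_block:
  assumes "pos_def (Suc p) S"
  shows "pos_def p (top_block p S)"
proof -
  have "0 < qf p (top_block p S) v v" if "\<exists>j<p. v j \<noteq> 0" for v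
  proof -
    let ?v = "\<lambda>j. if j < p then v j else 0"
    from that obtain j where "j < p" "v j \<noteq> 0" by blast
    then have "0 < qf (Suc p) S ?v ?v" by (intro pos_defD[OF assms, of j]) auto
    also have "qf (Suc p) S ?v ?v = qf p (top_block p S) v v"
      by (simp add: qf_def[of "Suc p"] qf_top_block)
    finally show ?thesis .
  qed
  then show ?thesis using assms by (auto simp: pos_def_def top_block_def)
qed

text \<open>Gaussian elimination on the last row: the unit triangular \<open>A\<close> subtracts the
  combination \<open>w\<close> of the other rows, so that \<open>A * S\<close> is block upper
  triangular with the Schur complement in its corner.\<close>

lemma det_Suc_block:
  assumes S: "S \<in> carrier_mat (Suc p) (Suc p)" and sym: "\<forall>i<Suc p. \<forall>j<Suc p. S $$ (i, j) = S $$ (j, i)"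
    and w: "\<forall>i<p. (\<Sum>j<p. S $$ (i, j) * w j) = S $$ (i, p)"
  shows "Determinant.det S = Determinant.det (top_block p S) * (S $$ (p, p) - (\<Sum>j<p. w j * S $$ (j, p)))"
proof -
  define A where "A = mat (Suc p) (Suc p) (\<lambda>(i, j). if i = j then 1 else if i = p then - w j else 0)"
  define U where "U = mat (Suc p) (Suc p) (\<lambda>(i, j). if i < p then S $$ (i, j) else
     if j < p then 0 else S $$ (p, p) - (\<Sum>j<p. w j * S $$ (j, p)))"
  have A: "A \<in> carrier_mat (Suc p) (Suc p)" by (simp add: A_def)
  have "Determinant.det A = 1"
  proof -
    have "Determinant.det A = prod_list (diag_mat A)"
      by (rule det_lower_triangular[OF _ A]) (auto simp: A_def)
    also have "diag_mat A = replicate (Suc p) 1"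
      by (rule nth_equalityI) (auto simp: diag_mat_def A_def simp del: upt_Suc replicate_Suc)
    finally show ?thesis by simp
  qed
  moreover have "A * S = U"
  proof (rule eq_matI)
    fix i j assume "i < dim_row U" "j < dim_col U"
    then have ij: "i < Suc p" "j < Suc p" by (auto simp: U_def)
    have "(A * S) $$ (i, j) = (\<Sum>k<Suc p. A $$ (i, k) * S $$ (k, j))"
      using ij A S by (simp add: scalar_prod_def lessThan_atLeast0)
    also have "\<dots> = U $$ (i, j)"
    proof (cases "i < p")
      case True
      then have "(\<Sum>k<Suc p. A $$ (i, k) * S $$ (k, j)) = (\<Sum>k<Suc p. if k = i then S $$ (i, j) else 0)"
        using ij by (intro sum.cong) (auto simp: A_def)
      then show ?thesis using True ij by (simp add: U_def sum.delta del: sum.lessThan_Suc)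
    next
      case False
      then have ip: "i = p" using ij by simp
      have s: "(\<Sum>k<Suc p. A $$ (i, k) * S $$ (k, j)) = S $$ (p, j) - (\<Sum>k<p. w k * S $$ (k, j))"
        using ij by (simp add: ip A_def sum_negf)
      show ?thesis
      proof (cases "j < p")
        case True
        have "(\<Sum>k<p. w k * S $$ (k, j)) = (\<Sum>k<p. S $$ (j, k) * w k)"
          using sym True by (intro sum.cong) auto
        also have "\<dots> = S $$ (p, j)" using w sym True by auto
        finally show ?thesis using True ij unfolding s by (simp add: U_def ip)
      next
        case False
        then have "j = p" using ij by simp
        then show ?thesis unfolding s by (simp add: U_def ip)
      qed
    qed
    finally show "(A * S) $$ (i, j) = U $$ (i, j)" .
  qed (use A S in \<open>auto simp: U_def\<close>)
  moreover have "Determinant.det U = Determinant.det (top_block p S) * (S $$ (p, p) - (\<Sum>j<p. w j * S $$ (j, p)))"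
  proof -
    have "U = four_block_mat (top_block p S) (mat p 1 (\<lambda>(i, j). S $$ (i, p))) (0\<^sub>m 1 p)
        (mat 1 1 (\<lambda>_. S $$ (p, p) - (\<Sum>j<p. w j * S $$ (j, p))))"
      by (rule eq_matI) (auto simp: U_def top_block_def less_Suc_eq)
    then have "Determinant.det U = Determinant.det (four_block_mat (top_block p S) (mat p 1 (\<lambda>(i, j). S $$ (i, p))) (0\<^sub>m 1 p)
        (mat 1 1 (\<lambda>_. S $$ (p, p) - (\<Sum>j<p. w j * S $$ (j, p)))))" by (rule arg_cong)
    also have "\<dots> = Determinant.det (top_block p S) *
        Determinant.det (mat 1 1 (\<lambda>_. S $$ (p, p) - (\<Sum>j<p. w j * S $$ (j, p))))"
      by (rule det_four_block_mat_lower_left_zero[of _ p _ 1]) (auto simp: top_block_def)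
    finally show ?thesis by (simp add: det_single)
  qed
  ultimately show ?thesis using det_mult[OF A S] by simp
qed

text \<open>Trades the inverse matrix for any solution \<open>y\<close> of S y = x, so that the
  inverse of a block matrix never has to be computed.\<close>

lemma mvn_density_quadratic:
  assumes pd: "pos_def p S" and y: "\<forall>i<p. (\<Sum>j<p. S $$ (i, j) * y j) = x i"
  shows "mvn_density p S x = exp (- sdot p x y / 2) / sqrt ((2 * pi) ^ p * Determinant.det S)"
proof -
  have S: "S \<in> carrier_mat p p" using pd by (simp add: pos_def_def)
  obtain B where B: "B \<in> carrier_mat p p" "mat_inverse S = Some B" "B * S = 1\<^sub>m p"
    using solve_linear[OF S pos_def_det_nz[OF pd]] by auto
  have "S *\<^sub>v vec p y = vec p x"
    using S y by (intro eq_vecI) (auto simp: scalar_prod_def lessThan_atLeast0)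
  then have "B *\<^sub>v vec p x = B *\<^sub>v (S *\<^sub>v vec p y)" by simp
  also have "\<dots> = vec p y"
    using B S by (simp add: assoc_mult_mat_vec[symmetric, OF B(1) S])
  finally show ?thesis
    by (simp add: mvn_density_def B(2) vec_scalar_prod sdot_def)
qed

lemma pos_def_nonneg:
  assumes "pos_def p S"
  shows "0 \<le> qf p S v v"
proof (cases "\<exists>j<p. v j \<noteq> 0")
  case True
  then show ?thesis using pos_defD[OF assms] by (metis less_imp_le)
next
  case False
  then have "qf p S v v = 0" unfolding qf_def by (intro sum.neutral ballI) auto
  then show ?thesis by simp
qed

text \<open>The conditional law of the last coordinate given the others: normal with regression mean
  \<open>sdot p w x\<close> and standard deviation \<open>s\<close>, the square root of the Schur
  complement. The same \<open>w\<close> and \<open>s\<close> split the quadratic form.\<close>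

lemma schur_step:
  assumes pd: "pos_def (Suc p) S"
  obtains w s where "0 < s"
    "\<And>x. mvn_density (Suc p) S x = mvn_density p (top_block p S) x * normal_density (sdot p w x) s (x p)"
    "\<And>u v. qf (Suc p) S u v =
      qf p (top_block p S) (\<lambda>j. u j + u p * w j) (\<lambda>j. v j + v p * w j) + u p * v p * s\<^sup>2"
    "\<forall>i<p. (\<Sum>j<p. S $$ (i, j) * w j) = S $$ (i, p)"
proof -
  let ?T = "top_block p S"
  have S: "S \<in> carrier_mat (Suc p) (Suc p)" and sym: "\<forall>i<Suc p. \<forall>j<Suc p. S $$ (i, j) = S $$ (j, i)"
    using pd unfolding pos_def_def by blast+
  have pdT: "pos_def p ?T" using pd by (rule pos_def_top_block)
  then have T: "?T \<in> carrier_mat p p" by (simp add: pos_def_def)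
  obtain w where w: "\<forall>i<p. (\<Sum>j<p. ?T $$ (i, j) * w j) = S $$ (i, p)"
    using solve_linear_fun[OF T pos_def_det_nz[OF pdT], of "\<lambda>i. S $$ (i, p)"] by blast
  have w': "\<forall>i<p. (\<Sum>j<p. S $$ (i, j) * w j) = S $$ (i, p)"
    using w by (simp add: top_block_def)
  define d where "d = S $$ (p, p) - (\<Sum>j<p. w j * S $$ (j, p))"
  note Q = qf_Suc[OF sym w', folded d_def]
  have d: "0 < d"
  proof -
    \<comment> \<open>This vector annihilates the completed square, so that positive definiteness of
      \<open>S\<close> leaves exactly \<open>d\<close>.\<close>
    let ?v = "\<lambda>j. if j = p then 1 else - w j"
    have "0 < qf (Suc p) S ?v ?v" by (rule pos_defD[OF pd, of p]) auto
    also have "\<dots> = qf p ?T (\<lambda>j. ?v j + ?v p * w j) (\<lambda>j. ?v j + ?v p * w j) + d"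
      unfolding Q by simp
    also have "qf p ?T (\<lambda>j. ?v j + ?v p * w j) (\<lambda>j. ?v j + ?v p * w j) = 0"
      unfolding qf_def by (intro sum.neutral ballI) auto
    finally show ?thesis by simp
  qed
  define s where "s = sqrt d"
  have s: "0 < s" "s\<^sup>2 = d" using d by (auto simp: s_def)
  have dens: "mvn_density (Suc p) S x = mvn_density p ?T x * normal_density (sdot p w x) s (x p)" for x
  proof -
    obtain y where y: "\<forall>i<Suc p. (\<Sum>j<Suc p. S $$ (i, j) * y j) = x i"
      using solve_linear_fun[OF S pos_def_det_nz[OF pd], of x] by blast
    have yx: "x i = (\<Sum>j<p. S $$ (i, j) * y j) + S $$ (i, p) * y p" if "i < Suc p" for i
      using y that by auto
    have z: "\<forall>i<p. (\<Sum>j<p. ?T $$ (i, j) * (y j + y p * w j)) = x i"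
    proof (intro allI impI)
      fix i assume i: "i < p"
      have "(\<Sum>j<p. ?T $$ (i, j) * (y j + y p * w j)) = (\<Sum>j<p. S $$ (i, j) * y j) + y p * (\<Sum>j<p. S $$ (i, j) * w j)"
        using i by (simp add: top_block_def algebra_simps sum.distrib sum_distrib_left)
      also have "\<dots> = x i" using w' yx[of i] i by simp
      finally show "(\<Sum>j<p. ?T $$ (i, j) * (y j + y p * w j)) = x i" .
    qed
    have wx: "sdot p w x = (\<Sum>j<p. S $$ (p, j) * y j) + (\<Sum>j<p. w j * S $$ (j, p)) * y p"
    proof -
      have "sdot p w x = (\<Sum>i<p. \<Sum>j<p. w i * S $$ (i, j) * y j) + (\<Sum>j<p. w j * S $$ (j, p)) * y p"
        unfolding sdot_def by (simp add: yx algebra_simps sum.distrib sum_distrib_left)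
      also have "(\<Sum>i<p. \<Sum>j<p. w i * S $$ (i, j) * y j) = (\<Sum>j<p. (\<Sum>i<p. S $$ (j, i) * w i) * y j)"
        by (subst sum.swap) (use sym in \<open>auto simp: sum_distrib_left sum_distrib_right mult_ac intro!: sum.cong\<close>)
      also have "\<dots> = (\<Sum>j<p. S $$ (p, j) * y j)"
        using w' sym by (intro sum.cong) auto
      finally show ?thesis .
    qed
    \<comment> \<open>The last coordinate of the solution of S y = x is the regression residual
      divided by the Schur complement. Hence the exponent splits into that of the leading block and
      that of the conditional density.\<close>
    have dy: "x p - sdot p w x = d * y p"
      unfolding wx yx[of p, simplified] d_def by (simp add: algebra_simps)
    have quad: "sdot (Suc p) x y = sdot p x (\<lambda>j. y j + y p * w j) + (x p - sdot p w x)\<^sup>2 / d"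
    proof -
      have "sdot p x (\<lambda>j. y j + y p * w j) = sdot p x y + y p * sdot p w x"
        by (simp add: sdot_def algebra_simps sum.distrib sum_distrib_left)
      moreover have "(x p - sdot p w x)\<^sup>2 / d = (x p - sdot p w x) * y p"
        using d by (simp add: dy power2_eq_square)
      ultimately show ?thesis by (simp add: sdot_def[of "Suc p"] sdot_def[of p x y] algebra_simps)
    qed
    have det: "Determinant.det S = Determinant.det ?T * d"
      unfolding d_def by (rule det_Suc_block[OF S sym w'])
    have "exp (- (q + r / d) / 2) = exp (- q / 2) * exp (- r / (2 * d))" for q r
      by (simp flip: exp_add add: field_simps)
    then show ?thesis
      unfolding mvn_density_quadratic[OF pd y] mvn_density_quadratic[OF pdT z] quad det
      by (simp add: normal_density_def s(2) real_sqrt_mult mult_ac)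
  qed
  show thesis
    by (rule that[OF s(1) dens _ w']) (simp add: Q s(2))
qed

lemma measurable_sdot[measurable]:
  "(\<lambda>x. sdot p v x) \<in> borel_measurable (Pi\<^sub>M {..<p} (\<lambda>_. borel))"
  unfolding sdot_def by measurable

lemma measurable_mvn_density:
  assumes "pos_def p S"
  shows "mvn_density p S \<in> borel_measurable (Pi\<^sub>M {..<p} (\<lambda>_. borel))"
proof -
  have S: "S \<in> carrier_mat p p" using assms by (simp add: pos_def_def)
  obtain B where B: "B \<in> carrier_mat p p" "mat_inverse S = Some B"
    using solve_linear[OF S pos_def_det_nz[OF assms]] by auto
  have "vec p x \<bullet> (B *\<^sub>v vec p x) = (\<Sum>i<p. x i * (\<Sum>j<p. B $$ (i, j) * x j))" for x
    using B by (auto simp: scalar_prod_def lessThan_atLeast0 intro!: sum.cong)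
  then have "mvn_density p S = (\<lambda>x. exp (- (\<Sum>i<p. x i * (\<Sum>j<p. B $$ (i, j) * x j)) / 2) /
      sqrt ((2 * pi) ^ p * Determinant.det S))"
    by (simp add: mvn_density_def[abs_def] B(2))
  then show ?thesis by simp
qed

lemma sets_lborel_PiM: "sets (Pi\<^sub>M I (\<lambda>_. lborel :: real measure)) = sets (Pi\<^sub>M I (\<lambda>_. borel))"
  by (rule sets_PiM_cong) auto

text \<open>The sampling form of the conditional law: draw the first \<open>p\<close> coordinates,
  then set the last one to its regression value plus independent noise.\<close>

lemma nn_integral_mvn_Suc:
  assumes pd: "pos_def (Suc p) S" and s: "0 < s"
    and dens: "\<And>x. mvn_density (Suc p) S x = mvn_density p (top_block p S) x * normal_density (sdot p w x) s (x p)"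
    and f: "f \<in> borel_measurable (Pi\<^sub>M {..<Suc p} (\<lambda>_. borel))"
  shows "(\<integral>\<^sup>+x. f x \<partial>mvn (Suc p) S) =
    (\<integral>\<^sup>+x. (\<integral>\<^sup>+h. f (x(p := sdot p w x + s * h)) \<partial>gau) \<partial>mvn p (top_block p S))"
proof -
  interpret product_sigma_finite "\<lambda>_::nat. lborel :: real measure" ..
  note cong = measurable_cong_sets[OF sets_lborel_PiM refl]
  note f[measurable] measurable_mvn_density[OF pd, measurable]
    measurable_mvn_density[OF pos_def_top_block[OF pd], measurable]
  have [measurable]: "f \<in> borel_measurable (Pi\<^sub>M (insert p {..<p}) (\<lambda>_. borel))"
    using f by (simp add: lessThan_Suc)
  have ins: "{..<Suc p} = insert p {..<p}" by auto
  let ?D = "\<lambda>x. ennreal (mvn_density p (top_block p S) x)"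
  let ?N = "\<lambda>x y. ennreal (normal_density (sdot p w x) s y)"
  have [simp]: "mvn_density p T (x(p := y)) = mvn_density p T x" for T x y
  proof -
    have "vec p (x(p := y)) = vec p x" by auto
    then show ?thesis by (simp add: mvn_density_def)
  qed
  have [simp]: "sdot p w (x(p := y)) = sdot p w x" for x y
    by (simp add: sdot_def)
  have nn: "0 \<le> mvn_density p T x" if "0 \<le> Determinant.det T" for T x
    using that by (simp add: mvn_density_def)
  have "(\<integral>\<^sup>+x. f x \<partial>mvn (Suc p) S) = (\<integral>\<^sup>+x. ennreal (mvn_density (Suc p) S x) * f x \<partial>Pi\<^sub>M {..<Suc p} (\<lambda>_. lborel))"
    unfolding mvn_def by (rule nn_integral_density) (simp_all only: cong f, measurable)
  also have "\<dots> = (\<integral>\<^sup>+x. (\<integral>\<^sup>+y. ennreal (mvn_density (Suc p) S (x(p := y))) * f (x(p := y)) \<partial>lborel) \<partial>Pi\<^sub>M {..<p} (\<lambda>_. lborel))"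
    unfolding ins by (rule product_nn_integral_insert) (simp_all only: cong ins[symmetric], auto)
  also have "\<dots> = (\<integral>\<^sup>+x. ?D x * (\<integral>\<^sup>+y. ?N x y * f (x(p := y)) \<partial>lborel) \<partial>Pi\<^sub>M {..<p} (\<lambda>_. lborel))"
  proof (rule nn_integral_cong)
    fix x assume "x \<in> space (Pi\<^sub>M {..<p} (\<lambda>_. lborel :: real measure))"
    then have [measurable]: "x \<in> space (Pi\<^sub>M {..<p} (\<lambda>_. borel :: real measure))"
      by (simp add: space_PiM)
    have [measurable]: "(\<lambda>y. f (x(p := y))) \<in> borel_measurable borel"
      by measurable
    show "(\<integral>\<^sup>+y. ennreal (mvn_density (Suc p) S (x(p := y))) * f (x(p := y)) \<partial>lborel) =
        ?D x * (\<integral>\<^sup>+y. ?N x y * f (x(p := y)) \<partial>lborel)"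
      by (subst nn_integral_cmult[symmetric]) (auto simp: dens ennreal_mult'' mult.assoc intro!: nn_integral_cong)
  qed
  also have "\<dots> = (\<integral>\<^sup>+x. ?D x * (\<integral>\<^sup>+h. f (x(p := sdot p w x + s * h)) \<partial>gau) \<partial>Pi\<^sub>M {..<p} (\<lambda>_. lborel))"
  proof (intro nn_integral_cong arg_cong2[where f="(*)"] refl)
    fix x assume "x \<in> space (Pi\<^sub>M {..<p} (\<lambda>_. lborel :: real measure))"
    then have [measurable]: "x \<in> space (Pi\<^sub>M {..<p} (\<lambda>_. borel :: real measure))"
      by (simp add: space_PiM)
    have [measurable]: "(\<lambda>y. f (x(p := y))) \<in> borel_measurable borel"
      by measurable
    show "(\<integral>\<^sup>+y. ?N x y * f (x(p := y)) \<partial>lborel) = (\<integral>\<^sup>+h. f (x(p := sdot p w x + s * h)) \<partial>gau)"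
      by (rule nn_integral_normal_eq_gau[OF _ s]) measurable
  qed
  also have "\<dots> = (\<integral>\<^sup>+x. (\<integral>\<^sup>+h. f (x(p := sdot p w x + s * h)) \<partial>gau) \<partial>mvn p (top_block p S))"
    unfolding mvn_def by (rule nn_integral_density[symmetric]) (simp_all only: cong, measurable)
  finally show ?thesis .
qed

lemma mvn_0:
  assumes "S \<in> carrier_mat 0 0"
  shows "mvn 0 S = Pi\<^sub>M {} (\<lambda>_. lborel)"
proof -
  have "mvn_density 0 S x = 1" for x
    using assms by (simp add: mvn_density_def det_dim_zero scalar_prod_def)
  then show ?thesis by (simp add: mvn_def density_1)
qed

text \<open>Induction on the dimension: the last coordinate is a linear functional of the others plus an
  independent Gaussian variable.\<close>
lemma nn_integral_mvn_linear:
  assumes "pos_def p S" and "f \<in> borel_measurable borel"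
  shows "(\<integral>\<^sup>+x. f (sdot p v x) \<partial>mvn p S) = (\<integral>\<^sup>+g. f (sqrt (qf p S v v) * g) \<partial>gau)"
  using assms
proof (induction p arbitrary: S v f)
  case 0
  interpret product_sigma_finite "\<lambda>_::nat. lborel :: real measure" ..
  show ?case using 0
    by (simp add: mvn_0 pos_def_def emeasure_PiM_empty space_PiM_empty sdot_def qf_def)
next
  case (Suc p)
  note [measurable] = Suc.prems(2)
  obtain w s where s: "0 < s" and
    dens: "\<And>x. mvn_density (Suc p) S x = mvn_density p (top_block p S) x * normal_density (sdot p w x) s (x p)" and
    Q: "\<And>u v. qf (Suc p) S u v =
      qf p (top_block p S) (\<lambda>j. u j + u p * w j) (\<lambda>j. v j + v p * w j) + u p * v p * s\<^sup>2" and
    "\<forall>i<p. (\<Sum>j<p. S $$ (i, j) * w j) = S $$ (i, p)"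
    by (rule schur_step[OF Suc.prems(1)]) (rule that)
  let ?u = "\<lambda>j. v j + v p * w j"
  have pdT: "pos_def p (top_block p S)" using Suc.prems(1) by (rule pos_def_top_block)
  have nonneg: "0 \<le> qf p (top_block p S) ?u ?u"
    by (rule pos_def_nonneg[OF pdT])
  have lin: "sdot (Suc p) v (x(p := sdot p w x + s * h)) = sdot p ?u x + (v p * s) * h" for x h
    by (simp add: sdot_def algebra_simps sum.distrib sum_distrib_left)
  have "(\<integral>\<^sup>+x. f (sdot (Suc p) v x) \<partial>mvn (Suc p) S) =
      (\<integral>\<^sup>+x. (\<integral>\<^sup>+h. f (sdot p ?u x + (v p * s) * h) \<partial>gau) \<partial>mvn p (top_block p S))"
    by (subst nn_integral_mvn_Suc[OF Suc.prems(1) s dens]) (simp_all add: lin)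
  also have "\<dots> = (\<integral>\<^sup>+g. (\<integral>\<^sup>+h. f (sqrt (qf p (top_block p S) ?u ?u) * g + (v p * s) * h) \<partial>gau) \<partial>gau)"
    by (rule Suc.IH[OF pdT, of "\<lambda>t. \<integral>\<^sup>+h. f (t + (v p * s) * h) \<partial>gau"]) measurable
  also have "\<dots> = (\<integral>\<^sup>+g. f (sqrt (qf (Suc p) S v v) * g) \<partial>gau)"
    using nonneg by (subst nn_integral_gau_merge) (simp_all add: Q power_mult_distrib power2_eq_square mult_ac)
  finally show ?case .
qed

lemma prob_space_mvn:
  assumes "pos_def p S"
  shows "prob_space (mvn p S)"
  using nn_integral_mvn_linear[OF assms, of "\<lambda>_. 1" "\<lambda>_. 0"]
  by (intro prob_spaceI) (simp add: nn_integral_gau_const)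

lemma nn_integral_gau_exp_linear: "(\<integral>\<^sup>+h. ennreal (exp (a * h)) \<partial>gau) = ennreal (exp (a\<^sup>2 / 2))"
proof -
  have "std_normal_density h * exp (a * h) = exp (a\<^sup>2 / 2) * normal_density a 1 h" for h
    unfolding normal_density_def by (simp flip: exp_add add: power2_eq_square field_simps)
  then have "(\<integral>\<^sup>+h. ennreal (exp (a * h)) \<partial>gau) = (\<integral>\<^sup>+h. ennreal (exp (a\<^sup>2 / 2)) * ennreal (normal_density a 1 h) \<partial>lborel)"
    by (subst nn_integral_gau) (simp_all flip: ennreal_mult')
  also have "\<dots> = ennreal (exp (a\<^sup>2 / 2)) * (\<integral>\<^sup>+h. ennreal (normal_density a 1 h) \<partial>lborel)"
    by (rule nn_integral_cmult) simp
  also have "(\<integral>\<^sup>+h. ennreal (normal_density a 1 h) \<partial>lborel) = 1"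
    by (subst nn_integral_eq_integral) auto
  finally show ?thesis by simp
qed

lemma nn_integral_gau_shift_sq: "(\<integral>\<^sup>+h. ennreal ((c + s * h)\<^sup>2) \<partial>gau) = ennreal (c\<^sup>2 + s\<^sup>2)"
proof -
  have 2: "(\<integral>\<^sup>+h. ennreal (h\<^sup>2) \<partial>gau) = 1"
    using nn_integral_gau_even_moment[of 1] by simp
  have i2: "integrable gau (\<lambda>h. h\<^sup>2)"
    by (rule integrableI_nonneg) (simp_all add: 2)
  have e2: "(\<integral>h. h\<^sup>2 \<partial>gau) = 1"
    using nn_integral_eq_integral[OF i2] 2 by simp
  have i1: "integrable gau (\<lambda>h. h)"
    using gau.square_integrable_imp_integrable[of "\<lambda>h. h"] i2 by simp
  have e1: "(\<integral>h. h \<partial>gau) = 0"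
    unfolding gau_def using integral_std_normal_moment_odd[of 0] by (subst integral_density) auto
  have eq: "(c + s * h)\<^sup>2 = c\<^sup>2 + 2 * c * s * h + s\<^sup>2 * h\<^sup>2" for h
    by (simp add: power2_eq_square algebra_simps)
  have i: "integrable gau (\<lambda>h. (c + s * h)\<^sup>2)"
    unfolding eq using i1 i2 by auto
  have "(\<integral>h. (c + s * h)\<^sup>2 \<partial>gau) = c\<^sup>2 + s\<^sup>2"
    unfolding eq using i1 i2 gau.prob_space by (simp add: e1 e2)
  then show ?thesis using nn_integral_eq_integral[OF i] by simp
qed

section \<open>Moments of an observation\<close>

lemma ennreal_lincomb3:
  assumes "0 \<le> a" "0 \<le> x" "0 \<le> b" "0 \<le> y" "0 \<le> c" "0 \<le> z"
  shows "ennreal (a * x + (b * y + c * z)) = ennreal a * ennreal x + (ennreal b * ennreal y + ennreal c * ennreal z)"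
  using assms by (simp only: ennreal_plus ennreal_mult mult_nonneg_nonneg add_nonneg_nonneg)

lemma inverse_sqrt_le_exp:
  fixes y :: real
  assumes y: "0 \<le> y" "y \<le> 1 / 2"
  shows "1 / sqrt (1 - y) \<le> exp y"
proof -
  have "y * (2 * y) \<le> y * 1" using y by (intro mult_left_mono) auto
  then have "1 \<le> (1 + 2 * y) * (1 - y)" by (simp add: algebra_simps)
  also have "\<dots> \<le> exp (2 * y) * (1 - y)"
    using y by (intro mult_right_mono exp_ge_add_one_self) auto
  finally have "1 / (1 - y) \<le> exp (2 * y)" using y by (simp add: divide_le_eq)
  then have "1 / (1 - y) \<le> (exp y)\<^sup>2" by (simp add: exp_double)
  then have "sqrt (1 / (1 - y)) \<le> exp y" by (intro real_le_lsqrt) auto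
  then show ?thesis by (simp add: real_sqrt_divide)
qed

definition good_param :: "nat \<Rightarrow> real Matrix.vec \<Rightarrow> real mat \<Rightarrow> real \<Rightarrow> bool" where
  "good_param p \<beta> S \<sigma> \<longleftrightarrow> pos_def p S \<and> \<beta> \<in> carrier_vec p \<and> 0 < \<sigma>"

abbreviation xb :: "nat \<Rightarrow> (nat \<Rightarrow> real) \<Rightarrow> obs \<Rightarrow> real" where
  "xb p v z \<equiv> sdot p v (snd z)"

lemma sets_obs_law[measurable_cong, simp]: "sets (obs_law p \<theta>) = sets (obs_space p)"
  by (cases \<theta>) (simp add: obs_law_def)

lemma space_obs_law[simp]: "space (obs_law p \<theta>) = space (obs_space p)"
  by (rule sets_eq_imp_space_eq) simp

lemma measurable_obs_fst[measurable]: "fst \<in> borel_measurable (obs_space p)"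
  by (simp add: obs_space_def)

lemma measurable_obs_snd[measurable]: "snd \<in> obs_space p \<rightarrow>\<^sub>M Pi\<^sub>M {..<p} (\<lambda>_. borel)"
  by (simp add: obs_space_def)

lemma measurable_obs_coord: "j < p \<Longrightarrow> (\<lambda>z. snd z j) \<in> borel_measurable (obs_space p)"
  by (rule measurable_compose[OF measurable_obs_snd]) auto

lemma nn_integral_obs_law:
  assumes g: "good_param p \<beta> S \<sigma>" and f[measurable]: "f \<in> borel_measurable (obs_space p)"
  shows "(\<integral>\<^sup>+z. f z \<partial>obs_law p (\<beta>, S, \<sigma>)) =
    (\<integral>\<^sup>+x. (\<integral>\<^sup>+h. f (sdot p (($) \<beta>) x + \<sigma> * h, x) \<partial>gau) \<partial>mvn p S)"
proof -
  let ?E = "density lborel (\<lambda>e. ennreal (normal_density 0 \<sigma> e))"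
  have b: "\<beta> \<in> carrier_vec p" and s: "0 < \<sigma>" and pd: "pos_def p S" using g by (auto simp: good_param_def)
  interpret M: prob_space "mvn p S" by (rule prob_space_mvn[OF pd])
  interpret E: prob_space ?E by (rule prob_space_normal_density[OF s])
  have eq: "vec p x \<bullet> \<beta> = sdot p (($) \<beta>) x" for x
    using b by (simp add: vec_scalar_prod sdot_def mult.commute)
  have [measurable]: "f \<in> borel_measurable (borel \<Otimes>\<^sub>M Pi\<^sub>M {..<p} (\<lambda>_. borel))"
    using f by (simp add: obs_space_def)
  have [measurable]: "(\<lambda>(x, e). (sdot p (($) \<beta>) x + e, x)) \<in> mvn p S \<Otimes>\<^sub>M ?E \<rightarrow>\<^sub>M obs_space p"
    unfolding obs_space_def by measurable
  have "(\<integral>\<^sup>+z. f z \<partial>obs_law p (\<beta>, S, \<sigma>)) =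
      (\<integral>\<^sup>+w. f (case w of (x, e) \<Rightarrow> (sdot p (($) \<beta>) x + e, x)) \<partial>(mvn p S \<Otimes>\<^sub>M ?E))"
    unfolding obs_law_def by (simp add: eq nn_integral_distr)
  also have "\<dots> = (\<integral>\<^sup>+x. (\<integral>\<^sup>+e. f (sdot p (($) \<beta>) x + e, x) \<partial>?E) \<partial>mvn p S)"
    by (subst E.nn_integral_fst[symmetric]) simp_all
  also have "\<dots> = (\<integral>\<^sup>+x. (\<integral>\<^sup>+h. f (sdot p (($) \<beta>) x + \<sigma> * h, x) \<partial>gau) \<partial>mvn p S)"
  proof (rule nn_integral_cong)
    fix x assume "x \<in> space (mvn p S)"
    then have [measurable]: "x \<in> space (Pi\<^sub>M {..<p} (\<lambda>_. borel :: real measure))" by simp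
    have [measurable]: "(\<lambda>e. f (sdot p (($) \<beta>) x + e, x)) \<in> borel_measurable borel" by measurable
    show "(\<integral>\<^sup>+e. f (sdot p (($) \<beta>) x + e, x) \<partial>?E) = (\<integral>\<^sup>+h. f (sdot p (($) \<beta>) x + \<sigma> * h, x) \<partial>gau)"
      using nn_integral_normal_eq_gau[OF _ s, of "\<lambda>e. f (sdot p (($) \<beta>) x + e, x)" 0]
      by (subst nn_integral_density) auto
  qed
  finally show ?thesis .
qed

lemma prob_space_obs_law:
  assumes "good_param p \<beta> S \<sigma>"
  shows "prob_space (obs_law p (\<beta>, S, \<sigma>))"
proof -
  interpret M: prob_space "mvn p S" using assms by (auto simp: good_param_def intro: prob_space_mvn)
  show ?thesis
    using nn_integral_obs_law[OF assms, of "\<lambda>_. 1"] M.emeasure_space_1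
    by (intro prob_spaceI) simp
qed

lemma sdot_add_left: "sdot p (\<lambda>j. u j + v j) x = sdot p u x + sdot p v x"
  by (simp add: sdot_def algebra_simps sum.distrib)

lemma sdot_diff_left: "sdot p (\<lambda>j. u j - v j) x = sdot p u x - sdot p v x"
  by (simp add: sdot_def algebra_simps sum_subtractf)

lemma sdot_unit: "i < p \<Longrightarrow> sdot p (\<lambda>l. if l = i then a else 0) x = a * x i"
  unfolding sdot_def by (simp add: if_distrib[where f="\<lambda>y. y * _"] cong: if_cong)

lemma nn_integral_mvn_sq:
  assumes "pos_def p S"
  shows "(\<integral>\<^sup>+x. ennreal ((sdot p v x)\<^sup>2) \<partial>mvn p S) = ennreal (qf p S v v)"
proof -
  have "(\<integral>\<^sup>+x. ennreal ((sdot p v x)\<^sup>2) \<partial>mvn p S) = (\<integral>\<^sup>+g. ennreal ((0 + sqrt (qf p S v v) * g)\<^sup>2) \<partial>gau)"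
    using nn_integral_mvn_linear[OF assms, of "\<lambda>t. ennreal (t\<^sup>2)" v] by simp
  also have "\<dots> = ennreal (qf p S v v)"
    unfolding nn_integral_gau_shift_sq using pos_def_nonneg[OF assms] by simp
  finally show ?thesis .
qed

lemma nn_integral_mvn_pow4:
  assumes "pos_def p S"
  shows "(\<integral>\<^sup>+x. ennreal ((sdot p v x) ^ 4) \<partial>mvn p S) = ennreal (3 * (qf p S v v)\<^sup>2)"
proof -
  let ?q = "qf p S v v"
  have q: "0 \<le> ?q" by (rule pos_def_nonneg[OF assms])
  have 4: "(\<integral>\<^sup>+g. ennreal (g ^ 4) \<partial>gau) = 3"
    using nn_integral_gau_even_moment[of 2] by (simp add: fact_numeral)
  have "(\<integral>\<^sup>+x. ennreal ((sdot p v x) ^ 4) \<partial>mvn p S) = (\<integral>\<^sup>+g. ennreal ((sqrt ?q * g) ^ 4) \<partial>gau)"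
    using nn_integral_mvn_linear[OF assms, of "\<lambda>t. ennreal (t ^ 4)" v] by simp
  also have "\<dots> = (\<integral>\<^sup>+g. ennreal (?q\<^sup>2) * ennreal (g ^ 4) \<partial>gau)"
  proof -
    have "(sqrt ?q * g) ^ 4 = ?q\<^sup>2 * g ^ 4" for g
    proof -
      have "(sqrt ?q) ^ 4 = ((sqrt ?q)\<^sup>2)\<^sup>2" by (simp flip: power_mult)
      then show ?thesis using q by (simp add: power_mult_distrib)
    qed
    then show ?thesis by (simp add: ennreal_mult')
  qed
  also have "\<dots> = ennreal (3 * ?q\<^sup>2)"
    by (subst nn_integral_cmult) (simp_all add: 4 ennreal_mult' mult.commute)
  finally show ?thesis .
qed

lemma nn_integral_mvn_exp_sq:
  assumes "pos_def p S" and "2 * a * qf p S v v < 1"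
  shows "(\<integral>\<^sup>+x. ennreal (exp (a * (sdot p v x)\<^sup>2)) \<partial>mvn p S) = ennreal (1 / sqrt (1 - 2 * a * qf p S v v))"
proof -
  have "(\<integral>\<^sup>+x. ennreal (exp (a * (sdot p v x)\<^sup>2)) \<partial>mvn p S) =
      (\<integral>\<^sup>+g. ennreal (exp ((a * qf p S v v) * g\<^sup>2)) \<partial>gau)"
    using nn_integral_mvn_linear[OF assms(1), of "\<lambda>t. ennreal (exp (a * t\<^sup>2))" v] pos_def_nonneg[OF assms(1), of v]
    by (simp add: power_mult_distrib mult_ac)
  also have "\<dots> = ennreal (1 / sqrt (1 - 2 * a * qf p S v v))"
    using assms(2) by (subst nn_integral_gau_exp_sq) (simp_all add: mult_ac)
  finally show ?thesis .
qed

context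
  fixes p :: nat and \<beta> :: "real Matrix.vec" and S :: "real mat" and \<sigma> :: real
  assumes good: "good_param p \<beta> S \<sigma>"
begin

lemma pd: "pos_def p S"
  using good by (auto simp: good_param_def)

interpretation M: prob_space "mvn p S"
  by (rule prob_space_mvn[OF pd])

text \<open>The coefficient \<open>a\<close> of the noise serves two purposes: 1 and -1 feed the
  polarisation in \<open>mean_product\<close>, and 0 gives the second moment of a single
  covariate.\<close>

lemma nn_integral_obs_sq:
  "(\<integral>\<^sup>+z. ennreal ((xb p v z + a * (fst z - xb p (($) \<beta>) z))\<^sup>2) \<partial>obs_law p (\<beta>, S, \<sigma>)) =
    ennreal (qf p S v v + a\<^sup>2 * \<sigma>\<^sup>2)"
proof -
  have "(\<integral>\<^sup>+z. ennreal ((xb p v z + a * (fst z - xb p (($) \<beta>) z))\<^sup>2) \<partial>obs_law p (\<beta>, S, \<sigma>)) =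
      (\<integral>\<^sup>+x. (\<integral>\<^sup>+h. ennreal ((sdot p v x + (a * \<sigma>) * h)\<^sup>2) \<partial>gau) \<partial>mvn p S)"
    by (subst nn_integral_obs_law[OF good]) (simp_all add: mult.assoc)
  also have "\<dots> = (\<integral>\<^sup>+x. ennreal ((sdot p v x)\<^sup>2) + ennreal ((a * \<sigma>)\<^sup>2) \<partial>mvn p S)"
    by (simp add: nn_integral_gau_shift_sq ennreal_plus)
  also have "\<dots> = ennreal (qf p S v v) + ennreal ((a * \<sigma>)\<^sup>2)"
    by (subst nn_integral_add) (simp_all add: nn_integral_mvn_sq[OF pd] M.emeasure_space_1[simplified])
  also have "\<dots> = ennreal (qf p S v v + a\<^sup>2 * \<sigma>\<^sup>2)"
    using pos_def_nonneg[OF pd] by (simp add: ennreal_plus power_mult_distrib)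
  finally show ?thesis .
qed

text \<open>This is why debiasing works: the residual is \<open>xb p d\<close> plus noise
  independent of the covariates, so only the covariance of \<open>xb p u\<close> and
  \<open>xb p d\<close> survives. Polarisation reduces it to second moments of linear
  combinations.\<close>

lemma mean_product:
  fixes b u :: "nat \<Rightarrow> real"
  defines "d \<equiv> \<lambda>j. \<beta> $ j - b j"
  shows "integrable (obs_law p (\<beta>, S, \<sigma>)) (\<lambda>z. xb p u z * (fst z - xb p b z))"
    "(\<integral>z. xb p u z * (fst z - xb p b z) \<partial>obs_law p (\<beta>, S, \<sigma>)) = qf p S u d"
proof -
  let ?M = "obs_law p (\<beta>, S, \<sigma>)"
  let ?f = "\<lambda>v a z. (xb p v z + a * (fst z - xb p (($) \<beta>) z))\<^sup>2"
  have i: "integrable ?M (?f v a)" and e: "(\<integral>z. ?f v a z \<partial>?M) = qf p S v v + a\<^sup>2 * \<sigma>\<^sup>2" for v a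
  proof -
    have [measurable]: "?f v a \<in> borel_measurable ?M" by measurable
    show i: "integrable ?M (?f v a)"
      by (rule integrableI_nonneg) (simp_all add: nn_integral_obs_sq)
    have "ennreal (\<integral>z. ?f v a z \<partial>?M) = ennreal (qf p S v v + a\<^sup>2 * \<sigma>\<^sup>2)"
      using nn_integral_eq_integral[OF i] nn_integral_obs_sq[of v a] by simp
    then show "(\<integral>z. ?f v a z \<partial>?M) = qf p S v v + a\<^sup>2 * \<sigma>\<^sup>2"
      using pos_def_nonneg[OF pd, of v] by (subst (asm) ennreal_inj) simp_all
  qed
  have eq: "xb p u z * (fst z - xb p b z) =
      (?f (\<lambda>j. u j + d j) 1 z - ?f (\<lambda>j. u j - d j) (-1) z) / 4" for z
    unfolding d_def sdot_add_left sdot_diff_left by (simp add: power2_eq_square algebra_simps)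
  show "integrable ?M (\<lambda>z. xb p u z * (fst z - xb p b z))"
    unfolding eq by (intro integrable_divide Bochner_Integration.integrable_diff i)
  have "(\<integral>z. xb p u z * (fst z - xb p b z) \<partial>?M) = (qf p S (\<lambda>j. u j + d j) (\<lambda>j. u j + d j) - qf p S (\<lambda>j. u j - d j) (\<lambda>j. u j - d j)) / 4"
    unfolding eq by (simp only: integral_divide_zero Bochner_Integration.integral_diff[OF i i] e) simp
  also have "\<dots> = qf p S u d"
  proof -
    have sym: "\<forall>i<p. \<forall>j<p. S $$ (i, j) = S $$ (j, i)" using pd by (simp add: pos_def_def)
    show ?thesis
      unfolding qf_add_left qf_add_right qf_diff_left qf_diff_right qf_commute[OF sym, of d u] by simp
  qed
  finally show "(\<integral>z. xb p u z * (fst z - xb p b z) \<partial>?M) = qf p S u d" .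
qed

text \<open>\<open>xb p u\<close> and \<open>xb p d\<close> are correlated, so their mixed fourth
  moment is split by the arithmetic-geometric mean inequality with weights D / (2 U) and U / (2 D).
  Gaussian fourth moments are 3 times squared variances, and these weights balance the two halves to
  a total of 3 U D.\<close>

lemma second_moment_product:
  fixes b u :: "nat \<Rightarrow> real"
  defines "d \<equiv> \<lambda>j. \<beta> $ j - b j"
  assumes U: "qf p S u u \<le> U" "0 < U" and D: "qf p S d d \<le> D" "0 < D"
  shows "(\<integral>\<^sup>+z. ennreal ((xb p u z * (fst z - xb p b z))\<^sup>2) \<partial>obs_law p (\<beta>, S, \<sigma>)) \<le> ennreal (3 * U * D + \<sigma>\<^sup>2 * U)"
proof -
  have "(\<integral>\<^sup>+z. ennreal ((xb p u z * (fst z - xb p b z))\<^sup>2) \<partial>obs_law p (\<beta>, S, \<sigma>)) =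
      (\<integral>\<^sup>+x. (\<integral>\<^sup>+h. ennreal ((sdot p u x)\<^sup>2) * ennreal ((sdot p d x + \<sigma> * h)\<^sup>2) \<partial>gau) \<partial>mvn p S)"
  proof -
    have "(sdot p u x * (sdot p (($) \<beta>) x + \<sigma> * h - sdot p b x))\<^sup>2 = (sdot p u x)\<^sup>2 * (sdot p d x + \<sigma> * h)\<^sup>2" for x h
    proof -
      have "sdot p (($) \<beta>) x + \<sigma> * h - sdot p b x = sdot p d x + \<sigma> * h"
        by (simp add: d_def sdot_diff_left)
      then show ?thesis by (simp only: power_mult_distrib)
    qed
    then show ?thesis
      by (subst nn_integral_obs_law[OF good]) (simp_all add: ennreal_mult')
  qed
  also have "\<dots> = (\<integral>\<^sup>+x. ennreal ((sdot p u x)\<^sup>2 * ((sdot p d x)\<^sup>2 + \<sigma>\<^sup>2)) \<partial>mvn p S)"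
    by (subst nn_integral_cmult) (simp_all add: nn_integral_gau_shift_sq ennreal_mult')
  also have "\<dots> \<le> (\<integral>\<^sup>+x. ennreal (D / (2 * U)) * ennreal ((sdot p u x) ^ 4) +
      (ennreal (U / (2 * D)) * ennreal ((sdot p d x) ^ 4) + ennreal (\<sigma>\<^sup>2) * ennreal ((sdot p u x)\<^sup>2)) \<partial>mvn p S)"
  proof (rule nn_integral_mono)
    fix x
    let ?A = "(sdot p u x)\<^sup>2" and ?B = "(sdot p d x)\<^sup>2"
    have "0 \<le> (D * ?A - U * ?B)\<^sup>2 / (2 * U * D)" using U D by simp
    also have "\<dots> = (D / (2 * U)) * ?A\<^sup>2 + (U / (2 * D)) * ?B\<^sup>2 - ?A * ?B"
      using U D by (simp add: power2_eq_square field_simps)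
    finally have "?A * (?B + \<sigma>\<^sup>2) \<le> (D / (2 * U)) * (sdot p u x) ^ 4 + ((U / (2 * D)) * (sdot p d x) ^ 4 + \<sigma>\<^sup>2 * ?A)"
      by (simp add: algebra_simps flip: power_mult)
    then have "ennreal (?A * (?B + \<sigma>\<^sup>2)) \<le> ennreal ((D / (2 * U)) * (sdot p u x) ^ 4 + ((U / (2 * D)) * (sdot p d x) ^ 4 + \<sigma>\<^sup>2 * ?A))"
      by (rule ennreal_leI)
    also have "\<dots> = ennreal (D / (2 * U)) * ennreal ((sdot p u x) ^ 4) +
      (ennreal (U / (2 * D)) * ennreal ((sdot p d x) ^ 4) + ennreal (\<sigma>\<^sup>2) * ennreal (?A))"
      using U D by (intro ennreal_lincomb3) (auto simp: zero_le_even_power)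
    finally show "ennreal (?A * (?B + \<sigma>\<^sup>2)) \<le> ennreal (D / (2 * U)) * ennreal ((sdot p u x) ^ 4) +
      (ennreal (U / (2 * D)) * ennreal ((sdot p d x) ^ 4) + ennreal (\<sigma>\<^sup>2) * ennreal (?A))" .
  qed
  also have "\<dots> = ennreal (D / (2 * U)) * ennreal (3 * (qf p S u u)\<^sup>2) +
      (ennreal (U / (2 * D)) * ennreal (3 * (qf p S d d)\<^sup>2) + ennreal (\<sigma>\<^sup>2) * ennreal (qf p S u u))"
    by (simp add: nn_integral_add nn_integral_cmult nn_integral_mvn_pow4[OF pd] nn_integral_mvn_sq[OF pd])
  also have "\<dots> = ennreal ((D / (2 * U)) * (3 * (qf p S u u)\<^sup>2) + ((U / (2 * D)) * (3 * (qf p S d d)\<^sup>2) + \<sigma>\<^sup>2 * qf p S u u))"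
    using U D pos_def_nonneg[OF pd, of u] by (intro ennreal_lincomb3[symmetric]) auto
  also have "\<dots> \<le> ennreal (3 * U * D + \<sigma>\<^sup>2 * U)"
  proof (rule ennreal_leI)
    have "(qf p S u u)\<^sup>2 \<le> U\<^sup>2" "(qf p S d d)\<^sup>2 \<le> D\<^sup>2"
      using U D pos_def_nonneg[OF pd] by (auto intro: power_mono)
    then have "(D / (2 * U)) * (3 * (qf p S u u)\<^sup>2) + ((U / (2 * D)) * (3 * (qf p S d d)\<^sup>2) + \<sigma>\<^sup>2 * qf p S u u)
       \<le> (D / (2 * U)) * (3 * U\<^sup>2) + ((U / (2 * D)) * (3 * D\<^sup>2) + \<sigma>\<^sup>2 * U)"
      using U D by (intro add_mono mult_left_mono) auto
    also have "\<dots> = 3 * U * D + \<sigma>\<^sup>2 * U"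
      using U D by (simp add: power2_eq_square field_simps)
    finally show "(D / (2 * U)) * (3 * (qf p S u u)\<^sup>2) + ((U / (2 * D)) * (3 * (qf p S d d)\<^sup>2) + \<sigma>\<^sup>2 * qf p S u u)
       \<le> 3 * U * D + \<sigma>\<^sup>2 * U" .
  qed
  finally show ?thesis .
qed

lemma nn_integral_obs_exp_sq:
  assumes "0 \<le> a"
  shows "(\<integral>\<^sup>+z. ennreal (exp (- a * (xb p v z)\<^sup>2)) \<partial>obs_law p (\<beta>, S, \<sigma>)) = ennreal (1 / sqrt (1 + 2 * a * qf p S v v))"
proof -
  have "- (2 * a * qf p S v v) \<le> 0" using assms pos_def_nonneg[OF pd, of v] by simp
  then have "- (2 * a * qf p S v v) < 1" by linarith
  then show ?thesis using nn_integral_mvn_exp_sq[OF pd, of "- a" v]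
    by (subst nn_integral_obs_law[OF good]) (simp_all add: nn_integral_gau_const)
qed

text \<open>A product of two Gaussians is only sub-exponential: integrating the noise first leaves
  the exponential of the squared covariate, which is integrable for small \<open>t\<close> only.
  Hence the smallness condition.\<close>

lemma nn_integral_obs_noise:
  assumes j: "j < p" and t: "t\<^sup>2 * \<sigma>\<^sup>2 * S $$ (j, j) \<le> 1 / 2"
  shows "(\<integral>\<^sup>+z. ennreal (exp (t * (snd z j * (fst z - xb p (($) \<beta>) z)))) \<partial>obs_law p (\<beta>, S, \<sigma>)) \<le>
    ennreal (exp (t\<^sup>2 * \<sigma>\<^sup>2 * S $$ (j, j)))"
proof -
  note [measurable] = measurable_obs_coord[OF j]
  let ?e = "\<lambda>l. if l = j then 1 else (0::real)"
  let ?a = "(t * \<sigma>)\<^sup>2 / 2"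
  have q: "qf p S ?e ?e = S $$ (j, j)" using qf_unit[OF j j, of S 1 1] by simp
  have "(\<integral>\<^sup>+z. ennreal (exp (t * (snd z j * (fst z - xb p (($) \<beta>) z)))) \<partial>obs_law p (\<beta>, S, \<sigma>)) =
      (\<integral>\<^sup>+x. (\<integral>\<^sup>+h. ennreal (exp ((t * x j * \<sigma>) * h)) \<partial>gau) \<partial>mvn p S)"
    by (subst nn_integral_obs_law[OF good]) (simp_all add: mult_ac)
  also have "\<dots> = (\<integral>\<^sup>+x. ennreal (exp (?a * (sdot p ?e x)\<^sup>2)) \<partial>mvn p S)"
    unfolding nn_integral_gau_exp_linear sdot_unit[OF j] by (simp add: power_mult_distrib mult_ac)
  also have "\<dots> = ennreal (1 / sqrt (1 - 2 * ?a * qf p S ?e ?e))"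
    using t by (intro nn_integral_mvn_exp_sq[OF pd]) (simp add: q power_mult_distrib)
  also have "\<dots> \<le> ennreal (exp (t\<^sup>2 * \<sigma>\<^sup>2 * S $$ (j, j)))"
  proof (rule ennreal_leI)
    have "0 < qf p S ?e ?e" by (rule pos_defD[OF pd j]) simp
    then show "1 / sqrt (1 - 2 * ?a * qf p S ?e ?e) \<le> exp (t\<^sup>2 * \<sigma>\<^sup>2 * S $$ (j, j))"
      using inverse_sqrt_le_exp[OF _ t] unfolding q by (simp add: power_mult_distrib)
  qed
  finally show ?thesis .
qed

end

section \<open>Tail bounds for independent samples\<close>

lemma chernoff_PiM:
  fixes M :: "'a measure" and I :: "nat set" and a c :: real
  assumes "prob_space M" and I: "finite I" and g[measurable]: "g \<in> borel_measurable M"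
    and c: "(\<integral>\<^sup>+x. ennreal (exp (g x)) \<partial>M) \<le> ennreal c" "0 \<le> c"
  shows "emeasure (Pi\<^sub>M I (\<lambda>_. M)) {z \<in> space (Pi\<^sub>M I (\<lambda>_. M)). a \<le> (\<Sum>i\<in>I. g (z i))} \<le> ennreal (exp (- a) * c ^ card I)"
proof -
  interpret M: prob_space M by fact
  interpret product_sigma_finite "\<lambda>_::nat. M" ..
  let ?P = "Pi\<^sub>M I (\<lambda>_. M)"
  let ?A = "{z \<in> space ?P. a \<le> (\<Sum>i\<in>I. g (z i))}"
  have "emeasure ?P ?A = (\<integral>\<^sup>+z. indicator ?A z \<partial>?P)"
    by (subst nn_integral_indicator) auto
  also have "\<dots> \<le> (\<integral>\<^sup>+z. ennreal (exp (- a)) * (\<Prod>i\<in>I. ennreal (exp (g (z i)))) \<partial>?P)"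
  proof (rule nn_integral_mono)
    fix z
    have "ennreal (exp (- a)) * (\<Prod>i\<in>I. ennreal (exp (g (z i)))) = ennreal (exp ((\<Sum>i\<in>I. g (z i)) - a))"
      using I by (simp add: prod_ennreal exp_sum exp_diff exp_minus ennreal_mult' flip: divide_inverse)
        (simp add: divide_inverse ennreal_mult' mult.commute prod_nonneg)
    moreover have "indicator ?A z \<le> ennreal (exp ((\<Sum>i\<in>I. g (z i)) - a))"
      by (auto simp: indicator_def one_ennreal.rep_eq simp flip: ennreal_1 intro!: ennreal_leI)
    ultimately show "indicator ?A z \<le> ennreal (exp (- a)) * (\<Prod>i\<in>I. ennreal (exp (g (z i))))" by simp
  qed
  also have "\<dots> = ennreal (exp (- a)) * (\<Prod>i\<in>I. \<integral>\<^sup>+x. ennreal (exp (g x)) \<partial>M)"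
  proof -
    have "(\<integral>\<^sup>+z. (\<Prod>i\<in>I. ennreal (exp (g (z i)))) \<partial>?P) = (\<Prod>i\<in>I. \<integral>\<^sup>+x. ennreal (exp (g x)) \<partial>M)"
      by (rule product_nn_integral_prod[OF I]) simp
    then show ?thesis by (subst nn_integral_cmult) simp_all
  qed
  also have "\<dots> \<le> ennreal (exp (- a)) * (\<Prod>i\<in>I. ennreal c)"
    by (intro mult_left_mono prod_mono_ennreal c) auto
  also have "\<dots> = ennreal (exp (- a) * c ^ card I)"
    using c(2) by (simp add: ennreal_mult' ennreal_power)
  finally show ?thesis .
qed

lemma markov_sum_PiM:
  fixes M :: "'a measure" and I :: "nat set" and a c :: real
  assumes "prob_space M" and I: "finite I" and g[measurable]: "g \<in> borel_measurable M" and nn: "\<And>x. 0 \<le> g x"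
    and c: "(\<integral>\<^sup>+x. ennreal (g x) \<partial>M) \<le> ennreal c" "0 \<le> c" and a: "0 < a"
  shows "emeasure (Pi\<^sub>M I (\<lambda>_. M)) {z \<in> space (Pi\<^sub>M I (\<lambda>_. M)). a \<le> (\<Sum>i\<in>I. g (z i))} \<le> ennreal (card I * c / a)"
proof -
  interpret M: prob_space M by fact
  interpret product_prob_space "\<lambda>_::nat. M" I ..
  let ?P = "Pi\<^sub>M I (\<lambda>_. M)"
  let ?A = "{z \<in> space ?P. a \<le> (\<Sum>i\<in>I. g (z i))}"
  have "emeasure ?P ?A = (\<integral>\<^sup>+z. indicator ?A z \<partial>?P)"
    by (subst nn_integral_indicator) auto
  also have "\<dots> \<le> (\<integral>\<^sup>+z. ennreal (1 / a) * (\<Sum>i\<in>I. ennreal (g (z i))) \<partial>?P)"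
  proof (rule nn_integral_mono)
    fix z
    have "ennreal (1 / a) * (\<Sum>i\<in>I. ennreal (g (z i))) = ennreal ((\<Sum>i\<in>I. g (z i)) / a)"
      using nn a by (simp add: sum_ennreal flip: ennreal_mult')
    moreover have "indicator ?A z \<le> ennreal ((\<Sum>i\<in>I. g (z i)) / a)"
      using a by (auto simp: indicator_def simp flip: ennreal_1 intro!: ennreal_leI)
    ultimately show "indicator ?A z \<le> ennreal (1 / a) * (\<Sum>i\<in>I. ennreal (g (z i)))" by simp
  qed
  also have "\<dots> = ennreal (1 / a) * (\<Sum>i\<in>I. \<integral>\<^sup>+z. ennreal (g (z i)) \<partial>?P)"
    by (subst nn_integral_cmult) (auto intro!: arg_cong2[where f="(*)"] nn_integral_sum)
  also have "(\<Sum>i\<in>I. \<integral>\<^sup>+z. ennreal (g (z i)) \<partial>?P) = (\<Sum>i\<in>I. \<integral>\<^sup>+x. ennreal (g x) \<partial>M)"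
  proof (rule sum.cong)
    fix i assume i: "i \<in> I"
    have "(\<integral>\<^sup>+x. ennreal (g x) \<partial>M) = (\<integral>\<^sup>+x. ennreal (g x) \<partial>distr ?P M (\<lambda>z. z i))"
      using PiM_component[OF i] by simp
    also have "\<dots> = (\<integral>\<^sup>+z. ennreal (g (z i)) \<partial>?P)"
      using i by (subst nn_integral_distr) auto
    finally show "(\<integral>\<^sup>+z. ennreal (g (z i)) \<partial>?P) = (\<integral>\<^sup>+x. ennreal (g x) \<partial>M)" by simp
  qed simp
  also have "ennreal (1 / a) * \<dots> \<le> ennreal (1 / a) * (\<Sum>i\<in>I. ennreal c)"
    by (intro mult_left_mono sum_mono c) auto
  also have "\<dots> = ennreal (card I * c / a)"
    using c(2) a by (simp add: ennreal_of_nat_eq_real_of_nat flip: ennreal_mult')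
  finally show ?thesis .
qed

lemma chebyshev_PiM:
  fixes M :: "'a measure" and I :: "nat set" and h :: "'a \<Rightarrow> real" and m V a :: real
  assumes "prob_space M" and I: "finite I" and h: "integrable M h" "(\<integral>x. h x \<partial>M) = m"
    and V: "(\<integral>\<^sup>+x. ennreal ((h x)\<^sup>2) \<partial>M) \<le> ennreal V" "0 \<le> V" and a: "0 < a"
  shows "emeasure (Pi\<^sub>M I (\<lambda>_. M)) {z \<in> space (Pi\<^sub>M I (\<lambda>_. M)). a \<le> \<bar>\<Sum>i\<in>I. (h (z i) - m)\<bar>} \<le> ennreal (card I * V / a\<^sup>2)"
proof -
  interpret M: prob_space M by fact
  interpret product_prob_space "\<lambda>_::nat. M" I ..
  let ?P = "Pi\<^sub>M I (\<lambda>_. M)"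
  let ?A = "{z \<in> space ?P. a \<le> \<bar>\<Sum>i\<in>I. (h (z i) - m)\<bar>}"
  have [measurable]: "h \<in> borel_measurable M" using h(1) by simp
  define X where "X x = h x - m" for x
  have [measurable]: "X \<in> borel_measurable M" unfolding X_def by measurable
  have iX: "integrable M X" unfolding X_def using h(1) by simp
  have eX: "(\<integral>x. X x \<partial>M) = 0" unfolding X_def using h by (simp add: M.prob_space)
  have ih2: "integrable M (\<lambda>x. (h x)\<^sup>2)"
    using V by (intro integrableI_nonneg) (auto simp: less_top[symmetric] top_unique)
  have eh2: "(\<integral>x. (h x)\<^sup>2 \<partial>M) \<le> V"
    using V nn_integral_eq_integral[OF ih2] by (simp add: ennreal_le_iff)
  have X2: "(X x)\<^sup>2 = (h x)\<^sup>2 - 2 * m * h x + m\<^sup>2" for x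
    by (simp add: X_def power2_eq_square algebra_simps)
  have iX2: "integrable M (\<lambda>x. (X x)\<^sup>2)" unfolding X2 using ih2 h(1) by simp
  have eX2: "(\<integral>x. (X x)\<^sup>2 \<partial>M) \<le> V"
    unfolding X2 using ih2 h eh2 by (simp add: M.prob_space power2_eq_square algebra_simps) (smt (verit) zero_le_square)
  \<comment> \<open>\<open>F\<close> writes X (z i) X (z j) as a product with one factor per
    coordinate, so that one product rule yields both the variances (i = j) and the vanishing
    covariances.\<close>
  define F where "F i j k x = (if k = i \<and> k = j then (X x)\<^sup>2 else if k = i \<or> k = j then X x else 1)" for i j k :: nat and x
  have iF: "integrable M (F i j k)" for i j k
    unfolding F_def using iX iX2 by (cases "k = i"; cases "k = j") auto
  have prodF: "(\<Prod>k\<in>I. F i j k (z k)) = X (z i) * X (z j)" if "i \<in> I" "j \<in> I" for i j z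
  proof (cases "i = j")
    case True
    have "(\<Prod>k\<in>I. F i j k (z k)) = (\<Prod>k\<in>I. if k = i then (X (z i))\<^sup>2 else 1)"
      using True by (intro prod.cong) (auto simp: F_def)
    then show ?thesis using that I True by (simp add: prod.delta power2_eq_square)
  next
    case False
    have "(\<Prod>k\<in>I. F i j k (z k)) = (\<Prod>k\<in>I. (if k = i then X (z i) else 1) * (if k = j then X (z j) else 1))"
      using False by (intro prod.cong) (auto simp: F_def)
    then show ?thesis using that I by (simp add: prod.distrib prod.delta)
  qed
  have int: "integrable ?P (\<lambda>z. X (z i) * X (z j))" if "i \<in> I" "j \<in> I" for i j
    using product_integrable_prod[OF I, of "F i j"] iF prodF[OF that] by simp
  have ex: "(\<integral>z. X (z i) * X (z j) \<partial>?P) = (if i = j then (\<integral>x. (X x)\<^sup>2 \<partial>M) else 0)" if "i \<in> I" "j \<in> I" for i j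
  proof -
    have "(\<integral>z. X (z i) * X (z j) \<partial>?P) = (\<Prod>k\<in>I. \<integral>x. F i j k x \<partial>M)"
      using product_integral_prod[OF I, of "F i j"] iF prodF[OF that] by simp
    also have "\<dots> = (if i = j then (\<integral>x. (X x)\<^sup>2 \<partial>M) else 0)"
    proof (cases "i = j")
      case True
      have "(\<Prod>k\<in>I. \<integral>x. F i j k x \<partial>M) = (\<Prod>k\<in>I. if k = i then (\<integral>x. (X x)\<^sup>2 \<partial>M) else 1)"
        using True by (intro prod.cong) (auto simp: F_def M.prob_space)
      then show ?thesis using that I True by (simp add: prod.delta)
    next
      case False
      have "(\<integral>x. F i j i x \<partial>M) = 0" using False eX by (simp add: F_def)
      then show ?thesis using that I False by (auto intro!: prod_zero)
    qed
    finally show ?thesis .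
  qed
  have sq: "(\<Sum>i\<in>I. X (z i))\<^sup>2 = (\<Sum>i\<in>I. \<Sum>j\<in>I. X (z i) * X (z j))" for z
    by (simp add: power2_eq_square sum_product)
  have iS: "integrable ?P (\<lambda>z. (\<Sum>i\<in>I. X (z i))\<^sup>2)"
    unfolding sq by (intro Bochner_Integration.integrable_sum int)
  have eS: "(\<integral>z. (\<Sum>i\<in>I. X (z i))\<^sup>2 \<partial>?P) \<le> card I * V"
  proof -
    have "(\<integral>z. (\<Sum>i\<in>I. X (z i))\<^sup>2 \<partial>?P) = (\<Sum>i\<in>I. \<Sum>j\<in>I. (\<integral>z. X (z i) * X (z j) \<partial>?P))"
      unfolding sq using int by (simp add: Bochner_Integration.integral_sum Bochner_Integration.integrable_sum)
    also have "\<dots> = (\<Sum>i\<in>I. (\<integral>x. (X x)\<^sup>2 \<partial>M))"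
      using I by (intro sum.cong) (simp_all add: ex sum.delta)
    also have "\<dots> \<le> (\<Sum>i\<in>I. V)" by (intro sum_mono eX2)
    finally show ?thesis by simp
  qed
  have "emeasure ?P ?A = (\<integral>\<^sup>+z. indicator ?A z \<partial>?P)"
    by (subst nn_integral_indicator) auto
  also have "\<dots> \<le> (\<integral>\<^sup>+z. ennreal (1 / a\<^sup>2) * ennreal ((\<Sum>i\<in>I. X (z i))\<^sup>2) \<partial>?P)"
  proof (rule nn_integral_mono)
    fix z
    have "1 \<le> (\<Sum>i\<in>I. X (z i))\<^sup>2 / a\<^sup>2" if "a \<le> \<bar>\<Sum>i\<in>I. X (z i)\<bar>"
    proof -
      have "a\<^sup>2 \<le> (\<bar>\<Sum>i\<in>I. X (z i)\<bar>)\<^sup>2" using that a by (intro power_mono) auto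
      then show ?thesis using a by simp
    qed
    then show "indicator ?A z \<le> ennreal (1 / a\<^sup>2) * ennreal ((\<Sum>i\<in>I. X (z i))\<^sup>2)"
      by (auto simp: indicator_def X_def[symmetric] simp flip: ennreal_1 ennreal_mult' intro!: ennreal_leI)
  qed
  also have "\<dots> = ennreal (1 / a\<^sup>2) * ennreal (\<integral>z. (\<Sum>i\<in>I. X (z i))\<^sup>2 \<partial>?P)"
    using iS by (subst nn_integral_cmult) (auto simp: nn_integral_eq_integral)
  also have "\<dots> \<le> ennreal (1 / a\<^sup>2) * ennreal (card I * V)"
    by (intro mult_left_mono ennreal_leI eS) auto
  also have "\<dots> = ennreal (card I * V / a\<^sup>2)"
    by (simp flip: ennreal_mult')
  finally show ?thesis .
qed

section \<open>Sparse eigenvalues and the sparse estimator\<close>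

definition nnz :: "nat \<Rightarrow> (nat \<Rightarrow> real) \<Rightarrow> nat" where
  "nnz p v = card {j. j < p \<and> v j \<noteq> 0}"

text \<open>A polynomially fine grid is good enough: its cardinality is \<open>exp (O(K log p))\<close>, which the lower tail
  bound \<open>exp (- n / 4)\<close> beats as soon as \<open>n\<close> exceeds a large multiple of \<open>K log p\<close>.\<close>
definition grid_net :: "nat \<Rightarrow> nat \<Rightarrow> nat \<Rightarrow> (nat \<Rightarrow> real) set" where
  "grid_net p K N = {v. (\<forall>j. \<exists>i::int. \<bar>i\<bar> \<le> int N \<and> v j = of_int i / real N) \<and> (\<forall>j\<ge>p. v j = 0) \<and> nnz p v \<le> K}"

lemma finite_card_grid_net:
  assumes p: "0 < p"
  shows "finite (grid_net p K N)" "card (grid_net p K N) \<le> (p * (2 * N + 1)) ^ K"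
proof -
  define D where "D = (\<Pi>\<^sub>E i\<in>{..<K}. {..<p} \<times> {- int N..int N})"
  define \<Phi> where "\<Phi> f = (\<lambda>j. \<Sum>i<K. if fst (f i) = j then of_int (snd (f i)) / real N else 0)" for f :: "nat \<Rightarrow> nat \<times> int"
  have finD: "finite D" unfolding D_def by (intro finite_PiE) auto
  have cardD: "card D = (p * (2 * N + 1)) ^ K"
    unfolding D_def by (subst card_PiE) (simp_all add: card_cartesian_product nat_add_distrib nat_mult_distrib)
  have sub: "grid_net p K N \<subseteq> \<Phi> ` D"
  proof
    fix v assume v: "v \<in> grid_net p K N"
    define T where "T = {j. j < p \<and> v j \<noteq> 0}"
    have T: "finite T" "card T \<le> K" using v by (auto simp: T_def grid_net_def nnz_def)
    obtain e where e: "bij_betw e {..<card T} T" using T(1) by (metis ex_bij_betw_nat_finite lessThan_atLeast0)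
    obtain m where m: "\<And>j. \<bar>m j\<bar> \<le> int N" "\<And>j. v j = of_int (m j) / real N"
      using v unfolding grid_net_def mem_Collect_eq by metis
    define f where "f = (\<lambda>i\<in>{..<K}. if i < card T then (e i, m (e i)) else (0, 0))"
    have eT: "e i < p" if "i < card T" for i using e that unfolding bij_betw_def T_def by auto
    have "f \<in> D" using m(1) eT p by (auto simp: D_def f_def abs_le_iff minus_le_iff)
    moreover have "\<Phi> f = v"
    proof
      fix j
      have "\<Phi> f j = (\<Sum>i<K. if i < card T \<and> e i = j then v j else 0)"
        unfolding \<Phi>_def by (intro sum.cong) (auto simp: f_def m(2)[of j])
      also have "\<dots> = v j"
      proof (cases "j \<in> T")
        case True
        then obtain i where i: "i < card T" "e i = j" using e by (metis bij_betw_iff_bijections lessThan_iff)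
        have uniq: "(i' < card T \<and> e i' = j) = (i' = i)" for i'
          using i e by (metis bij_betw_imp_inj_on inj_on_eq_iff lessThan_iff)
        show ?thesis unfolding uniq using i T(2) by (simp add: sum.delta)
      next
        case False
        then have "\<not> (i < card T \<and> e i = j)" for i using e by (auto simp: bij_betw_def)
        moreover have "v j = 0" using False v by (cases "j < p") (auto simp: T_def grid_net_def)
        ultimately show ?thesis by simp
      qed
      finally show "\<Phi> f j = v j" .
    qed
    ultimately show "v \<in> \<Phi> ` D" by auto
  qed
  show "finite (grid_net p K N)" using sub finD by (rule finite_surj[rotated])
  have "card (grid_net p K N) \<le> card D" using sub finD by (rule surj_card_le[rotated])
  then show "card (grid_net p K N) \<le> (p * (2 * N + 1)) ^ K" by (simp add: cardD)
qed

lemma sdot_cauchy: "(sdot p u v)\<^sup>2 \<le> sqn p u * sqn p v"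
  unfolding sdot_def sqn_def by (rule Cauchy_Schwarz_ineq_sum)

lemma L1_le_L2_sparse:
  assumes "nnz p v \<le> K"
  shows "(\<Sum>j<p. \<bar>v j\<bar>)\<^sup>2 \<le> real K * sqn p v"
proof -
  let ?T = "{j. j < p \<and> v j \<noteq> 0}"
  have "(\<Sum>j<p. \<bar>v j\<bar>) = (\<Sum>j\<in>?T. 1 * \<bar>v j\<bar>)"
    by (intro sum.mono_neutral_cong_right) auto
  then have "(\<Sum>j<p. \<bar>v j\<bar>)\<^sup>2 = (\<Sum>j\<in>?T. 1 * \<bar>v j\<bar>)\<^sup>2" by simp
  also have "\<dots> \<le> (\<Sum>j\<in>?T. 1\<^sup>2) * (\<Sum>j\<in>?T. \<bar>v j\<bar>\<^sup>2)" by (rule Cauchy_Schwarz_ineq_sum)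
  also have "(\<Sum>j\<in>?T. \<bar>v j\<bar>\<^sup>2) = sqn p v"
    unfolding sqn_def by (intro sum.mono_neutral_cong_left) auto
  also have "(\<Sum>j\<in>?T. 1\<^sup>2 :: real) = real (nnz p v)" by (simp add: nnz_def)
  also have "real (nnz p v) * sqn p v \<le> real K * sqn p v"
    using assms sqn_nonneg by (intro mult_right_mono) auto
  finally show ?thesis .
qed

text \<open>Discretisation: scale \<open>v\<close> to sup-norm 1, round it to the grid, apply
  \<open>H3\<close> there and pay for the rounding by the triangle inequality in the Euclidean norm
  over the sample. Against a polynomially fine grid, the crude column bound \<open>H2\<close> is
  enough to control the rounding error.\<close>

lemma sparse_eigenvalue:
  fixes x :: "nat \<Rightarrow> nat \<Rightarrow> real"
  assumes M: "0 < M" and N: "0 < N" and KN: "16 * M * real K * (real p)\<^sup>2 \<le> (real N)\<^sup>2" "K \<le> N\<^sup>2"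
    and H2: "(\<Sum>i<n. sqn p (x i)) \<le> real n * (real p)\<^sup>2"
    and H3: "\<And>v. v \<in> grid_net p K N \<Longrightarrow> real n * sqn p v / (4 * M) \<le> (\<Sum>i<n. (sdot p v (x i))\<^sup>2)"
    and v: "nnz p v \<le> K"
  shows "real n * sqn p v / (64 * M) \<le> (\<Sum>i<n. (sdot p v (x i))\<^sup>2)"
proof (cases "\<exists>j<p. v j \<noteq> 0")
  case False
  then have "sqn p v = 0" unfolding sqn_def by (intro sum.neutral) auto
  then show ?thesis by (simp add: sum_nonneg)
next
  case True
  define a where "a = Max ((\<lambda>j. \<bar>v j\<bar>) ` {..<p})"
  obtain j0 where j0: "j0 < p" "\<bar>v j0\<bar> = a"
  proof -
    have "a \<in> (\<lambda>j. \<bar>v j\<bar>) ` {..<p}" unfolding a_def using True by (intro Max_in) auto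
    then show thesis using that by auto
  qed
  have le_a: "\<bar>v j\<bar> \<le> a" if "j < p" for j unfolding a_def using that by (intro Max_ge) auto
  have a: "0 < a" using True le_a by (metis order_less_le_trans zero_less_abs_iff)
  define w where "w j = (if j < p then v j / a else 0)" for j
  have w1: "\<bar>w j\<bar> \<le> 1" for j using le_a[of j] a by (auto simp: w_def)
  \<comment> \<open>Rounding towards zero keeps every zero, so the support does not grow, and it
    fixes 1 and -1, so the coordinate of maximal modulus gives \<open>sqn p w'\<close> at least
    1.\<close>
  define m where "m j = (if 0 \<le> w j then \<lfloor>w j * real N\<rfloor> else - \<lfloor>- w j * real N\<rfloor>)" for j
  define w' where "w' j = of_int (m j) / real N" for j
  have close: "\<bar>w j - w' j\<bar> \<le> 1 / real N" for j
  proof -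
    have "\<bar>w j * real N - of_int (m j)\<bar> \<le> 1"
      unfolding m_def by (cases "0 \<le> w j") (simp; linarith)+
    moreover have "w j - w' j = (w j * real N - of_int (m j)) / real N"
      using N by (simp add: w'_def field_simps)
    ultimately show ?thesis using N by (simp add: divide_right_mono)
  qed
  have z: "w' j = 0" if "w j = 0" for j using that by (simp add: w'_def m_def)
  have mN: "\<bar>m j\<bar> \<le> int N" for j
  proof -
    have b: "\<lfloor>t * real N\<rfloor> \<le> int N \<and> 0 \<le> \<lfloor>t * real N\<rfloor>" if "0 \<le> t" "t \<le> 1" for t
    proof -
      have "t * real N \<le> 1 * real N" using that by (intro mult_right_mono) auto
      then show ?thesis using that by (auto simp: floor_le_iff)
    qed
    show ?thesis
    proof (cases "0 \<le> w j")
      case True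
      then have "m j = \<lfloor>w j * real N\<rfloor>" by (simp add: m_def)
      then show ?thesis using b[OF True] w1[of j] by linarith
    next
      case False
      then have "m j = - \<lfloor>- w j * real N\<rfloor>" by (simp add: m_def)
      then show ?thesis using b[of "- w j"] False w1[of j] by linarith
    qed
  qed
  have sub: "{j. j < p \<and> w' j \<noteq> 0} \<subseteq> {j. j < p \<and> v j \<noteq> 0}"
    using z by (auto simp: w_def)
  then have "nnz p w' \<le> nnz p v" unfolding nnz_def by (intro card_mono) auto
  then have net: "w' \<in> grid_net p K N"
    using v mN z by (auto simp: grid_net_def w'_def w_def)
  have w'1: "1 \<le> sqn p w'"
  proof -
    have "\<bar>w j0\<bar> = 1" using j0 a by (simp add: w_def)
    then have "w j0 = 1 \<or> w j0 = -1" by linarith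
    then have "(w' j0)\<^sup>2 = 1" using N by (auto simp: w'_def m_def)
    moreover have "(w' j0)\<^sup>2 \<le> sqn p w'" unfolding sqn_def using j0(1) by (intro member_le_sum) auto
    ultimately show ?thesis by simp
  qed
  let ?d = "\<lambda>j. w j - w' j"
  have dsq: "sqn p ?d \<le> real K / (real N)\<^sup>2"
  proof -
    let ?T = "{j. j < p \<and> v j \<noteq> 0}"
    have "sqn p ?d = (\<Sum>j\<in>?T. (?d j)\<^sup>2)"
      unfolding sqn_def using z by (intro sum.mono_neutral_cong_right) (auto simp: w_def)
    also have "\<dots> \<le> (\<Sum>j\<in>?T. (1 / real N)\<^sup>2)"
    proof (rule sum_mono)
      fix j show "(?d j)\<^sup>2 \<le> (1 / real N)\<^sup>2"
        using power_mono[OF close[of j], of 2] by simp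
    qed
    also have "\<dots> = real (nnz p v) * (1 / real N)\<^sup>2" by (simp add: nnz_def)
    also have "\<dots> \<le> real K * (1 / real N)\<^sup>2" using v by (intro mult_right_mono) auto
    finally show ?thesis by (simp add: power_divide)
  qed
  let ?L = "\<lambda>u. L2_set (\<lambda>i. sdot p u (x i)) {..<n}"
  let ?s = "sqrt (real n)"
  have L_sq: "(?L u)\<^sup>2 = (\<Sum>i<n. (sdot p u (x i))\<^sup>2)" for u
    by (simp add: L2_set_def sum_nonneg)
  have tri: "?L w' \<le> ?L w + ?L ?d"
  proof -
    have "?L w' = L2_set (\<lambda>i. sdot p w (x i) + (- sdot p ?d (x i))) {..<n}"
      by (simp add: sdot_diff_left)
    also have "\<dots> \<le> ?L w + L2_set (\<lambda>i. - sdot p ?d (x i)) {..<n}" by (rule L2_set_triangle_ineq)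
    also have "L2_set (\<lambda>i. - sdot p ?d (x i)) {..<n} = ?L ?d" by (simp add: L2_set_def)
    finally show ?thesis .
  qed
  have Ld: "?L ?d \<le> ?s * (1 / (4 * sqrt M))"
  proof -
    have "(?L ?d)\<^sup>2 \<le> (\<Sum>i<n. sqn p ?d * sqn p (x i))"
      unfolding L_sq by (intro sum_mono sdot_cauchy)
    also have "\<dots> = sqn p ?d * (\<Sum>i<n. sqn p (x i))" by (simp add: sum_distrib_left)
    also have "\<dots> \<le> (real K / (real N)\<^sup>2) * (real n * (real p)\<^sup>2)"
      by (intro mult_mono dsq H2 sum_nonneg sqn_nonneg) auto
    also have "\<dots> = real n * ((real K * (real p)\<^sup>2) / (real N)\<^sup>2)" by simp
    also have "\<dots> \<le> real n * (1 / (16 * M))"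
      using KN(1) M N by (intro mult_left_mono) (auto simp: field_simps)
    also have "\<dots> = (?s * (1 / (4 * sqrt M)))\<^sup>2"
      using M by (simp add: power_mult_distrib power_divide)
    finally show ?thesis using M by (intro power2_le_imp_le[of "?L ?d"]) auto
  qed
  define W where "W = sqrt (sqn p w')"
  have W: "1 \<le> W" "W\<^sup>2 = sqn p w'" using w'1 by (auto simp: W_def)
  have Lw': "?s * (W / (2 * sqrt M)) \<le> ?L w'"
  proof (rule power2_le_imp_le)
    have "(?s * (W / (2 * sqrt M)))\<^sup>2 = real n * sqn p w' / (4 * M)"
      using M by (simp add: power_mult_distrib power_divide W(2))
    also have "\<dots> \<le> (?L w')\<^sup>2" unfolding L_sq by (rule H3[OF net])
    finally show "(?s * (W / (2 * sqrt M)))\<^sup>2 \<le> (?L w')\<^sup>2" .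
  qed simp
  have "?s * (1 / (4 * sqrt M)) \<le> ?s * (W / (4 * sqrt M))"
    using W M by (intro mult_left_mono divide_right_mono) auto
  moreover have "?s * (W / (2 * sqrt M)) = ?s * (W / (4 * sqrt M)) + ?s * (W / (4 * sqrt M))"
    using M by (simp add: field_simps)
  ultimately have Lw: "?s * (W / (4 * sqrt M)) \<le> ?L w"
    using tri Ld Lw' by linarith
  have wW: "sqrt (sqn p w) \<le> 2 * W"
  proof -
    have "sqrt (sqn p w) = L2_set (\<lambda>j. w' j + ?d j) {..<p}" by (simp add: sqn_def L2_set_def)
    also have "\<dots> \<le> L2_set w' {..<p} + L2_set ?d {..<p}" by (rule L2_set_triangle_ineq)
    also have "L2_set w' {..<p} = W" by (simp add: W_def sqn_def L2_set_def)
    also have "L2_set ?d {..<p} \<le> 1"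
    proof -
      have "real K \<le> (real N)\<^sup>2" using KN(2) by (metis of_nat_le_iff of_nat_power)
      then have "real K / (real N)\<^sup>2 \<le> 1" using N by (simp add: divide_le_eq)
      then have "sqn p ?d \<le> 1" using dsq by linarith
      then show ?thesis by (simp add: L2_set_def sqn_def)
    qed
    finally show ?thesis using W(1) by linarith
  qed
  \<comment> \<open>Origin of 64: the grid bound W / (2 sqrt M) loses half to rounding because W is
    at least 1, and the norm of \<open>w\<close> is at most 2 W. This leaves the norm divided by 8
    sqrt M, to be squared.\<close>
  have "?s * (sqrt (sqn p w) / (8 * sqrt M)) \<le> ?s * (2 * W / (8 * sqrt M))"
    using wW M by (intro mult_left_mono divide_right_mono) auto
  also have "\<dots> = ?s * (W / (4 * sqrt M))" by simp
  finally have "?s * (sqrt (sqn p w) / (8 * sqrt M)) \<le> ?L w" using Lw by linarith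
  then have "(?s * (sqrt (sqn p w) / (8 * sqrt M)))\<^sup>2 \<le> (?L w)\<^sup>2"
    using M by (intro power_mono) (auto simp: sqn_nonneg)
  then have fin: "real n * sqn p w / (64 * M) \<le> (\<Sum>i<n. (sdot p w (x i))\<^sup>2)"
    using M unfolding L_sq by (simp add: power_mult_distrib power_divide sqn_nonneg)
  have "sqn p v = a\<^sup>2 * sqn p w"
    using a by (simp add: sqn_def sum_distrib_left w_def power_divide)
  moreover have "sdot p v (x i) = a * sdot p w (x i)" for i
    using a by (simp add: sdot_def sum_distrib_left w_def)
  ultimately show ?thesis
    using mult_left_mono[OF fin, of "a\<^sup>2"] by (simp add: power_mult_distrib sum_distrib_left mult_ac)
qed

section \<open>The sparse estimator and its deterministic error bound\<close>

definition grad :: "nat \<Rightarrow> nat \<Rightarrow> (nat \<Rightarrow> real) \<Rightarrow> (nat \<Rightarrow> obs) \<Rightarrow> nat \<Rightarrow> real" where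
  "grad p n b z j = (\<Sum>i<n. snd (z i) j * (fst (z i) - xb p b (z i)))"

text \<open>Candidates are rational vectors, so that the first feasible one is a measurable function of the data.\<close>
definition cand_set :: "nat \<Rightarrow> nat \<Rightarrow> (nat \<Rightarrow> real) set" where
  "cand_set p k = {v. (\<forall>j. v j \<in> \<rat>) \<and> (\<forall>j\<ge>p. v j = 0) \<and> nnz p v \<le> k}"

definition cand :: "nat \<Rightarrow> nat \<Rightarrow> nat \<Rightarrow> nat \<Rightarrow> real" where
  "cand p k = from_nat_into (cand_set p k)"

text \<open>A Dantzig-selector constraint. On the good event the truth satisfies it with 1 in place
  of 2; the slack pays for approximating the truth by a rational vector.\<close>

definition feasible :: "nat \<Rightarrow> nat \<Rightarrow> real \<Rightarrow> (nat \<Rightarrow> real) \<Rightarrow> (nat \<Rightarrow> obs) \<Rightarrow> bool" where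
  "feasible p n \<mu> b z \<longleftrightarrow> (\<forall>j\<in>{..<p}. \<bar>grad p n b z j\<bar> \<le> 2 * real n * \<mu>)"

text \<open>Every feasible candidate has the required error, so nothing has to be minimised and the
  first one is taken. If none is feasible, the index is some fixed number.\<close>

definition sel :: "nat \<Rightarrow> nat \<Rightarrow> nat \<Rightarrow> real \<Rightarrow> (nat \<Rightarrow> obs) \<Rightarrow> nat" where
  "sel p k n \<mu> z = (LEAST c. feasible p n \<mu> (cand p k c) z)"

lemma countable_cand_set: "countable (cand_set p k)"
proof -
  have "countable (PiE {..<p} (\<lambda>_. \<rat> :: real set))"
    by (rule countable_PiE) (auto simp: countable_rat)
  then have c: "countable ((\<lambda>f j. if j < p then f j else 0) ` PiE {..<p} (\<lambda>_. \<rat> :: real set))" by simp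
  have "cand_set p k \<subseteq> (\<lambda>f j. if j < p then f j else 0) ` PiE {..<p} (\<lambda>_. \<rat> :: real set)"
  proof
    fix v assume v: "v \<in> cand_set p k"
    have "restrict v {..<p} \<in> PiE {..<p} (\<lambda>_. \<rat>)" using v by (auto simp: cand_set_def)
    moreover have "v = (\<lambda>j. if j < p then restrict v {..<p} j else 0)" using v by (auto simp: cand_set_def)
    ultimately show "v \<in> (\<lambda>f j. if j < p then f j else 0) ` PiE {..<p} (\<lambda>_. \<rat> :: real set)"
      by (rule rev_image_eqI[where x="restrict v {..<p}"])
  qed
  then show ?thesis using c by (rule countable_subset)
qed

lemma cand_in: "cand p k c \<in> cand_set p k"
proof -
  have "(\<lambda>_. 0) \<in> cand_set p k" by (simp add: cand_set_def nnz_def)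
  then show ?thesis unfolding cand_def by (intro from_nat_into) auto
qed

lemma cand_surj: "v \<in> cand_set p k \<Longrightarrow> \<exists>c. cand p k c = v"
  unfolding cand_def using from_nat_into_surj[OF countable_cand_set] by blast

lemma grad_diff:
  "grad p n b z j - grad p n b' z j = (\<Sum>i<n. snd (z i) j * xb p (\<lambda>l. b' l - b l) (z i))"
  by (simp add: grad_def sum_subtractf[symmetric] sdot_diff_left algebra_simps)

text \<open>The truth is approximated by rationals on its own support, which preserves sparsity. The
  accuracy \<open>\<delta>\<close> may depend on the data because only existence is claimed; the
  summand 1 in \<open>L\<close> avoids a division by zero.\<close>

lemma feasible_exists:
  assumes noise: "\<And>j. j < p \<Longrightarrow> \<bar>grad p n b z j\<bar> \<le> real n * \<mu>" and sp: "nnz p b \<le> k" and pos: "0 < \<mu>" "0 < n"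
  shows "\<exists>c. feasible p n \<mu> (cand p k c) z"
proof -
  define L where "L = (\<Sum>i<n. \<Sum>j<p. \<Sum>l<p. \<bar>snd (z i) j\<bar> * \<bar>snd (z i) l\<bar>) + 1"
  have L: "1 \<le> L" unfolding L_def by (simp add: sum_nonneg)
  define \<delta> where "\<delta> = real n * \<mu> / L"
  have d: "0 < \<delta>" using pos L by (simp add: \<delta>_def)
  have "\<exists>r\<in>\<rat>. \<bar>b j - r\<bar> \<le> \<delta>" for j
  proof -
    obtain r where "r \<in> \<rat>" "b j < r" "r < b j + \<delta>" using Rats_dense_in_real[of "b j" "b j + \<delta>"] d by auto
    then show ?thesis by (intro bexI[of _ r]) auto
  qed
  then obtain r where r: "\<And>j. r j \<in> \<rat>" "\<And>j. \<bar>b j - r j\<bar> \<le> \<delta>" by metis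
  define v where "v j = (if j < p \<and> b j \<noteq> 0 then r j else 0)" for j
  have "{j. j < p \<and> v j \<noteq> 0} \<subseteq> {j. j < p \<and> b j \<noteq> 0}" by (auto simp: v_def)
  then have "nnz p v \<le> nnz p b" unfolding nnz_def by (intro card_mono) auto
  then have "v \<in> cand_set p k" using sp r(1) by (auto simp: cand_set_def v_def)
  then obtain c where c: "cand p k c = v" using cand_surj by blast
  have close: "\<bar>b j - v j\<bar> \<le> \<delta>" if "j < p" for j using r(2)[of j] d that by (auto simp: v_def)
  have "\<bar>grad p n v z j\<bar> \<le> 2 * real n * \<mu>" if j: "j < p" for j
  proof -
    have "\<bar>grad p n v z j - grad p n b z j\<bar> \<le> (\<Sum>i<n. \<Sum>l<p. \<bar>snd (z i) j\<bar> * (\<delta> * \<bar>snd (z i) l\<bar>))"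
      unfolding grad_diff sdot_def sum_distrib_left
      by (intro order.trans[OF sum_abs] sum_mono) (auto simp: abs_mult intro!: mult_left_mono mult_right_mono close)
    also have "\<dots> = \<delta> * (\<Sum>i<n. \<Sum>l<p. \<bar>snd (z i) j\<bar> * \<bar>snd (z i) l\<bar>)"
      by (simp add: sum_distrib_left mult_ac)
    also have "\<dots> \<le> \<delta> * L"
    proof (intro mult_left_mono)
      have "(\<Sum>i<n. \<Sum>l<p. \<bar>snd (z i) j\<bar> * \<bar>snd (z i) l\<bar>) \<le> (\<Sum>i<n. \<Sum>j<p. \<Sum>l<p. \<bar>snd (z i) j\<bar> * \<bar>snd (z i) l\<bar>)"
        by (intro sum_mono member_le_sum[of j "{..<p}" "\<lambda>j. \<Sum>l<p. \<bar>snd (z i) j\<bar> * \<bar>snd (z i) l\<bar>" for i])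
          (use j in \<open>auto intro!: sum_nonneg\<close>)
      then show "(\<Sum>i<n. \<Sum>l<p. \<bar>snd (z i) j\<bar> * \<bar>snd (z i) l\<bar>) \<le> L" by (simp add: L_def)
    qed (use d in simp)
    also have "\<dots> = real n * \<mu>" using L by (simp add: \<delta>_def)
    finally show ?thesis using noise[OF j] by linarith
  qed
  then have "feasible p n \<mu> (cand p k c) z" unfolding c feasible_def by auto
  then show ?thesis by blast
qed

lemma nnz_diff: "nnz p (\<lambda>j. u j - v j) \<le> nnz p u + nnz p v"
proof -
  have "{j. j < p \<and> u j - v j \<noteq> 0} \<subseteq> {j. j < p \<and> u j \<noteq> 0} \<union> {j. j < p \<and> v j \<noteq> 0}" by auto
  then have "nnz p (\<lambda>j. u j - v j) \<le> card ({j. j < p \<and> u j \<noteq> 0} \<union> {j. j < p \<and> v j \<noteq> 0})"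
    unfolding nnz_def by (intro card_mono) auto
  also have "\<dots> \<le> nnz p u + nnz p v" unfolding nnz_def by (rule card_Un_le)
  finally show ?thesis .
qed

text \<open>Both vectors are \<open>k\<close>-sparse, so their difference is
  \<open>2 * k\<close>-sparse and the sparse eigenvalue bound applies to it directly. The gradients
  of both are small, so the quadratic form of \<open>d\<close> is at most a multiple of its l1-norm
  \<open>L\<close>; sparsity bounds L^2 by 2 k times the squared Euclidean norm, and the resulting
  inequality, L^2 at most a multiple of L, is solved for \<open>L\<close>.\<close>

lemma estimator_error:
  fixes \<kappa> :: real
  assumes RE: "\<And>v. nnz p v \<le> 2 * k \<Longrightarrow> real n * sqn p v / \<kappa> \<le> (\<Sum>i<n. (xb p v (z i))\<^sup>2)"
    and noise: "\<And>j. j < p \<Longrightarrow> \<bar>grad p n b z j\<bar> \<le> real n * \<mu>" and sp: "nnz p b \<le> k"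
    and pos: "0 < \<mu>" "0 < n" "0 < \<kappa>"
  defines "d \<equiv> \<lambda>j. b j - cand p k (sel p k n \<mu> z) j"
  shows "sqn p d \<le> (3 * \<mu> * \<kappa>)\<^sup>2 * (2 * real k)" "(\<Sum>j<p. \<bar>d j\<bar>) \<le> 3 * \<mu> * \<kappa> * (2 * real k)"
proof -
  let ?b = "cand p k (sel p k n \<mu> z)"
  have feas: "feasible p n \<mu> ?b z"
    unfolding sel_def using feasible_exists[OF noise sp pos(1,2)] by (rule LeastI_ex)
  have "nnz p ?b \<le> k" using cand_in[of p k] by (simp add: cand_set_def)
  then have sd: "nnz p d \<le> 2 * k" using nnz_diff[of p b ?b] sp by (simp add: d_def)
  define L where "L = (\<Sum>j<p. \<bar>d j\<bar>)"
  have L0: "0 \<le> L" by (simp add: L_def sum_nonneg)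
  have "(\<Sum>i<n. (xb p d (z i))\<^sup>2) = (\<Sum>i<n. \<Sum>j<p. d j * (snd (z i) j * xb p d (z i)))"
    by (simp add: power2_eq_square sdot_def sum_distrib_right mult_ac)
  also have "\<dots> = (\<Sum>j<p. d j * (\<Sum>i<n. snd (z i) j * xb p d (z i)))"
    by (subst sum.swap) (simp add: sum_distrib_left)
  also have "\<dots> = (\<Sum>j<p. d j * (grad p n ?b z j - grad p n b z j))"
    unfolding grad_diff d_def ..
  also have "\<dots> \<le> (\<Sum>j<p. \<bar>d j\<bar> * (3 * real n * \<mu>))"
  proof (rule sum_mono)
    fix j assume "j \<in> {..<p}"
    then have j: "j < p" by simp
    have "\<bar>grad p n ?b z j - grad p n b z j\<bar> \<le> 3 * real n * \<mu>"
    proof -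
      have "\<bar>grad p n ?b z j\<bar> \<le> 2 * real n * \<mu>" using feas j by (simp add: feasible_def)
      then show ?thesis using noise[OF j] by linarith
    qed
    then have "\<bar>d j * (grad p n ?b z j - grad p n b z j)\<bar> \<le> \<bar>d j\<bar> * (3 * real n * \<mu>)"
      unfolding abs_mult by (intro mult_left_mono) auto
    then show "d j * (grad p n ?b z j - grad p n b z j) \<le> \<bar>d j\<bar> * (3 * real n * \<mu>)" by linarith
  qed
  also have "\<dots> = real n * (3 * \<mu> * L)" by (simp add: L_def sum_distrib_left mult_ac)
  finally have "real n * (sqn p d / \<kappa>) \<le> real n * (3 * \<mu> * L)" using RE[OF sd] by simp
  then have 1: "sqn p d \<le> 3 * \<mu> * \<kappa> * L" using pos by (simp add: field_simps)
  have L2: "L\<^sup>2 \<le> 2 * real k * sqn p d"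
    using L1_le_L2_sparse[OF sd] by (simp add: L_def)
  also have "\<dots> \<le> 2 * real k * (3 * \<mu> * \<kappa> * L)" using 1 by (intro mult_left_mono) auto
  finally have "L * L \<le> (3 * \<mu> * \<kappa> * (2 * real k)) * L" by (simp add: power2_eq_square mult_ac)
  then have 2: "L \<le> 3 * \<mu> * \<kappa> * (2 * real k)"
    using L0 pos by (cases "L = 0") (auto simp: mult_le_cancel_right)
  then show "(\<Sum>j<p. \<bar>d j\<bar>) \<le> 3 * \<mu> * \<kappa> * (2 * real k)" by (simp add: L_def)
  have "3 * \<mu> * \<kappa> * L \<le> 3 * \<mu> * \<kappa> * (3 * \<mu> * \<kappa> * (2 * real k))"
    using 2 pos by (intro mult_left_mono) auto
  also have "\<dots> = (3 * \<mu> * \<kappa>)\<^sup>2 * (2 * real k)" by (simp add: power2_eq_square)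
  finally show "sqn p d \<le> (3 * \<mu> * \<kappa>)\<^sup>2 * (2 * real k)" using 1 by linarith
qed

lemma measurable_xb: "(\<lambda>z. xb p v z) \<in> borel_measurable (obs_space p)"
  by measurable

section \<open>Deviation bounds for the random design\<close>

locale gaussian_design =
  fixes p :: nat and \<beta> :: "real Matrix.vec" and S :: "real mat" and \<sigma> M s\<^sub>0 :: real
  assumes good: "good_param p \<beta> S \<sigma>" and p_pos: "0 < p" and M1: "1 \<le> M" and sigma_le: "\<sigma> \<le> s\<^sub>0"
    and qlo: "\<And>v. sqn p v / M \<le> qf p S v v" and qhi: "\<And>v. qf p S v v \<le> M * sqn p v"
begin

abbreviation "law \<equiv> obs_law p (\<beta>, S, \<sigma>)"
abbreviation "b0 \<equiv> ($) \<beta>"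

lemma prob_law: "prob_space law"
  by (rule prob_space_obs_law[OF good])

lemma diag_le: "j < p \<Longrightarrow> S $$ (j, j) \<le> M" and diag_nonneg: "j < p \<Longrightarrow> 0 \<le> S $$ (j, j)"
proof -
  assume j: "j < p"
  let ?e = "\<lambda>l. if l = j then 1 else (0::real)"
  have q: "qf p S ?e ?e = S $$ (j, j)" using qf_unit[OF j j, of S 1 1] by simp
  have "sqn p ?e = 1" using j by (simp add: sqn_def if_distrib[where f="\<lambda>x. x\<^sup>2"] cong: if_cong)
  then show "S $$ (j, j) \<le> M" using qhi[of ?e] q by simp
  show "0 \<le> S $$ (j, j)" using pos_def_nonneg[OF pd[OF good], of ?e] q by simp
qed

text \<open>The sign \<open>c\<close> covers both tails. The bound is uniform over noise levels up
  to \<open>s\<^sub>0\<close>, because \<open>s\<^sub>0\<close> and not \<open>\<sigma>\<close>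
  enters the exponent.\<close>

lemma noise_tail:
  assumes j: "j < p" and \<mu>: "0 < \<mu>" "\<mu>\<^sup>2 \<le> 2 * (s\<^sub>0\<^sup>2 * M)" and c: "c = 1 \<or> c = -1"
  shows "emeasure (Pi\<^sub>M {..<n} (\<lambda>_. law)) {z \<in> space (Pi\<^sub>M {..<n} (\<lambda>_. law)). real n * \<mu> \<le> c * grad p n b0 z j}
    \<le> ennreal (exp (- (real n * \<mu>\<^sup>2 / (4 * (s\<^sub>0\<^sup>2 * M)))))"
proof -
  define B where "B = s\<^sub>0\<^sup>2 * M"
  have s: "0 < \<sigma>" using good by (simp add: good_param_def)
  have B: "0 < B" using s sigma_le M1 by (simp add: B_def)
  \<comment> \<open>The minimiser of t^2 B - t \<mu>, the exponent per observation. The assumption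
    that \<mu>^2 is at most 2 B says exactly that this \<open>t\<close> keeps t^2 B at most 1 / 2,
    as the moment bound requires.\<close>
  define t where "t = \<mu> / (2 * B)"
  have t: "0 < t" using \<mu> B by (simp add: t_def)
  note [measurable] = measurable_obs_coord[OF j]
  let ?g = "\<lambda>z. (c * t) * (snd z j * (fst z - xb p b0 z))"
  have le: "(c * t)\<^sup>2 * \<sigma>\<^sup>2 * S $$ (j, j) \<le> t\<^sup>2 * B"
  proof -
    have "(c * t)\<^sup>2 = t\<^sup>2" using c by auto
    moreover have "\<sigma>\<^sup>2 * S $$ (j, j) \<le> B"
      unfolding B_def using s sigma_le diag_le[OF j] diag_nonneg[OF j] by (intro mult_mono power_mono) auto
    ultimately show ?thesis using mult_left_mono[of "\<sigma>\<^sup>2 * S $$ (j, j)" B "t\<^sup>2"] by (simp add: mult.assoc)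
  qed
  have tB: "t\<^sup>2 * B = \<mu>\<^sup>2 / (4 * B)" using B by (simp add: t_def power2_eq_square field_simps)
  also have "\<dots> \<le> 1 / 2" using \<mu>(2) B by (simp add: B_def field_simps)
  finally have half: "(c * t)\<^sup>2 * \<sigma>\<^sup>2 * S $$ (j, j) \<le> 1 / 2" using le by linarith
  have "(\<integral>\<^sup>+z. ennreal (exp (?g z)) \<partial>law) \<le> ennreal (exp ((c * t)\<^sup>2 * \<sigma>\<^sup>2 * S $$ (j, j)))"
    by (rule nn_integral_obs_noise[OF good j half])
  also have "\<dots> \<le> ennreal (exp (t\<^sup>2 * B))" using le by (intro ennreal_leI) simp
  finally have E: "(\<integral>\<^sup>+z. ennreal (exp (?g z)) \<partial>law) \<le> ennreal (exp (t\<^sup>2 * B))" .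
  have gm: "?g \<in> borel_measurable law"
    unfolding measurable_cong_sets[OF sets_obs_law refl]
    by (intro borel_measurable_times borel_measurable_const borel_measurable_diff borel_measurable_power
        measurable_obs_fst measurable_xb measurable_obs_coord[OF j])
  have "{z \<in> space (Pi\<^sub>M {..<n} (\<lambda>_. law)). real n * \<mu> \<le> c * grad p n b0 z j} =
      {z \<in> space (Pi\<^sub>M {..<n} (\<lambda>_. law)). t * (real n * \<mu>) \<le> (\<Sum>i<n. ?g (z i))}"
  proof -
    have "(\<Sum>i<n. ?g (z i)) = t * (c * grad p n b0 z j)" for z
      by (simp add: grad_def sum_distrib_left mult_ac)
    then show ?thesis using t by (simp add: mult_le_cancel_left)
  qed
  also have "emeasure (Pi\<^sub>M {..<n} (\<lambda>_. law)) \<dots> \<le> ennreal (exp (- (t * (real n * \<mu>))) * exp (t\<^sup>2 * B) ^ card {..<n})"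
    by (rule chernoff_PiM[OF prob_law finite_lessThan gm E]) simp
  also have "exp (- (t * (real n * \<mu>))) * exp (t\<^sup>2 * B) ^ card {..<n} = exp (- (real n * \<mu>\<^sup>2 / (4 * B)))"
  proof -
    have "- (t * (real n * \<mu>)) + real n * (t\<^sup>2 * B) = - (real n * \<mu>\<^sup>2 / (4 * B))"
      unfolding tB using B by (simp add: t_def power2_eq_square field_simps)
    then show ?thesis by (simp flip: exp_of_nat_mult exp_add)
  qed
  finally show ?thesis by (simp add: B_def)
qed

text \<open>Markov's inequality suffices: the squared norm of a row has mean at most M p and is
  compared with p^2, which gives failure probability M / p.\<close>

lemma column_tail:
  assumes n: "0 < n"
  shows "emeasure (Pi\<^sub>M {..<n} (\<lambda>_. law)) {z \<in> space (Pi\<^sub>M {..<n} (\<lambda>_. law)). real n * (real p)\<^sup>2 \<le> (\<Sum>i<n. sqn p (snd (z i)))}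
    \<le> ennreal (M / real p)"
proof -
  have mj: "(\<lambda>z. snd z j) \<in> borel_measurable (obs_space p)" if "j < p" for j
    by (rule measurable_obs_coord[OF that])
  have [measurable]: "(\<lambda>z. sqn p (snd z)) \<in> borel_measurable (obs_space p)"
    unfolding sqn_def by (intro borel_measurable_sum borel_measurable_power mj) auto
  have "(\<integral>\<^sup>+z. ennreal (sqn p (snd z)) \<partial>law) = (\<integral>\<^sup>+z. (\<Sum>j<p. ennreal ((snd z j)\<^sup>2)) \<partial>law)"
    by (simp add: sqn_def sum_ennreal)
  also have "\<dots> = (\<Sum>j<p. \<integral>\<^sup>+z. ennreal ((snd z j)\<^sup>2) \<partial>law)"
    using mj by (intro nn_integral_sum) (auto simp: measurable_cong_sets[OF sets_obs_law refl])
  also have "\<dots> = (\<Sum>j<p. ennreal (S $$ (j, j)))"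
  proof (intro sum.cong refl)
    fix j assume "j \<in> {..<p}"
    then have j: "j < p" by simp
    show "(\<integral>\<^sup>+z. ennreal ((snd z j)\<^sup>2) \<partial>law) = ennreal (S $$ (j, j))"
      using nn_integral_obs_sq[OF good, of "\<lambda>l. if l = j then 1 else 0" 0] qf_unit[OF j j, of S 1 1]
      by (simp add: sdot_unit[OF j])
  qed
  also have "\<dots> \<le> (\<Sum>j<p. ennreal M)" using diag_le by (intro sum_mono ennreal_leI) auto
  also have "\<dots> = ennreal (real p * M)" using M1 by (simp add: ennreal_mult' ennreal_of_nat_eq_real_of_nat)
  finally have E: "(\<integral>\<^sup>+z. ennreal (sqn p (snd z)) \<partial>law) \<le> ennreal (real p * M)" .
  have "emeasure (Pi\<^sub>M {..<n} (\<lambda>_. law)) {z \<in> space (Pi\<^sub>M {..<n} (\<lambda>_. law)). real n * (real p)\<^sup>2 \<le> (\<Sum>i<n. sqn p (snd (z i)))}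
    \<le> ennreal (real (card {..<n}) * (real p * M) / (real n * (real p)\<^sup>2))"
    using M1 n p_pos by (intro markov_sum_PiM[OF prob_law _ _ _ E]) (auto simp: sqn_nonneg)
  also have "real (card {..<n}) * (real p * M) / (real n * (real p)\<^sup>2) = M / real p"
    using n p_pos by (simp add: power2_eq_square)
  finally show ?thesis .
qed

lemma lower_tail:
  assumes v: "0 < sqn p v"
  shows "emeasure (Pi\<^sub>M {..<n} (\<lambda>_. law)) {z \<in> space (Pi\<^sub>M {..<n} (\<lambda>_. law)). (\<Sum>i<n. (xb p v (z i))\<^sup>2) \<le> real n * sqn p v / (4 * M)}
    \<le> ennreal (exp (- (real n / 4)))"
proof -
  define q where "q = qf p S v v"
  have q2: "sqn p v / M \<le> q" using qlo[of v] by (simp add: q_def)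
  have "0 < sqn p v / M" using v M1 by simp
  with q2 have q: "0 < q" "sqn p v / M \<le> q" by linarith+
  \<comment> \<open>Chosen so that the Laplace transform (1 + 2 s q)^(-1/2) equals 1 / 2. At a
    quarter of the mean the Chernoff bound is then exp (3 n / 8) / 2^n, and 3 / 8 + 1 / 4 = 5 / 8 is
    below ln 2.\<close>
  define s where "s = 3 / (2 * q)"
  have s: "0 < s" using q by (simp add: s_def)
  let ?g = "\<lambda>z. - s * (xb p v z)\<^sup>2"
  have E: "(\<integral>\<^sup>+z. ennreal (exp (?g z)) \<partial>law) \<le> ennreal (1 / 2)"
    using nn_integral_obs_exp_sq[OF good, of s v] s q by (simp add: s_def flip: q_def)
  have gm: "?g \<in> borel_measurable law"
    unfolding measurable_cong_sets[OF sets_obs_law refl]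
    by (intro borel_measurable_times borel_measurable_const borel_measurable_diff borel_measurable_power
        measurable_obs_fst measurable_xb)
  have "emeasure (Pi\<^sub>M {..<n} (\<lambda>_. law)) {z \<in> space (Pi\<^sub>M {..<n} (\<lambda>_. law)). (\<Sum>i<n. (xb p v (z i))\<^sup>2) \<le> real n * sqn p v / (4 * M)}
    \<le> emeasure (Pi\<^sub>M {..<n} (\<lambda>_. law)) {z \<in> space (Pi\<^sub>M {..<n} (\<lambda>_. law)). - s * (real n * q / 4) \<le> (\<Sum>i<n. ?g (z i))}"
  proof (intro emeasure_mono)
    have "real n * sqn p v / (4 * M) \<le> real n * q / 4"
      using mult_left_mono[OF q(2), of "real n / 4"] by simp
    then show "{z \<in> space (Pi\<^sub>M {..<n} (\<lambda>_. law)). (\<Sum>i<n. (xb p v (z i))\<^sup>2) \<le> real n * sqn p v / (4 * M)} \<subseteq>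
      {z \<in> space (Pi\<^sub>M {..<n} (\<lambda>_. law)). - s * (real n * q / 4) \<le> (\<Sum>i<n. ?g (z i))}"
    proof (intro subsetI CollectI conjI)
      fix z assume le: "real n * sqn p v / (4 * M) \<le> real n * q / 4"
        and z: "z \<in> {z \<in> space (Pi\<^sub>M {..<n} (\<lambda>_. law)). (\<Sum>i<n. (xb p v (z i))\<^sup>2) \<le> real n * sqn p v / (4 * M)}"
      then show "z \<in> space (Pi\<^sub>M {..<n} (\<lambda>_. law))" by simp
      have "(\<Sum>i<n. (xb p v (z i))\<^sup>2) \<le> real n * sqn p v / (4 * M)" using z by blast
      then have "(\<Sum>i<n. (xb p v (z i))\<^sup>2) \<le> real n * q / 4" using le by (rule order_trans)
      then have "s * (\<Sum>i<n. (xb p v (z i))\<^sup>2) \<le> s * (real n * q / 4)" using s by (intro mult_left_mono) auto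
      then show "- s * (real n * q / 4) \<le> (\<Sum>i<n. ?g (z i))" by (simp add: sum_distrib_left sum_negf)
    qed
  next
    have [measurable]: "?g \<in> borel_measurable law" by (rule gm)
    show "{z \<in> space (Pi\<^sub>M {..<n} (\<lambda>_. law)). - s * (real n * q / 4) \<le> (\<Sum>i<n. ?g (z i))} \<in> sets (Pi\<^sub>M {..<n} (\<lambda>_. law))"
      by measurable
  qed
  also have "\<dots> \<le> ennreal (exp (- (- s * (real n * q / 4))) * (1 / 2) ^ card {..<n})"
    by (rule chernoff_PiM[OF prob_law finite_lessThan gm E]) simp
  also have "\<dots> \<le> ennreal (exp (- (real n / 4)))"
  proof (rule ennreal_leI)
    have "- (- s * (real n * q / 4)) = real n * (3 / 8)" using q by (simp add: s_def)
    then have "exp (- (- s * (real n * q / 4))) = exp (real n * (3 / 8))" by simp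
    moreover have "(1 / 2 :: real) ^ card {..<n} = exp (- (real n * ln 2))"
      by (simp add: exp_minus exp_of_nat_mult power_one_over inverse_eq_divide)
    moreover have "real n * (3 / 8) - real n * ln 2 \<le> - (real n / 4)"
    proof -
      have "5 / 8 \<le> ln (2::real)" using ln2_ge_two_thirds by simp
      then show ?thesis using mult_left_mono[of "5/8" "ln 2" "real n"] by simp
    qed
    moreover have "exp (real n * (3 / 8)) * exp (- (real n * ln 2)) = exp (real n * (3 / 8) - real n * ln 2)"
      by (simp flip: exp_add)
    ultimately show "exp (- (- s * (real n * q / 4))) * (1 / 2) ^ card {..<n} \<le> exp (- (real n / 4))"
      by (simp only: exp_le_cancel_iff)
  qed
  finally show ?thesis .
qed

end

section \<open>The debiased estimator\<close>

definition slope_stat :: "nat \<Rightarrow> (nat \<Rightarrow> real) \<Rightarrow> (nat \<Rightarrow> real) \<Rightarrow> obs \<Rightarrow> real" where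
  "slope_stat p u b z = xb p u z * (fst z - xb p b z)"

text \<open>A one-step correction: the plug-in value plus an average over the observations in
  \<open>I\<close> that estimates the covariance form of \<open>u\<close> and the error of
  \<open>b\<close>.\<close>

definition debiased :: "nat \<Rightarrow> (nat \<Rightarrow> real) \<Rightarrow> (nat \<Rightarrow> real) \<Rightarrow> nat set \<Rightarrow> (nat \<Rightarrow> real) \<Rightarrow> (nat \<Rightarrow> obs) \<Rightarrow> real" where
  "debiased p \<xi> u I b z = sdot p \<xi> b + (\<Sum>i\<in>I. slope_stat p u b (z i)) / real (card I)"

definition est :: "nat \<Rightarrow> (nat \<Rightarrow> real) \<Rightarrow> (nat \<Rightarrow> real) \<Rightarrow> nat \<Rightarrow> nat \<Rightarrow> nat \<Rightarrow> real \<Rightarrow> (nat \<Rightarrow> obs) \<Rightarrow> real" where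
  "est p \<xi> u k n\<^sub>1 n\<^sub>2 \<mu> z = debiased p \<xi> u {n\<^sub>1..<n\<^sub>1 + n\<^sub>2} (cand p k (sel p k n\<^sub>1 \<mu> z)) z"

lemma measurable_component_obs:
  "i \<in> I \<Longrightarrow> f \<in> borel_measurable (obs_space p) \<Longrightarrow> (\<lambda>z. f (z i)) \<in> borel_measurable (Pi\<^sub>M I (\<lambda>_. obs_space p))"
  by (rule measurable_compose[OF measurable_component_singleton])

lemma measurable_grad:
  assumes "j < p" "{..<n} \<subseteq> I"
  shows "(\<lambda>z. grad p n b z j) \<in> borel_measurable (Pi\<^sub>M I (\<lambda>_. obs_space p))"
proof -
  have "(\<lambda>z. snd z j * (fst z - xb p b z)) \<in> borel_measurable (obs_space p)"
    by (intro borel_measurable_times borel_measurable_diff measurable_obs_fst measurable_xb measurable_obs_coord assms)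
  then show ?thesis unfolding grad_def using assms(2)
    by (intro borel_measurable_sum measurable_component_obs[where f="\<lambda>z. snd z j * (fst z - xb p b z)"]) auto
qed

lemma measurable_sel:
  assumes "{..<n} \<subseteq> I"
  shows "sel p k n \<mu> \<in> Pi\<^sub>M I (\<lambda>_. obs_space p) \<rightarrow>\<^sub>M count_space UNIV"
proof -
  have "Measurable.pred (Pi\<^sub>M I (\<lambda>_. obs_space p)) (feasible p n \<mu> b)" for b
    unfolding feasible_def
  proof (intro pred_intros_finite finite_lessThan)
    fix j assume "j \<in> {..<p}"
    then have [measurable]: "(\<lambda>z. grad p n b z j) \<in> borel_measurable (Pi\<^sub>M I (\<lambda>_. obs_space p))"
      using measurable_grad assms by auto
    show "Measurable.pred (Pi\<^sub>M I (\<lambda>_. obs_space p)) (\<lambda>z. \<bar>grad p n b z j\<bar> \<le> 2 * real n * \<mu>)" by measurable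
  qed
  then show ?thesis unfolding sel_def[abs_def] by (intro measurable_Least)
qed

lemma measurable_slope_stat: "slope_stat p u b \<in> borel_measurable (obs_space p)"
  unfolding slope_stat_def
  by (intro borel_measurable_times borel_measurable_diff measurable_obs_fst measurable_xb)

lemma measurable_debiased:
  assumes "J \<subseteq> I"
  shows "debiased p \<xi> u J b \<in> borel_measurable (Pi\<^sub>M I (\<lambda>_. obs_space p))"
proof -
  have "(\<lambda>z. slope_stat p u b (z i)) \<in> borel_measurable (Pi\<^sub>M I (\<lambda>_. obs_space p))" if "i \<in> J" for i
    using that assms by (intro measurable_component_obs measurable_slope_stat) auto
  then show ?thesis unfolding debiased_def[abs_def]
    by (intro borel_measurable_add borel_measurable_const borel_measurable_divide borel_measurable_sum)
qed

lemma measurable_est: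
  "est p \<xi> u k n\<^sub>1 n\<^sub>2 \<mu> \<in> borel_measurable (Pi\<^sub>M {..<n\<^sub>1 + n\<^sub>2} (\<lambda>_. obs_space p))"
  unfolding est_def[abs_def]
  by (rule measurable_compose_countable[where f="\<lambda>c z. debiased p \<xi> u {n\<^sub>1..<n\<^sub>1 + n\<^sub>2} (cand p k c) z"])
    (auto intro!: measurable_debiased measurable_sel)

context gaussian_design
begin

lemma sets_PiM_law: "sets (Pi\<^sub>M I (\<lambda>_. law)) = sets (Pi\<^sub>M I (\<lambda>_. obs_space p))"
  by (rule sets_PiM_cong) auto

lemma measurable_PiM_law: "measurable (Pi\<^sub>M I (\<lambda>_. law)) N = measurable (Pi\<^sub>M I (\<lambda>_. obs_space p)) N"
  by (rule measurable_cong_sets[OF sets_PiM_law refl])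

text \<open>The exceptional event collects the two noise tails of every coordinate, oversized rows,
  and failures of the lower tail on the grid. Outside it \<open>sparse_eigenvalue\<close> and
  \<open>estimator_error\<close> apply, so all probability sits in one union bound.\<close>

lemma first_half:
  assumes n: "0 < n" and \<mu>: "0 < \<mu>" "\<mu>\<^sup>2 \<le> 2 * (s\<^sub>0\<^sup>2 * M)" and N: "0 < N"
    and KN: "16 * M * real (2 * k) * (real p)\<^sup>2 \<le> (real N)\<^sup>2" "2 * k \<le> N\<^sup>2" and sp: "nnz p b0 \<le> k"
  obtains A where "A \<in> sets (Pi\<^sub>M {..<n} (\<lambda>_. law))"
    "emeasure (Pi\<^sub>M {..<n} (\<lambda>_. law)) A \<le>
      ennreal (2 * real p * exp (- (real n * \<mu>\<^sup>2 / (4 * (s\<^sub>0\<^sup>2 * M)))) + M / real p + real ((p * (2 * N + 1)) ^ (2 * k)) * exp (- (real n / 4)))"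
    "\<And>z. z \<in> space (Pi\<^sub>M {..<n} (\<lambda>_. law)) \<Longrightarrow> z \<notin> A \<Longrightarrow>
      sqn p (\<lambda>j. b0 j - cand p k (sel p k n \<mu> z) j) \<le> (3 * \<mu> * (64 * M))\<^sup>2 * (2 * real k) \<and>
      (\<Sum>j<p. \<bar>b0 j - cand p k (sel p k n \<mu> z) j\<bar>) \<le> 3 * \<mu> * (64 * M) * (2 * real k)"
proof -
  let ?P = "Pi\<^sub>M {..<n} (\<lambda>_. law)"
  define A1 where "A1 c j = {z \<in> space ?P. real n * \<mu> \<le> c * grad p n b0 z j}" for c j
  define A2 where "A2 = {z \<in> space ?P. real n * (real p)\<^sup>2 \<le> (\<Sum>i<n. sqn p (snd (z i)))}"
  define A3 where "A3 v = {z \<in> space ?P. (\<Sum>i<n. (xb p v (z i))\<^sup>2) \<le> real n * sqn p v / (4 * M)}" for v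
  \<comment> \<open>The zero vector is left out because \<open>lower_tail\<close> needs positive
    variance; for it the grid inequality is trivial.\<close>
  define Net where "Net = {v \<in> grid_net p (2 * k) N. 0 < sqn p v}"
  have finNet: "finite Net" unfolding Net_def using finite_card_grid_net(1)[OF p_pos] by simp
  have cardNet: "card Net \<le> (p * (2 * N + 1)) ^ (2 * k)"
    using card_mono[OF finite_card_grid_net(1)[OF p_pos], of Net "2 * k" N] finite_card_grid_net(2)[OF p_pos, of "2 * k" N]
    by (auto simp: Net_def)
  have mA1: "A1 c j \<in> sets ?P" if "j < p" for c j
  proof -
    have [measurable]: "(\<lambda>z. grad p n b0 z j) \<in> borel_measurable ?P"
      unfolding measurable_PiM_law by (rule measurable_grad[OF that]) simp
    show ?thesis unfolding A1_def by measurable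
  qed
  have mA2: "A2 \<in> sets ?P"
  proof -
    have "(\<lambda>z. sqn p (snd z)) \<in> borel_measurable (obs_space p)"
      unfolding sqn_def by (intro borel_measurable_sum borel_measurable_power measurable_obs_coord) simp
    then have [measurable]: "(\<lambda>z. \<Sum>i<n. sqn p (snd (z i))) \<in> borel_measurable ?P"
      unfolding measurable_PiM_law
      by (intro borel_measurable_sum measurable_component_obs[where f="\<lambda>z. sqn p (snd z)"])
    show ?thesis unfolding A2_def by measurable
  qed
  have mA3: "A3 v \<in> sets ?P" for v
  proof -
    have [measurable]: "(\<lambda>z. \<Sum>i<n. (xb p v (z i))\<^sup>2) \<in> borel_measurable ?P"
      unfolding measurable_PiM_law
      by (intro borel_measurable_sum measurable_component_obs[where f="\<lambda>z. (xb p v z)\<^sup>2"] borel_measurable_power measurable_xb)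
    show ?thesis unfolding A3_def by measurable
  qed
  let ?e1 = "exp (- (real n * \<mu>\<^sup>2 / (4 * (s\<^sub>0\<^sup>2 * M))))" and ?e3 = "exp (- (real n / 4))"
  define A where "A = ((\<Union>j\<in>{..<p}. A1 1 j) \<union> (\<Union>j\<in>{..<p}. A1 (-1) j)) \<union> (A2 \<union> (\<Union>v\<in>Net. A3 v))"
  have s1: "(\<Union>j\<in>{..<p}. A1 c j) \<in> sets ?P" for c using mA1 by (intro sets.finite_UN) auto
  have s3: "(\<Union>v\<in>Net. A3 v) \<in> sets ?P" using mA3 finNet by (intro sets.finite_UN) auto
  have e1: "emeasure ?P (\<Union>j\<in>{..<p}. A1 c j) \<le> ennreal (real p * ?e1)" if c: "c = 1 \<or> c = -1" for c
  proof -
    have "emeasure ?P (\<Union>j\<in>{..<p}. A1 c j) \<le> (\<Sum>j<p. emeasure ?P (A1 c j))"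
      using mA1 by (intro emeasure_subadditive_finite) auto
    also have "\<dots> \<le> (\<Sum>j<p. ennreal ?e1)"
      unfolding A1_def using \<mu> c by (intro sum_mono noise_tail) auto
    also have "\<dots> = ennreal (real p * ?e1)" by (simp add: ennreal_mult' ennreal_of_nat_eq_real_of_nat)
    finally show ?thesis .
  qed
  have e3: "emeasure ?P (\<Union>v\<in>Net. A3 v) \<le> ennreal (real ((p * (2 * N + 1)) ^ (2 * k)) * ?e3)"
  proof -
    have "emeasure ?P (\<Union>v\<in>Net. A3 v) \<le> (\<Sum>v\<in>Net. emeasure ?P (A3 v))"
      using mA3 finNet by (intro emeasure_subadditive_finite) auto
    also have "\<dots> \<le> (\<Sum>v\<in>Net. ennreal ?e3)"
      unfolding A3_def by (intro sum_mono lower_tail) (simp add: Net_def)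
    also have "\<dots> = ennreal (real (card Net) * ?e3)" by (simp add: ennreal_mult' ennreal_of_nat_eq_real_of_nat)
    also have "\<dots> \<le> ennreal (real ((p * (2 * N + 1)) ^ (2 * k)) * ?e3)"
      using cardNet by (intro ennreal_leI mult_right_mono) (simp_all only: of_nat_le_iff exp_ge_zero)
    finally show ?thesis .
  qed
  have e2: "emeasure ?P A2 \<le> ennreal (M / real p)" unfolding A2_def by (rule column_tail[OF n])
  have "emeasure ?P A \<le> (emeasure ?P (\<Union>j\<in>{..<p}. A1 1 j) + emeasure ?P (\<Union>j\<in>{..<p}. A1 (-1) j)) + (emeasure ?P A2 + emeasure ?P (\<Union>v\<in>Net. A3 v))"
    unfolding A_def using s1 s3 mA2
    by (intro order.trans[OF emeasure_subadditive] add_mono emeasure_subadditive) auto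
  also have "\<dots> \<le> (ennreal (real p * ?e1) + ennreal (real p * ?e1)) + (ennreal (M / real p) + ennreal (real ((p * (2 * N + 1)) ^ (2 * k)) * ?e3))"
    by (intro add_mono e1 e2 e3) auto
  also have "\<dots> = ennreal (2 * real p * ?e1 + M / real p + real ((p * (2 * N + 1)) ^ (2 * k)) * ?e3)"
    using M1 by (subst ennreal_plus[symmetric]; (subst ennreal_plus[symmetric])?; (subst ennreal_plus[symmetric])?) (auto intro!: arg_cong[where f=ennreal])
  finally have eA: "emeasure ?P A \<le> ennreal (2 * real p * ?e1 + M / real p + real ((p * (2 * N + 1)) ^ (2 * k)) * ?e3)" .
  have sA: "A \<in> sets ?P" unfolding A_def using s1 s3 mA2 by auto
  show thesis
  proof (rule that[OF sA eA])
    fix z assume z: "z \<in> space ?P" "z \<notin> A"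
    have noise: "\<bar>grad p n b0 z j\<bar> \<le> real n * \<mu>" if "j < p" for j
    proof -
      have "z \<notin> A1 1 j" "z \<notin> A1 (-1) j" using z(2) that by (auto simp: A_def)
      then show ?thesis using z(1) by (auto simp: A1_def abs_le_iff)
    qed
    have H2: "(\<Sum>i<n. sqn p (snd (z i))) \<le> real n * (real p)\<^sup>2"
      using z by (auto simp: A_def A2_def)
    have H3: "real n * sqn p v / (4 * M) \<le> (\<Sum>i<n. (xb p v (z i))\<^sup>2)" if "v \<in> grid_net p (2 * k) N" for v
    proof (cases "0 < sqn p v")
      case True
      then have "z \<notin> A3 v" using z(2) that by (auto simp: A_def Net_def)
      then show ?thesis using z(1) by (auto simp: A3_def)
    next
      case False
      then have "sqn p v = 0" using sqn_nonneg[of p v] by simp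
      then show ?thesis by (simp add: sum_nonneg)
    qed
    have "real n * sqn p v / (64 * M) \<le> (\<Sum>i<n. (xb p v (z i))\<^sup>2)" if "nnz p v \<le> 2 * k" for v
      using M1 by (intro sparse_eigenvalue[OF _ N KN H2 H3 that]) auto
    from estimator_error[OF this noise sp \<mu>(1) n] M1
    show "sqn p (\<lambda>j. b0 j - cand p k (sel p k n \<mu> z) j) \<le> (3 * \<mu> * (64 * M))\<^sup>2 * (2 * real k) \<and>
      (\<Sum>j<p. \<bar>b0 j - cand p k (sel p k n \<mu> z) j\<bar>) \<le> 3 * \<mu> * (64 * M) * (2 * real k)"
      by simp
  qed
qed

text \<open>As \<open>u\<close> inverts \<open>S\<close> on the truncated loading, the mean of the
  correction is exactly the error of \<open>b\<close> along the first \<open>m\<close> loadings;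
  what remains is a bias of at most \<open>nx * L\<close>. The candidate \<open>b\<close> is fixed
  here and a constant error probability is enough, so Chebyshev's inequality handles the
  fluctuation.\<close>

lemma second_half:
  fixes \<xi> u b :: "nat \<Rightarrow> real"
  assumes I: "finite I" "I \<noteq> {}" and u: "\<And>i. i < p \<Longrightarrow> (\<Sum>j<p. S $$ (i, j) * u j) = (if i < m then \<xi> i else 0)"
    and U: "qf p S u u \<le> U" "0 < U"
    and D: "sqn p (\<lambda>j. b0 j - b j) \<le> D" "0 < D" and L: "(\<Sum>j<p. \<bar>b0 j - b j\<bar>) \<le> L"
    and nx: "\<And>j. m \<le> j \<Longrightarrow> j < p \<Longrightarrow> \<bar>\<xi> j\<bar> \<le> nx" "0 \<le> nx" and R: "0 < R"
  shows "emeasure (Pi\<^sub>M I (\<lambda>_. law)) {z \<in> space (Pi\<^sub>M I (\<lambda>_. law)). R + nx * L < \<bar>debiased p \<xi> u I b z - sdot p \<xi> b0\<bar>} \<le>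
    ennreal ((3 * U * (M * D) + s\<^sub>0\<^sup>2 * U) / (real (card I) * R\<^sup>2))"
proof -
  let ?P = "Pi\<^sub>M I (\<lambda>_. law)"
  let ?d = "\<lambda>j. b0 j - b j"
  define m' where "m' = qf p S u ?d"
  have sym: "\<forall>i<p. \<forall>j<p. S $$ (i, j) = S $$ (j, i)" using pd[OF good] by (simp add: pos_def_def)
  have m'_eq: "m' = (\<Sum>i<p. ?d i * (if i < m then \<xi> i else 0))"
    unfolding m'_def qf_commute[OF sym, of u] using u
    by (simp add: qf_def mult.assoc sum_distrib_left[symmetric])
  have bias: "\<bar>sdot p \<xi> b + m' - sdot p \<xi> b0\<bar> \<le> nx * L"
  proof -
    have "sdot p \<xi> b + m' - sdot p \<xi> b0 = (\<Sum>i<p. - (if i < m then 0 else \<xi> i * ?d i))"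
      unfolding m'_eq sdot_def sum.distrib[symmetric] sum_subtractf[symmetric]
      by (intro sum.cong) (auto simp: algebra_simps)
    also have "\<bar>\<dots>\<bar> \<le> (\<Sum>i<p. nx * \<bar>?d i\<bar>)"
      using nx by (intro order.trans[OF sum_abs] sum_mono) (auto simp: abs_mult intro!: mult_right_mono)
    also have "\<dots> \<le> nx * L" using L nx(2) by (simp add: sum_distrib_left[symmetric] mult_left_mono)
    finally show ?thesis .
  qed
  have cI: "0 < real (card I)" using I by (simp add: card_gt_0_iff)
  have qd: "qf p S ?d ?d \<le> M * D" using qhi[of ?d] D(1) M1 by (meson mult_left_mono order_trans zero_le_one)
  have V: "(\<integral>\<^sup>+z. ennreal ((slope_stat p u b z)\<^sup>2) \<partial>law) \<le> ennreal (3 * U * (M * D) + s\<^sub>0\<^sup>2 * U)"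
  proof -
    have "(\<integral>\<^sup>+z. ennreal ((slope_stat p u b z)\<^sup>2) \<partial>law) \<le> ennreal (3 * U * (M * D) + \<sigma>\<^sup>2 * U)"
      unfolding slope_stat_def using second_moment_product[OF good U qd] M1 D(2) by simp
    also have "\<dots> \<le> ennreal (3 * U * (M * D) + s\<^sub>0\<^sup>2 * U)"
      using U(2) sigma_le good by (intro ennreal_leI add_left_mono mult_right_mono power_mono) (auto simp: good_param_def)
    finally show ?thesis .
  qed
  have "emeasure ?P {z \<in> space ?P. R + nx * L < \<bar>debiased p \<xi> u I b z - sdot p \<xi> b0\<bar>}
     \<le> emeasure ?P {z \<in> space ?P. real (card I) * R \<le> \<bar>\<Sum>i\<in>I. (slope_stat p u b (z i) - m')\<bar>}"
  proof (rule emeasure_mono)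
    show "{z \<in> space ?P. R + nx * L < \<bar>debiased p \<xi> u I b z - sdot p \<xi> b0\<bar>} \<subseteq>
      {z \<in> space ?P. real (card I) * R \<le> \<bar>\<Sum>i\<in>I. (slope_stat p u b (z i) - m')\<bar>}"
    proof (intro subsetI CollectI conjI)
      fix z assume z: "z \<in> {z \<in> space ?P. R + nx * L < \<bar>debiased p \<xi> u I b z - sdot p \<xi> b0\<bar>}"
      then show "z \<in> space ?P" by blast
      have "debiased p \<xi> u I b z - sdot p \<xi> b0 = (sdot p \<xi> b + m' - sdot p \<xi> b0) + (\<Sum>i\<in>I. (slope_stat p u b (z i) - m')) / real (card I)"
        using cI by (simp add: debiased_def sum_subtractf field_simps)
      moreover have "R + nx * L < \<bar>debiased p \<xi> u I b z - sdot p \<xi> b0\<bar>" using z by blast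
      ultimately have "R \<le> \<bar>(\<Sum>i\<in>I. (slope_stat p u b (z i) - m')) / real (card I)\<bar>"
        using bias by linarith
      then show "real (card I) * R \<le> \<bar>\<Sum>i\<in>I. (slope_stat p u b (z i) - m')\<bar>"
        using cI by (simp add: field_simps)
    qed
    have [measurable]: "(\<lambda>z. \<Sum>i\<in>I. (slope_stat p u b (z i) - m')) \<in> borel_measurable ?P"
      unfolding measurable_PiM_law
      by (intro borel_measurable_sum borel_measurable_diff borel_measurable_const measurable_component_obs measurable_slope_stat)
    show "{z \<in> space ?P. real (card I) * R \<le> \<bar>\<Sum>i\<in>I. (slope_stat p u b (z i) - m')\<bar>} \<in> sets ?P" by measurable
  qed
  also have "\<dots> \<le> ennreal (real (card I) * (3 * U * (M * D) + s\<^sub>0\<^sup>2 * U) / (real (card I) * R)\<^sup>2)"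
    using mean_product[OF good, of u b] V U D M1 cI R
    by (intro chebyshev_PiM[OF prob_law I(1)]) (auto simp: m'_def slope_stat_def)
  also have "real (card I) * (3 * U * (M * D) + s\<^sub>0\<^sup>2 * U) / (real (card I) * R)\<^sup>2 = (3 * U * (M * D) + s\<^sub>0\<^sup>2 * U) / (real (card I) * R\<^sup>2)"
    using cI by (simp add: power2_eq_square)
  finally show ?thesis .
qed

text \<open>Sample splitting: conditionally on the first part of the sample the selected candidate is fixed.\<close>
lemma split_sample:
  fixes e\<^sub>1 e\<^sub>2 :: real
  assumes A: "A \<in> sets (Pi\<^sub>M {..<n\<^sub>1} (\<lambda>_. law))" "emeasure (Pi\<^sub>M {..<n\<^sub>1} (\<lambda>_. law)) A \<le> ennreal e\<^sub>1" and e: "0 \<le> e\<^sub>1" "0 \<le> e\<^sub>2"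
    and B: "\<And>z. z \<in> space (Pi\<^sub>M {..<n\<^sub>1} (\<lambda>_. law)) \<Longrightarrow> z \<notin> A \<Longrightarrow>
      emeasure (Pi\<^sub>M {n\<^sub>1..<n\<^sub>1 + n\<^sub>2} (\<lambda>_. law)) {y \<in> space (Pi\<^sub>M {n\<^sub>1..<n\<^sub>1 + n\<^sub>2} (\<lambda>_. law)).
        R < \<bar>debiased p \<xi> u {n\<^sub>1..<n\<^sub>1 + n\<^sub>2} (cand p k (sel p k n\<^sub>1 \<mu> z)) y - t\<bar>} \<le> ennreal e\<^sub>2"
  shows "emeasure (Pi\<^sub>M {..<n\<^sub>1 + n\<^sub>2} (\<lambda>_. law)) {z \<in> space (Pi\<^sub>M {..<n\<^sub>1 + n\<^sub>2} (\<lambda>_. law)). R < \<bar>est p \<xi> u k n\<^sub>1 n\<^sub>2 \<mu> z - t\<bar>}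
    \<le> ennreal (e\<^sub>1 + e\<^sub>2)"
proof -
  interpret L: prob_space law by (rule prob_law)
  interpret product_prob_space "\<lambda>_::nat. law" "{..<n\<^sub>1 + n\<^sub>2}" ..
  let ?I = "{..<n\<^sub>1}" and ?J = "{n\<^sub>1..<n\<^sub>1 + n\<^sub>2}"
  let ?P = "Pi\<^sub>M {..<n\<^sub>1 + n\<^sub>2} (\<lambda>_. law)" and ?P1 = "Pi\<^sub>M ?I (\<lambda>_. law)" and ?P2 = "Pi\<^sub>M ?J (\<lambda>_. law)"
  have un: "{..<n\<^sub>1 + n\<^sub>2} = ?I \<union> ?J" by auto
  interpret P2: prob_space ?P2 by (rule prob_space_PiM) (rule prob_law)
  interpret P1: prob_space ?P1 by (rule prob_space_PiM) (rule prob_law)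
  let ?E = "{z \<in> space ?P. R < \<bar>est p \<xi> u k n\<^sub>1 n\<^sub>2 \<mu> z - t\<bar>}"
  have [measurable]: "est p \<xi> u k n\<^sub>1 n\<^sub>2 \<mu> \<in> borel_measurable ?P"
    unfolding measurable_PiM_law by (rule measurable_est)
  have sE: "?E \<in> sets ?P" by measurable
  have grad_merge: "grad p n\<^sub>1 b (merge ?I ?J (x, y)) j = grad p n\<^sub>1 b x j" for b x y j
    unfolding grad_def by (intro sum.cong) (auto simp: merge_def)
  have sel_merge: "sel p k n\<^sub>1 \<mu> (merge ?I ?J (x, y)) = sel p k n\<^sub>1 \<mu> x" for x y
    by (simp add: sel_def feasible_def grad_merge)
  have est_merge: "est p \<xi> u k n\<^sub>1 n\<^sub>2 \<mu> (merge ?I ?J (x, y)) = debiased p \<xi> u ?J (cand p k (sel p k n\<^sub>1 \<mu> x)) y" for x y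
    unfolding est_def sel_merge debiased_def
    by (intro arg_cong2[where f="(+)"] refl arg_cong2[where f="(/)"] sum.cong) (auto simp: merge_def)
  have "emeasure ?P ?E = (\<integral>\<^sup>+z. indicator ?E z \<partial>?P)" using sE by simp
  also have "\<dots> = (\<integral>\<^sup>+x. (\<integral>\<^sup>+y. indicator ?E (merge ?I ?J (x, y)) \<partial>?P2) \<partial>?P1)"
    using sE unfolding un by (intro product_nn_integral_fold) auto
  also have "\<dots> \<le> (\<integral>\<^sup>+x. indicator A x + ennreal e\<^sub>2 \<partial>?P1)"
  proof (rule nn_integral_mono)
    fix x assume x: "x \<in> space ?P1"
    let ?F = "{y \<in> space ?P2. R < \<bar>debiased p \<xi> u ?J (cand p k (sel p k n\<^sub>1 \<mu> x)) y - t\<bar>}"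
    have [measurable]: "debiased p \<xi> u ?J (cand p k (sel p k n\<^sub>1 \<mu> x)) \<in> borel_measurable ?P2"
      unfolding measurable_PiM_law by (rule measurable_debiased) simp
    have sF: "?F \<in> sets ?P2" by measurable
    have "(\<integral>\<^sup>+y. indicator ?E (merge ?I ?J (x, y)) \<partial>?P2) \<le> (\<integral>\<^sup>+y. indicator ?F y \<partial>?P2)"
      by (intro nn_integral_mono) (auto simp: indicator_def est_merge)
    also have "\<dots> = emeasure ?P2 ?F" using sF by simp
    also have "\<dots> \<le> indicator A x + ennreal e\<^sub>2"
      using B[OF x] P2.emeasure_le_1[of ?F] by (cases "x \<in> A") (auto intro: order_trans)
    finally show "(\<integral>\<^sup>+y. indicator ?E (merge ?I ?J (x, y)) \<partial>?P2) \<le> indicator A x + ennreal e\<^sub>2" .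
  qed
  also have "\<dots> = emeasure ?P1 A + ennreal e\<^sub>2"
    using A(1) by (subst nn_integral_add) (auto simp: P1.emeasure_space_1)
  also have "\<dots> \<le> ennreal e\<^sub>1 + ennreal e\<^sub>2" by (intro add_mono A(2)) auto
  also have "\<dots> = ennreal (e\<^sub>1 + e\<^sub>2)" using e by simp
  finally show ?thesis .
qed

end

section \<open>From an estimator to an upper bound on the detection boundary\<close>

lemma nnz_l0norm: "\<beta> \<in> carrier_vec p \<Longrightarrow> nnz p (($) \<beta>) = l0norm \<beta>"
  by (simp add: nnz_def l0norm_def)

lemma scalar_prod_sdot: "\<beta> \<in> carrier_vec p \<Longrightarrow> \<xi> \<bullet> \<beta> = sdot p (($) \<xi>) (($) \<beta>)"
  by (auto simp: scalar_prod_def sdot_def lessThan_atLeast0)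

lemma sets_data_law: "sets (data_law n p \<theta>) = sets (data_space n p)"
  unfolding data_law_def data_space_def by (rule sets_PiM_cong) auto

lemma space_data_law: "space (data_law n p \<theta>) = space (data_space n p)"
  by (rule sets_eq_imp_space_eq[OF sets_data_law])

lemma prob_space_data_law:
  assumes "good_param p \<beta> S \<sigma>"
  shows "prob_space (data_law n p (\<beta>, S, \<sigma>))"
  unfolding data_law_def by (intro prob_space_PiM prob_space_obs_law assms)

lemma expect_indicator:
  assumes "A \<in> sets (data_space n p)"
  shows "expect n p \<theta> (indicator A) = ereal (measure (data_law n p \<theta>) A)"
proof -
  have "A \<in> sets (data_law n p \<theta>)" using assms by (simp add: sets_data_law)
  moreover from this have "A \<inter> space (data_law n p \<theta>) = A" by (rule sets.Int_space_eq2)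
  ultimately show ?thesis by (simp add: expect_def)
qed

text \<open>Reject when the estimate is more than \<open>R\<close> away from
  \<open>t\<^sub>0\<close>. If the functional is at least 3 R away and the error is at most R, the
  estimate stays at least 2 R away, strictly beyond the threshold. Alternatives are covered by
  \<open>err\<close> since \<open>k\<close> is at most \<open>k\<^sub>u\<close>.\<close>

lemma tau_adap_le_of_estimator:
  fixes T :: "(nat \<Rightarrow> obs) \<Rightarrow> real" and R \<epsilon> :: real
  assumes T: "T \<in> borel_measurable (data_space n p)" and R: "0 < R" and \<epsilon>: "0 \<le> \<epsilon>" "\<epsilon> \<le> \<alpha>" "\<epsilon> \<le> \<eta>"
    and \<xi>: "\<xi> \<in> carrier_vec p" and pdS: "pos_def p S" and kk: "k \<le> k\<^sub>u" and \<alpha>: "0 \<le> \<alpha>"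
    and err: "\<And>\<beta> \<sigma>. \<beta> \<in> carrier_vec p \<Longrightarrow> l0norm \<beta> \<le> k\<^sub>u \<Longrightarrow> 0 < \<sigma> \<Longrightarrow> \<sigma> \<le> M\<^sub>2 \<Longrightarrow>
      emeasure (data_law n p (\<beta>, S, \<sigma>)) {z \<in> space (data_space n p). R < \<bar>T z - \<xi> \<bullet> \<beta>\<bar>} \<le> ennreal \<epsilon>"
  shows "tau_adap M\<^sub>2 \<alpha> \<eta> n p t\<^sub>0 k\<^sub>u k S \<xi> \<le> ereal (3 * R)"
proof -
  note [measurable] = T
  define A where "A = {z \<in> space (data_space n p). R < \<bar>T z - t\<^sub>0\<bar>}"
  have sA: "A \<in> sets (data_space n p)" unfolding A_def by measurable
  define \<psi> where "\<psi> = (indicator A :: _ \<Rightarrow> real)"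
  have null: "expect n p \<theta> \<psi> \<le> ereal \<alpha>" if "\<theta> \<in> Theta_null M\<^sub>2 k\<^sub>u S \<xi> t\<^sub>0" for \<theta>
  proof -
    from that obtain \<beta> \<sigma> where \<theta>: "\<theta> = (\<beta>, S, \<sigma>)" and b: "\<beta> \<in> carrier_vec p" "l0norm \<beta> \<le> k\<^sub>u" "0 < \<sigma>" "\<sigma> \<le> M\<^sub>2" "\<xi> \<bullet> \<beta> = t\<^sub>0"
      using \<xi> by (auto simp: Theta_null_def)
    interpret prob_space "data_law n p \<theta>"
      unfolding \<theta> by (rule prob_space_data_law) (use b pdS in \<open>simp add: good_param_def\<close>)
    have "emeasure (data_law n p \<theta>) A \<le> ennreal \<epsilon>"
      using err[OF b(1-4)] unfolding A_def \<theta> b(5) .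
    then show ?thesis unfolding \<psi>_def expect_indicator[OF sA]
      using \<epsilon> by (simp add: emeasure_eq_measure)
  qed
  have alt: "ereal (1 - \<eta>) \<le> expect n p \<theta> \<psi>" if "\<theta> \<in> Theta_alt M\<^sub>2 k S \<xi> t\<^sub>0 (3 * R)" for \<theta>
  proof -
    from that obtain \<beta> \<sigma> where \<theta>: "\<theta> = (\<beta>, S, \<sigma>)" and b: "\<beta> \<in> carrier_vec p" "l0norm \<beta> \<le> k\<^sub>u" "0 < \<sigma>" "\<sigma> \<le> M\<^sub>2"
      "3 * R \<le> \<bar>\<xi> \<bullet> \<beta> - t\<^sub>0\<bar>"
      using \<xi> kk by (auto simp: Theta_alt_def)
    interpret prob_space "data_law n p \<theta>"
      unfolding \<theta> by (rule prob_space_data_law) (use b pdS in \<open>simp add: good_param_def\<close>)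
    let ?E = "{z \<in> space (data_space n p). R < \<bar>T z - \<xi> \<bullet> \<beta>\<bar>}"
    have "space (data_law n p \<theta>) - A \<subseteq> ?E"
      using b(5) R unfolding A_def space_data_law by auto
    then have "prob (space (data_law n p \<theta>) - A) \<le> prob ?E"
      by (intro finite_measure_mono) (simp_all add: sets_data_law)
    also have "prob ?E \<le> \<epsilon>"
      using err[OF b(1-4)] \<epsilon> unfolding \<theta>[symmetric] by (simp add: emeasure_eq_measure)
    also have "prob (space (data_law n p \<theta>) - A) = 1 - prob A"
      using sA by (intro prob_compl) (simp add: sets_data_law)
    finally show ?thesis unfolding \<psi>_def expect_indicator[OF sA] using \<epsilon> by simp
  qed
  have "\<psi> \<in> tests n p \<alpha> (Theta_null M\<^sub>2 k\<^sub>u S \<xi> t\<^sub>0)"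
    using null sA unfolding tests_def \<psi>_def by (auto simp: indicator_def intro!: SUP_least)
  moreover have "ereal (1 - \<eta>) \<le> (INF \<theta> \<in> Theta_alt M\<^sub>2 k S \<xi> t\<^sub>0 (3 * R). expect n p \<theta> \<psi>)"
    using alt by (intro INF_greatest)
  ultimately have "ereal (1 - \<eta>) \<le> (SUP \<psi> \<in> tests n p \<alpha> (Theta_null M\<^sub>2 k\<^sub>u S \<xi> t\<^sub>0). INF \<theta> \<in> Theta_alt M\<^sub>2 k S \<xi> t\<^sub>0 (3 * R). expect n p \<theta> \<psi>)"
    by (rule SUP_upper2[where f="\<lambda>\<psi>. INF \<theta> \<in> Theta_alt M\<^sub>2 k S \<xi> t\<^sub>0 (3 * R). expect n p \<theta> \<psi>"])
  then show ?thesis using R unfolding tau_adap_def by (intro Inf_lower CollectI exI[of _ "3 * R"]) simp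
qed

lemma pos_def_of_eigenvalues:
  assumes S: "S \<in> carrier_mat p p" and sym: "transpose_mat S = S" and p: "0 < p" and M: "1 < M"
    and lo: "1 / M \<le> lambda_min S" and hi: "lambda_max S \<le> M"
  shows "pos_def p S" "\<And>v. sqn p v / M \<le> qf p S v v" "\<And>v. qf p S v v \<le> M * sqn p v"
proof -
  show q: "sqn p v / M \<le> qf p S v v" "qf p S v v \<le> M * sqn p v" for v
    using eigen_bounds[OF S sym p lo hi, of v] by simp_all
  have sym': "\<forall>i<p. \<forall>j<p. S $$ (i, j) = S $$ (j, i)"
    using S sym by (metis carrier_matD index_transpose_mat(1))
  have "0 < qf p S v v" if "j < p" "v j \<noteq> 0" for v j
  proof -
    have "0 < sqn p v / M" using sqn_pos[of j p v] that M by simp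
    then show ?thesis using q(1)[of v] by linarith
  qed
  then show "pos_def p S" unfolding pos_def_def using S sym' by blast
qed

lemma loading_carrier: "is_loading p \<xi> \<Longrightarrow> \<xi> \<in> carrier_vec p"
  by (simp add: is_loading_def)

lemma loading_mono: "is_loading p \<xi> \<Longrightarrow> i \<le> j \<Longrightarrow> j < p \<Longrightarrow> \<bar>\<xi> $ j\<bar> \<le> \<bar>\<xi> $ i\<bar>"
  by (simp add: is_loading_def)

lemma loading_first:
  assumes "is_loading p \<xi>"
  shows "0 < p" "\<xi> $ 0 \<noteq> 0"
proof -
  have "\<xi> \<noteq> 0\<^sub>v p" "\<xi> \<in> carrier_vec p" using assms by (auto simp: is_loading_def)
  then obtain j where j: "j < p" "\<xi> $ j \<noteq> 0" by (metis carrier_vecD eq_vecI index_zero_vec)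
  then show "0 < p" by simp
  show "\<xi> $ 0 \<noteq> 0" using loading_mono[OF assms, of 0 j] j by auto
qed

definition rate :: "nat \<Rightarrow> nat \<Rightarrow> nat \<Rightarrow> real Matrix.vec \<Rightarrow> nat \<Rightarrow> real" where
  "rate n p k\<^sub>u \<xi> m = H_load (real m) \<xi> * (1 / sqrt (real n)) + next_abs \<xi> m * real k\<^sub>u * sqrt (ln (real p) / real n)"

lemma H_load_sq: "\<xi> \<in> carrier_vec p \<Longrightarrow> (H_load (real m) \<xi>)\<^sup>2 = (\<Sum>j<min m p. (\<xi> $ j)\<^sup>2)"
  by (simp add: H_load_def sum_nonneg)

lemma H_load_nonneg: "0 \<le> H_load t \<xi>"
  by (simp add: H_load_def sum_nonneg)

lemma next_abs_nonneg: "0 \<le> next_abs \<xi> m"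
  by (simp add: next_abs_def)

lemma rate_pos:
  assumes \<xi>: "is_loading p \<xi>" and n: "0 < n" and k: "0 < k\<^sub>u" and p: "2 \<le> p"
  shows "0 < rate n p k\<^sub>u \<xi> m"
proof (cases "m = 0")
  case True
  have "0 < next_abs \<xi> 0" using loading_first[OF \<xi>] loading_carrier[OF \<xi>] by (simp add: next_abs_def)
  then have "0 < next_abs \<xi> m * real k\<^sub>u * sqrt (ln (real p) / real n)" using k n p True by simp
  then show ?thesis unfolding rate_def using H_load_nonneg[of "real m" \<xi>]
    by (metis add_nonneg_pos divide_nonneg_nonneg mult_nonneg_nonneg of_nat_0_le_iff real_sqrt_ge_zero zero_le_one)
next
  case False
  have "0 < (\<Sum>j<min m p. (\<xi> $ j)\<^sup>2)"
    using False loading_first[OF \<xi>] by (intro sum_pos2[of _ 0]) auto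
  then have "0 < H_load (real m) \<xi>" using loading_carrier[OF \<xi>] by (simp add: H_load_def)
  then have "0 < H_load (real m) \<xi> * (1 / sqrt (real n))" using n by simp
  moreover have "0 \<le> next_abs \<xi> m * real k\<^sub>u * sqrt (ln (real p) / real n)"
    using next_abs_nonneg[of \<xi> m] p by (intro mult_nonneg_nonneg) auto
  ultimately show ?thesis by (simp add: rate_def)
qed

lemma exp_ln_mult: "0 < p \<Longrightarrow> exp (- (real c * ln (real p))) = 1 / real p ^ c"
  by (simp add: exp_minus exp_of_nat_mult inverse_eq_divide)

text \<open>With mesh p^-3 the grid has at most p^(12 k) points, while the constant 100 makes each
  failure probability at most p^(-25 k).\<close>

lemma net_union_bound:
  assumes p: "3 \<le> p" and k: "1 \<le> k" and n: "100 * real k * ln (real p) \<le> real n"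
  shows "real ((p * (2 * p ^ 3 + 1)) ^ (2 * k)) * exp (- (real n / 4)) \<le> 1 / real p"
proof -
  have "2 * p ^ 3 + 1 \<le> p ^ 5"
  proof -
    have "3 * p ^ 3 \<le> p * p * p ^ 3" using mult_le_mono[of 3 p 1 p] p by (intro mult_right_mono) auto
    moreover have "1 \<le> p ^ 3" using p by simp
    ultimately have "2 * p ^ 3 + 1 \<le> p * p * p ^ 3" by linarith
    also have "p * p * p ^ 3 = p ^ 5" by (simp add: eval_nat_numeral)
    finally show ?thesis .
  qed
  then have "p * (2 * p ^ 3 + 1) \<le> p * p ^ 5" by (rule mult_le_mono2)
  then have "p * (2 * p ^ 3 + 1) \<le> p ^ 6" by (simp add: eval_nat_numeral)
  then have "(p * (2 * p ^ 3 + 1)) ^ (2 * k) \<le> (p ^ 6) ^ (2 * k)" by (rule power_mono) simp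
  also have "\<dots> = p ^ (12 * k)" by (simp flip: power_mult)
  finally have c: "real ((p * (2 * p ^ 3 + 1)) ^ (2 * k)) \<le> real p ^ (12 * k)"
    by (metis of_nat_le_iff of_nat_power)
  have lp: "0 \<le> ln (real p)" using p by simp
  have "real (25 * k) * ln (real p) \<le> real n / 4" using n by simp
  then have "exp (- (real n / 4)) \<le> exp (- (real (25 * k) * ln (real p)))" by simp
  also have "\<dots> = 1 / real p ^ (25 * k)" using p by (intro exp_ln_mult) simp
  finally have "real ((p * (2 * p ^ 3 + 1)) ^ (2 * k)) * exp (- (real n / 4)) \<le> real p ^ (12 * k) * (1 / real p ^ (25 * k))"
    using c by (intro mult_mono) auto
  also have "\<dots> = 1 / real p ^ (13 * k)"
  proof -
    have "real p ^ (25 * k) = real p ^ (12 * k) * real p ^ (13 * k)" by (simp flip: power_add)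
    then show ?thesis using p by simp
  qed
  also have "\<dots> \<le> 1 / real p ^ 1"
    using p k by (intro divide_left_mono power_increasing) auto
  finally show ?thesis by simp
qed

text \<open>With q the form of \<open>u\<close>: q equals the inner product of \<open>u\<close> and
  \<open>w\<close>, and the squared norm of \<open>u\<close> is at most M q, so Cauchy-Schwarz gives
  q^2 at most M q times the squared norm of \<open>w\<close>.\<close>

lemma solution_qf_bound:
  assumes pdS: "pos_def p S" and M: "0 < M" and qlo: "\<And>v. sqn p v / M \<le> qf p S v v"
    and u: "\<And>i. i < p \<Longrightarrow> (\<Sum>j<p. S $$ (i, j) * u j) = w i"
  shows "qf p S u u \<le> M * sqn p w"
proof -
  let ?q = "qf p S u u"
  have q0: "0 \<le> ?q" by (rule pos_def_nonneg[OF pdS])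
  have "?q = sdot p u w"
    using u by (simp add: qf_def sdot_def mult.assoc sum_distrib_left[symmetric])
  then have "?q\<^sup>2 \<le> sqn p u * sqn p w" using sdot_cauchy[of p u w] by simp
  also have "\<dots> \<le> (M * ?q) * sqn p w"
    using qlo[of u] M by (intro mult_right_mono sqn_nonneg) (simp add: divide_le_eq mult.commute)
  finally have "?q * ?q \<le> (M * sqn p w) * ?q" by (simp add: power2_eq_square mult_ac)
  then show ?thesis using q0 M sqn_nonneg[of p w] by (cases "?q = 0") (auto simp: mult_le_cancel_right)
qed

lemma upper_single:
  fixes M s\<^sub>0 \<epsilon> B D CL CR :: real
  assumes M: "1 < M" and s0: "0 < s\<^sub>0" and \<epsilon>: "0 < \<epsilon>" "\<epsilon> \<le> \<alpha>" "\<epsilon> \<le> \<eta>"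
    and p: "3 \<le> p" "16 * M \<le> real p" "4 * (3 + M) / (3 * \<epsilon>) \<le> real p"
    and ku: "1 \<le> k\<^sub>u" "2 * k\<^sub>u \<le> p" and kk: "k \<le> k\<^sub>u" and n: "600 * real k\<^sub>u * ln (real p) \<le> real n"
    and \<xi>: "is_loading p \<xi>" and m: "m \<le> p"
    and S: "S \<in> carrier_mat p p" and sym: "transpose_mat S = S"
    and lo: "1 / M \<le> lambda_min S" and hi: "lambda_max S \<le> M"
  defines "B \<equiv> s\<^sub>0\<^sup>2 * M" and "D \<equiv> 6000 * M\<^sup>2 * B" and "CL \<equiv> 384 * M * sqrt (24 * B)"
    and "CR \<equiv> sqrt (8 * M * (3 * M * D + s\<^sub>0\<^sup>2) / \<epsilon>)"
  shows "tau_adap s\<^sub>0 \<alpha> \<eta> n p t\<^sub>0 k\<^sub>u k S \<xi> \<le> ereal (3 * (CR + CL) * rate n p k\<^sub>u \<xi> m)"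
proof -
  have B: "0 < B" using M s0 by (simp add: B_def)
  have D: "0 < D" using M B by (simp add: D_def)
  have CR: "0 < CR" using M D \<epsilon> s0 by (simp add: CR_def add_pos_pos)
  have CL: "0 \<le> CL" using M B by (simp add: CL_def)
  have p0: "0 < p" using p by simp
  note SS = pos_def_of_eigenvalues[OF S sym p0 M lo hi]
  have lp: "1 \<le> ln (real p)"
  proof -
    have "exp 1 \<le> (3::real)" using exp_le by simp
    also have "3 \<le> real p" using p by simp
    finally show ?thesis using p by (simp add: ln_ge_iff)
  qed
  have ku_lp: "1 \<le> real k\<^sub>u * ln (real p)" using ku lp by (intro mult_ge1_I) auto
  have n600: "600 \<le> real n" using n ku_lp by linarith
  define n\<^sub>1 where "n\<^sub>1 = n div 2"
  define n\<^sub>2 where "n\<^sub>2 = n - n\<^sub>1"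
  have nn: "n = n\<^sub>1 + n\<^sub>2" by (simp add: n\<^sub>1_def n\<^sub>2_def)
  have n1: "real n / 3 \<le> real n\<^sub>1" "real n \<le> 2 * real n\<^sub>2" "0 < n\<^sub>1" "0 < n\<^sub>2"
    using n600 unfolding n\<^sub>1_def n\<^sub>2_def by linarith+
  have n1': "200 * real k\<^sub>u * ln (real p) \<le> real n\<^sub>1" using n n1(1) by linarith
  \<comment> \<open>With this choice the noise exponent is 2 log p, so the union over 2 p tails
    costs 2 / p.\<close>
  define \<mu> where "\<mu> = sqrt (8 * B * ln (real p) / real n\<^sub>1)"
  have \<mu>2: "\<mu>\<^sup>2 = 8 * B * ln (real p) / real n\<^sub>1" using B lp n1 by (simp add: \<mu>_def)
  have \<mu>: "0 < \<mu>" using B lp n1 by (simp add: \<mu>_def)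
  have "ln (real p) \<le> real k\<^sub>u * ln (real p)" using ku lp by (simp add: mult_le_cancel_right1)
  then have lpn: "200 * ln (real p) \<le> real n\<^sub>1" using n1' by linarith
  have \<mu>B: "\<mu>\<^sup>2 \<le> 2 * B"
    unfolding \<mu>2 using lpn B n1 by (simp add: field_simps)
  define r where "r = rate n p k\<^sub>u \<xi> m"
  have r: "0 < r" unfolding r_def using \<xi> n600 ku p by (intro rate_pos) auto
  define L where "L = 3 * \<mu> * (64 * M) * (2 * real k\<^sub>u)"
  define nx where "nx = next_abs \<xi> m"
  have nx: "0 \<le> nx" "\<And>j. m \<le> j \<Longrightarrow> j < p \<Longrightarrow> \<bar>\<xi> $ j\<bar> \<le> nx"
    using loading_mono[OF \<xi>, of m] loading_carrier[OF \<xi>] by (auto simp: nx_def next_abs_def)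
  have nxL: "nx * L \<le> CL * r"
  proof -
    have "\<mu> \<le> sqrt (24 * B * (ln (real p) / real n))"
      unfolding \<mu>_def
    proof (rule real_sqrt_le_mono)
      have "8 * B * ln (real p) / real n\<^sub>1 \<le> 8 * B * ln (real p) / (real n / 3)"
        using n1 n600 B lp by (intro divide_left_mono) auto
      then show "8 * B * ln (real p) / real n\<^sub>1 \<le> 24 * B * (ln (real p) / real n)" by simp
    qed
    also have "\<dots> = sqrt (24 * B) * sqrt (ln (real p) / real n)" by (rule real_sqrt_mult)
    finally have "nx * L \<le> nx * (3 * (sqrt (24 * B) * sqrt (ln (real p) / real n)) * (64 * M) * (2 * real k\<^sub>u))"
      unfolding L_def using nx(1) M by (intro mult_left_mono mult_right_mono) auto
    also have "\<dots> = CL * (nx * real k\<^sub>u * sqrt (ln (real p) / real n))" by (simp add: CL_def mult_ac)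
    also have "\<dots> \<le> CL * r"
      using CL H_load_nonneg[of "real m" \<xi>] by (intro mult_left_mono) (auto simp: r_def rate_def nx_def)
    finally show ?thesis .
  qed
  define w where "w i = (if i < m then \<xi> $ i else 0)" for i
  obtain u where u: "\<And>i. i < p \<Longrightarrow> (\<Sum>j<p. S $$ (i, j) * u j) = w i"
    using solve_linear_fun[OF S pos_def_det_nz[OF SS(1)], of w] by blast
  \<comment> \<open>Expressed through the rate \<open>r\<close> instead of H(m): it still dominates
    the variance of the direction, and it is positive even for m = 0, where H vanishes.\<close>
  define U where "U = M * real n * r\<^sup>2"
  have U: "0 < U" using M n600 r by (simp add: U_def)
  have qu: "qf p S u u \<le> U"
  proof -
    have "sqn p w = (H_load (real m) \<xi>)\<^sup>2"
      unfolding H_load_sq[OF loading_carrier[OF \<xi>]] sqn_def w_def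
      using m by (intro sum.mono_neutral_cong_right) auto
    also have "\<dots> = real n * (H_load (real m) \<xi> * (1 / sqrt (real n)))\<^sup>2"
      using n600 by (simp add: power_mult_distrib power_divide)
    also have "\<dots> \<le> real n * r\<^sup>2"
      using H_load_nonneg[of "real m" \<xi>] nx(1) lp
      by (intro mult_left_mono power_mono) (auto simp: r_def rate_def nx_def)
    finally have "sqn p w \<le> real n * r\<^sup>2" .
    then have "M * sqn p w \<le> U" using M by (simp add: U_def mult_left_mono)
    then show ?thesis using solution_qf_bound[OF SS(1) _ SS(2) u] M by linarith
  qed
  define R where "R = CR * r"
  have R: "0 < R" using CR r by (simp add: R_def)
  have RL: "0 < R + nx * L" using R nx(1) \<mu> M by (intro add_pos_nonneg) (auto simp: L_def)
  have "tau_adap s\<^sub>0 \<alpha> \<eta> n p t\<^sub>0 k\<^sub>u k S \<xi> \<le> ereal (3 * (R + nx * L))"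
  proof (rule tau_adap_le_of_estimator[where T="est p (($) \<xi>) u k\<^sub>u n\<^sub>1 n\<^sub>2 \<mu>" and \<epsilon>=\<epsilon>])
    show "est p (($) \<xi>) u k\<^sub>u n\<^sub>1 n\<^sub>2 \<mu> \<in> borel_measurable (data_space n p)"
      unfolding data_space_def nn by (rule measurable_est)
  next
    fix \<beta> \<sigma> assume b: "\<beta> \<in> carrier_vec p" "l0norm \<beta> \<le> k\<^sub>u" "0 < \<sigma>" "\<sigma> \<le> s\<^sub>0"
    interpret gaussian_design p \<beta> S \<sigma> M s\<^sub>0
      using b SS p0 M by unfold_locales (auto simp: good_param_def)
    have sp: "nnz p (($) \<beta>) \<le> k\<^sub>u" using b by (simp add: nnz_l0norm)
    have N: "0 < p ^ 3" using p0 by simp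
    have KN1: "16 * M * real (2 * k\<^sub>u) * (real p)\<^sup>2 \<le> (real (p ^ 3))\<^sup>2"
    proof -
      have "16 * M * real (2 * k\<^sub>u) * (real p)\<^sup>2 \<le> real p * real p * (real p)\<^sup>2"
        using p(2) ku(2) M by (intro mult_mono) (auto simp flip: of_nat_le_iff)
      also have "\<dots> = real p ^ 4" by (simp add: eval_nat_numeral)
      also have "\<dots> \<le> real p ^ 6" using p0 by (intro power_increasing) auto
      finally show ?thesis by (simp flip: power_mult)
    qed
    have KN2: "2 * k\<^sub>u \<le> (p ^ 3)\<^sup>2"
    proof -
      have "p ^ 1 \<le> p ^ 6" using p0 by (intro power_increasing) auto
      then show ?thesis using ku(2) by (simp flip: power_mult)
    qed
    obtain A where A: "A \<in> sets (Pi\<^sub>M {..<n\<^sub>1} (\<lambda>_. law))"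
      "emeasure (Pi\<^sub>M {..<n\<^sub>1} (\<lambda>_. law)) A \<le>
        ennreal (2 * real p * exp (- (real n\<^sub>1 * \<mu>\<^sup>2 / (4 * (s\<^sub>0\<^sup>2 * M)))) + M / real p + real ((p * (2 * p ^ 3 + 1)) ^ (2 * k\<^sub>u)) * exp (- (real n\<^sub>1 / 4)))"
      "\<And>z. z \<in> space (Pi\<^sub>M {..<n\<^sub>1} (\<lambda>_. law)) \<Longrightarrow> z \<notin> A \<Longrightarrow>
        sqn p (\<lambda>j. b0 j - cand p k\<^sub>u (sel p k\<^sub>u n\<^sub>1 \<mu> z) j) \<le> (3 * \<mu> * (64 * M))\<^sup>2 * (2 * real k\<^sub>u) \<and>
        (\<Sum>j<p. \<bar>b0 j - cand p k\<^sub>u (sel p k\<^sub>u n\<^sub>1 \<mu> z) j\<bar>) \<le> 3 * \<mu> * (64 * M) * (2 * real k\<^sub>u)"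
      using first_half[OF n1(3) \<mu> \<mu>B[unfolded B_def] N KN1 KN2 sp] by blast
    have e1: "2 * real p * exp (- (real n\<^sub>1 * \<mu>\<^sup>2 / (4 * (s\<^sub>0\<^sup>2 * M)))) + M / real p + real ((p * (2 * p ^ 3 + 1)) ^ (2 * k\<^sub>u)) * exp (- (real n\<^sub>1 / 4)) \<le> 3 * \<epsilon> / 4"
    proof -
      have "real n\<^sub>1 * \<mu>\<^sup>2 / (4 * B) = real 2 * ln (real p)"
        unfolding \<mu>2 using B n1 by simp
      then have "exp (- (real n\<^sub>1 * \<mu>\<^sup>2 / (4 * (s\<^sub>0\<^sup>2 * M)))) = 1 / real p ^ 2"
        unfolding B_def[symmetric] using exp_ln_mult[OF p0, of 2] by simp
      then have 1: "2 * real p * exp (- (real n\<^sub>1 * \<mu>\<^sup>2 / (4 * (s\<^sub>0\<^sup>2 * M)))) = 2 / real p"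
        using p0 by (simp add: power2_eq_square)
      have 3: "real ((p * (2 * p ^ 3 + 1)) ^ (2 * k\<^sub>u)) * exp (- (real n\<^sub>1 / 4)) \<le> 1 / real p"
        using p ku n1' by (intro net_union_bound) auto
      have "(3 + M) / real p \<le> 3 * \<epsilon> / 4"
        using p(3) \<epsilon>(1) p0 by (simp add: field_simps)
      moreover have "(3 + M) / real p = 2 / real p + M / real p + 1 / real p" by (simp add: add_divide_distrib)
      ultimately show ?thesis using 1 3 by linarith
    qed
    \<comment> \<open>Here n of order k_u log p is used a second time: \<mu>^2 k_u is at most B /
      25, so the Euclidean error stays below a constant and the variance of the debiased average is
      bounded uniformly over all \<beta>.\<close>
    have D_le: "(3 * \<mu> * (64 * M))\<^sup>2 * (2 * real k\<^sub>u) \<le> D"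
    proof -
      have "(3 * \<mu> * (64 * M))\<^sup>2 * (2 * real k\<^sub>u) = 73728 * M\<^sup>2 * (\<mu>\<^sup>2 * real k\<^sub>u)"
        by (simp add: power_mult_distrib)
      also have "\<mu>\<^sup>2 * real k\<^sub>u \<le> B / 25"
        unfolding \<mu>2 using n1' n1(3) B mult_left_mono[OF n1', of "B / 25"] by (simp add: field_simps)
      then have "73728 * M\<^sup>2 * (\<mu>\<^sup>2 * real k\<^sub>u) \<le> 73728 * M\<^sup>2 * (B / 25)" by (intro mult_left_mono) auto
      also have "\<dots> \<le> D" using B by (simp add: D_def)
      finally show ?thesis .
    qed
    have "emeasure (Pi\<^sub>M {..<n\<^sub>1 + n\<^sub>2} (\<lambda>_. law)) {z \<in> space (Pi\<^sub>M {..<n\<^sub>1 + n\<^sub>2} (\<lambda>_. law)).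
        R + nx * L < \<bar>est p (($) \<xi>) u k\<^sub>u n\<^sub>1 n\<^sub>2 \<mu> z - sdot p (($) \<xi>) b0\<bar>} \<le> ennreal (3 * \<epsilon> / 4 + \<epsilon> / 4)"
    proof (rule split_sample[OF A(1)])
      show "emeasure (Pi\<^sub>M {..<n\<^sub>1} (\<lambda>_. law)) A \<le> ennreal (3 * \<epsilon> / 4)"
        using A(2) e1 by (meson ennreal_leI order_trans)
    next
      fix z assume z: "z \<in> space (Pi\<^sub>M {..<n\<^sub>1} (\<lambda>_. law))" "z \<notin> A"
      let ?J = "{n\<^sub>1..<n\<^sub>1 + n\<^sub>2}"
      have "emeasure (Pi\<^sub>M ?J (\<lambda>_. law)) {y \<in> space (Pi\<^sub>M ?J (\<lambda>_. law)).
          R + nx * L < \<bar>debiased p (($) \<xi>) u ?J (cand p k\<^sub>u (sel p k\<^sub>u n\<^sub>1 \<mu> z)) y - sdot p (($) \<xi>) b0\<bar>}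
        \<le> ennreal ((3 * U * (M * D) + s\<^sub>0\<^sup>2 * U) / (real (card ?J) * R\<^sup>2))"
      proof (rule second_half[where m=m])
        show "(\<Sum>j<p. S $$ (i, j) * u j) = (if i < m then \<xi> $ i else 0)" if "i < p" for i
          using u[OF that] by (simp add: w_def)
      qed (use qu U D R nx n1 A(3)[OF z] D_le in \<open>auto simp: L_def\<close>)
      also have "\<dots> \<le> ennreal (\<epsilon> / 4)"
      proof (rule ennreal_leI)
        have "R\<^sup>2 = (8 * M * (3 * M * D + s\<^sub>0\<^sup>2) / \<epsilon>) * r\<^sup>2"
          using M D \<epsilon> by (simp add: R_def CR_def power_mult_distrib)
        then have eq: "\<epsilon> * R\<^sup>2 = 8 * M * (3 * M * D + s\<^sub>0\<^sup>2) * r\<^sup>2" using \<epsilon> by simp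
        have "3 * U * (M * D) + s\<^sub>0\<^sup>2 * U = real n * (M * (3 * M * D + s\<^sub>0\<^sup>2) * r\<^sup>2)"
          by (simp add: U_def algebra_simps)
        also have "\<dots> \<le> 2 * real n\<^sub>2 * (M * (3 * M * D + s\<^sub>0\<^sup>2) * r\<^sup>2)"
          using n1(2) M D by (intro mult_right_mono) auto
        also have "\<dots> = \<epsilon> / 4 * (real (card ?J) * R\<^sup>2)"
          using eq by (simp add: algebra_simps)
        finally show "(3 * U * (M * D) + s\<^sub>0\<^sup>2 * U) / (real (card ?J) * R\<^sup>2) \<le> \<epsilon> / 4"
          using R n1(4) by (simp add: divide_le_eq)
      qed
      finally show "emeasure (Pi\<^sub>M ?J (\<lambda>_. law)) {y \<in> space (Pi\<^sub>M ?J (\<lambda>_. law)).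
          R + nx * L < \<bar>debiased p (($) \<xi>) u ?J (cand p k\<^sub>u (sel p k\<^sub>u n\<^sub>1 \<mu> z)) y - sdot p (($) \<xi>) b0\<bar>} \<le> ennreal (\<epsilon> / 4)" .
    qed (use \<epsilon> in auto)
    moreover have "space (data_space n p) = space (Pi\<^sub>M {..<n\<^sub>1 + n\<^sub>2} (\<lambda>_. law))"
      unfolding data_space_def nn by (simp add: space_PiM)
    moreover have "\<xi> \<bullet> \<beta> = sdot p (($) \<xi>) b0"
      by (rule scalar_prod_sdot[OF b(1)])
    ultimately show "emeasure (data_law n p (\<beta>, S, \<sigma>)) {z \<in> space (data_space n p).
        R + nx * L < \<bar>est p (($) \<xi>) u k\<^sub>u n\<^sub>1 n\<^sub>2 \<mu> z - \<xi> \<bullet> \<beta>\<bar>} \<le> ennreal \<epsilon>"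
      by (simp add: data_law_def nn)
  qed (use RL \<epsilon> loading_carrier[OF \<xi>] SS kk in auto)
  also have "ereal (3 * (R + nx * L)) \<le> ereal (3 * (CR + CL) * r)"
    using nxL by (simp add: R_def algebra_simps)
  finally show ?thesis unfolding r_def .
qed

lemma upper_rate_rate: "upper_rate n p k\<^sub>u \<xi> = Min ((\<lambda>m. rate n p k\<^sub>u \<xi> m) ` {0..p})"
  by (simp add: upper_rate_def rate_def)

lemma upper_rate_attained: "\<exists>m\<le>p. upper_rate n p k\<^sub>u \<xi> = rate n p k\<^sub>u \<xi> m"
proof -
  have "upper_rate n p k\<^sub>u \<xi> \<in> (\<lambda>m. rate n p k\<^sub>u \<xi> m) ` {0..p}"
    unfolding upper_rate_rate by (rule Min_in) auto
  then show ?thesis by auto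
qed

lemma upper_rate_le: "m \<le> p \<Longrightarrow> upper_rate n p k\<^sub>u \<xi> \<le> rate n p k\<^sub>u \<xi> m"
  unfolding upper_rate_rate by (rule Min_le) auto

text \<open>Fixes the constants before the dimension, the sample size and the parameters, with
  \<epsilon> the smaller of the two admissible error probabilities, so that the bound is uniform
  along the sequence.\<close>

lemma upper_bound:
  fixes M s\<^sub>0 \<alpha> \<eta> :: real
  assumes M: "1 < M" and s0: "0 < s\<^sub>0" and "0 < \<alpha>" "0 < \<eta>"
  obtains C P where "0 < C"
    "\<And>p n k\<^sub>u k \<xi> S t\<^sub>0. P \<le> real p \<Longrightarrow> 1 \<le> k\<^sub>u \<Longrightarrow> 2 * k\<^sub>u \<le> p \<Longrightarrow> k \<le> k\<^sub>u \<Longrightarrow>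
      600 * real k\<^sub>u * ln (real p) \<le> real n \<Longrightarrow> is_loading p \<xi> \<Longrightarrow> S \<in> carrier_mat p p \<Longrightarrow> transpose_mat S = S \<Longrightarrow>
      1 / M \<le> lambda_min S \<Longrightarrow> lambda_max S \<le> M \<Longrightarrow>
      tau_adap s\<^sub>0 \<alpha> \<eta> n p t\<^sub>0 k\<^sub>u k S \<xi> \<le> ereal (C * upper_rate n p k\<^sub>u \<xi>)"
proof -
  define \<epsilon> where "\<epsilon> = min \<alpha> \<eta>"
  define B where "B = s\<^sub>0\<^sup>2 * M"
  define D where "D = 6000 * M\<^sup>2 * B"
  define C where "C = 3 * (sqrt (8 * M * (3 * M * D + s\<^sub>0\<^sup>2) / \<epsilon>) + 384 * M * sqrt (24 * B))"
  define P where "P = Max {3, 16 * M, 4 * (3 + M) / (3 * \<epsilon>)}"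
  have \<epsilon>: "0 < \<epsilon>" "\<epsilon> \<le> \<alpha>" "\<epsilon> \<le> \<eta>" using assms by (auto simp: \<epsilon>_def)
  have "0 < B" using M s0 by (simp add: B_def)
  then have "0 < C" unfolding C_def using M s0 \<epsilon> by (intro mult_pos_pos add_nonneg_pos) (auto simp: D_def)
  moreover have "tau_adap s\<^sub>0 \<alpha> \<eta> n p t\<^sub>0 k\<^sub>u k S \<xi> \<le> ereal (C * upper_rate n p k\<^sub>u \<xi>)"
    if "P \<le> real p" "1 \<le> k\<^sub>u" "2 * k\<^sub>u \<le> p" "k \<le> k\<^sub>u" "600 * real k\<^sub>u * ln (real p) \<le> real n" "is_loading p \<xi>"
      "S \<in> carrier_mat p p" "transpose_mat S = S" "1 / M \<le> lambda_min S" "lambda_max S \<le> M"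
    for p n k\<^sub>u k \<xi> S t\<^sub>0
  proof -
    obtain m where m: "m \<le> p" "upper_rate n p k\<^sub>u \<xi> = rate n p k\<^sub>u \<xi> m" using upper_rate_attained by blast
    have p: "3 \<le> p" "16 * M \<le> real p" "4 * (3 + M) / (3 * \<epsilon>) \<le> real p" using that(1) by (auto simp: P_def)
    show ?thesis unfolding m(2) C_def D_def B_def
      using upper_single[OF M s0 \<epsilon> p that(2-6) m(1) that(7-10), of t\<^sub>0] .
  qed
  ultimately show thesis by (rule that)
qed

section \<open>Likelihood ratios\<close>

interpretation gau_gau: pair_sigma_finite gau gau
  by (intro pair_sigma_finite.intro gau.sigma_finite_measure_axioms)

interpretation gau_lborel: pair_sigma_finite gau lborel
  by (intro pair_sigma_finite.intro gau.sigma_finite_measure_axioms sigma_finite_lborel)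

lemma measurable3:
  assumes F: "(\<lambda>(a, b, c). F a b c) \<in> borel_measurable (borel \<Otimes>\<^sub>M borel \<Otimes>\<^sub>M borel)"
    and "f \<in> borel_measurable N" "g \<in> borel_measurable N" "h \<in> borel_measurable N"
  shows "(\<lambda>x. F (f x) (g x) (h x)) \<in> borel_measurable N"
proof -
  have "(\<lambda>x. (f x, g x, h x)) \<in> N \<rightarrow>\<^sub>M borel \<Otimes>\<^sub>M borel \<Otimes>\<^sub>M borel"
    using assms(2-4) by measurable
  from measurable_compose[OF this F] show ?thesis by simp
qed

lemma qf_cong: "(\<And>j. j < p \<Longrightarrow> u j = u' j) \<Longrightarrow> (\<And>j. j < p \<Longrightarrow> v j = v' j) \<Longrightarrow> qf p S u v = qf p S u' v'"
  by (simp add: qf_def)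

lemma sdot_zero: "(\<And>j. j < p \<Longrightarrow> u j = 0) \<Longrightarrow> sdot p u x = 0"
  by (simp add: sdot_def)

definition diag :: "nat \<Rightarrow> real mat \<Rightarrow> bool" where
  "diag p S \<longleftrightarrow> (\<forall>i<p. \<forall>j<p. i \<noteq> j \<longrightarrow> S $$ (i, j) = 0)"

lemma qf_diag: "diag p S \<Longrightarrow> qf p S u v = (\<Sum>j<p. S $$ (j, j) * (u j * v j))"
proof -
  assume d: "diag p S"
  have "(\<Sum>j<p. u i * S $$ (i, j) * v j) = S $$ (i, i) * (u i * v i)" if i: "i < p" for i
  proof -
    have "(\<Sum>j<p. u i * S $$ (i, j) * v j) = (\<Sum>j<p. if j = i then S $$ (i, i) * (u i * v i) else 0)"
      using d i by (intro sum.cong) (auto simp: diag_def)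
    then show ?thesis using i by simp
  qed
  then show ?thesis by (simp add: qf_def)
qed

text \<open>Linear forms with pairwise disjoint supports are independent when \<open>S\<close> is
  diagonal. Three are needed: the part common to two perturbations and the two private parts. In the
  induction the last coordinate enters at most one form, and Fubini moves its Gaussian next to the
  one it merges with.\<close>

lemma nn_integral_mvn_disjoint:
  assumes "pos_def p S" "diag p S"
    and "\<And>j. j < p \<Longrightarrow> a j = 0 \<and> b j = 0 \<or> a j = 0 \<and> c j = 0 \<or> b j = 0 \<and> c j = 0"
    and "(\<lambda>(r, s, t). F r s t) \<in> borel_measurable (borel \<Otimes>\<^sub>M borel \<Otimes>\<^sub>M borel)"
  shows "(\<integral>\<^sup>+x. F (sdot p a x) (sdot p b x) (sdot p c x) \<partial>mvn p S) =
    (\<integral>\<^sup>+g. (\<integral>\<^sup>+h. (\<integral>\<^sup>+k. F (sqrt (qf p S a a) * g) (sqrt (qf p S b b) * h) (sqrt (qf p S c c) * k) \<partial>gau) \<partial>gau) \<partial>gau)"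
  using assms
proof (induction p arbitrary: S F)
  case 0
  interpret product_sigma_finite "\<lambda>_::nat. lborel :: real measure" ..
  show ?case using 0
    by (simp add: mvn_0 pos_def_def emeasure_PiM_empty space_PiM_empty sdot_def qf_def)
next
  case (Suc p)
  note F = Suc.prems(4)
  note mF[measurable (raw)] = measurable3[OF F]
  obtain w s where s: "0 < s" and
    dens: "\<And>x. mvn_density (Suc p) S x = mvn_density p (top_block p S) x * normal_density (sdot p w x) s (x p)" and
    Q: "\<And>u v. qf (Suc p) S u v =
      qf p (top_block p S) (\<lambda>j. u j + u p * w j) (\<lambda>j. v j + v p * w j) + u p * v p * s\<^sup>2" and
    w: "\<forall>i<p. (\<Sum>j<p. S $$ (i, j) * w j) = S $$ (i, p)"
    by (rule schur_step[OF Suc.prems(1)]) (rule that)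
  let ?T = "top_block p S"
  have pdT: "pos_def p ?T" using Suc.prems(1) by (rule pos_def_top_block)
  have dT: "diag p ?T" using Suc.prems(2) by (auto simp: diag_def top_block_def)
  \<comment> \<open>For a diagonal matrix the regression of the last coordinate on the others is
    zero, so the new coordinate is independent of them.\<close>
  have w0: "w i = 0" if i: "i < p" for i
  proof -
    have "(\<Sum>j<p. S $$ (i, j) * w j) = (\<Sum>j<p. if j = i then S $$ (i, i) * w i else 0)"
      using Suc.prems(2) i by (intro sum.cong) (auto simp: diag_def)
    then have "S $$ (i, i) * w i = S $$ (i, p)" using w i by simp
    also have "\<dots> = 0" using Suc.prems(2) i by (auto simp: diag_def)
    finally have z: "S $$ (i, i) * w i = 0" .
    have "0 < qf (Suc p) S (\<lambda>l. if l = i then 1 else 0) (\<lambda>l. if l = i then 1 else 0)"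
      using i by (intro pos_defD[OF Suc.prems(1), of i]) auto
    then have "0 < S $$ (i, i)" using qf_unit[of i "Suc p" i S 1 1] i by simp
    then show ?thesis using z by simp
  qed
  have q: "qf (Suc p) S u u = qf p ?T u u + (u p * s)\<^sup>2" for u
  proof -
    have "qf p ?T (\<lambda>j. u j + u p * w j) (\<lambda>j. u j + u p * w j) = qf p ?T u u"
      by (rule qf_cong) (simp_all add: w0)
    then show ?thesis unfolding Q by (simp add: power_mult_distrib power2_eq_square)
  qed
  have lin: "sdot (Suc p) u (x(p := sdot p w x + s * h)) = sdot p u x + (u p * s) * h" for u x h
    using sdot_zero[of p w, OF w0] by (simp add: sdot_def)
  have q0: "0 \<le> qf p ?T u u" for u by (rule pos_def_nonneg[OF pdT])
  have sq: "sqrt ((sqrt (qf p ?T u u))\<^sup>2 + (u p * s)\<^sup>2) = sqrt (qf (Suc p) S u u)" for u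
    using q0 by (simp add: q)
  have dis: "a p = 0 \<and> b p = 0 \<or> a p = 0 \<and> c p = 0 \<or> b p = 0 \<and> c p = 0" using Suc.prems(3)[of p] by simp
  let ?A = "sqrt (qf p ?T a a)" and ?B = "sqrt (qf p ?T b b)" and ?C = "sqrt (qf p ?T c c)"
  have "(\<integral>\<^sup>+x. F (sdot (Suc p) a x) (sdot (Suc p) b x) (sdot (Suc p) c x) \<partial>mvn (Suc p) S) =
      (\<integral>\<^sup>+x. (\<integral>\<^sup>+h. F (sdot p a x + (a p * s) * h) (sdot p b x + (b p * s) * h) (sdot p c x + (c p * s) * h) \<partial>gau) \<partial>mvn p ?T)"
    by (subst nn_integral_mvn_Suc[OF Suc.prems(1) s dens])
      (simp_all only: lin, intro mF measurable_sdot)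
  also have "\<dots> = (\<integral>\<^sup>+g1. (\<integral>\<^sup>+g2. (\<integral>\<^sup>+g3. (\<integral>\<^sup>+h. F (?A * g1 + (a p * s) * h) (?B * g2 + (b p * s) * h) (?C * g3 + (c p * s) * h) \<partial>gau) \<partial>gau) \<partial>gau) \<partial>gau)"
  proof (rule Suc.IH[OF pdT dT, of "\<lambda>r1 r2 r3. \<integral>\<^sup>+h. F (r1 + (a p * s) * h) (r2 + (b p * s) * h) (r3 + (c p * s) * h) \<partial>gau"])
    show "a j = 0 \<and> b j = 0 \<or> a j = 0 \<and> c j = 0 \<or> b j = 0 \<and> c j = 0" if "j < p" for j
      using Suc.prems(3)[of j] that by simp
    show "(\<lambda>(r1, r2, r3). \<integral>\<^sup>+h. F (r1 + (a p * s) * h) (r2 + (b p * s) * h) (r3 + (c p * s) * h) \<partial>gau) \<in> borel_measurable (borel \<Otimes>\<^sub>M borel \<Otimes>\<^sub>M borel)"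
      unfolding split_beta' by measurable
  qed
  also have "\<dots> = (\<integral>\<^sup>+g1. (\<integral>\<^sup>+g2. (\<integral>\<^sup>+g3. F (sqrt (qf (Suc p) S a a) * g1) (sqrt (qf (Suc p) S b b) * g2) (sqrt (qf (Suc p) S c c) * g3) \<partial>gau) \<partial>gau) \<partial>gau)"
    using dis
  proof (elim disjE conjE)
    assume z: "a p = 0" "b p = 0"
    have "(\<integral>\<^sup>+g3. (\<integral>\<^sup>+h. F r1 r2 (?C * g3 + (c p * s) * h) \<partial>gau) \<partial>gau) = (\<integral>\<^sup>+g3. F r1 r2 (sqrt (qf (Suc p) S c c) * g3) \<partial>gau)" for r1 r2
      by (subst nn_integral_gau_merge) (simp_all add: sq)
    then show ?thesis using z q0 by (simp add: q)
  next
    assume z: "a p = 0" "c p = 0"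
    have "(\<integral>\<^sup>+g2. (\<integral>\<^sup>+g3. (\<integral>\<^sup>+h. F r1 (?B * g2 + (b p * s) * h) (?C * g3) \<partial>gau) \<partial>gau) \<partial>gau) =
      (\<integral>\<^sup>+g2. (\<integral>\<^sup>+g3. F r1 (sqrt (qf (Suc p) S b b) * g2) (?C * g3) \<partial>gau) \<partial>gau)" for r1
    proof -
      have "(\<integral>\<^sup>+g2. (\<integral>\<^sup>+g3. (\<integral>\<^sup>+h. F r1 (?B * g2 + (b p * s) * h) (?C * g3) \<partial>gau) \<partial>gau) \<partial>gau) =
        (\<integral>\<^sup>+g2. (\<integral>\<^sup>+h. (\<integral>\<^sup>+g3. F r1 (?B * g2 + (b p * s) * h) (?C * g3) \<partial>gau) \<partial>gau) \<partial>gau)"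
        by (intro nn_integral_cong gau_gau.Fubini') measurable
      also have "\<dots> = (\<integral>\<^sup>+g2. (\<integral>\<^sup>+g3. F r1 (sqrt (qf (Suc p) S b b) * g2) (?C * g3) \<partial>gau) \<partial>gau)"
        by (subst nn_integral_gau_merge[of "\<lambda>t. \<integral>\<^sup>+g3. F r1 t (?C * g3) \<partial>gau"]) (simp_all add: sq)
      finally show ?thesis .
    qed
    then show ?thesis using z q0 by (simp add: q)
  next
    assume z: "b p = 0" "c p = 0"
    have "(\<integral>\<^sup>+g1. (\<integral>\<^sup>+g2. (\<integral>\<^sup>+g3. (\<integral>\<^sup>+h. F (?A * g1 + (a p * s) * h) (?B * g2) (?C * g3) \<partial>gau) \<partial>gau) \<partial>gau) \<partial>gau) =
      (\<integral>\<^sup>+g1. (\<integral>\<^sup>+g2. (\<integral>\<^sup>+h. (\<integral>\<^sup>+g3. F (?A * g1 + (a p * s) * h) (?B * g2) (?C * g3) \<partial>gau) \<partial>gau) \<partial>gau) \<partial>gau)"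
      by (intro nn_integral_cong gau_gau.Fubini') measurable
    also have "\<dots> = (\<integral>\<^sup>+g1. (\<integral>\<^sup>+h. (\<integral>\<^sup>+g2. (\<integral>\<^sup>+g3. F (?A * g1 + (a p * s) * h) (?B * g2) (?C * g3) \<partial>gau) \<partial>gau) \<partial>gau) \<partial>gau)"
      by (intro nn_integral_cong gau_gau.Fubini') measurable
    also have "\<dots> = (\<integral>\<^sup>+g1. (\<integral>\<^sup>+g2. (\<integral>\<^sup>+g3. F (sqrt (qf (Suc p) S a a) * g1) (?B * g2) (?C * g3) \<partial>gau) \<partial>gau) \<partial>gau)"
      by (subst nn_integral_gau_merge[of "\<lambda>t. \<integral>\<^sup>+g2. (\<integral>\<^sup>+g3. F t (?B * g2) (?C * g3) \<partial>gau) \<partial>gau"]) (simp_all add: sq)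
    finally show ?thesis using z q0 by (simp add: q)
  qed
  finally show ?case .
qed

section \<open>Cross moments of likelihood ratios\<close>

lemma nn_integral_gau_normal_density:
  assumes s: "0 < s"
  shows "(\<integral>\<^sup>+g. ennreal (normal_density (m + c * g) s y) \<partial>gau) = ennreal (normal_density m (sqrt (c\<^sup>2 + s\<^sup>2)) y)"
proof (cases "c = 0")
  case True
  then show ?thesis using s by (simp add: nn_integral_gau_const)
next
  case False
  have sh: "normal_density (m + t) s y = normal_density 0 s ((y - m) - t)" for t
    by (simp add: normal_density_def algebra_simps)
  have "(\<integral>\<^sup>+g. ennreal (normal_density (m + c * g) s y) \<partial>gau) = (\<integral>\<^sup>+g. ennreal (normal_density 0 s ((y - m) - \<bar>c\<bar> * g)) \<partial>gau)"
    unfolding sh by (rule nn_integral_gau_abs[of "\<lambda>t. ennreal (normal_density 0 s ((y - m) - t))"]) simp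
  also have "\<dots> = (\<integral>\<^sup>+t. ennreal (normal_density 0 \<bar>c\<bar> t) * ennreal (normal_density 0 s ((y - m) - t)) \<partial>lborel)"
    using nn_integral_normal_eq_gau[of "\<lambda>t. ennreal (normal_density 0 s ((y - m) - t))" "\<bar>c\<bar>" 0] False by simp
  also have "\<dots> = (\<integral>\<^sup>+t. ennreal (normal_density 0 s ((y - m) - t) * normal_density 0 \<bar>c\<bar> t) \<partial>lborel)"
    by (simp add: ennreal_mult' mult.commute)
  also have "\<dots> = ennreal (normal_density 0 (sqrt (s\<^sup>2 + \<bar>c\<bar>\<^sup>2)) (y - m))"
    using fun_cong[OF conv_normal_density_zero_mean[of s "\<bar>c\<bar>"], of "y - m"] s False by simp
  also have "\<dots> = ennreal (normal_density m (sqrt (c\<^sup>2 + s\<^sup>2)) y)"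
    by (simp add: normal_density_def add.commute)
  finally show ?thesis .
qed

lemma normal_density_sq:
  assumes "0 < s"
  shows "(normal_density m s y)\<^sup>2 = 1 / (2 * s * sqrt pi) * normal_density m (s / sqrt 2) y"
proof -
  have "(exp (- (y - m)\<^sup>2 / (2 * s\<^sup>2)))\<^sup>2 = exp (- (y - m)\<^sup>2 / (2 * (s / sqrt 2)\<^sup>2))"
    using assms by (simp add: power_divide flip: exp_double)
  then show ?thesis
    using assms by (simp add: normal_density_def power_mult_distrib power_divide real_sqrt_mult real_sqrt_divide power2_eq_square)
qed

text \<open>The quotient is a multiple of a normal density with precision 1 / t^2 - 1 / s^2, which
  is positive because t < s.\<close>

lemma nn_integral_normal_ratio:
  assumes t: "0 < t" "t < s"
  shows "(\<integral>\<^sup>+y. ennreal (normal_density 0 t y / normal_density 0 s y) \<partial>lborel) = ennreal (sqrt (2 * pi) * s\<^sup>2 / sqrt (s\<^sup>2 - t\<^sup>2))"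
proof -
  have d: "0 < s\<^sup>2 - t\<^sup>2" using t by (simp add: power_strict_mono)
  define r where "r = t * s / sqrt (s\<^sup>2 - t\<^sup>2)"
  have r: "0 < r" "r\<^sup>2 = t\<^sup>2 * s\<^sup>2 / (s\<^sup>2 - t\<^sup>2)" using t d by (auto simp: r_def power_mult_distrib power_divide)
  define K where "K = sqrt (2 * pi) * s\<^sup>2 / sqrt (s\<^sup>2 - t\<^sup>2)"
  have K: "0 \<le> K" using d by (simp add: K_def)
  have "normal_density 0 t y / normal_density 0 s y = K * normal_density 0 r y" for y
  proof -
    have "- y\<^sup>2 / (2 * t\<^sup>2) - (- y\<^sup>2 / (2 * s\<^sup>2)) = - y\<^sup>2 / (2 * r\<^sup>2)"
      unfolding r(2) using t d by (simp add: divide_simps) (simp add: algebra_simps)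
    then have "exp (- y\<^sup>2 / (2 * t\<^sup>2)) / exp (- y\<^sup>2 / (2 * s\<^sup>2)) = exp (- y\<^sup>2 / (2 * r\<^sup>2))"
      by (simp flip: exp_diff)
    moreover have "normal_density 0 t y / normal_density 0 s y = (s / t) * (exp (- y\<^sup>2 / (2 * t\<^sup>2)) / exp (- y\<^sup>2 / (2 * s\<^sup>2)))"
      using t by (simp add: normal_density_def real_sqrt_mult)
    moreover have "K * normal_density 0 r y = (s / t) * exp (- y\<^sup>2 / (2 * r\<^sup>2))"
    proof -
      have nd: "normal_density 0 r y = 1 / (sqrt (2 * pi) * r) * exp (- y\<^sup>2 / (2 * r\<^sup>2))"
        using r(1) by (simp add: normal_density_def real_sqrt_mult)
      have "K * normal_density 0 r y = ((s\<^sup>2 / sqrt (s\<^sup>2 - t\<^sup>2)) / r) * exp (- y\<^sup>2 / (2 * r\<^sup>2))"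
        unfolding nd K_def by simp
      moreover have "(s\<^sup>2 / sqrt (s\<^sup>2 - t\<^sup>2)) / r = s / t"
        using t d by (simp add: r_def power2_eq_square)
      ultimately show ?thesis by (simp only:)
    qed
    ultimately show ?thesis by simp
  qed
  then have "(\<integral>\<^sup>+y. ennreal (normal_density 0 t y / normal_density 0 s y) \<partial>lborel) =
      (\<integral>\<^sup>+y. ennreal K * ennreal (normal_density 0 r y) \<partial>lborel)"
    using K by (simp add: ennreal_mult')
  also have "\<dots> = ennreal K * (\<integral>\<^sup>+y. ennreal (normal_density 0 r y) \<partial>lborel)"
    by (rule nn_integral_cmult) simp
  also have "(\<integral>\<^sup>+y. ennreal (normal_density 0 r y) \<partial>lborel) = 1"
    using r(1) by (subst nn_integral_eq_integral) auto
  finally show ?thesis by (simp add: K_def)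
qed

text \<open>The likelihood ratio of one observation when the coefficient moves by
  \<open>\<delta>\<close> and the noise level from \<open>s\<close> to \<open>s'\<close>. The law of
  the covariates is shared, so only the conditional densities of the response appear.\<close>

definition lr :: "nat \<Rightarrow> (nat \<Rightarrow> real) \<Rightarrow> real \<Rightarrow> (nat \<Rightarrow> real) \<Rightarrow> real \<Rightarrow> obs \<Rightarrow> real" where
  "lr p b s \<delta> s' z = normal_density (xb p \<delta> z) s' (fst z - xb p b z) / normal_density 0 s (fst z - xb p b z)"

lemma measurable_normal_density2[measurable (raw)]:
  "f \<in> borel_measurable N \<Longrightarrow> g \<in> borel_measurable N \<Longrightarrow> (\<lambda>x. normal_density (f x) s (g x)) \<in> borel_measurable N"
  unfolding normal_density_def
  by (intro borel_measurable_times borel_measurable_const measurable_compose[OF _ borel_measurable_exp]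
      borel_measurable_divide borel_measurable_uminus borel_measurable_power borel_measurable_diff)

lemma measurable_lr[measurable]: "lr p b s \<delta> s' \<in> borel_measurable (obs_space p)"
  unfolding lr_def[abs_def] by measurable

lemma lr_nonneg: "0 \<le> lr p b s \<delta> s' z"
  by (simp add: lr_def)

lemma obs_law_density:
  assumes g: "good_param p \<beta> S s" and g': "good_param p \<beta>' S s'"
    and d: "\<And>j. j < p \<Longrightarrow> \<beta>' $ j = \<beta> $ j + \<delta> j"
  shows "obs_law p (\<beta>', S, s') = density (obs_law p (\<beta>, S, s)) (\<lambda>z. ennreal (lr p (($) \<beta>) s \<delta> s' z))"
proof (rule measure_eqI)
  show "sets (obs_law p (\<beta>', S, s')) = sets (density (obs_law p (\<beta>, S, s)) (\<lambda>z. ennreal (lr p (($) \<beta>) s \<delta> s' z)))"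
    by simp
  fix A assume "A \<in> sets (obs_law p (\<beta>', S, s'))"
  then have A[measurable]: "A \<in> sets (obs_space p)" by simp
  have s: "0 < s" "0 < s'" using g g' by (auto simp: good_param_def)
  have b': "sdot p (($) \<beta>') x = sdot p (($) \<beta>) x + sdot p \<delta> x" for x
    unfolding sdot_add_left[symmetric] by (simp add: sdot_def d)
  have "emeasure (density (obs_law p (\<beta>, S, s)) (\<lambda>z. ennreal (lr p (($) \<beta>) s \<delta> s' z))) A =
      (\<integral>\<^sup>+z. ennreal (lr p (($) \<beta>) s \<delta> s' z) * indicator A z \<partial>obs_law p (\<beta>, S, s))"
    by (rule emeasure_density) (simp_all add: measurable_cong_sets[OF sets_obs_law refl])
  also have "\<dots> = (\<integral>\<^sup>+x. (\<integral>\<^sup>+h. ennreal (lr p (($) \<beta>) s \<delta> s' (sdot p (($) \<beta>) x + s * h, x)) * indicator A (sdot p (($) \<beta>) x + s * h, x) \<partial>gau) \<partial>mvn p S)"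
    by (rule nn_integral_obs_law[OF g]) measurable
  also have "\<dots> = (\<integral>\<^sup>+x. (\<integral>\<^sup>+h. indicator A (sdot p (($) \<beta>') x + s' * h, x) \<partial>gau) \<partial>mvn p S)"
  proof (rule nn_integral_cong)
    fix x assume "x \<in> space (mvn p S)"
    then have [measurable]: "x \<in> space (Pi\<^sub>M {..<p} (\<lambda>_. borel :: real measure))" by simp
    let ?B = "sdot p (($) \<beta>) x" and ?d = "sdot p \<delta> x"
    have [measurable]: "(\<lambda>y. (?B + y, x)) \<in> borel \<rightarrow>\<^sub>M obs_space p" unfolding obs_space_def by measurable
    have [measurable]: "(\<lambda>y. indicator A (?B + y, x) :: ennreal) \<in> borel_measurable borel"
      by (rule measurable_compose[of "\<lambda>y. (?B + y, x)" _ "obs_space p"]) measurable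
    have "(\<integral>\<^sup>+h. ennreal (lr p (($) \<beta>) s \<delta> s' (?B + s * h, x)) * indicator A (?B + s * h, x) \<partial>gau) =
       (\<integral>\<^sup>+h. (\<lambda>y. ennreal (normal_density ?d s' y / normal_density 0 s y) * indicator A (?B + y, x)) (0 + s * h) \<partial>gau)"
      by (simp add: lr_def)
    also have "\<dots> = (\<integral>\<^sup>+y. ennreal (normal_density 0 s y) * (ennreal (normal_density ?d s' y / normal_density 0 s y) * indicator A (?B + y, x)) \<partial>lborel)"
      by (rule nn_integral_normal_eq_gau[symmetric, OF _ s(1)]) measurable
    also have "\<dots> = (\<integral>\<^sup>+y. ennreal (normal_density ?d s' y) * indicator A (?B + y, x) \<partial>lborel)"
    proof (rule nn_integral_cong)
      fix y
      have "normal_density 0 s y * (normal_density ?d s' y / normal_density 0 s y) = normal_density ?d s' y"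
        using normal_density_pos[OF s(1), of 0 y] by simp
      then show "ennreal (normal_density 0 s y) * (ennreal (normal_density ?d s' y / normal_density 0 s y) * indicator A (?B + y, x)) =
        ennreal (normal_density ?d s' y) * indicator A (?B + y, x)"
        by (simp add: mult.assoc[symmetric] flip: ennreal_mult')
    qed
    also have "\<dots> = (\<integral>\<^sup>+h. indicator A (?B + (?d + s' * h), x) \<partial>gau)"
      by (rule nn_integral_normal_eq_gau[OF _ s(2)]) measurable
    finally show "(\<integral>\<^sup>+h. ennreal (lr p (($) \<beta>) s \<delta> s' (?B + s * h, x)) * indicator A (?B + s * h, x) \<partial>gau) =
        (\<integral>\<^sup>+h. indicator A (sdot p (($) \<beta>') x + s' * h, x) \<partial>gau)"
      by (simp add: b' add.assoc)
  qed
  also have "\<dots> = (\<integral>\<^sup>+z. indicator A z \<partial>obs_law p (\<beta>', S, s'))"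
    by (rule nn_integral_obs_law[OF g', symmetric]) measurable
  also have "\<dots> = emeasure (obs_law p (\<beta>', S, s')) A" by simp
  finally show "emeasure (obs_law p (\<beta>', S, s')) A =
      emeasure (density (obs_law p (\<beta>, S, s)) (\<lambda>z. ennreal (lr p (($) \<beta>) s \<delta> s' z))) A" by simp
qed

text \<open>\<open>g\<close> carries the common part, \<open>h\<close> and \<open>k\<close> the
  private ones. Integrating out \<open>h\<close> and \<open>k\<close> adds their variances to the
  lowered noise variances, and the balance v^2 + t^2 = s^2 - w makes both densities equal; the
  private sizes thus disappear from the result.\<close>

lemma gaussian_overlap_integral:
  assumes s: "0 < s" and w: "0 \<le> w" "w < s\<^sup>2" and v: "v\<^sup>2 + t\<^sup>2 = s\<^sup>2 - w" "v'\<^sup>2 + t'\<^sup>2 = s\<^sup>2 - w" and t: "0 < t" "0 < t'"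
  shows "(\<integral>\<^sup>+g. (\<integral>\<^sup>+h. (\<integral>\<^sup>+k. (\<integral>\<^sup>+y. ennreal (normal_density (sqrt w * g + v * h) t y * normal_density (sqrt w * g + v' * k) t' y / normal_density 0 s y) \<partial>lborel) \<partial>gau) \<partial>gau) \<partial>gau)
    = ennreal (s\<^sup>2 / (s\<^sup>2 - w))"
proof -
  define r where "r = sqrt (s\<^sup>2 - w)"
  have r: "0 < r" "r\<^sup>2 = s\<^sup>2 - w" using w by (auto simp: r_def)
  let ?I = "\<lambda>y. ennreal (1 / normal_density 0 s y)"
  have split: "ennreal (a * b / normal_density 0 s y) = ennreal a * (ennreal b * ?I y)" if "0 \<le> a" "0 \<le> b" for a b y
    using that by (simp flip: ennreal_mult')
  have "(\<integral>\<^sup>+g. (\<integral>\<^sup>+h. (\<integral>\<^sup>+k. (\<integral>\<^sup>+y. ennreal (normal_density (sqrt w * g + v * h) t y * normal_density (sqrt w * g + v' * k) t' y / normal_density 0 s y) \<partial>lborel) \<partial>gau) \<partial>gau) \<partial>gau)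
    = (\<integral>\<^sup>+g. (\<integral>\<^sup>+h. (\<integral>\<^sup>+k. (\<integral>\<^sup>+y. ennreal (normal_density (sqrt w * g + v * h) t y) * (ennreal (normal_density (sqrt w * g + v' * k) t' y) * ?I y) \<partial>lborel) \<partial>gau) \<partial>gau) \<partial>gau)"
    by (simp only: split normal_density_nonneg)
  also have "\<dots> = (\<integral>\<^sup>+g. (\<integral>\<^sup>+h. (\<integral>\<^sup>+y. (\<integral>\<^sup>+k. ennreal (normal_density (sqrt w * g + v * h) t y) * (ennreal (normal_density (sqrt w * g + v' * k) t' y) * ?I y) \<partial>gau) \<partial>lborel) \<partial>gau) \<partial>gau)"
    by (intro nn_integral_cong gau_lborel.Fubini'[symmetric]) measurable
  also have "\<dots> = (\<integral>\<^sup>+g. (\<integral>\<^sup>+h. (\<integral>\<^sup>+y. ennreal (normal_density (sqrt w * g + v * h) t y) * (ennreal (normal_density (sqrt w * g) r y) * ?I y) \<partial>lborel) \<partial>gau) \<partial>gau)"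
    using nn_integral_gau_normal_density[OF t(2), of _ v'] by (simp add: nn_integral_cmult nn_integral_multc v r_def)
  also have "\<dots> = (\<integral>\<^sup>+g. (\<integral>\<^sup>+y. (\<integral>\<^sup>+h. ennreal (normal_density (sqrt w * g + v * h) t y) * (ennreal (normal_density (sqrt w * g) r y) * ?I y) \<partial>gau) \<partial>lborel) \<partial>gau)"
    by (intro nn_integral_cong gau_lborel.Fubini'[symmetric]) measurable
  also have "\<dots> = (\<integral>\<^sup>+g. (\<integral>\<^sup>+y. ennreal (normal_density (sqrt w * g) r y) * (ennreal (normal_density (sqrt w * g) r y) * ?I y) \<partial>lborel) \<partial>gau)"
    using nn_integral_gau_normal_density[OF t(1), of _ v] by (simp add: nn_integral_multc v r_def)
  also have "\<dots> = (\<integral>\<^sup>+y. (\<integral>\<^sup>+g. ennreal (normal_density (sqrt w * g) r y) * (ennreal (normal_density (sqrt w * g) r y) * ?I y) \<partial>gau) \<partial>lborel)"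
    by (intro gau_lborel.Fubini'[symmetric]) measurable
  \<comment> \<open>The product is now the square of one normal density, itself a multiple of a
    normal density with half the variance. Averaging over \<open>g\<close> gives variance (s^2 + w)
    / 2, still below s^2, so the quotient by the base density is integrable.\<close>
  also have "\<dots> = (\<integral>\<^sup>+y. (\<integral>\<^sup>+g. ennreal (1 / (2 * r * sqrt pi)) * (ennreal (normal_density (0 + sqrt w * g) (r / sqrt 2) y) * ?I y) \<partial>gau) \<partial>lborel)"
  proof -
    have "ennreal (normal_density m r y) * (ennreal (normal_density m r y) * ?I y) =
      ennreal (1 / (2 * r * sqrt pi)) * (ennreal (normal_density (0 + m) (r / sqrt 2) y) * ?I y)" for m y
    proof -
      have "ennreal (normal_density m r y) * (ennreal (normal_density m r y) * ?I y) = ennreal ((normal_density m r y)\<^sup>2) * ?I y"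
        by (simp add: power2_eq_square ennreal_mult' mult.assoc)
      moreover have "ennreal (c * b) * i = ennreal c * (ennreal b * i)" if "0 \<le> c" for c b i
        using that by (simp add: ennreal_mult' mult.assoc)
      moreover have "0 \<le> 1 / (2 * r * sqrt pi)" using r(1) by simp
      ultimately show ?thesis unfolding normal_density_sq[OF r(1)] by (simp only: add_0)
    qed
    then show ?thesis by simp
  qed
  also have "\<dots> = (\<integral>\<^sup>+y. ennreal (1 / (2 * r * sqrt pi)) * (ennreal (normal_density 0 (sqrt ((sqrt w)\<^sup>2 + (r / sqrt 2)\<^sup>2)) y) * ?I y) \<partial>lborel)"
    using r(1) by (subst nn_integral_cmult, simp, subst nn_integral_multc, simp, subst nn_integral_gau_normal_density) simp_all
  also have "\<dots> = ennreal (1 / (2 * r * sqrt pi)) * (\<integral>\<^sup>+y. ennreal (normal_density 0 (sqrt ((sqrt w)\<^sup>2 + (r / sqrt 2)\<^sup>2)) y / normal_density 0 s y) \<partial>lborel)"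
    by (subst nn_integral_cmult) (simp_all flip: ennreal_mult')
  also have "\<dots> = ennreal (1 / (2 * r * sqrt pi)) * ennreal (sqrt (2 * pi) * s\<^sup>2 / sqrt (r\<^sup>2 / 2))"
  proof -
    let ?t = "sqrt ((sqrt w)\<^sup>2 + (r / sqrt 2)\<^sup>2)"
    have e: "(sqrt w)\<^sup>2 + (r / sqrt 2)\<^sup>2 = (s\<^sup>2 + w) / 2" using w r by (simp add: power_divide field_simps)
    have t2: "?t\<^sup>2 = (s\<^sup>2 + w) / 2" unfolding e using w s by simp
    have "0 < ?t" unfolding e using w s by (simp add: add_pos_nonneg)
    moreover have "?t < s"
      using t2 w(2) s by (intro power2_less_imp_less[of ?t s]) (auto simp: field_simps)
    moreover have "s\<^sup>2 - ?t\<^sup>2 = r\<^sup>2 / 2" unfolding t2 r(2) by (simp add: field_simps)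
    ultimately show ?thesis using nn_integral_normal_ratio[of ?t s] by (simp only:)
  qed
  also have "\<dots> = ennreal (s\<^sup>2 / (s\<^sup>2 - w))"
  proof -
    have "1 / (2 * r * sqrt pi) * (sqrt (2 * pi) * s\<^sup>2 / sqrt (r\<^sup>2 / 2)) = s\<^sup>2 / r\<^sup>2"
    proof -
      have "1 / (2 * r * c) * ((q * c) * S / (r / q)) = (q * q) * S / (2 * (r * r))" if "0 < q" "0 < c" for q c S :: real
        using that r(1) by (simp add: field_simps)
      from this[of "sqrt 2" "sqrt pi" "s\<^sup>2"]
      have "1 / (2 * r * sqrt pi) * (sqrt 2 * sqrt pi * s\<^sup>2 / (r / sqrt 2)) = s\<^sup>2 / r\<^sup>2"
        by (simp add: power2_eq_square)
      moreover have "sqrt (2 * pi) = sqrt 2 * sqrt pi" "sqrt (r\<^sup>2 / 2) = r / sqrt 2"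
        using r(1) by (simp_all add: real_sqrt_mult real_sqrt_divide)
      ultimately show ?thesis by (simp only:)
    qed
    then show ?thesis using r(1) by (simp add: r(2) flip: ennreal_mult')
  qed
  finally show ?thesis .
qed

text \<open>Perturbations that agree wherever both are nonzero split into a common part
  \<open>a\<close> and two remainders, all with disjoint supports, so that the overlap integral
  applies. The conditions on \<open>t\<close> and \<open>t'\<close> keep the total variance of the
  response equal to that at the base point.\<close>

lemma lr_second_moment:
  assumes g: "good_param p \<beta> S s" and dg: "diag p S"
    and ov: "\<And>j. j < p \<Longrightarrow> \<delta> j \<noteq> 0 \<Longrightarrow> \<delta>' j \<noteq> 0 \<Longrightarrow> \<delta> j = \<delta>' j"
    and t: "0 < t" "t\<^sup>2 = s\<^sup>2 - qf p S \<delta> \<delta>" and t': "0 < t'" "t'\<^sup>2 = s\<^sup>2 - qf p S \<delta>' \<delta>'"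
  shows "(\<integral>\<^sup>+z. ennreal (lr p (($) \<beta>) s \<delta> t z) * ennreal (lr p (($) \<beta>) s \<delta>' t' z) \<partial>obs_law p (\<beta>, S, s)) =
    ennreal (s\<^sup>2 / (s\<^sup>2 - qf p S \<delta> \<delta>'))"
proof -
  have pdS: "pos_def p S" and s: "0 < s" using g by (auto simp: good_param_def)
  define a where "a j = (if \<delta> j = \<delta>' j then \<delta> j else 0)" for j
  define v where "v j = \<delta> j - a j" for j
  define v' where "v' j = \<delta>' j - a j" for j
  have dis: "a j = 0 \<and> v j = 0 \<or> a j = 0 \<and> v' j = 0 \<or> v j = 0 \<and> v' j = 0" if "j < p" for j
    using ov[OF that] by (auto simp: a_def v_def v'_def)
  have prod: "\<delta> j * \<delta> j = a j * a j + v j * v j" "\<delta>' j * \<delta>' j = a j * a j + v' j * v' j" "\<delta> j * \<delta>' j = a j * a j" if "j < p" for j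
    using ov[OF that] by (auto simp: a_def v_def v'_def)
  have q: "qf p S \<delta> \<delta> = qf p S a a + qf p S v v" "qf p S \<delta>' \<delta>' = qf p S a a + qf p S v' v'" "qf p S \<delta> \<delta>' = qf p S a a"
    unfolding qf_diag[OF dg] sum.distrib[symmetric] by (auto intro!: sum.cong simp: prod algebra_simps)
  note nonneg = pos_def_nonneg[OF pdS]
  let ?F = "\<lambda>r1 r2 r3. \<integral>\<^sup>+y. ennreal (normal_density (r1 + r2) t y * normal_density (r1 + r3) t' y / normal_density 0 s y) \<partial>lborel"
  have "(\<integral>\<^sup>+z. ennreal (lr p (($) \<beta>) s \<delta> t z) * ennreal (lr p (($) \<beta>) s \<delta>' t' z) \<partial>obs_law p (\<beta>, S, s)) =
     (\<integral>\<^sup>+x. (\<integral>\<^sup>+h. ennreal (lr p (($) \<beta>) s \<delta> t (sdot p (($) \<beta>) x + s * h, x)) * ennreal (lr p (($) \<beta>) s \<delta>' t' (sdot p (($) \<beta>) x + s * h, x)) \<partial>gau) \<partial>mvn p S)"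
    by (rule nn_integral_obs_law[OF g]) measurable
  also have "\<dots> = (\<integral>\<^sup>+x. ?F (sdot p a x) (sdot p v x) (sdot p v' x) \<partial>mvn p S)"
  proof (rule nn_integral_cong)
    fix x
    have d: "sdot p \<delta> x = sdot p a x + sdot p v x" "sdot p \<delta>' x = sdot p a x + sdot p v' x"
      unfolding sdot_add_left[symmetric] by (simp_all add: v_def v'_def)
    have "(\<integral>\<^sup>+h. ennreal (lr p (($) \<beta>) s \<delta> t (sdot p (($) \<beta>) x + s * h, x)) * ennreal (lr p (($) \<beta>) s \<delta>' t' (sdot p (($) \<beta>) x + s * h, x)) \<partial>gau) =
      (\<integral>\<^sup>+h. (\<lambda>y. ennreal (normal_density (sdot p \<delta> x) t y / normal_density 0 s y) * ennreal (normal_density (sdot p \<delta>' x) t' y / normal_density 0 s y)) (0 + s * h) \<partial>gau)"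
      by (simp add: lr_def)
    also have "\<dots> = (\<integral>\<^sup>+y. ennreal (normal_density 0 s y) * (ennreal (normal_density (sdot p \<delta> x) t y / normal_density 0 s y) * ennreal (normal_density (sdot p \<delta>' x) t' y / normal_density 0 s y)) \<partial>lborel)"
      by (rule nn_integral_normal_eq_gau[symmetric, OF _ s]) measurable
    also have "\<dots> = (\<integral>\<^sup>+y. ennreal (normal_density (sdot p \<delta> x) t y * normal_density (sdot p \<delta>' x) t' y / normal_density 0 s y) \<partial>lborel)"
    proof (rule nn_integral_cong)
      fix y
      have "normal_density 0 s y * (normal_density (sdot p \<delta> x) t y / normal_density 0 s y * (normal_density (sdot p \<delta>' x) t' y / normal_density 0 s y)) =
        normal_density (sdot p \<delta> x) t y * normal_density (sdot p \<delta>' x) t' y / normal_density 0 s y"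
        using normal_density_pos[OF s, of 0 y] by simp
      then show "ennreal (normal_density 0 s y) * (ennreal (normal_density (sdot p \<delta> x) t y / normal_density 0 s y) * ennreal (normal_density (sdot p \<delta>' x) t' y / normal_density 0 s y)) =
        ennreal (normal_density (sdot p \<delta> x) t y * normal_density (sdot p \<delta>' x) t' y / normal_density 0 s y)"
        by (simp only: ennreal_mult'[symmetric] normal_density_nonneg divide_nonneg_nonneg mult_nonneg_nonneg)
    qed
    finally show "(\<integral>\<^sup>+h. ennreal (lr p (($) \<beta>) s \<delta> t (sdot p (($) \<beta>) x + s * h, x)) * ennreal (lr p (($) \<beta>) s \<delta>' t' (sdot p (($) \<beta>) x + s * h, x)) \<partial>gau) =
      ?F (sdot p a x) (sdot p v x) (sdot p v' x)" unfolding d .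
  qed
  also have "\<dots> = (\<integral>\<^sup>+g. (\<integral>\<^sup>+h. (\<integral>\<^sup>+k. ?F (sqrt (qf p S a a) * g) (sqrt (qf p S v v) * h) (sqrt (qf p S v' v') * k) \<partial>gau) \<partial>gau) \<partial>gau)"
  proof (rule nn_integral_mvn_disjoint[OF pdS dg, of a v v' ?F])
    show "(\<lambda>(r1, r2, r3). ?F r1 r2 r3) \<in> borel_measurable (borel \<Otimes>\<^sub>M borel \<Otimes>\<^sub>M borel)"
      unfolding split_beta' by measurable
  qed (rule dis)
  also have "\<dots> = ennreal (s\<^sup>2 / (s\<^sup>2 - qf p S a a))"
  proof (rule gaussian_overlap_integral[OF s nonneg _ _ _ t(1) t'(1)])
    have "0 < t\<^sup>2" using t(1) by simp
    then show "qf p S a a < s\<^sup>2" using t(2) q(1) nonneg[of v] by linarith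
    show "(sqrt (qf p S v v))\<^sup>2 + t\<^sup>2 = s\<^sup>2 - qf p S a a" using nonneg[of v] by (simp add: t(2) q(1))
    show "(sqrt (qf p S v' v'))\<^sup>2 + t'\<^sup>2 = s\<^sup>2 - qf p S a a" using nonneg[of v'] by (simp add: t'(2) q(2))
  qed
  finally show ?thesis unfolding q(3) .
qed

lemma PiM_density:
  fixes M :: "'a measure" and I :: "nat set"
  assumes M: "prob_space M" and I: "finite I" and f[measurable]: "f \<in> borel_measurable M"
    and D: "prob_space (density M f)"
  shows "Pi\<^sub>M I (\<lambda>_. density M f) = density (Pi\<^sub>M I (\<lambda>_. M)) (\<lambda>z. \<Prod>i\<in>I. f (z i))"
proof -
  interpret M: prob_space M by fact
  interpret D: prob_space "density M f" by fact
  interpret PM: product_sigma_finite "\<lambda>_::nat. M" ..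
  interpret PD: product_sigma_finite "\<lambda>_::nat. density M f" ..
  have [measurable]: "(\<lambda>z. \<Prod>i\<in>I. f (z i)) \<in> borel_measurable (Pi\<^sub>M I (\<lambda>_. M))"
    by measurable
  show ?thesis
  proof (rule PD.PiM_eqI[OF I, symmetric])
    show "sets (density (Pi\<^sub>M I (\<lambda>_. M)) (\<lambda>z. \<Prod>i\<in>I. f (z i))) = sets (Pi\<^sub>M I (\<lambda>_. density M f))"
      unfolding sets_density by (rule sets_PiM_cong) auto
    fix A assume "\<And>i. i \<in> I \<Longrightarrow> A i \<in> sets (density M f)"
    then have A[measurable]: "\<And>i. i \<in> I \<Longrightarrow> A i \<in> sets M" by simp
    have sA: "Pi\<^sub>E I A \<in> sets (Pi\<^sub>M I (\<lambda>_. M))" using I A by (intro sets_PiM_I_finite) auto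
    have "emeasure (density (Pi\<^sub>M I (\<lambda>_. M)) (\<lambda>z. \<Prod>i\<in>I. f (z i))) (Pi\<^sub>E I A) =
        (\<integral>\<^sup>+z. (\<Prod>i\<in>I. f (z i)) * indicator (Pi\<^sub>E I A) z \<partial>Pi\<^sub>M I (\<lambda>_. M))"
      using sA by (intro emeasure_density) auto
    also have "\<dots> = (\<integral>\<^sup>+z. (\<Prod>i\<in>I. f (z i) * indicator (A i) (z i)) \<partial>Pi\<^sub>M I (\<lambda>_. M))"
    proof (rule nn_integral_cong)
      fix z assume z: "z \<in> space (Pi\<^sub>M I (\<lambda>_. M))"
      have "indicator (Pi\<^sub>E I A) z = (\<Prod>i\<in>I. indicator (A i) (z i) :: ennreal)"
      proof (cases "\<forall>i\<in>I. z i \<in> A i")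
        case True
        then have "z \<in> Pi\<^sub>E I A" using z by (auto simp: space_PiM PiE_def)
        then show ?thesis using True by (simp add: indicator_def)
      next
        case False
        then obtain i where "i \<in> I" "z i \<notin> A i" by blast
        then have "z \<notin> Pi\<^sub>E I A" "(\<Prod>i\<in>I. indicator (A i) (z i) :: ennreal) = 0"
          using I by (auto intro!: prod_zero bexI[of _ i])
        then show ?thesis by simp
      qed
      then show "(\<Prod>i\<in>I. f (z i)) * indicator (Pi\<^sub>E I A) z = (\<Prod>i\<in>I. f (z i) * indicator (A i) (z i))"
        by (simp add: prod.distrib)
    qed
    also have "\<dots> = (\<Prod>i\<in>I. \<integral>\<^sup>+x. f x * indicator (A i) x \<partial>M)"
      using A by (intro PM.product_nn_integral_prod[OF I]) auto
    also have "\<dots> = (\<Prod>i\<in>I. emeasure (density M f) (A i))"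
      using A by (intro prod.cong refl) (simp add: emeasure_density)
    finally show "emeasure (density (Pi\<^sub>M I (\<lambda>_. M)) (\<lambda>z. \<Prod>i\<in>I. f (z i))) (Pi\<^sub>E I A) = (\<Prod>i\<in>I. emeasure (density M f) (A i))" .
  qed
qed

text \<open>The second moment method: the mixture of the null likelihood ratios \<open>L f\<close> is close to 1 in \<open>L\<^sup>2(P)\<close>
  if its chi-square divergence is at most \<open>\<rho>\<^sup>2\<close>.\<close>
lemma mixture_power_bound:
  fixes L :: "'b \<Rightarrow> 'a \<Rightarrow> real" and \<rho> a :: real
  assumes P: "prob_space P" and \<Phi>: "finite \<Phi>" "\<Phi> \<noteq> {}"
    and L[measurable]: "\<And>f. f \<in> \<Phi> \<Longrightarrow> L f \<in> borel_measurable P" and L0: "\<And>f z. 0 \<le> L f z"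
    and mass: "\<And>f. f \<in> \<Phi> \<Longrightarrow> (\<integral>\<^sup>+z. ennreal (L f z) \<partial>P) = 1"
    and cross: "\<And>f f'. f \<in> \<Phi> \<Longrightarrow> f' \<in> \<Phi> \<Longrightarrow> (\<integral>\<^sup>+z. ennreal (L f z) * ennreal (L f' z) \<partial>P) \<le> ennreal (V f f')"
    and V0: "\<And>f f'. 0 \<le> V f f'"
    and chi: "(\<Sum>f\<in>\<Phi>. \<Sum>f'\<in>\<Phi>. V f f') \<le> (1 + \<rho>\<^sup>2) * (real (card \<Phi>))\<^sup>2" and \<rho>: "0 < \<rho>"
    and \<psi>[measurable]: "\<psi> \<in> borel_measurable P" and \<psi>01: "\<And>z. z \<in> space P \<Longrightarrow> 0 \<le> \<psi> z \<and> \<psi> z \<le> 1"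
    and null: "\<And>f. f \<in> \<Phi> \<Longrightarrow> (\<integral>z. L f z * \<psi> z \<partial>P) \<le> a"
  shows "(\<integral>z. \<psi> z \<partial>P) \<le> a + \<rho>"
proof -
  interpret prob_space P by fact
  let ?N = "real (card \<Phi>)"
  have N: "0 < ?N" using \<Phi> by (simp add: card_gt_0_iff)
  define Lb where "Lb z = (\<Sum>f\<in>\<Phi>. L f z) / ?N" for z
  have [measurable]: "Lb \<in> borel_measurable P" unfolding Lb_def[abs_def] by measurable
  have iL: "integrable P (L f)" if "f \<in> \<Phi>" for f
    using that mass L0 by (intro integrableI_nonneg) auto
  have eL: "(\<integral>z. L f z \<partial>P) = 1" if "f \<in> \<Phi>" for f
    using nn_integral_eq_integral[OF iL[OF that]] mass[OF that] L0 by simp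
  have iLL: "integrable P (\<lambda>z. L f z * L f' z)" if "f \<in> \<Phi>" "f' \<in> \<Phi>" for f f'
    using that cross[OF that] L0
    by (intro integrableI_nonneg) (auto simp: ennreal_mult' intro: le_less_trans)
  have eLL: "(\<integral>z. L f z * L f' z \<partial>P) \<le> V f f'" if "f \<in> \<Phi>" "f' \<in> \<Phi>" for f f'
    using nn_integral_eq_integral[OF iLL[OF that]] cross[OF that] L0 V0[of f f'] by (simp add: ennreal_mult')
  have i\<psi>: "integrable P \<psi>"
    using \<psi>01 by (intro integrable_const_bound[of _ 1]) auto
  have iL\<psi>: "integrable P (\<lambda>z. L f z * \<psi> z)" if "f \<in> \<Phi>" for f
  proof (rule Bochner_Integration.integrable_bound[OF iL[OF that]])
    show "AE z in P. norm (L f z * \<psi> z) \<le> norm (L f z)"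
      using \<psi>01 L0 by (intro AE_I2) (auto simp: abs_mult mult_left_le)
  qed (use that in measurable)
  have iLb: "integrable P Lb" unfolding Lb_def[abs_def] using iL by auto
  have eLb: "(\<integral>z. Lb z \<partial>P) = 1" unfolding Lb_def using iL eL N by simp
  have sq: "(Lb z)\<^sup>2 = (\<Sum>f\<in>\<Phi>. \<Sum>f'\<in>\<Phi>. L f z * L f' z) / ?N\<^sup>2" for z
    by (simp add: Lb_def power_divide power2_eq_square sum_product)
  have iLb2: "integrable P (\<lambda>z. (Lb z)\<^sup>2)" unfolding sq using iLL by auto
  have eLb2: "(\<integral>z. (Lb z)\<^sup>2 \<partial>P) \<le> 1 + \<rho>\<^sup>2"
  proof -
    have "(\<integral>z. (Lb z)\<^sup>2 \<partial>P) = (\<Sum>f\<in>\<Phi>. \<Sum>f'\<in>\<Phi>. \<integral>z. L f z * L f' z \<partial>P) / ?N\<^sup>2"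
      unfolding sq using iLL by (simp add: Bochner_Integration.integral_sum Bochner_Integration.integrable_sum)
    also have "\<dots> \<le> (\<Sum>f\<in>\<Phi>. \<Sum>f'\<in>\<Phi>. V f f') / ?N\<^sup>2"
      by (intro divide_right_mono sum_mono eLL) auto
    also have "\<dots> \<le> 1 + \<rho>\<^sup>2" using chi N by (simp add: divide_le_eq)
    finally show ?thesis .
  qed
  have iLb\<psi>: "integrable P (\<lambda>z. Lb z * \<psi> z)" and eLb\<psi>: "(\<integral>z. Lb z * \<psi> z \<partial>P) \<le> a"
  proof -
    have eq: "Lb z * \<psi> z = (\<Sum>f\<in>\<Phi>. L f z * \<psi> z) / ?N" for z by (simp add: Lb_def sum_distrib_right)
    show "integrable P (\<lambda>z. Lb z * \<psi> z)" unfolding eq using iL\<psi> by auto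
    have "(\<integral>z. Lb z * \<psi> z \<partial>P) = (\<Sum>f\<in>\<Phi>. \<integral>z. L f z * \<psi> z \<partial>P) / ?N" unfolding eq using iL\<psi> by simp
    also have "\<dots> \<le> (\<Sum>f\<in>\<Phi>. a) / ?N" using null by (intro divide_right_mono sum_mono) auto
    also have "\<dots> = a" using N by simp
    finally show "(\<integral>z. Lb z * \<psi> z \<partial>P) \<le> a" .
  qed
  \<comment> \<open>The elementary bound |x| at most \<rho> / 2 + x^2 / (2 \<rho>) with x = 1 -
    \<open>Lb z\<close> replaces Cauchy-Schwarz; it is integrated pointwise and, at chi-square
    divergence \<rho>^2, also gives \<rho>.\<close>
  let ?R = "\<lambda>z. \<rho> / 2 + ((Lb z)\<^sup>2 - 2 * Lb z + 1) / (2 * \<rho>)"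
  have iR: "integrable P ?R" using iLb iLb2 by auto
  have "(\<integral>z. \<psi> z \<partial>P) \<le> (\<integral>z. Lb z * \<psi> z + ?R z \<partial>P)"
  proof (rule integral_mono[OF i\<psi>])
    show "integrable P (\<lambda>z. Lb z * \<psi> z + ?R z)" using iLb\<psi> iR by (rule Bochner_Integration.integrable_add)
    fix z assume z: "z \<in> space P"
    have "(1 - Lb z) * \<psi> z \<le> \<bar>1 - Lb z\<bar> * \<psi> z"
      using \<psi>01[OF z] by (intro mult_right_mono) auto
    also have "\<dots> \<le> \<bar>1 - Lb z\<bar> * 1"
      using \<psi>01[OF z] by (intro mult_left_mono) auto
    also have "\<bar>1 - Lb z\<bar> * 1 \<le> \<rho> / 2 + (1 - Lb z)\<^sup>2 / (2 * \<rho>)"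
    proof -
      have "0 \<le> (\<rho> - \<bar>1 - Lb z\<bar>)\<^sup>2 / (2 * \<rho>)" using \<rho> by simp
      also have "\<dots> = \<rho> / 2 + (1 - Lb z)\<^sup>2 / (2 * \<rho>) - \<bar>1 - Lb z\<bar>"
        using \<rho> by (cases "0 \<le> 1 - Lb z") (simp_all add: field_simps power2_eq_square)
      finally show ?thesis by simp
    qed
    finally show "\<psi> z \<le> Lb z * \<psi> z + ?R z" by (simp add: algebra_simps power2_eq_square)
  qed
  also have "\<dots> = (\<integral>z. Lb z * \<psi> z \<partial>P) + (\<integral>z. ?R z \<partial>P)"
    using iLb\<psi> iR by (rule Bochner_Integration.integral_add)
  also have "(\<integral>z. ?R z \<partial>P) = \<rho> / 2 + ((\<integral>z. (Lb z)\<^sup>2 \<partial>P) - 2 * 1 + 1) / (2 * \<rho>)"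
    using iLb iLb2 by (simp add: prob_space eLb)
  also have "\<dots> \<le> \<rho> / 2 + \<rho>\<^sup>2 / (2 * \<rho>)"
    using eLb2 \<rho> by (intro add_left_mono divide_right_mono) auto
  also have "\<dots> = \<rho>" using \<rho> by (simp add: power2_eq_square)
  finally show ?thesis using eLb\<psi> by linarith
qed

section \<open>The lower bound for diagonal covariance\<close>

lemma block_index_less:
  assumes "i < s" "r < q"
  shows "i * q + r < s * (q :: nat)"
proof -
  have "i * q + r < Suc i * q" using assms(2) by simp
  also have "\<dots> \<le> s * q" using assms(1) by (intro mult_le_mono1) simp
  finally show ?thesis .
qed

lemma sum_blocks: "(\<Sum>j<s * q. f j) = (\<Sum>i<s. \<Sum>r<q. f (i * q + r :: nat))"
proof -
  have "(\<Sum>j<s * q. f j) = (\<Sum>i<s. sum f {i * q..<i * q + q})"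
    by (rule sum.nat_group[symmetric])
  also have "\<dots> = (\<Sum>i<s. \<Sum>r<q. f (i * q + r))"
  proof (rule sum.cong)
    show "sum f {i * q..<i * q + q} = (\<Sum>r<q. f (i * q + r))" for i
      using sum.shift_bounds_nat_ivl[of f 0 "i * q" q] by (simp add: add.commute lessThan_atLeast0)
  qed simp
  finally show ?thesis .
qed

text \<open>One coordinate is perturbed in each of \<open>s\<close> consecutive blocks of length \<open>q\<close>; the size of the
  perturbation is inversely proportional to the loading, so that its effect on the functional is constant.\<close>
definition block_pert :: "real Matrix.vec \<Rightarrow> real \<Rightarrow> nat \<Rightarrow> nat \<Rightarrow> (nat \<Rightarrow> nat) \<Rightarrow> nat \<Rightarrow> real" where
  "block_pert \<xi> a s q \<phi> j = (if j < s * q \<and> j mod q = \<phi> (j div q) then - a / \<xi> $ j else 0)"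

lemma block_pert_at:
  assumes "i < s" "r < q"
  shows "block_pert \<xi> a s q \<phi> (i * q + r) = (if r = \<phi> i then - a / \<xi> $ (i * q + r) else 0)"
proof -
  have "i * q + r < s * q" using assms by (rule block_index_less)
  moreover have "(i * q + r) div q = i" "(i * q + r) mod q = r" using assms by auto
  ultimately show ?thesis by (simp add: block_pert_def)
qed

lemma sum_block_pert:
  assumes "s * q \<le> p" and f: "\<And>j. j < p \<Longrightarrow> \<not> j < s * q \<Longrightarrow> f j = 0"
  shows "(\<Sum>j<p. f j) = (\<Sum>i<s. \<Sum>r<q. f (i * q + r :: nat))"
proof -
  have "(\<Sum>j<p. f j) = (\<Sum>j<s * q. f j)"
    using assms by (intro sum.mono_neutral_right) auto
  then show ?thesis by (simp add: sum_blocks)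
qed

lemma nnz_block_pert: "nnz p (block_pert \<xi> a s q \<phi>) \<le> s"
proof -
  have "{j. j < p \<and> block_pert \<xi> a s q \<phi> j \<noteq> 0} \<subseteq> (\<lambda>i. i * q + \<phi> i) ` {..<s}"
  proof
    fix j assume "j \<in> {j. j < p \<and> block_pert \<xi> a s q \<phi> j \<noteq> 0}"
    then have j: "j < s * q" "j mod q = \<phi> (j div q)" by (auto simp: block_pert_def split: if_splits)
    have "j = (j div q) * q + \<phi> (j div q)" using j(2) by (metis div_mult_mod_eq)
    moreover have "j div q < s" using j(1) by (simp add: less_mult_imp_div_less)
    ultimately show "j \<in> (\<lambda>i. i * q + \<phi> i) ` {..<s}" by blast
  qed
  then have "nnz p (block_pert \<xi> a s q \<phi>) \<le> card ((\<lambda>i. i * q + \<phi> i) ` {..<s})"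
    unfolding nnz_def by (intro card_mono) auto
  also have "\<dots> \<le> s" using card_image_le[of "{..<s}" "\<lambda>i. i * q + \<phi> i"] by simp
  finally show ?thesis .
qed

lemma sdot_block_pert:
  assumes sq: "s * q \<le> p" and \<phi>: "\<And>i. i < s \<Longrightarrow> \<phi> i < q" and nz: "\<And>j. j < s * q \<Longrightarrow> \<xi> $ j \<noteq> 0"
  shows "sdot p (($) \<xi>) (block_pert \<xi> a s q \<phi>) = - a * real s"
proof -
  have "sdot p (($) \<xi>) (block_pert \<xi> a s q \<phi>) = (\<Sum>i<s. \<Sum>r<q. \<xi> $ (i * q + r) * block_pert \<xi> a s q \<phi> (i * q + r))"
    unfolding sdot_def using sq by (intro sum_block_pert) (auto simp: block_pert_def)
  also have "\<dots> = (\<Sum>i<s. \<Sum>r<q. if r = \<phi> i then - a else 0)"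
  proof (intro sum.cong refl)
    fix i r assume "i \<in> {..<s}" "r \<in> {..<q}"
    then have ir: "i < s" "r < q" by auto
    then have "i * q + r < s * q" by (rule block_index_less)
    then show "\<xi> $ (i * q + r) * block_pert \<xi> a s q \<phi> (i * q + r) = (if r = \<phi> i then - a else 0)"
      using nz by (simp add: block_pert_at[OF ir])
  qed
  also have "\<dots> = (\<Sum>i<s. - a)" using \<phi> by (intro sum.cong) auto
  finally show ?thesis by simp
qed

definition agree :: "nat \<Rightarrow> (nat \<Rightarrow> nat) \<Rightarrow> (nat \<Rightarrow> nat) \<Rightarrow> real" where
  "agree s \<phi> \<phi>' = (\<Sum>i<s. if \<phi> i = \<phi>' i then 1 else 0)"

lemma agree_bounds: "0 \<le> agree s \<phi> \<phi>'" "agree s \<phi> \<phi>' \<le> real s"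
proof -
  show "0 \<le> agree s \<phi> \<phi>'" unfolding agree_def by (intro sum_nonneg) auto
  have "agree s \<phi> \<phi>' \<le> (\<Sum>i<s. 1)" unfolding agree_def by (intro sum_mono) auto
  then show "agree s \<phi> \<phi>' \<le> real s" by simp
qed

lemma qf_block_pert:
  assumes dg: "diag p S" and Sb: "\<And>j. j < p \<Longrightarrow> 0 \<le> S $$ (j, j) \<and> S $$ (j, j) \<le> M"
    and sq: "s * q \<le> p" and \<phi>: "\<And>i. i < s \<Longrightarrow> \<phi> i < q" and x: "0 < x" "\<And>j. j < s * q \<Longrightarrow> x \<le> \<bar>\<xi> $ j\<bar>"
  shows "0 \<le> qf p S (block_pert \<xi> a s q \<phi>) (block_pert \<xi> a s q \<phi>')"
    "qf p S (block_pert \<xi> a s q \<phi>) (block_pert \<xi> a s q \<phi>') \<le> agree s \<phi> \<phi>' * (M * a\<^sup>2 / x\<^sup>2)"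
proof -
  let ?d = "block_pert \<xi> a s q \<phi>" and ?d' = "block_pert \<xi> a s q \<phi>'"
  have eq: "qf p S ?d ?d' = (\<Sum>i<s. \<Sum>r<q. S $$ (i * q + r, i * q + r) * (?d (i * q + r) * ?d' (i * q + r)))"
    unfolding qf_diag[OF dg] using sq by (intro sum_block_pert) (auto simp: block_pert_def)
  have term_le: "0 \<le> S $$ (i * q + r, i * q + r) * (?d (i * q + r) * ?d' (i * q + r)) \<and>
      S $$ (i * q + r, i * q + r) * (?d (i * q + r) * ?d' (i * q + r)) \<le> (if r = \<phi> i then if \<phi> i = \<phi>' i then M * a\<^sup>2 / x\<^sup>2 else 0 else 0)"
    if ir: "i < s" "r < q" for i r
  proof -
    let ?j = "i * q + r"
    have j: "?j < s * q" using ir by (rule block_index_less)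
    then have jp: "?j < p" using sq by simp
    have S: "0 \<le> S $$ (?j, ?j)" "S $$ (?j, ?j) \<le> M" using Sb[OF jp] by auto
    have "x\<^sup>2 \<le> (\<xi> $ ?j)\<^sup>2" using power_mono[OF x(2)[OF j], of 2] x(1) by simp
    moreover have "0 < (\<xi> $ ?j)\<^sup>2" using x(2)[OF j] x(1) by auto
    ultimately have "S $$ (?j, ?j) * (a\<^sup>2 / (\<xi> $ ?j)\<^sup>2) \<le> M * (a\<^sup>2 / x\<^sup>2)"
      using S x(1) by (intro mult_mono divide_left_mono) auto
    then show ?thesis using S
      by (auto simp: block_pert_at[OF ir] power2_eq_square)
  qed
  show "0 \<le> qf p S ?d ?d'" unfolding eq using term_le by (intro sum_nonneg) auto
  have "qf p S ?d ?d' \<le> (\<Sum>i<s. \<Sum>r<q. if r = \<phi> i then if \<phi> i = \<phi>' i then M * a\<^sup>2 / x\<^sup>2 else 0 else 0)"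
    unfolding eq using term_le by (intro sum_mono) auto
  also have "\<dots> = (\<Sum>i<s. (if \<phi> i = \<phi>' i then 1 else 0) * (M * a\<^sup>2 / x\<^sup>2))"
    using \<phi> by (intro sum.cong) auto
  also have "\<dots> = agree s \<phi> \<phi>' * (M * a\<^sup>2 / x\<^sup>2)" by (simp only: agree_def sum_distrib_right)
  finally show "qf p S ?d ?d' \<le> agree s \<phi> \<phi>' * (M * a\<^sup>2 / x\<^sup>2)" .
qed

text \<open>Up to normalisation, the moment generating function of the overlap under a uniform
  choice of \<open>\<phi>'\<close>. Choices in different blocks are independent, so the sum
  factorises.\<close>

lemma sum_exp_agree:
  assumes \<phi>: "\<And>i. i < s \<Longrightarrow> \<phi> i < q"
  shows "(\<Sum>\<phi>'\<in>{..<s} \<rightarrow>\<^sub>E {..<q}. exp (\<kappa> * agree s \<phi> \<phi>')) = (real q - 1 + exp \<kappa>) ^ s"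
proof -
  have "exp (\<kappa> * agree s \<phi> \<phi>') = (\<Prod>i<s. if \<phi> i = \<phi>' i then exp \<kappa> else 1)" for \<phi>'
    unfolding agree_def sum_distrib_left exp_sum[OF finite_lessThan] by (intro prod.cong) auto
  then have "(\<Sum>\<phi>'\<in>{..<s} \<rightarrow>\<^sub>E {..<q}. exp (\<kappa> * agree s \<phi> \<phi>')) = (\<Sum>\<phi>'\<in>{..<s} \<rightarrow>\<^sub>E {..<q}. \<Prod>i<s. if \<phi> i = \<phi>' i then exp \<kappa> else 1)"
    by simp
  also have "\<dots> = (\<Prod>i<s. \<Sum>y<q. if \<phi> i = y then exp \<kappa> else 1)"
    by (rule prod_sum_PiE[symmetric]) auto
  also have "\<dots> = (\<Prod>i<s. real q - 1 + exp \<kappa>)"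
  proof (intro prod.cong refl)
    fix i assume "i \<in> {..<s}"
    then have "\<phi> i < q" using \<phi> by simp
    have "(\<Sum>y<q. if \<phi> i = y then exp \<kappa> else 1) = (\<Sum>y<q. 1 + (if \<phi> i = y then exp \<kappa> - 1 else 0))"
      by (intro sum.cong) auto
    also have "\<dots> = real q + (exp \<kappa> - 1)" using \<open>\<phi> i < q\<close> by (simp add: sum.distrib)
    finally show "(\<Sum>y<q. if \<phi> i = y then exp \<kappa> else 1) = real q - 1 + exp \<kappa>" by simp
  qed
  finally show ?thesis by simp
qed

lemma chi_square_bound:
  fixes \<kappa> :: real
  assumes q: "0 < q" and \<kappa>: "0 \<le> \<kappa>" "\<kappa> \<le> 1" "\<kappa> * real s \<le> \<kappa>\<^sub>0 * real q"
  shows "(\<Sum>\<phi>\<in>{..<s} \<rightarrow>\<^sub>E {..<q}. \<Sum>\<phi>'\<in>{..<s} \<rightarrow>\<^sub>E {..<q}. exp (\<kappa> * agree s \<phi> \<phi>')) \<le>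
    exp (2 * \<kappa>\<^sub>0) * (real (card ({..<s} \<rightarrow>\<^sub>E {..<q})))\<^sup>2"
proof -
  have card: "real (card ({..<s} \<rightarrow>\<^sub>E {..<q})) = real q ^ s" by (simp add: card_PiE)
  have "(\<Sum>\<phi>\<in>{..<s} \<rightarrow>\<^sub>E {..<q}. \<Sum>\<phi>'\<in>{..<s} \<rightarrow>\<^sub>E {..<q}. exp (\<kappa> * agree s \<phi> \<phi>')) =
      (\<Sum>\<phi>\<in>{..<s} \<rightarrow>\<^sub>E {..<q}. (real q - 1 + exp \<kappa>) ^ s)"
    by (intro sum.cong refl sum_exp_agree) auto
  also have "\<dots> = real q ^ s * (real q - 1 + exp \<kappa>) ^ s" by (simp add: card_PiE)
  also have "(real q - 1 + exp \<kappa>) ^ s \<le> exp (2 * \<kappa>\<^sub>0) * real q ^ s"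
  proof -
    have "\<kappa>\<^sup>2 \<le> \<kappa>" using \<kappa> by (simp add: power2_eq_square mult_left_le)
    then have "exp \<kappa> - 1 \<le> 2 * \<kappa>" using exp_bound[OF \<kappa>(1,2)] by linarith
    then have "real q - 1 + exp \<kappa> \<le> real q + 2 * \<kappa>" by linarith
    also have "\<dots> = real q * (1 + 2 * \<kappa> / real q)" using q by (simp add: field_simps)
    also have "\<dots> \<le> real q * exp (2 * \<kappa> / real q)" by (intro mult_left_mono exp_ge_add_one_self) simp
    finally have "(real q - 1 + exp \<kappa>) ^ s \<le> (real q * exp (2 * \<kappa> / real q)) ^ s"
      using q by (intro power_mono) (auto intro!: add_nonneg_nonneg)
    also have "\<dots> = real q ^ s * exp (real s * (2 * \<kappa> / real q))"
      by (simp only: power_mult_distrib exp_of_nat_mult)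
    also have "\<dots> \<le> real q ^ s * exp (2 * \<kappa>\<^sub>0)"
      using \<kappa>(3) q by (intro mult_left_mono) (auto simp: field_simps)
    finally show ?thesis by (simp add: mult.commute)
  qed
  then have "real q ^ s * (real q - 1 + exp \<kappa>) ^ s \<le> real q ^ s * (exp (2 * \<kappa>\<^sub>0) * real q ^ s)"
    by (intro mult_left_mono) auto
  finally show ?thesis unfolding card by (simp add: power2_eq_square mult_ac)
qed

lemma inverse_one_minus_le_exp:
  fixes y :: real
  assumes "0 \<le> y" "y \<le> 1 / 2"
  shows "1 / (1 - y) \<le> exp (2 * y)"
proof -
  have "y * (2 * y) \<le> y * 1" using assms by (intro mult_left_mono) auto
  then have "1 \<le> (1 + 2 * y) * (1 - y)" by (simp add: algebra_simps)
  also have "\<dots> \<le> exp (2 * y) * (1 - y)" using assms by (intro mult_right_mono exp_ge_add_one_self) auto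
  finally show ?thesis using assms by (simp add: divide_le_eq)
qed

lemma tau_adap_nonneg: "0 \<le> tau_adap M\<^sub>2 \<alpha> \<eta> n p t\<^sub>0 k\<^sub>u k S \<xi>"
  unfolding tau_adap_def by (intro Inf_greatest) auto

lemma scalar_prod_vec: "\<xi> \<bullet> vec p v = sdot p (($) \<xi>) v"
  by (simp add: scalar_prod_def sdot_def lessThan_atLeast0)

lemma l0norm_vec: "l0norm (vec p v) = nnz p v"
  unfolding l0norm_def nnz_def by (intro arg_cong[where f=card]) auto

lemma nnz_add: "nnz p (\<lambda>j. u j + v j) \<le> nnz p u + nnz p v"
proof -
  have "{j. j < p \<and> u j + v j \<noteq> 0} \<subseteq> {j. j < p \<and> u j \<noteq> 0} \<union> {j. j < p \<and> v j \<noteq> 0}" by auto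
  then have "nnz p (\<lambda>j. u j + v j) \<le> card ({j. j < p \<and> u j \<noteq> 0} \<union> {j. j < p \<and> v j \<noteq> 0})"
    unfolding nnz_def by (intro card_mono) auto
  also have "\<dots> \<le> nnz p u + nnz p v" unfolding nnz_def by (rule card_Un_le)
  finally show ?thesis .
qed

text \<open>The base point is the one-sparse alternative, and densities are taken with respect to
  it; the mixture runs over nulls. Every block choice lowers the functional by exactly a s, so all
  of them land on the same value. The bound on \<open>a\<close> lets an agreeing block add at most
  \<kappa> / (2 n) to the relative overlap, and s at most n keeps that overlap at most 1 /
  2.\<close>

lemma tau_adap_ge:
  fixes M s\<^sub>0 \<rho> \<kappa> \<kappa>\<^sub>0 x a :: real
  assumes M: "0 < M" and s0: "0 < s\<^sub>0" and \<rho>: "0 < \<rho>" "\<alpha> + \<rho> < 1 - \<eta>"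
    and pdS: "pos_def p S" and dg: "diag p S" and Sb: "\<And>j. j < p \<Longrightarrow> 0 \<le> S $$ (j, j) \<and> S $$ (j, j) \<le> M"
    and \<xi>: "\<xi> \<in> carrier_vec p" and p: "0 < p"
    and sq: "s * q \<le> p" "1 \<le> s" "1 \<le> q" and x: "0 < x" "\<And>j. j < s * q \<Longrightarrow> x \<le> \<bar>\<xi> $ j\<bar>"
    and k: "1 \<le> k" "s + 1 \<le> k\<^sub>u" and n: "s \<le> n"
    and \<kappa>: "0 < \<kappa>" "\<kappa> \<le> 1" "\<kappa> * real s \<le> \<kappa>\<^sub>0 * real q" "exp (2 * \<kappa>\<^sub>0) \<le> 1 + \<rho>\<^sup>2"
    and a: "0 < a" "2 * real n * M * a\<^sup>2 \<le> \<kappa> * s\<^sub>0\<^sup>2 * x\<^sup>2"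
  shows "ereal (a * real s) \<le> tau_adap s\<^sub>0 \<alpha> \<eta> n p t\<^sub>0 k\<^sub>u k S \<xi>"
proof -
  have n0: "0 < n" using sq n by simp
  define \<Phi> where "\<Phi> = ({..<s} \<rightarrow>\<^sub>E {..<q})"
  have "0 \<in> {..<q}" using sq by simp
  then have \<Phi>: "finite \<Phi>" "\<Phi> \<noteq> {}" by (auto simp: \<Phi>_def PiE_eq_empty_iff simp del: lessThan_iff intro!: finite_PiE)
  have \<Phi>_less: "\<phi> i < q" if "\<phi> \<in> \<Phi>" "i < s" for \<phi> i using that by (auto simp: \<Phi>_def)
  have xi0: "\<xi> $ 0 \<noteq> 0" using x(2)[of 0] x(1) sq by auto
  \<comment> \<open>All the mass is on coordinate 0, where the loading is nonzero. A block may
    perturb the same coordinate; the effects add, and the support still has at most s + 1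
    elements.\<close>
  define b where "b j = (if j = 0 then (t\<^sub>0 + a * real s) / \<xi> $ 0 else 0)" for j :: nat
  define \<beta> where "\<beta> = vec p b"
  define \<delta> where "\<delta> = block_pert \<xi> a s q"
  define \<beta>' where "\<beta>' \<phi> = vec p (\<lambda>j. b j + \<delta> \<phi> j)" for \<phi>
  define Q where "Q \<phi> \<phi>' = qf p S (\<delta> \<phi>) (\<delta> \<phi>')" for \<phi> \<phi>'
  \<comment> \<open>The noise level which, together with the perturbation, reproduces the variance
    of the response. Starting from the largest admissible level \<open>s\<^sub>0\<close>, a lowered
    level stays admissible.\<close>
  define t where "t \<phi> = sqrt (s\<^sub>0\<^sup>2 - Q \<phi> \<phi>)" for \<phi>
  have Q: "0 \<le> Q \<phi> \<phi>'" "Q \<phi> \<phi>' / s\<^sub>0\<^sup>2 \<le> \<kappa> * agree s \<phi> \<phi>' / (2 * real n)" if "\<phi> \<in> \<Phi>" "\<phi>' \<in> \<Phi>" for \<phi> \<phi>'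
  proof -
    have B: "0 \<le> qf p S (block_pert \<xi> a s q \<phi>) (block_pert \<xi> a s q \<phi>')"
      "qf p S (block_pert \<xi> a s q \<phi>) (block_pert \<xi> a s q \<phi>') \<le> agree s \<phi> \<phi>' * (M * a\<^sup>2 / x\<^sup>2)"
      by (rule qf_block_pert[OF dg Sb sq(1) \<Phi>_less[OF that(1)] x]; assumption)+
    show "0 \<le> Q \<phi> \<phi>'" using B(1) by (simp add: Q_def \<delta>_def)
    have "M * a\<^sup>2 / x\<^sup>2 \<le> \<kappa> * s\<^sub>0\<^sup>2 / (2 * real n)" using a(2) x(1) n0 by (simp add: field_simps)
    then have "Q \<phi> \<phi>' \<le> agree s \<phi> \<phi>' * (\<kappa> * s\<^sub>0\<^sup>2 / (2 * real n))"
      using B(2) mult_left_mono[OF _ agree_bounds(1), of "M * a\<^sup>2 / x\<^sup>2" "\<kappa> * s\<^sub>0\<^sup>2 / (2 * real n)" s \<phi> \<phi>']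
      unfolding Q_def \<delta>_def by linarith
    then show "Q \<phi> \<phi>' / s\<^sub>0\<^sup>2 \<le> \<kappa> * agree s \<phi> \<phi>' / (2 * real n)" using s0 by (simp add: field_simps)
  qed
  have Q_half: "Q \<phi> \<phi>' / s\<^sub>0\<^sup>2 \<le> 1 / 2" if "\<phi> \<in> \<Phi>" "\<phi>' \<in> \<Phi>" for \<phi> \<phi>'
  proof -
    have "\<kappa> * agree s \<phi> \<phi>' \<le> 1 * real s" using \<kappa> agree_bounds by (intro mult_mono) auto
    also have "\<dots> \<le> real n" using n by simp
    finally have "\<kappa> * agree s \<phi> \<phi>' / (2 * real n) \<le> 1 / 2" using n0 by (simp add: field_simps)
    then show ?thesis using Q(2)[OF that] by linarith
  qed
  have t: "0 < t \<phi>" "(t \<phi>)\<^sup>2 = s\<^sub>0\<^sup>2 - Q \<phi> \<phi>" "t \<phi> \<le> s\<^sub>0" if "\<phi> \<in> \<Phi>" for \<phi>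
  proof -
    have "Q \<phi> \<phi> \<le> s\<^sub>0\<^sup>2 / 2" using Q_half[OF that that] s0 by (simp add: field_simps)
    moreover have "0 < s\<^sub>0\<^sup>2" using s0 by simp
    ultimately have "0 < s\<^sub>0\<^sup>2 - Q \<phi> \<phi>" by linarith
    then show "0 < t \<phi>" "(t \<phi>)\<^sup>2 = s\<^sub>0\<^sup>2 - Q \<phi> \<phi>" by (auto simp: t_def)
    show "t \<phi> \<le> s\<^sub>0" unfolding t_def using Q(1)[OF that that] s0 by (intro real_le_lsqrt) auto
  qed
  have good: "good_param p \<beta> S s\<^sub>0" using pdS s0 by (simp add: good_param_def \<beta>_def)
  have good': "good_param p (\<beta>' \<phi>) S (t \<phi>)" if "\<phi> \<in> \<Phi>" for \<phi>
    using pdS t(1)[OF that] by (simp add: good_param_def \<beta>'_def)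
  have nnzb: "nnz p b \<le> 1"
  proof -
    have "nnz p b \<le> card {0::nat}" unfolding nnz_def by (intro card_mono) (auto simp: b_def)
    then show ?thesis by simp
  qed
  have sb: "sdot p (($) \<xi>) b = t\<^sub>0 + a * real s"
  proof -
    have "sdot p (($) \<xi>) b = (\<Sum>j<p. if j = 0 then t\<^sub>0 + a * real s else 0)"
      unfolding sdot_def b_def using xi0 by (intro sum.cong) auto
    then show ?thesis using p by simp
  qed
  have in_null: "(\<beta>' \<phi>, S, t \<phi>) \<in> Theta_null s\<^sub>0 k\<^sub>u S \<xi> t\<^sub>0" if "\<phi> \<in> \<Phi>" for \<phi>
  proof -
    have "\<xi> \<bullet> \<beta>' \<phi> = sdot p (($) \<xi>) b + sdot p (($) \<xi>) (\<delta> \<phi>)"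
      unfolding \<beta>'_def scalar_prod_vec by (simp add: sdot_def algebra_simps sum.distrib)
    also have "sdot p (($) \<xi>) (\<delta> \<phi>) = - a * real s"
      unfolding \<delta>_def using x by (intro sdot_block_pert[OF sq(1) \<Phi>_less[OF that]]) force+
    finally have "\<xi> \<bullet> \<beta>' \<phi> = t\<^sub>0" by (simp add: sb)
    moreover have "l0norm (\<beta>' \<phi>) \<le> k\<^sub>u"
      unfolding \<beta>'_def l0norm_vec using nnz_add[of p b "\<delta> \<phi>"] nnzb nnz_block_pert[of p \<xi> a s q \<phi>] k(2)
      by (simp add: \<delta>_def)
    ultimately show ?thesis using t[OF that] \<xi> by (auto simp: Theta_null_def \<beta>'_def)
  qed
  let ?P = "data_law n p (\<beta>, S, s\<^sub>0)"
  interpret P: prob_space ?P by (rule prob_space_data_law[OF good])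
  define L where "L \<phi> z = (\<Prod>i<n. lr p (($) \<beta>) s\<^sub>0 (\<delta> \<phi>) (t \<phi>) (z i))" for \<phi> z
  have L0: "0 \<le> L \<phi> z" for \<phi> z unfolding L_def by (intro prod_nonneg ballI lr_nonneg)
  have mL: "L \<phi> \<in> borel_measurable ?P" for \<phi>
  proof -
    have "L \<phi> \<in> borel_measurable (data_space n p)"
      unfolding L_def[abs_def] data_space_def
      by (intro borel_measurable_prod measurable_component_obs[where f="lr p (($) \<beta>) s\<^sub>0 (\<delta> \<phi>) (t \<phi>)"] measurable_lr)
    then show ?thesis by (simp add: measurable_cong_sets[OF sets_data_law refl])
  qed
  have dens: "data_law n p (\<beta>' \<phi>, S, t \<phi>) = density ?P (\<lambda>z. ennreal (L \<phi> z))" if "\<phi> \<in> \<Phi>" for \<phi>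
  proof -
    have law: "obs_law p (\<beta>' \<phi>, S, t \<phi>) = density (obs_law p (\<beta>, S, s\<^sub>0)) (\<lambda>z. ennreal (lr p (($) \<beta>) s\<^sub>0 (\<delta> \<phi>) (t \<phi>) z))"
      by (rule obs_law_density[OF good good'[OF that]]) (simp add: \<beta>_def \<beta>'_def)
    show ?thesis unfolding data_law_def law
      using prob_space_obs_law[OF good'[OF that]]
      by (subst PiM_density[OF prob_space_obs_law[OF good]])
        (simp_all add: law L_def prod_ennreal lr_nonneg measurable_cong_sets[OF sets_obs_law refl])
  qed
  have mass: "(\<integral>\<^sup>+z. ennreal (L \<phi> z) \<partial>?P) = 1" if "\<phi> \<in> \<Phi>" for \<phi>
  proof -
    interpret N: prob_space "density ?P (\<lambda>z. ennreal (L \<phi> z))"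
      unfolding dens[OF that, symmetric] by (rule prob_space_data_law[OF good'[OF that]])
    show ?thesis using N.emeasure_space_1 mL[of \<phi>] by (simp add: emeasure_density cong: nn_integral_cong)
  qed
  have cross: "(\<integral>\<^sup>+z. ennreal (L \<phi> z) * ennreal (L \<phi>' z) \<partial>?P) \<le> ennreal (exp (\<kappa> * agree s \<phi> \<phi>'))"
    if f: "\<phi> \<in> \<Phi>" "\<phi>' \<in> \<Phi>" for \<phi> \<phi>'
  proof -
    interpret L: prob_space "obs_law p (\<beta>, S, s\<^sub>0)" by (rule prob_space_obs_law[OF good])
    interpret product_sigma_finite "\<lambda>_::nat. obs_law p (\<beta>, S, s\<^sub>0)" ..
    let ?l = "\<lambda>\<phi> z. ennreal (lr p (($) \<beta>) s\<^sub>0 (\<delta> \<phi>) (t \<phi>) z)"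
    have ov: "\<delta> \<phi> j = \<delta> \<phi>' j" if "\<delta> \<phi> j \<noteq> 0" "\<delta> \<phi>' j \<noteq> 0" for j
      using that by (auto simp: \<delta>_def block_pert_def split: if_splits)
    have one: "(\<integral>\<^sup>+z. ?l \<phi> z * ?l \<phi>' z \<partial>obs_law p (\<beta>, S, s\<^sub>0)) = ennreal (s\<^sub>0\<^sup>2 / (s\<^sub>0\<^sup>2 - Q \<phi> \<phi>'))"
      unfolding Q_def using t[OF f(1)] t[OF f(2)]
      by (intro lr_second_moment[OF good dg ov]) (auto simp: Q_def)
    have "(\<integral>\<^sup>+z. ennreal (L \<phi> z) * ennreal (L \<phi>' z) \<partial>?P) = (\<integral>\<^sup>+z. (\<Prod>i<n. ?l \<phi> (z i) * ?l \<phi>' (z i)) \<partial>Pi\<^sub>M {..<n} (\<lambda>_. obs_law p (\<beta>, S, s\<^sub>0)))"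
      by (simp add: data_law_def L_def prod.distrib prod_ennreal lr_nonneg)
    also have "\<dots> = (\<Prod>i<n. \<integral>\<^sup>+z. ?l \<phi> z * ?l \<phi>' z \<partial>obs_law p (\<beta>, S, s\<^sub>0))"
      by (rule product_nn_integral_prod) (simp_all add: measurable_cong_sets[OF sets_obs_law refl])
    also have "\<dots> = ennreal (s\<^sub>0\<^sup>2 / (s\<^sub>0\<^sup>2 - Q \<phi> \<phi>')) ^ n" unfolding one by simp
    also have "\<dots> \<le> ennreal (exp (\<kappa> * agree s \<phi> \<phi>'))"
    proof -
      define y where "y = Q \<phi> \<phi>' / s\<^sub>0\<^sup>2"
      have y: "0 \<le> y" "y \<le> 1 / 2" using Q(1)[OF f] Q_half[OF f] s0 by (auto simp: y_def)
      have "s\<^sub>0\<^sup>2 / (s\<^sub>0\<^sup>2 - Q \<phi> \<phi>') = 1 / (1 - y)"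
      proof -
        have "s\<^sub>0\<^sup>2 - Q \<phi> \<phi>' = s\<^sub>0\<^sup>2 * (1 - y)" using s0 by (simp add: y_def algebra_simps)
        then show ?thesis using s0 by simp
      qed
      also have "\<dots> \<le> exp (2 * y)" by (rule inverse_one_minus_le_exp[OF y])
      finally have le: "s\<^sub>0\<^sup>2 / (s\<^sub>0\<^sup>2 - Q \<phi> \<phi>') \<le> exp (2 * y)" .
      have "ennreal (s\<^sub>0\<^sup>2 / (s\<^sub>0\<^sup>2 - Q \<phi> \<phi>')) ^ n \<le> ennreal (exp (2 * y)) ^ n"
        by (intro power_mono ennreal_leI le) simp
      also have "\<dots> = ennreal (exp (real n * (2 * y)))"
        by (simp only: ennreal_power exp_ge_zero exp_of_nat_mult)
      also have "\<dots> \<le> ennreal (exp (\<kappa> * agree s \<phi> \<phi>'))"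
      proof -
        have "2 * real n * y \<le> 2 * real n * (\<kappa> * agree s \<phi> \<phi>' / (2 * real n))"
          using Q(2)[OF f] by (intro mult_left_mono) (auto simp: y_def)
        then have "real n * (2 * y) \<le> \<kappa> * agree s \<phi> \<phi>'" using n0 by simp
        then show ?thesis by (intro ennreal_leI) simp
      qed
      finally show ?thesis .
    qed
    finally show ?thesis .
  qed
  have chi: "(\<Sum>\<phi>\<in>\<Phi>. \<Sum>\<phi>'\<in>\<Phi>. exp (\<kappa> * agree s \<phi> \<phi>')) \<le> (1 + \<rho>\<^sup>2) * (real (card \<Phi>))\<^sup>2"
  proof -
    have "(\<Sum>\<phi>\<in>\<Phi>. \<Sum>\<phi>'\<in>\<Phi>. exp (\<kappa> * agree s \<phi> \<phi>')) \<le> exp (2 * \<kappa>\<^sub>0) * (real (card \<Phi>))\<^sup>2"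
      unfolding \<Phi>_def using sq \<kappa> by (intro chi_square_bound) auto
    also have "\<dots> \<le> (1 + \<rho>\<^sup>2) * (real (card \<Phi>))\<^sup>2" using \<kappa>(4) by (intro mult_right_mono) auto
    finally show ?thesis .
  qed
  have power: "expect n p (\<beta>, S, s\<^sub>0) \<psi> \<le> ereal (\<alpha> + \<rho>)"
    if \<psi>: "\<psi> \<in> tests n p \<alpha> (Theta_null s\<^sub>0 k\<^sub>u S \<xi> t\<^sub>0)" for \<psi>
  proof -
    have m\<psi>: "\<psi> \<in> borel_measurable ?P" and \<psi>01: "\<And>z. z \<in> space ?P \<Longrightarrow> 0 \<le> \<psi> z \<and> \<psi> z \<le> 1"
      and sup: "(SUP \<theta>\<in>Theta_null s\<^sub>0 k\<^sub>u S \<xi> t\<^sub>0. expect n p \<theta> \<psi>) \<le> ereal \<alpha>"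
      using \<psi> by (auto simp: tests_def measurable_cong_sets[OF sets_data_law refl] space_data_law)
    have "(\<integral>z. L \<phi> z * \<psi> z \<partial>?P) \<le> \<alpha>" if "\<phi> \<in> \<Phi>" for \<phi>
    proof -
      have "expect n p (\<beta>' \<phi>, S, t \<phi>) \<psi> \<le> ereal \<alpha>"
        using sup SUP_upper[OF in_null[OF that], of "\<lambda>\<theta>. expect n p \<theta> \<psi>"] by (rule order_trans[rotated])
      then have "(\<integral>z. \<psi> z \<partial>density ?P (\<lambda>z. ennreal (L \<phi> z))) \<le> \<alpha>"
        by (simp add: expect_def dens[OF that])
      then show ?thesis using L0 mL[of \<phi>] m\<psi> by (simp add: integral_density)
    qed
    then have "(\<integral>z. \<psi> z \<partial>?P) \<le> \<alpha> + \<rho>"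
      by (intro mixture_power_bound[OF P.prob_space_axioms \<Phi> mL L0 mass cross _ chi \<rho>(1) m\<psi> \<psi>01]) auto
    then show ?thesis by (simp add: expect_def)
  qed
  show ?thesis unfolding tau_adap_def
  proof (intro Inf_greatest)
    fix e assume "e \<in> {ereal \<tau> |\<tau>. 0 < \<tau> \<and> ereal (1 - \<eta>) \<le> (SUP \<psi>\<in>tests n p \<alpha> (Theta_null s\<^sub>0 k\<^sub>u S \<xi> t\<^sub>0). INF \<theta>\<in>Theta_alt s\<^sub>0 k S \<xi> t\<^sub>0 \<tau>. expect n p \<theta> \<psi>)}"
    then obtain \<tau> where \<tau>: "e = ereal \<tau>" "0 < \<tau>"
      "ereal (1 - \<eta>) \<le> (SUP \<psi>\<in>tests n p \<alpha> (Theta_null s\<^sub>0 k\<^sub>u S \<xi> t\<^sub>0). INF \<theta>\<in>Theta_alt s\<^sub>0 k S \<xi> t\<^sub>0 \<tau>. expect n p \<theta> \<psi>)"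
      by blast
    show "ereal (a * real s) \<le> e"
    proof (rule ccontr)
      \<comment> \<open>A separation of at most a s puts the base point into the alternative, where
        every test of level \<alpha> has power at most \<alpha> + \<rho>, below the required 1 -
        \<eta>.\<close>
      assume "\<not> ereal (a * real s) \<le> e"
      then have lt: "\<tau> \<le> a * real s" using \<tau>(1) by simp
      have "\<xi> \<bullet> \<beta> = t\<^sub>0 + a * real s" by (simp add: \<beta>_def scalar_prod_vec sb)
      then have "\<tau> \<le> \<bar>\<xi> \<bullet> \<beta> - t\<^sub>0\<bar>" using lt by simp
      moreover have "l0norm \<beta> \<le> k" unfolding \<beta>_def l0norm_vec using nnzb k(1) by simp
      ultimately have "(\<beta>, S, s\<^sub>0) \<in> Theta_alt s\<^sub>0 k S \<xi> t\<^sub>0 \<tau>"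
        using \<xi> s0 by (auto simp: Theta_alt_def \<beta>_def)
      then have "(SUP \<psi>\<in>tests n p \<alpha> (Theta_null s\<^sub>0 k\<^sub>u S \<xi> t\<^sub>0). INF \<theta>\<in>Theta_alt s\<^sub>0 k S \<xi> t\<^sub>0 \<tau>. expect n p \<theta> \<psi>) \<le> ereal (\<alpha> + \<rho>)"
        using power by (intro SUP_least INF_lower2[of "(\<beta>, S, s\<^sub>0)"]) auto
      then have "ereal (1 - \<eta>) \<le> ereal (\<alpha> + \<rho>)" using \<tau>(3) by (rule order_trans[rotated])
      then show False using \<rho>(2) by simp
    qed
  qed
qed

lemma diag_of_diagonal_mat: "S \<in> carrier_mat p p \<Longrightarrow> diagonal_mat S \<Longrightarrow> diag p S"
  by (auto simp: diagonal_mat_def diag_def)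

text \<open>The lower-bound rate from perturbing the first \<open>m\<close> coordinates, times sqrt
  n: the chi-square constraint allows sqrt m and sparsity allows k_u. The index \<open>m - 1\<close>
  is the m-th loading, the smallest one perturbed.\<close>

definition level :: "nat \<Rightarrow> real Matrix.vec \<Rightarrow> nat \<Rightarrow> real" where
  "level k\<^sub>u \<xi> m = min (sqrt (real m)) (real k\<^sub>u) * \<bar>\<xi> $ (m - 1)\<bar>"

lemma lower_bound:
  fixes M s\<^sub>0 \<alpha> \<eta> :: real
  assumes M: "1 < M" and s0: "0 < s\<^sub>0" and \<alpha>\<eta>: "\<alpha> + \<eta> < 1"
  obtains c where "0 < c"
    "\<And>p n k\<^sub>u k \<xi> S t\<^sub>0 m. 2 \<le> k\<^sub>u \<Longrightarrow> 1 \<le> k \<Longrightarrow> k\<^sub>u \<le> n \<Longrightarrow> is_loading p \<xi> \<Longrightarrow> S \<in> carrier_mat p p \<Longrightarrow> transpose_mat S = S \<Longrightarrow>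
      1 / M \<le> lambda_min S \<Longrightarrow> lambda_max S \<le> M \<Longrightarrow> diagonal_mat S \<Longrightarrow> 1 \<le> m \<Longrightarrow> m \<le> p \<Longrightarrow>
      ereal (c * (level k\<^sub>u \<xi> m / sqrt (real n))) \<le> tau_adap s\<^sub>0 \<alpha> \<eta> n p t\<^sub>0 k\<^sub>u k S \<xi>"
proof -
  define \<rho> where "\<rho> = (1 - \<alpha> - \<eta>) / 2"
  have \<rho>: "0 < \<rho>" "\<alpha> + \<rho> < 1 - \<eta>" using \<alpha>\<eta> by (auto simp: \<rho>_def field_simps)
  \<comment> \<open>The overlap budget for which the chi-square divergence is at most \<rho>^2,
    capped at 1 so that the later \<open>\<kappa>\<close> is at most 1.\<close>
  define \<kappa>\<^sub>0 where "\<kappa>\<^sub>0 = min 1 (ln (1 + \<rho>\<^sup>2) / 2)"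
  have \<kappa>0: "0 < \<kappa>\<^sub>0" "\<kappa>\<^sub>0 \<le> 1" using \<rho> by (auto simp: \<kappa>\<^sub>0_def ln_gt_zero)
  have \<kappa>0': "exp (2 * \<kappa>\<^sub>0) \<le> 1 + \<rho>\<^sup>2"
  proof -
    have "2 * \<kappa>\<^sub>0 \<le> ln (1 + \<rho>\<^sup>2)" by (simp add: \<kappa>\<^sub>0_def min_def)
    then have "exp (2 * \<kappa>\<^sub>0) \<le> exp (ln (1 + \<rho>\<^sup>2))" by simp
    also have "\<dots> = 1 + \<rho>\<^sup>2" using \<rho> by (intro exp_ln) (simp add: add_pos_nonneg)
    finally show ?thesis .
  qed
  define c where "c = s\<^sub>0 * sqrt (\<kappa>\<^sub>0 / (2 * M)) / 2"
  have c: "0 < c" using s0 \<kappa>0 M by (simp add: c_def)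
  moreover have "ereal (c * (level k\<^sub>u \<xi> m / sqrt (real n))) \<le> tau_adap s\<^sub>0 \<alpha> \<eta> n p t\<^sub>0 k\<^sub>u k S \<xi>"
    if k: "2 \<le> k\<^sub>u" "1 \<le> k" and n: "k\<^sub>u \<le> n" and \<xi>: "is_loading p \<xi>"
      and S: "S \<in> carrier_mat p p" "transpose_mat S = S" "1 / M \<le> lambda_min S" "lambda_max S \<le> M" "diagonal_mat S"
      and m: "1 \<le> m" "m \<le> p"
    for p n k\<^sub>u k \<xi> S t\<^sub>0 m
  proof (cases "\<xi> $ (m - 1) = 0")
    case True
    then show ?thesis using tau_adap_nonneg by (simp add: level_def flip: zero_ereal_def)
  next
    case False
    define x where "x = \<bar>\<xi> $ (m - 1)\<bar>"
    have x: "0 < x" using False by (simp add: x_def)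
    \<comment> \<open>One of the \<open>k\<^sub>u\<close> coordinates is reserved for the base
      point. With blocks of length m div s, at least half of the first \<open>m\<close> coordinates
      are used.\<close>
    define s where "s = min (k\<^sub>u - 1) m"
    define q where "q = m div s"
    have s: "1 \<le> s" "s \<le> m" "s + 1 \<le> k\<^sub>u" using k m by (auto simp: s_def)
    have sq: "s * q \<le> m" by (simp add: q_def)
    have q: "1 \<le> q" using s by (simp add: q_def div_greater_zero_iff Suc_le_eq)
    have m2: "m \<le> 2 * (s * q)"
    proof -
      have "m = s * q + m mod s" by (simp add: q_def)
      moreover have "m mod s < s" using s by simp
      moreover have "s \<le> s * q" using q by simp
      ultimately show ?thesis by linarith
    qed
    have p: "0 < p" using m by simp
    note SS = pos_def_of_eigenvalues[OF S(1,2) p M S(3,4)]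
    have Sb: "0 \<le> S $$ (j, j) \<and> S $$ (j, j) \<le> M" if j: "j < p" for j
    proof -
      interpret gaussian_design p "0\<^sub>v p" S s\<^sub>0 M s\<^sub>0
        using SS p M s0 by unfold_locales (auto simp: good_param_def)
      show ?thesis using diag_le[OF j] diag_nonneg[OF j] by simp
    qed
    have xj: "x \<le> \<bar>\<xi> $ j\<bar>" if "j < s * q" for j
      using loading_mono[OF \<xi>, of j "m - 1"] that sq m by (auto simp: x_def)
    \<comment> \<open>Short blocks overlap often: when there are more blocks than positions in a
      block, the perturbation shrinks by q / s to keep the expected overlap within budget.\<close>
    define \<kappa> where "\<kappa> = \<kappa>\<^sub>0 * min 1 (real q / real s)"
    have \<kappa>: "0 < \<kappa>" "\<kappa> \<le> 1" "\<kappa> * real s \<le> \<kappa>\<^sub>0 * real q"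
    proof -
      show "0 < \<kappa>" using \<kappa>0 q s by (simp add: \<kappa>_def)
      show "\<kappa> \<le> 1" unfolding \<kappa>_def using \<kappa>0 q s by (intro mult_le_one) auto
      have "\<kappa> * real s \<le> \<kappa>\<^sub>0 * (real q / real s) * real s"
        unfolding \<kappa>_def using \<kappa>0 by (intro mult_right_mono mult_left_mono) auto
      then show "\<kappa> * real s \<le> \<kappa>\<^sub>0 * real q" using s by simp
    qed
    have n0: "0 < n" using k n by simp
    \<comment> \<open>The largest amplitude that the condition of \<open>tau_adap_ge\<close>
      permits.\<close>
    define a where "a = s\<^sub>0 * x * sqrt (\<kappa> / (2 * real n * M))"
    have a: "0 < a" using s0 x \<kappa> n0 M by (simp add: a_def)
    have a2: "2 * real n * M * a\<^sup>2 \<le> \<kappa> * s\<^sub>0\<^sup>2 * x\<^sup>2"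
      using \<kappa> n0 M by (simp add: a_def power_mult_distrib)
    have "ereal (a * real s) \<le> tau_adap s\<^sub>0 \<alpha> \<eta> n p t\<^sub>0 k\<^sub>u k S \<xi>"
      using M s n m sq
      by (intro tau_adap_ge[OF _ s0 \<rho> SS(1) diag_of_diagonal_mat[OF S(1,5)] Sb loading_carrier[OF \<xi>] p _ s(1) q x xj k(2) s(3) _ \<kappa> \<kappa>0' a a2]) auto
    moreover have "c * (level k\<^sub>u \<xi> m / sqrt (real n)) \<le> a * real s"
    proof -
      define u where "u = min (sqrt (real m)) (real k\<^sub>u)"
      define v where "v = sqrt (min 1 (real q / real s))"
      have u0: "0 \<le> u" by (simp add: u_def)
      \<comment> \<open>The two bounds match the two cases of \<open>\<kappa>\<close>: s is at least
        k_u / 2 or equal to m, and s q is at least m / 2. The factor 1 / 2 is the one in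
        \<open>c\<close>.\<close>
      have "(u / 2)\<^sup>2 \<le> min ((real s)\<^sup>2) (real s * real q)"
      proof (rule min.boundedI)
        have "u / 2 \<le> real s"
        proof (cases "k\<^sub>u - 1 \<le> m")
          case True
          then have "real s = real k\<^sub>u - 1" using k by (simp add: s_def of_nat_diff)
          moreover have "u \<le> real k\<^sub>u" by (simp add: u_def)
          moreover have "2 \<le> real k\<^sub>u" using k by simp
          ultimately show ?thesis by linarith
        next
          case False
          then have "s = m" by (simp add: s_def)
          moreover have "sqrt (real m) \<le> real m" using m by (intro real_le_lsqrt) (auto simp: power2_eq_square)
          moreover have "u \<le> sqrt (real m)" by (simp add: u_def)
          ultimately show ?thesis using u0 by linarith
        qed
        then show "(u / 2)\<^sup>2 \<le> (real s)\<^sup>2" using u0 by (intro power_mono) auto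
        have "u\<^sup>2 \<le> (sqrt (real m))\<^sup>2" using u0 by (intro power_mono) (auto simp: u_def)
        then have "u\<^sup>2 \<le> real m" by simp
        also have "real m \<le> 2 * (real s * real q)" using m2 by (metis of_nat_le_iff of_nat_mult of_nat_numeral)
        finally have "u\<^sup>2 \<le> 2 * (real s * real q)" .
        moreover have "0 \<le> real s * real q" by simp
        moreover have "(u / 2)\<^sup>2 = u\<^sup>2 / 4" by (simp add: power_divide)
        ultimately show "(u / 2)\<^sup>2 \<le> real s * real q" by linarith
      qed
      also have "\<dots> = (real s * v)\<^sup>2"
      proof -
        have "(real s * v)\<^sup>2 = (real s)\<^sup>2 * min 1 (real q / real s)"
          by (simp add: v_def power_mult_distrib)
        also have "\<dots> = min ((real s)\<^sup>2) (real s * real q)"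
          using s by (simp add: min_mult_distrib_left power2_eq_square)
        finally show ?thesis by simp
      qed
      finally have uv: "u / 2 \<le> real s * v"
        by (rule power2_le_imp_le) (simp add: v_def)
      have av: "a = s\<^sub>0 * x * (sqrt (\<kappa>\<^sub>0 / (2 * M)) * v / sqrt (real n))"
      proof -
        have "\<kappa> / (2 * real n * M) = (\<kappa>\<^sub>0 / (2 * M)) * min 1 (real q / real s) / real n"
          using M n0 by (simp add: \<kappa>_def field_simps)
        then show ?thesis by (simp only: a_def v_def real_sqrt_mult real_sqrt_divide)
      qed
      have "c * (level k\<^sub>u \<xi> m / sqrt (real n)) = s\<^sub>0 * x * (sqrt (\<kappa>\<^sub>0 / (2 * M)) / sqrt (real n)) * (u / 2)"
        by (simp add: c_def level_def u_def x_def mult_ac)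
      also have "\<dots> \<le> s\<^sub>0 * x * (sqrt (\<kappa>\<^sub>0 / (2 * M)) / sqrt (real n)) * (real s * v)"
        using uv s0 x \<kappa>0 M by (intro mult_left_mono mult_nonneg_nonneg) auto
      also have "\<dots> = a * real s" by (simp add: av)
      finally show ?thesis .
    qed
    ultimately show ?thesis by (meson ereal_less_eq(3) order_trans)
  qed
  ultimately show thesis by (rule that)
qed

section \<open>Comparison of the rates\<close>

definition num :: "real Matrix.vec \<Rightarrow> real \<Rightarrow> real" where
  "num \<xi> z = (\<Sum>j<l0norm \<xi>. \<bar>\<xi> $ j\<bar> * exp (- z / (\<xi> $ j)\<^sup>2))"

text \<open>The square of the denominator in the equation for \<open>zeta\<close>; its square root
  at the squared \<open>lam\<close> is the second summand of \<open>nu1\<close>.\<close>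

definition den :: "real Matrix.vec \<Rightarrow> real \<Rightarrow> real" where
  "den \<xi> z = (\<Sum>j<l0norm \<xi>. (\<xi> $ j)\<^sup>2 * exp (- z / (\<xi> $ j)\<^sup>2))"

lemma loading_support:
  assumes "is_loading p \<xi>"
  shows "l0norm \<xi> \<le> p" "0 < l0norm \<xi>" "\<And>j. j < l0norm \<xi> \<Longrightarrow> \<xi> $ j \<noteq> 0" "\<And>j. l0norm \<xi> \<le> j \<Longrightarrow> j < p \<Longrightarrow> \<xi> $ j = 0"
proof -
  let ?A = "{j. j < p \<and> \<xi> $ j \<noteq> 0}"
  have l0: "l0norm \<xi> = card ?A" using loading_carrier[OF assms] by (auto simp: l0norm_def)
  have fin: "finite ?A" by simp
  have down: "i \<in> ?A" if "j \<in> ?A" "i \<le> j" for i j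
    using that loading_mono[OF assms, of i j] by auto
  show "l0norm \<xi> \<le> p" unfolding l0 using card_mono[of "{..<p}" ?A] by auto
  show "0 < l0norm \<xi>" unfolding l0 using loading_first[OF assms] fin by (auto simp: card_gt_0_iff)
  show "\<xi> $ j \<noteq> 0" if j: "j < l0norm \<xi>" for j
  proof
    assume z: "\<xi> $ j = 0"
    have "?A \<subseteq> {..<j}"
    proof
      fix i assume i: "i \<in> ?A"
      show "i \<in> {..<j}" using down[OF i, of j] z by (cases "j \<le> i") auto
    qed
    then have "card ?A \<le> j" using card_mono[of "{..<j}" ?A] by auto
    then show False using j l0 by simp
  qed
  show "\<xi> $ j = 0" if j: "l0norm \<xi> \<le> j" "j < p" for j
  proof (rule ccontr)
    assume "\<xi> $ j \<noteq> 0"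
    then have "j \<in> ?A" using j by simp
    then have "{..j} \<subseteq> ?A" using down by auto
    then have "Suc j \<le> card ?A" using card_mono[OF fin, of "{..j}"] by simp
    then show False using j l0 by simp
  qed
qed

context
  fixes p :: nat and \<xi> :: "real Matrix.vec"
  assumes \<xi>: "is_loading p \<xi>"
begin

private abbreviation "K \<equiv> l0norm \<xi>"

lemma K_pos: "0 < K" and K_le: "K \<le> p" and nz: "j < K \<Longrightarrow> \<xi> $ j \<noteq> 0"
  using loading_support[OF \<xi>] by auto

lemma xi_le_first: "j < K \<Longrightarrow> (\<xi> $ j)\<^sup>2 \<le> (\<xi> $ 0)\<^sup>2"
  using loading_mono[OF \<xi>, of 0 j] K_le by (simp add: abs_le_square_iff)

lemma num_pos: "0 < num \<xi> z"
  unfolding num_def using K_pos nz by (intro sum_pos) auto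

lemma den_pos: "0 < den \<xi> z"
  unfolding den_def using K_pos nz by (intro sum_pos) auto

lemma num_le_sqrt_den: "num \<xi> z \<le> sqrt (real K) * sqrt (\<Sum>j<K. (\<xi> $ j)\<^sup>2 * exp (- z / (\<xi> $ j)\<^sup>2) * exp (- z / (\<xi> $ j)\<^sup>2))"
proof -
  have "(num \<xi> z)\<^sup>2 = (\<Sum>j<K. 1 * (\<bar>\<xi> $ j\<bar> * exp (- z / (\<xi> $ j)\<^sup>2)))\<^sup>2" by (simp add: num_def)
  also have "\<dots> \<le> (\<Sum>j<K. 1\<^sup>2) * (\<Sum>j<K. (\<bar>\<xi> $ j\<bar> * exp (- z / (\<xi> $ j)\<^sup>2))\<^sup>2)"
    by (rule Cauchy_Schwarz_ineq_sum)
  also have "\<dots> = real K * (\<Sum>j<K. (\<xi> $ j)\<^sup>2 * exp (- z / (\<xi> $ j)\<^sup>2) * exp (- z / (\<xi> $ j)\<^sup>2))"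
    by (simp add: power_mult_distrib power2_eq_square[of "exp _"] mult_ac)
  finally have "sqrt ((num \<xi> z)\<^sup>2) \<le> sqrt (real K * (\<Sum>j<K. (\<xi> $ j)\<^sup>2 * exp (- z / (\<xi> $ j)\<^sup>2) * exp (- z / (\<xi> $ j)\<^sup>2)))"
    by (rule real_sqrt_le_mono)
  then show ?thesis using num_pos[of z] by (simp add: real_sqrt_mult)
qed

text \<open>Cauchy-Schwarz leaves each weight squared, and one copy is bounded by the weight of the
  largest loading. This shows that the ratio tends to 0, hence that \<open>zeta\<close> exists, and
  later bounds \<open>zeta\<close> from above.\<close>

lemma num_le_decay:
  assumes z: "0 \<le> z"
  shows "num \<xi> z \<le> sqrt (real K) * exp (- z / (2 * (\<xi> $ 0)\<^sup>2)) * sqrt (den \<xi> z)"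
proof -
  let ?e = "exp (- z / (\<xi> $ 0)\<^sup>2)"
  have x0: "0 < (\<xi> $ 0)\<^sup>2" using nz[of 0] K_pos by simp
  have "(\<Sum>j<K. (\<xi> $ j)\<^sup>2 * exp (- z / (\<xi> $ j)\<^sup>2) * exp (- z / (\<xi> $ j)\<^sup>2)) \<le> (\<Sum>j<K. (\<xi> $ j)\<^sup>2 * exp (- z / (\<xi> $ j)\<^sup>2) * ?e)"
  proof (intro sum_mono mult_left_mono)
    fix j assume "j \<in> {..<K}"
    then have j: "j < K" by simp
    have "z / (\<xi> $ 0)\<^sup>2 \<le> z / (\<xi> $ j)\<^sup>2"
      using xi_le_first[OF j] nz[OF j] x0 z by (intro divide_left_mono) auto
    then show "exp (- z / (\<xi> $ j)\<^sup>2) \<le> ?e" by simp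
  qed auto
  also have "\<dots> = ?e * den \<xi> z" by (simp add: den_def sum_distrib_left mult_ac)
  finally have "sqrt (\<Sum>j<K. (\<xi> $ j)\<^sup>2 * exp (- z / (\<xi> $ j)\<^sup>2) * exp (- z / (\<xi> $ j)\<^sup>2)) \<le> sqrt (?e * den \<xi> z)"
    by (rule real_sqrt_le_mono)
  also have "\<dots> = exp (- z / (2 * (\<xi> $ 0)\<^sup>2)) * sqrt (den \<xi> z)"
  proof -
    have "?e = (exp (- z / (2 * (\<xi> $ 0)\<^sup>2)))\<^sup>2" by (simp flip: exp_double)
    then show ?thesis by (simp add: real_sqrt_mult)
  qed
  finally have "sqrt (real K) * sqrt (\<Sum>j<K. (\<xi> $ j)\<^sup>2 * exp (- z / (\<xi> $ j)\<^sup>2) * exp (- z / (\<xi> $ j)\<^sup>2)) \<le>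
     sqrt (real K) * (exp (- z / (2 * (\<xi> $ 0)\<^sup>2)) * sqrt (den \<xi> z))"
    by (intro mult_left_mono) auto
  with num_le_sqrt_den[of z] show ?thesis by (simp add: mult.assoc)
qed

text \<open>The sum inequality of Chebyshev, with weights \<open>\<bar>\<xi>\<^sub>j\<bar> exp (- z / \<xi>\<^sub>j\<^sup>2)\<close>: both
  \<open>\<bar>\<xi>\<^sub>j\<bar>\<close> and \<open>exp (- h / \<xi>\<^sub>j\<^sup>2)\<close> are increasing in \<open>\<bar>\<xi>\<^sub>j\<bar>\<close>.\<close>
lemma ratio_antimono:
  assumes h: "z < z'"
  shows "num \<xi> z' / sqrt (den \<xi> z') < num \<xi> z / sqrt (den \<xi> z)"
proof -
  define w where "w j = \<bar>\<xi> $ j\<bar> * exp (- z / (\<xi> $ j)\<^sup>2)" for j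
  define r where "r j = exp (- (z' - z) / (\<xi> $ j)\<^sup>2)" for j
  have wpos: "0 < w j" if "j < K" for j using nz[OF that] by (simp add: w_def)
  have r1: "r j < 1" "0 < r j" if "j < K" for j using nz[OF that] h by (auto simp: r_def divide_less_0_iff)
  have ex: "exp (- z' / (\<xi> $ j)\<^sup>2) = exp (- z / (\<xi> $ j)\<^sup>2) * r j" for j
    by (simp add: r_def diff_divide_distrib flip: exp_add)
  have n: "num \<xi> z = (\<Sum>j<K. w j)" "num \<xi> z' = (\<Sum>j<K. w j * r j)"
    unfolding num_def w_def ex by (simp_all only: mult.assoc)
  have ab: "y\<^sup>2 * e = \<bar>y\<bar> * e * \<bar>y\<bar>" for y e :: real
    by (simp add: power2_eq_square)
  have d: "den \<xi> z = (\<Sum>j<K. w j * \<bar>\<xi> $ j\<bar>)" "den \<xi> z' = (\<Sum>j<K. w j * \<bar>\<xi> $ j\<bar> * r j)"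
    unfolding den_def w_def ex ab by (simp_all only: mult_ac)
  have cheb: "num \<xi> z' * den \<xi> z \<le> num \<xi> z * den \<xi> z'"
  proof -
    have "0 \<le> (\<Sum>i<K. \<Sum>j<K. w i * w j * ((\<bar>\<xi> $ i\<bar> - \<bar>\<xi> $ j\<bar>) * (r i - r j)))"
    proof (intro sum_nonneg)
      fix i j assume "i \<in> {..<K}" "j \<in> {..<K}"
      then have ij: "i < K" "j < K" by auto
      have mono: "r a \<le> r b" if "\<bar>\<xi> $ a\<bar> \<le> \<bar>\<xi> $ b\<bar>" "a < K" "b < K" for a b
      proof -
        have "(\<xi> $ a)\<^sup>2 \<le> (\<xi> $ b)\<^sup>2" using that(1) by (simp add: abs_le_square_iff)
        then have "(z' - z) / (\<xi> $ b)\<^sup>2 \<le> (z' - z) / (\<xi> $ a)\<^sup>2"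
          using h nz[OF that(2)] nz[OF that(3)] by (intro divide_left_mono) auto
        then show ?thesis by (simp only: r_def exp_le_cancel_iff minus_divide_left[symmetric] neg_le_iff_le)
      qed
      have "0 \<le> (\<bar>\<xi> $ i\<bar> - \<bar>\<xi> $ j\<bar>) * (r i - r j)"
        using mono[of i j] mono[of j i] ij
        by (cases "\<bar>\<xi> $ i\<bar> \<le> \<bar>\<xi> $ j\<bar>") (auto simp: mult_nonpos_nonpos)
      then show "0 \<le> w i * w j * ((\<bar>\<xi> $ i\<bar> - \<bar>\<xi> $ j\<bar>) * (r i - r j))"
        using wpos[OF ij(1)] wpos[OF ij(2)] by simp
    qed
    also have "\<dots> = 2 * ((\<Sum>j<K. w j) * (\<Sum>j<K. w j * \<bar>\<xi> $ j\<bar> * r j)) - 2 * ((\<Sum>j<K. w j * r j) * (\<Sum>j<K. w j * \<bar>\<xi> $ j\<bar>))"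
    proof -
      have "w i * w j * ((\<bar>\<xi> $ i\<bar> - \<bar>\<xi> $ j\<bar>) * (r i - r j)) =
        (w i * \<bar>\<xi> $ i\<bar> * r i) * w j + w i * (w j * \<bar>\<xi> $ j\<bar> * r j) - (w i * \<bar>\<xi> $ i\<bar>) * (w j * r j) - (w i * r i) * (w j * \<bar>\<xi> $ j\<bar>)" for i j
        by (simp add: algebra_simps)
      then show ?thesis
        by (simp only: sum.distrib sum_subtractf sum_product[symmetric]) (simp add: mult_ac)
    qed
    finally show ?thesis unfolding n d by simp
  qed
  have less: "num \<xi> z' < num \<xi> z"
    unfolding n using wpos r1 K_pos by (intro sum_strict_mono) auto
  note pos = num_pos[of z] num_pos[of z'] den_pos[of z] den_pos[of z']
  \<comment> \<open>The Chebyshev sum inequality compares num / den only weakly; multiplying by the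
    strictly decreasing \<open>num\<close> makes num^2 / den strictly decreasing.\<close>
  have "(num \<xi> z')\<^sup>2 * den \<xi> z = num \<xi> z' * (num \<xi> z' * den \<xi> z)" by (simp add: power2_eq_square)
  also have "\<dots> \<le> num \<xi> z' * (num \<xi> z * den \<xi> z')" using cheb pos by (intro mult_left_mono) auto
  also have "\<dots> < num \<xi> z * (num \<xi> z * den \<xi> z')" using less pos by (intro mult_strict_right_mono) auto
  finally have "(num \<xi> z')\<^sup>2 / den \<xi> z' < (num \<xi> z)\<^sup>2 / den \<xi> z"
    using pos by (simp add: divide_less_eq pos_less_divide_eq power2_eq_square mult_ac) 
  then have "sqrt ((num \<xi> z')\<^sup>2 / den \<xi> z') < sqrt ((num \<xi> z)\<^sup>2 / den \<xi> z)" by simp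
  then show ?thesis using pos by (simp add: real_sqrt_divide)
qed

text \<open>Existence is the intermediate value theorem and uniqueness is strict monotonicity;
  together they give the definite description in \<open>zeta\<close> its meaning.\<close>

lemma zeta_eq:
  assumes k: "1 \<le> k\<^sub>u"
  shows "num \<xi> (zeta k\<^sub>u \<xi>) / sqrt (den \<xi> (zeta k\<^sub>u \<xi>)) = real k\<^sub>u / 2"
proof -
  let ?f = "\<lambda>z. num \<xi> z / sqrt (den \<xi> z)"
  have x0: "0 < (\<xi> $ 0)\<^sup>2" using nz[of 0] K_pos by simp
  have cont: "continuous_on S ?f" for S
  proof -
    have "den \<xi> z \<noteq> 0" for z using den_pos[of z] by simp
    then show ?thesis using nz unfolding num_def den_def
      by (intro continuous_intros) auto
  qed
  \<comment> \<open>At \<open>a\<close> every weight is at least k_u^2, and the l2-norm is at most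
    the l1-norm, so the ratio is at least k_u. At \<open>b\<close> the decay bound gives sqrt K / (2
    sqrt K + 1), below 1 / 2.\<close>
  define a where "a = - 2 * (\<xi> $ 0)\<^sup>2 * ln (real k\<^sub>u)"
  define b where "b = 2 * (\<xi> $ 0)\<^sup>2 * ln (2 * sqrt (real K) + 1)"
  have a: "a \<le> 0" using x0 k by (simp add: a_def mult_nonneg_nonneg)
  have b: "0 \<le> b" using x0 by (simp add: b_def ln_ge_zero)
  have fa: "real k\<^sub>u / 2 \<le> ?f a"
  proof -
    have sq: "(\<bar>y\<bar> * e)\<^sup>2 = e * (y\<^sup>2 * e)" for y e :: real
      by (simp add: power_mult_distrib power2_eq_square[of e])
    have "(real k\<^sub>u)\<^sup>2 * den \<xi> a \<le> (\<Sum>j<K. (\<bar>\<xi> $ j\<bar> * exp (- a / (\<xi> $ j)\<^sup>2))\<^sup>2)"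
      unfolding den_def sum_distrib_left
    proof (rule sum_mono)
      fix j assume "j \<in> {..<K}"
      then have j: "j < K" by simp
      have "ln ((real k\<^sub>u)\<^sup>2) = - a / (\<xi> $ 0)\<^sup>2" using k x0 by (simp add: a_def ln_realpow)
      also have "\<dots> \<le> - a / (\<xi> $ j)\<^sup>2"
        using xi_le_first[OF j] nz[OF j] x0 a by (intro divide_left_mono) auto
      finally have "exp (ln ((real k\<^sub>u)\<^sup>2)) \<le> exp (- a / (\<xi> $ j)\<^sup>2)" by simp
      then have "(real k\<^sub>u)\<^sup>2 \<le> exp (- a / (\<xi> $ j)\<^sup>2)" using k by simp
      then have "(real k\<^sub>u)\<^sup>2 * ((\<xi> $ j)\<^sup>2 * exp (- a / (\<xi> $ j)\<^sup>2)) \<le> exp (- a / (\<xi> $ j)\<^sup>2) * ((\<xi> $ j)\<^sup>2 * exp (- a / (\<xi> $ j)\<^sup>2))"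
        by (intro mult_right_mono) auto
      then show "(real k\<^sub>u)\<^sup>2 * ((\<xi> $ j)\<^sup>2 * exp (- a / (\<xi> $ j)\<^sup>2)) \<le> (\<bar>\<xi> $ j\<bar> * exp (- a / (\<xi> $ j)\<^sup>2))\<^sup>2"
        by (simp only: sq)
    qed
    then have "sqrt ((real k\<^sub>u)\<^sup>2 * den \<xi> a) \<le> L2_set (\<lambda>j. \<bar>\<xi> $ j\<bar> * exp (- a / (\<xi> $ j)\<^sup>2)) {..<K}"
      unfolding L2_set_def by (rule real_sqrt_le_mono)
    also have "\<dots> \<le> num \<xi> a"
      unfolding num_def by (rule L2_set_le_sum) auto
    finally have "real k\<^sub>u * sqrt (den \<xi> a) \<le> num \<xi> a" by (simp add: real_sqrt_mult)
    then have "real k\<^sub>u \<le> ?f a" using den_pos[of a] by (simp add: le_divide_eq)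
    moreover have "real k\<^sub>u / 2 \<le> real k\<^sub>u" by simp
    ultimately show ?thesis by linarith
  qed
  have fb: "?f b \<le> real k\<^sub>u / 2"
  proof -
    have "exp (- b / (2 * (\<xi> $ 0)\<^sup>2)) = 1 / (2 * sqrt (real K) + 1)"
    proof -
      have "- b / (2 * (\<xi> $ 0)\<^sup>2) = - ln (2 * sqrt (real K) + 1)" using x0 by (simp add: b_def)
      moreover have "0 < 2 * sqrt (real K) + 1" by (simp add: add_nonneg_pos)
      ultimately show ?thesis by (simp add: exp_minus inverse_eq_divide)
    qed
    then have "num \<xi> b \<le> sqrt (real K) * (1 / (2 * sqrt (real K) + 1)) * sqrt (den \<xi> b)"
      using num_le_decay[OF b] by simp
    then have "?f b \<le> sqrt (real K) * (1 / (2 * sqrt (real K) + 1))"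
      using den_pos[of b] by (simp add: divide_le_eq)
    also have "\<dots> \<le> 1 / 2"
    proof -
      have "0 < 2 * sqrt (real K) + 1" by (simp add: add_nonneg_pos)
      then show ?thesis by (simp add: divide_le_eq)
    qed
    also have "\<dots> \<le> real k\<^sub>u / 2" using k by simp
    finally show ?thesis .
  qed
  obtain z where z: "?f z = real k\<^sub>u / 2"
    using IVT2'[of ?f b "real k\<^sub>u / 2" a] fa fb a b cont by auto
  have uniq: "y = z" if "?f y = real k\<^sub>u / 2" for y
    using ratio_antimono[of y z] ratio_antimono[of z y] that z by (cases y z rule: linorder_cases) auto
  have "(THE z. ?f z = real k\<^sub>u / 2) = z" by (rule the_equality[where P="\<lambda>z. ?f z = real k\<^sub>u / 2", OF z uniq])
  then have "zeta k\<^sub>u \<xi> = z" unfolding zeta_def num_def den_def .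
  then show ?thesis using z by simp
qed

end

section \<open>Comparing nu_1, the trade-off and the levels of the lower bound\<close>

lemma quadratic_bound:
  fixes B H c :: real
  assumes "0 \<le> B" "0 \<le> H" "0 \<le> c" "B\<^sup>2 \<le> H\<^sup>2 + c * B"
  shows "B \<le> H + c"
proof (rule ccontr)
  assume "\<not> B \<le> H + c"
  then have b: "H + c < B" by simp
  have "H * H \<le> H * B" using b assms by (intro mult_left_mono) auto
  moreover have "(H + c) * B < B * B" using b assms by (intro mult_strict_right_mono) auto
  ultimately show False using assms(4) by (simp add: power2_eq_square algebra_simps)
qed

lemma harmonic_le: "0 < m \<Longrightarrow> (\<Sum>j<m. 1 / real (Suc j)) \<le> 1 + ln (real m)"
proof (induction m)
  case (Suc m)
  show ?case
  proof (cases "m = 0")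
    case False
    have "ln (real m / real (Suc m)) \<le> real m / real (Suc m) - 1" using False by (intro ln_le_minus_one) auto
    also have "real m / real (Suc m) - 1 = - (1 / real (Suc m))" by (simp add: field_simps)
    finally have "1 / real (Suc m) \<le> ln (real (Suc m)) - ln (real m)" using False by (simp add: ln_div)
    then show ?thesis using Suc False by simp
  qed simp
qed simp

lemma sq_mult_exp_le_one: "y * exp (- y) \<le> (1::real)"
proof -
  have "y \<le> exp y" using exp_ge_add_one_self[of y] by linarith
  then have "y * exp (- y) \<le> exp y * exp (- y)" by (intro mult_right_mono) auto
  then show ?thesis by (simp flip: exp_add)
qed

text \<open>The quantity minimised in the upper bound, times sqrt n and without the
  logarithm.\<close>

definition trade :: "nat \<Rightarrow> real Matrix.vec \<Rightarrow> nat \<Rightarrow> real" where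
  "trade k\<^sub>u \<xi> m = H_load (real m) \<xi> + next_abs \<xi> m * real k\<^sub>u"

lemma nu1_eq: "nu1 k\<^sub>u \<xi> = lam k\<^sub>u \<xi> * real k\<^sub>u + sqrt (den \<xi> ((lam k\<^sub>u \<xi>)\<^sup>2))"
  by (simp add: nu1_def den_def)

lemma lam_nonneg: "0 \<le> lam k\<^sub>u \<xi>"
  by (simp add: lam_def)

context
  fixes p :: nat and \<xi> :: "real Matrix.vec"
  assumes \<xi>: "is_loading p \<xi>"
begin

private abbreviation "K' \<equiv> l0norm \<xi>"

lemma next_abs_ge: "m \<le> j \<Longrightarrow> j < p \<Longrightarrow> \<bar>\<xi> $ j\<bar> \<le> next_abs \<xi> m"
  using loading_mono[OF \<xi>, of m j] loading_carrier[OF \<xi>] by (auto simp: next_abs_def)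

lemma trade_nonneg: "0 \<le> trade k\<^sub>u \<xi> m"
  using H_load_nonneg[of "real m" \<xi>] next_abs_nonneg[of \<xi> m] by (simp add: trade_def)

text \<open>With B the square root of \<open>den\<close>: beyond \<open>m\<close> one factor
  |\<xi>_j| of each summand is replaced by the next loading, which leaves \<open>num\<close>, at
  most k_u B / 2. So B^2 is at most H^2 plus a multiple of B, and \<open>quadratic_bound\<close>
  solves for B.\<close>

lemma sqrt_den_le_trade:
  assumes z: "0 \<le> z" and m: "m \<le> p" and r: "num \<xi> z / sqrt (den \<xi> z) \<le> real k\<^sub>u / 2"
  shows "sqrt (den \<xi> z) \<le> trade k\<^sub>u \<xi> m"
proof -
  note Kp = K_le[OF \<xi>]
  define B where "B = sqrt (den \<xi> z)"
  have B: "0 < B" "B\<^sup>2 = den \<xi> z" using den_pos[OF \<xi>, of z] by (auto simp: B_def)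
  have numB: "num \<xi> z \<le> real k\<^sub>u / 2 * B" using r B(1) by (simp add: B_def divide_le_eq)
  have e1: "exp (- z / (\<xi> $ j)\<^sup>2) \<le> 1" for j using z by simp
  have "den \<xi> z \<le> (\<Sum>j<K'. (if j < m then (\<xi> $ j)\<^sup>2 else 0) + next_abs \<xi> m * (\<bar>\<xi> $ j\<bar> * exp (- z / (\<xi> $ j)\<^sup>2)))"
    unfolding den_def
  proof (rule sum_mono)
    fix j assume "j \<in> {..<K'}"
    then have j: "j < p" using Kp by simp
    show "(\<xi> $ j)\<^sup>2 * exp (- z / (\<xi> $ j)\<^sup>2) \<le> (if j < m then (\<xi> $ j)\<^sup>2 else 0) + next_abs \<xi> m * (\<bar>\<xi> $ j\<bar> * exp (- z / (\<xi> $ j)\<^sup>2))"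
    proof (cases "j < m")
      case True
      have "(\<xi> $ j)\<^sup>2 * exp (- z / (\<xi> $ j)\<^sup>2) \<le> (\<xi> $ j)\<^sup>2 * 1" using e1 by (intro mult_left_mono) auto
      moreover have "0 \<le> next_abs \<xi> m * (\<bar>\<xi> $ j\<bar> * exp (- z / (\<xi> $ j)\<^sup>2))"
        using next_abs_nonneg[of \<xi> m] by simp
      ultimately show ?thesis using True by simp
    next
      case False
      then have "\<bar>\<xi> $ j\<bar> * (\<bar>\<xi> $ j\<bar> * exp (- z / (\<xi> $ j)\<^sup>2)) \<le> next_abs \<xi> m * (\<bar>\<xi> $ j\<bar> * exp (- z / (\<xi> $ j)\<^sup>2))"
        using next_abs_ge[of m j] j by (intro mult_right_mono) auto
      moreover have "(\<xi> $ j)\<^sup>2 * e = \<bar>\<xi> $ j\<bar> * (\<bar>\<xi> $ j\<bar> * e)" for e by (simp add: power2_eq_square)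
      moreover have "(if j < m then (\<xi> $ j)\<^sup>2 else 0) = 0" using False by simp
      ultimately show ?thesis by (simp only: add_0)
    qed
  qed
  also have "\<dots> = (\<Sum>j<K'. if j < m then (\<xi> $ j)\<^sup>2 else 0) + next_abs \<xi> m * num \<xi> z"
    by (simp add: sum.distrib sum_distrib_left num_def)
  also have "(\<Sum>j<K'. if j < m then (\<xi> $ j)\<^sup>2 else 0) \<le> (H_load (real m) \<xi>)\<^sup>2"
  proof -
    have "(\<Sum>j<K'. if j < m then (\<xi> $ j)\<^sup>2 else 0) \<le> (\<Sum>j<p. if j < m then (\<xi> $ j)\<^sup>2 else 0)"
      using Kp by (intro sum_mono2) auto
    also have "\<dots> = (H_load (real m) \<xi>)\<^sup>2"
      unfolding H_load_sq[OF loading_carrier[OF \<xi>]] using m by (intro sum.mono_neutral_cong_right) auto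
    finally show ?thesis .
  qed
  also have "next_abs \<xi> m * num \<xi> z \<le> next_abs \<xi> m * (real k\<^sub>u / 2 * B)"
    using numB next_abs_nonneg by (intro mult_left_mono) auto
  also have "\<dots> \<le> (next_abs \<xi> m * real k\<^sub>u) * B"
    using next_abs_nonneg[of \<xi> m] B(1) by simp
  finally have "B\<^sup>2 \<le> (H_load (real m) \<xi>)\<^sup>2 + (next_abs \<xi> m * real k\<^sub>u) * B" unfolding B(2) by simp
  then show ?thesis unfolding trade_def B_def[symmetric]
    by (rule quadratic_bound[rotated 3]) (use B(1) next_abs_nonneg[of \<xi> m] H_load_nonneg[of "real m" \<xi>] in simp_all)
qed

text \<open>Cut where the loadings drop below \<open>lam\<close>: the next one then costs at most
  \<open>lam * k\<^sub>u\<close>, and each nonzero loading before the cut keeps weight at least exp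
  (-1), hence at least 1 / 4, in the second summand of \<open>nu1\<close>.\<close>

lemma trade_le_nu1: "\<exists>m\<le>p. trade k\<^sub>u \<xi> m \<le> 2 * nu1 k\<^sub>u \<xi>"
proof -
  let ?l = "lam k\<^sub>u \<xi>"
  define B where "B = sqrt (den \<xi> (?l\<^sup>2))"
  have B: "0 \<le> B" "B\<^sup>2 = den \<xi> (?l\<^sup>2)" using den_pos[OF \<xi>, of "?l\<^sup>2"] by (auto simp: B_def)
  \<comment> \<open>The alternative m = p makes the minimum exist, notably when \<open>lam\<close>
    is 0 and no loading lies below it.\<close>
  define m where "m = (LEAST m. m = p \<or> \<bar>\<xi> $ m\<bar> < ?l)"
  have mp: "m = p \<or> \<bar>\<xi> $ m\<bar> < ?l" unfolding m_def by (rule LeastI[of _ p]) simp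
  have m: "m \<le> p" unfolding m_def by (rule Least_le) simp
  have ge: "?l \<le> \<bar>\<xi> $ j\<bar>" if "j < m" for j
    using not_less_Least[OF that[unfolded m_def]] by auto
  have dim: "dim_vec \<xi> = p" using loading_carrier[OF \<xi>] by simp
  have nx: "next_abs \<xi> m \<le> ?l" using mp m lam_nonneg[of k\<^sub>u \<xi>] by (auto simp: next_abs_def dim)
  have "(H_load (real m) \<xi>)\<^sup>2 = (\<Sum>j<m. (\<xi> $ j)\<^sup>2)" using m by (simp add: H_load_sq[OF loading_carrier[OF \<xi>]] min_def)
  \<comment> \<open>When \<open>lam\<close> is 0 the cut may lie beyond the support; the zero
    loadings there are dropped before dividing by their squares.\<close>
  also have "\<dots> = (\<Sum>j<min m K'. (\<xi> $ j)\<^sup>2)"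
    using m loading_support(4)[OF \<xi>] by (intro sum.mono_neutral_right) auto
  also have "\<dots> \<le> (\<Sum>j<min m K'. 4 * ((\<xi> $ j)\<^sup>2 * exp (- ?l\<^sup>2 / (\<xi> $ j)\<^sup>2)))"
  proof (rule sum_mono)
    fix j assume "j \<in> {..<min m K'}"
    then have j: "j < m" "j < K'" by auto
    have nz: "0 < (\<xi> $ j)\<^sup>2" using loading_support(3)[OF \<xi> j(2)] by simp
    have "?l\<^sup>2 \<le> (\<xi> $ j)\<^sup>2" using power_mono[OF ge[OF j(1)] lam_nonneg, of 2] by simp
    then have "- 1 \<le> - ?l\<^sup>2 / (\<xi> $ j)\<^sup>2" using nz by (simp add: le_divide_eq)
    then have "exp (- 1) \<le> exp (- ?l\<^sup>2 / (\<xi> $ j)\<^sup>2)" by simp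
    moreover have "1 \<le> 4 * exp (- 1 :: real)"
    proof -
      have "exp 1 \<le> (4::real)" using exp_le by simp
      then show ?thesis by (simp add: exp_minus field_simps)
    qed
    ultimately have "1 \<le> 4 * exp (- ?l\<^sup>2 / (\<xi> $ j)\<^sup>2)" by linarith
    then have "(\<xi> $ j)\<^sup>2 * 1 \<le> (\<xi> $ j)\<^sup>2 * (4 * exp (- ?l\<^sup>2 / (\<xi> $ j)\<^sup>2))" by (intro mult_left_mono) auto
    then show "(\<xi> $ j)\<^sup>2 \<le> 4 * ((\<xi> $ j)\<^sup>2 * exp (- ?l\<^sup>2 / (\<xi> $ j)\<^sup>2))" by (simp add: mult_ac)
  qed
  also have "\<dots> \<le> (\<Sum>j<K'. 4 * ((\<xi> $ j)\<^sup>2 * exp (- ?l\<^sup>2 / (\<xi> $ j)\<^sup>2)))"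
    by (intro sum_mono2) auto
  also have "\<dots> = (2 * B)\<^sup>2" by (simp add: B(2) power_mult_distrib den_def sum_distrib_left)
  finally have "H_load (real m) \<xi> \<le> 2 * B" by (rule power2_le_imp_le) (use B(1) in simp)
  moreover have "next_abs \<xi> m * real k\<^sub>u \<le> ?l * real k\<^sub>u" using nx by (intro mult_right_mono) auto
  moreover have "0 \<le> ?l * real k\<^sub>u" using lam_nonneg[of k\<^sub>u \<xi>] by simp
  ultimately have "trade k\<^sub>u \<xi> m \<le> 2 * nu1 k\<^sub>u \<xi>" unfolding trade_def nu1_eq B_def[symmetric] by (simp add: algebra_simps)
  then show ?thesis using m by blast
qed

text \<open>If \<open>lam\<close> exceeds the loadings beyond \<open>m\<close> by the factor 2 sqrt
  (log p), their weights are at most p^-4 and they barely count in the equation for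
  \<open>zeta\<close>, which says that \<open>num\<close> is k_u B / 2. The head costs at most H B /
  \<open>lam\<close>, the tail at most B / 2; multiplying by \<open>lam\<close> and using k_u at
  least 2 absorbs the tail.\<close>

lemma lam_le_trade:
  assumes k: "2 \<le> k\<^sub>u" and p: "3 \<le> p" and m: "m \<le> p" and pos: "0 < zeta k\<^sub>u \<xi>"
    and big: "2 * sqrt (ln (real p)) * next_abs \<xi> m < lam k\<^sub>u \<xi>"
  shows "lam k\<^sub>u \<xi> * real k\<^sub>u \<le> 4 * H_load (real m) \<xi>"
proof -
  let ?l = "lam k\<^sub>u \<xi>" and ?z = "zeta k\<^sub>u \<xi>"
  note Kp = K_le[OF \<xi>] and nz = nz[OF \<xi>]
  have l: "0 < ?l" "?l\<^sup>2 = ?z" using pos by (auto simp: lam_def)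
  have lp: "0 \<le> ln (real p)" using p by simp
  define B where "B = sqrt (den \<xi> ?z)"
  have B: "0 < B" "B\<^sup>2 = den \<xi> ?z" using den_pos[OF \<xi>, of ?z] by (auto simp: B_def)
  have numB: "num \<xi> ?z = real k\<^sub>u / 2 * B"
    using zeta_eq[OF \<xi>, of k\<^sub>u] k B(1) by (simp add: B_def divide_eq_eq)
  let ?e = "\<lambda>j. exp (- ?z / (\<xi> $ j)\<^sup>2)"
  have x0: "0 < \<bar>\<xi> $ 0\<bar>" using loading_first[OF \<xi>] by simp
  have K0: "0 < K'" by (rule K_pos[OF \<xi>])
  \<comment> \<open>The tail is negligible only relative to \<open>B\<close>, so \<open>B\<close>
    must not be tiny: the equation for \<open>zeta\<close> and the decay bound keep the square root
    of the weight of the largest loading above 1 / p.\<close>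
  have Bge: "\<bar>\<xi> $ 0\<bar> / real p \<le> B"
  proof -
    let ?d = "exp (- ?z / (2 * (\<xi> $ 0)\<^sup>2))"
    have "real k\<^sub>u / 2 * B \<le> sqrt (real K') * ?d * B"
      using num_le_decay[OF \<xi>, of ?z] pos unfolding numB B_def by simp
    then have "real k\<^sub>u / 2 \<le> sqrt (real K') * ?d" using B(1) by (simp add: mult_le_cancel_right)
    then have "1 \<le> sqrt (real K') * ?d" using k by (simp add: order_trans[of 1 "real k\<^sub>u / 2"])
    also have "\<dots> \<le> real p * ?d"
    proof (intro mult_right_mono)
      have "real K' \<le> real p * real p" using Kp p by (metis le_square of_nat_le_iff of_nat_mult order_trans)
      then show "sqrt (real K') \<le> real p" by (intro real_le_lsqrt) (auto simp: power2_eq_square)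
    qed simp
    finally have d: "1 / real p \<le> ?d" using p by (simp add: divide_le_eq mult.commute)
    have "(\<bar>\<xi> $ 0\<bar> * ?d)\<^sup>2 = (\<xi> $ 0)\<^sup>2 * ?e 0"
      by (simp add: power_mult_distrib flip: exp_double)
    also have "\<dots> \<le> B\<^sup>2" unfolding B(2) den_def using K0 by (intro member_le_sum[of 0 "{..<K'}" "\<lambda>j. (\<xi> $ j)\<^sup>2 * ?e j"]) auto
    finally have "\<bar>\<xi> $ 0\<bar> * ?d \<le> B" by (rule power2_le_imp_le) (use B(1) in simp)
    moreover have "\<bar>\<xi> $ 0\<bar> * (1 / real p) \<le> \<bar>\<xi> $ 0\<bar> * ?d" using d by (intro mult_left_mono) auto
    ultimately show ?thesis by simp
  qed
  let ?h = "\<lambda>j. if j < m then \<bar>\<xi> $ j\<bar> * (?l * ?e j) else 0"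
  have split: "?l * num \<xi> ?z \<le> (\<Sum>j<K'. ?h j) + (\<Sum>j<K'. ?l * \<bar>\<xi> $ 0\<bar> / real p ^ 4)"
    unfolding num_def sum_distrib_left sum.distrib[symmetric]
  proof (rule sum_mono)
    fix j assume "j \<in> {..<K'}"
    then have j: "j < K'" by simp
    show "?l * (\<bar>\<xi> $ j\<bar> * ?e j) \<le> ?h j + ?l * \<bar>\<xi> $ 0\<bar> / real p ^ 4"
    proof (cases "j < m")
      case True
      then show ?thesis using l(1) by (simp add: mult_ac)
    next
      case False
      have xj: "0 < \<bar>\<xi> $ j\<bar>" using nz[OF j] by simp
      have "2 * sqrt (ln (real p)) * \<bar>\<xi> $ j\<bar> \<le> 2 * sqrt (ln (real p)) * next_abs \<xi> m"
        using False j Kp next_abs_ge[of m j] lp by (intro mult_left_mono) auto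
      then have "2 * sqrt (ln (real p)) * \<bar>\<xi> $ j\<bar> \<le> ?l" using big by linarith
      then have "(2 * sqrt (ln (real p)) * \<bar>\<xi> $ j\<bar>)\<^sup>2 \<le> ?l\<^sup>2" using lp by (intro power_mono) auto
      then have "4 * ln (real p) * (\<xi> $ j)\<^sup>2 \<le> ?z" using lp by (simp add: power_mult_distrib l(2))
      then have "4 * ln (real p) \<le> ?z / (\<xi> $ j)\<^sup>2" using xj by (simp add: le_divide_eq)
      then have "?e j \<le> exp (- (real 4 * ln (real p)))" by simp
      also have "\<dots> = 1 / real p ^ 4" using p by (intro exp_ln_mult) simp
      finally have "\<bar>\<xi> $ j\<bar> * ?e j \<le> \<bar>\<xi> $ 0\<bar> * (1 / real p ^ 4)"
        using loading_mono[OF \<xi>, of 0 j] j Kp by (intro mult_mono) auto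
      then have "?l * (\<bar>\<xi> $ j\<bar> * ?e j) \<le> ?l * (\<bar>\<xi> $ 0\<bar> * (1 / real p ^ 4))" using l(1) by (intro mult_left_mono) auto
      then show ?thesis using False by simp
    qed
  qed
  \<comment> \<open>Cauchy-Schwarz with \<open>lam\<close> attached to the weights: y exp (-y) at
    most 1, for y = \<open>zeta\<close> / \<xi>_j^2, trades \<open>lam\<close> squared times one
    copy of the weight for \<xi>_j^2, which reassembles B^2.\<close>
  have head: "(\<Sum>j<K'. ?h j) \<le> H_load (real m) \<xi> * B"
  proof -
    have "(\<Sum>j<K'. ?h j) = (\<Sum>j<K'. (if j < m then \<bar>\<xi> $ j\<bar> else 0) * (?l * ?e j))"
      by (intro sum.cong) auto
    also have "\<dots> \<le> \<bar>\<dots>\<bar>" by simp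
    also have "\<dots> \<le> sqrt ((\<Sum>j<K'. (if j < m then \<bar>\<xi> $ j\<bar> else 0)\<^sup>2) * (\<Sum>j<K'. (?l * ?e j)\<^sup>2))"
      using real_sqrt_le_mono[OF Cauchy_Schwarz_ineq_sum[of "\<lambda>j. if j < m then \<bar>\<xi> $ j\<bar> else 0" "\<lambda>j. ?l * ?e j" "{..<K'}"]] by simp
    also have "\<dots> \<le> sqrt ((H_load (real m) \<xi>)\<^sup>2 * B\<^sup>2)"
    proof (intro real_sqrt_le_mono mult_mono sum_nonneg)
      have "(\<Sum>j<K'. (if j < m then \<bar>\<xi> $ j\<bar> else 0)\<^sup>2) \<le> (\<Sum>j<p. (if j < m then \<bar>\<xi> $ j\<bar> else 0)\<^sup>2)"
        using Kp by (intro sum_mono2) auto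
      also have "\<dots> = (H_load (real m) \<xi>)\<^sup>2"
        unfolding H_load_sq[OF loading_carrier[OF \<xi>]] using m by (intro sum.mono_neutral_cong_right) auto
      finally show "(\<Sum>j<K'. (if j < m then \<bar>\<xi> $ j\<bar> else 0)\<^sup>2) \<le> (H_load (real m) \<xi>)\<^sup>2" .
      show "(\<Sum>j<K'. (?l * ?e j)\<^sup>2) \<le> B\<^sup>2"
        unfolding B(2) den_def
      proof (rule sum_mono)
        fix j assume "j \<in> {..<K'}"
        then have xj: "0 < (\<xi> $ j)\<^sup>2" using nz by simp
        define y where "y = ?z / (\<xi> $ j)\<^sup>2"
        have "(?l * ?e j)\<^sup>2 = ?z * (?e j * ?e j)" by (simp add: power_mult_distrib l(2) power2_eq_square[of "exp _"])
        also have "\<dots> = (\<xi> $ j)\<^sup>2 * ?e j * (y * exp (- y))" using xj by (simp add: y_def)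
        also have "\<dots> \<le> (\<xi> $ j)\<^sup>2 * ?e j * 1" by (intro mult_left_mono sq_mult_exp_le_one) auto
        finally show "(?l * ?e j)\<^sup>2 \<le> (\<xi> $ j)\<^sup>2 * ?e j" by simp
      qed
    qed auto
    also have "\<dots> = H_load (real m) \<xi> * B" using B(1) H_load_nonneg[of "real m" \<xi>] by (simp add: real_sqrt_mult)
    finally show ?thesis .
  qed
  have tail: "(\<Sum>j<K'. ?l * \<bar>\<xi> $ 0\<bar> / real p ^ 4) \<le> ?l / 2 * B"
  proof -
    have "(\<Sum>j<K'. ?l * \<bar>\<xi> $ 0\<bar> / real p ^ 4) = real K' * (?l * \<bar>\<xi> $ 0\<bar> / real p ^ 4)" by simp
    also have "\<dots> \<le> real p * (?l * \<bar>\<xi> $ 0\<bar> / real p ^ 4)" using Kp l(1) by (intro mult_right_mono) auto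
    also have "\<dots> = ?l * (\<bar>\<xi> $ 0\<bar> / real p) * (1 / real p ^ 2)" using p by (simp add: eval_nat_numeral)
    also have "\<dots> \<le> ?l * B * (1 / 2)"
    proof (intro mult_mono)
      have "2 * 1 \<le> real p * real p" using p by (intro mult_mono) auto
      then show "1 / (real p)\<^sup>2 \<le> 1 / 2" using p by (simp add: power2_eq_square field_simps)
    qed (use Bge l(1) B(1) x0 in auto)
    finally show ?thesis by simp
  qed
  have "?l * (real k\<^sub>u / 2 * B) \<le> (H_load (real m) \<xi> + ?l / 2) * B"
    using split head tail unfolding numB by (simp add: algebra_simps)
  then have "(?l * real k\<^sub>u / 2) * B \<le> (H_load (real m) \<xi> + ?l / 2) * B" by (simp add: mult_ac)
  then have "?l * real k\<^sub>u / 2 \<le> H_load (real m) \<xi> + ?l / 2" using B(1) by (simp add: mult_le_cancel_right)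
  moreover have "?l * 2 \<le> ?l * real k\<^sub>u" using k l(1) by (intro mult_left_mono) auto
  ultimately show ?thesis by linarith
qed

text \<open>For positive \<open>zeta\<close>, either \<open>lam_le_trade\<close> applies or
  \<open>lam\<close> is within 2 sqrt (log p) of the next loading. Otherwise \<open>lam\<close> is
  0, and monotonicity of the ratio gives the inequality at 0 that \<open>sqrt_den_le_trade\<close>
  needs.\<close>

lemma nu1_le_trade:
  assumes k: "2 \<le> k\<^sub>u" and p: "3 \<le> p" and lp: "1 \<le> ln (real p)" and m: "m \<le> p"
  shows "nu1 k\<^sub>u \<xi> \<le> 5 * sqrt (ln (real p)) * trade k\<^sub>u \<xi> m"
proof -
  let ?L = "sqrt (ln (real p))" and ?T = "trade k\<^sub>u \<xi> m"
  have L1: "1 \<le> ?L" using lp by simp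
  have T0: "0 \<le> ?T" by (rule trade_nonneg)
  have T1: "?T \<le> ?L * ?T" using L1 T0 by (simp add: mult_le_cancel_right1)
  have k1: "1 \<le> k\<^sub>u" using k by simp
  note H0 = H_load_nonneg[of "real m" \<xi>] and N0 = next_abs_nonneg[of \<xi> m]
  show ?thesis
  proof (cases "0 < zeta k\<^sub>u \<xi>")
    case True
    then have l2: "(lam k\<^sub>u \<xi>)\<^sup>2 = zeta k\<^sub>u \<xi>" by (simp add: lam_def)
    have B: "sqrt (den \<xi> ((lam k\<^sub>u \<xi>)\<^sup>2)) \<le> ?T"
      unfolding l2 using True m zeta_eq[OF \<xi> k1] by (intro sqrt_den_le_trade) auto
    have "lam k\<^sub>u \<xi> * real k\<^sub>u \<le> 4 * (?L * ?T)"
    proof (cases "2 * ?L * next_abs \<xi> m < lam k\<^sub>u \<xi>")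
      case big: True
      have "lam k\<^sub>u \<xi> * real k\<^sub>u \<le> 4 * H_load (real m) \<xi>" by (rule lam_le_trade[OF k p m True big])
      also have "\<dots> \<le> 4 * ?T" using N0 by (simp add: trade_def)
      finally show ?thesis using T1 by linarith
    next
      case False
      then have "lam k\<^sub>u \<xi> * real k\<^sub>u \<le> 2 * ?L * next_abs \<xi> m * real k\<^sub>u" by (intro mult_right_mono) auto
      also have "\<dots> = 2 * (?L * (next_abs \<xi> m * real k\<^sub>u))" by simp
      also have "\<dots> \<le> 2 * (?L * ?T)" using H0 lp by (intro mult_left_mono) (auto simp: trade_def)
      also have "\<dots> \<le> 4 * (?L * ?T)" using T0 lp by simp
      finally show ?thesis .
    qed
    then show ?thesis unfolding nu1_eq using B T1 by linarith
  next
    case False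
    then have l0: "lam k\<^sub>u \<xi> = 0" by (simp add: lam_def)
    have "num \<xi> 0 / sqrt (den \<xi> 0) \<le> real k\<^sub>u / 2"
    proof (cases "zeta k\<^sub>u \<xi> = 0")
      case True
      then show ?thesis using zeta_eq[OF \<xi> k1] by simp
    next
      case ne: False
      with False have "zeta k\<^sub>u \<xi> < 0" by simp
      from ratio_antimono[OF \<xi> this] show ?thesis using zeta_eq[OF \<xi> k1] by linarith
    qed
    then have "sqrt (den \<xi> 0) \<le> ?T" using m by (intro sqrt_den_le_trade) auto
    then show ?thesis unfolding nu1_eq l0 using T0 T1 by simp
  qed
qed

text \<open>Up to k_u^2 a level is sqrt j times the j-th loading, so squared loadings are at most
  R^2 / j and sum harmonically to R^2 times a logarithm. Beyond it the level is k_u times the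
  loading, which is the second summand of \<open>trade\<close>.\<close>

lemma trade_le_levels:
  assumes k: "1 \<le> k\<^sub>u" and p: "1 \<le> ln (real p)" and R: "\<And>m. 1 \<le> m \<Longrightarrow> m \<le> p \<Longrightarrow> level k\<^sub>u \<xi> m \<le> R"
  shows "\<exists>m\<le>p. trade k\<^sub>u \<xi> m \<le> 3 * sqrt (ln (real p)) * R"
proof -
  have p0: "0 < p" using loading_first[OF \<xi>] by simp
  have dim: "dim_vec \<xi> = p" using loading_carrier[OF \<xi>] by simp
  have R0: "0 \<le> R" using R[of 1] p0 by (auto simp: level_def intro: order_trans[rotated])
  \<comment> \<open>The index where sqrt m reaches k_u, so that the minimum in \<open>level\<close>
    changes branch.\<close>
  define m where "m = min (k\<^sub>u\<^sup>2) p"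
  have m: "m \<le> p" "0 < m" using k p0 by (auto simp: m_def)
  have "(H_load (real m) \<xi>)\<^sup>2 = (\<Sum>j<m. (\<xi> $ j)\<^sup>2)" using m by (simp add: H_load_sq[OF loading_carrier[OF \<xi>]] min_def)
  also have "\<dots> \<le> (\<Sum>j<m. R\<^sup>2 * (1 / real (Suc j)))"
  proof (rule sum_mono)
    fix j assume "j \<in> {..<m}"
    then have j: "Suc j \<le> k\<^sub>u\<^sup>2" "Suc j \<le> p" by (auto simp: m_def)
    have "sqrt (real (Suc j)) \<le> real k\<^sub>u"
      using j(1) by (intro real_le_lsqrt) (auto simp flip: of_nat_power simp del: of_nat_Suc)
    then have "sqrt (real (Suc j)) * \<bar>\<xi> $ j\<bar> \<le> R" using R[of "Suc j"] j(2) by (simp add: level_def min_def del: of_nat_Suc split: if_splits)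
    then have "(sqrt (real (Suc j)) * \<bar>\<xi> $ j\<bar>)\<^sup>2 \<le> R\<^sup>2" by (intro power_mono) auto
    then have "real (Suc j) * (\<xi> $ j)\<^sup>2 \<le> R\<^sup>2" by (simp add: power_mult_distrib del: of_nat_Suc)
    then show "(\<xi> $ j)\<^sup>2 \<le> R\<^sup>2 * (1 / real (Suc j))" by (simp add: le_divide_eq mult.commute del: of_nat_Suc)
  qed
  also have "\<dots> = R\<^sup>2 * (\<Sum>j<m. 1 / real (Suc j))" by (simp add: sum_distrib_left)
  also have "\<dots> \<le> R\<^sup>2 * (4 * ln (real p))"
  proof (intro mult_left_mono)
    have "ln (real m) \<le> ln (real p)" using m by simp
    then show "(\<Sum>j<m. 1 / real (Suc j)) \<le> 4 * ln (real p)" using harmonic_le[OF m(2)] p by linarith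
  qed simp
  also have "\<dots> = (2 * sqrt (ln (real p)) * R)\<^sup>2" using p by (simp add: power_mult_distrib mult_ac)
  finally have H: "H_load (real m) \<xi> \<le> 2 * sqrt (ln (real p)) * R"
    by (rule power2_le_imp_le) (use p R0 in simp)
  have N: "next_abs \<xi> m * real k\<^sub>u \<le> R"
  proof (cases "m < p")
    case True
    then have mk: "m = k\<^sub>u\<^sup>2" by (simp add: m_def min_def split: if_splits)
    have "real k\<^sub>u \<le> sqrt (real (Suc m))" unfolding mk by (intro real_le_rsqrt) simp
    then have "real k\<^sub>u * \<bar>\<xi> $ m\<bar> \<le> R" using R[of "Suc m"] True by (simp add: level_def min_def del: of_nat_Suc split: if_splits)
    then show ?thesis using True by (simp add: next_abs_def dim mult.commute)
  next
    case False
    then show ?thesis using R0 by (simp add: next_abs_def dim)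
  qed
  have "1 * R \<le> sqrt (ln (real p)) * R" using p R0 by (intro mult_right_mono) auto
  then have "trade k\<^sub>u \<xi> m \<le> 3 * sqrt (ln (real p)) * R" unfolding trade_def using H N by linarith
  then show ?thesis using m by blast
qed

end

lemma rate_le_trade:
  assumes "1 \<le> ln (real p)"
  shows "rate n p k\<^sub>u \<xi> m \<le> ln (real p) * (trade k\<^sub>u \<xi> m / sqrt (real n))"
proof -
  let ?L = "ln (real p)" and ?n = "sqrt (real n)"
  have "sqrt ?L \<le> ?L" using assms by (intro real_le_lsqrt) (auto simp: power2_eq_square)
  then have "next_abs \<xi> m * real k\<^sub>u * (sqrt ?L / ?n) \<le> next_abs \<xi> m * real k\<^sub>u * (?L / ?n)"
    using next_abs_nonneg[of \<xi> m] by (intro mult_left_mono divide_right_mono) auto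
  moreover have "1 * (H_load (real m) \<xi> / ?n) \<le> ?L * (H_load (real m) \<xi> / ?n)"
    using assms H_load_nonneg[of "real m" \<xi>] by (intro mult_right_mono) auto
  ultimately show ?thesis
    by (simp add: rate_def trade_def real_sqrt_divide add_divide_distrib distrib_left mult_ac)
qed

section \<open>Assembly along the sequence\<close>

theorem theorem5:
  fixes M\<^sub>1 M\<^sub>2 \<alpha> \<eta> \<gamma> :: real
  assumes "M\<^sub>1 > 1" and "M\<^sub>2 > 0"
    and "0 < \<alpha>" and "\<alpha> < 1" and "0 < \<eta>" and "\<eta> < 1" and "\<alpha> + \<eta> < 1"
    and "0 \<le> \<gamma>" and "\<gamma> < 1 / 2"
  shows "\<exists>c::real. c > 0 \<and>
    (\<forall>n p k\<^sub>u :: nat \<Rightarrow> nat.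
       filterlim n at_top sequentially \<and> filterlim p at_top sequentially \<and>
       filterlim k\<^sub>u at_top sequentially \<and>
       (\<lambda>i. ereal (real (k\<^sub>u i))) \<lesssim> (\<lambda>i. ereal (real (p i) powr \<gamma>)) \<and>
       (\<forall>\<^sub>F i in sequentially. real (n i) \<ge> c * real (k\<^sub>u i) * ln (real (p i))) \<longrightarrow>
       (\<forall>(k :: nat \<Rightarrow> nat) (\<xi> :: nat \<Rightarrow> real Matrix.vec) (t\<^sub>0 :: nat \<Rightarrow> real) (\<Sigma>\<^sub>0 :: nat \<Rightarrow> real mat).
          (\<forall>i. 1 \<le> k i \<and> k i \<le> k\<^sub>u i \<and> is_loading (p i) (\<xi> i) \<and>
               \<Sigma>\<^sub>0 i \<in> carrier_mat (p i) (p i) \<and> transpose_mat (\<Sigma>\<^sub>0 i) = \<Sigma>\<^sub>0 i \<and>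
               1 / M\<^sub>1 \<le> lambda_min (\<Sigma>\<^sub>0 i) \<and> lambda_min (\<Sigma>\<^sub>0 i) \<le> lambda_max (\<Sigma>\<^sub>0 i) \<and>
               lambda_max (\<Sigma>\<^sub>0 i) \<le> M\<^sub>1) \<longrightarrow>
          (\<lambda>i. tau_adap M\<^sub>2 \<alpha> \<eta> (n i) (p i) (t\<^sub>0 i) (k\<^sub>u i) (k i) (\<Sigma>\<^sub>0 i) (\<xi> i))
            \<lesssim> (\<lambda>i. ereal (upper_rate (n i) (p i) (k\<^sub>u i) (\<xi> i))) \<and>
          ((\<forall>i. diagonal_mat (\<Sigma>\<^sub>0 i)) \<longrightarrow>
             asymp_log p
               (\<lambda>i. tau_adap M\<^sub>2 \<alpha> \<eta> (n i) (p i) (t\<^sub>0 i) (k\<^sub>u i) (k i) (\<Sigma>\<^sub>0 i) (\<xi> i))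
               (\<lambda>i. ereal (nu1 (k\<^sub>u i) (\<xi> i) / sqrt (real (n i)))))))"
proof -
  note M = \<open>M\<^sub>1 > 1\<close> and s0 = \<open>M\<^sub>2 > 0\<close>
  obtain C P where C: "0 < C" and upper:
    "\<And>p n k\<^sub>u k \<xi> S t\<^sub>0. P \<le> real p \<Longrightarrow> 1 \<le> k\<^sub>u \<Longrightarrow> 2 * k\<^sub>u \<le> p \<Longrightarrow> k \<le> k\<^sub>u \<Longrightarrow>
      600 * real k\<^sub>u * ln (real p) \<le> real n \<Longrightarrow> is_loading p \<xi> \<Longrightarrow> S \<in> carrier_mat p p \<Longrightarrow> transpose_mat S = S \<Longrightarrow>
      1 / M\<^sub>1 \<le> lambda_min S \<Longrightarrow> lambda_max S \<le> M\<^sub>1 \<Longrightarrow>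
      tau_adap M\<^sub>2 \<alpha> \<eta> n p t\<^sub>0 k\<^sub>u k S \<xi> \<le> ereal (C * upper_rate n p k\<^sub>u \<xi>)"
    by (rule upper_bound[OF M s0 \<open>0 < \<alpha>\<close> \<open>0 < \<eta>\<close>]) (rule that)
  obtain c where c: "0 < c" and lower:
    "\<And>p n k\<^sub>u k \<xi> S t\<^sub>0 m. 2 \<le> k\<^sub>u \<Longrightarrow> 1 \<le> k \<Longrightarrow> k\<^sub>u \<le> n \<Longrightarrow> is_loading p \<xi> \<Longrightarrow> S \<in> carrier_mat p p \<Longrightarrow> transpose_mat S = S \<Longrightarrow>
      1 / M\<^sub>1 \<le> lambda_min S \<Longrightarrow> lambda_max S \<le> M\<^sub>1 \<Longrightarrow> diagonal_mat S \<Longrightarrow> 1 \<le> m \<Longrightarrow> m \<le> p \<Longrightarrow>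
      ereal (c * (level k\<^sub>u \<xi> m / sqrt (real n))) \<le> tau_adap M\<^sub>2 \<alpha> \<eta> n p t\<^sub>0 k\<^sub>u k S \<xi>"
    by (rule lower_bound[OF M s0 \<open>\<alpha> + \<eta> < 1\<close>]) (rule that)
  show ?thesis
  \<comment> \<open>The first half holds at least n / 3 observations, hence at least 200 k_u log p
    of them: enough for the union bound over the grid and for a bounded Euclidean error.\<close>
  proof (intro exI[of _ 600] conjI allI impI; (elim conjE)?)
    show "0 < (600 :: real)" by simp
    fix n p k\<^sub>u k :: "nat \<Rightarrow> nat" and \<xi> :: "nat \<Rightarrow> real Matrix.vec" and t\<^sub>0 :: "nat \<Rightarrow> real" and \<Sigma>\<^sub>0 :: "nat \<Rightarrow> real mat"
    assume p: "filterlim p at_top sequentially" and ku: "filterlim k\<^sub>u at_top sequentially"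
      and kg: "(\<lambda>i. ereal (real (k\<^sub>u i))) \<lesssim> (\<lambda>i. ereal (real (p i) powr \<gamma>))"
      and n: "\<forall>\<^sub>F i in sequentially. 600 * real (k\<^sub>u i) * ln (real (p i)) \<le> real (n i)"
      and H: "\<forall>i. 1 \<le> k i \<and> k i \<le> k\<^sub>u i \<and> is_loading (p i) (\<xi> i) \<and>
               \<Sigma>\<^sub>0 i \<in> carrier_mat (p i) (p i) \<and> transpose_mat (\<Sigma>\<^sub>0 i) = \<Sigma>\<^sub>0 i \<and>
               1 / M\<^sub>1 \<le> lambda_min (\<Sigma>\<^sub>0 i) \<and> lambda_min (\<Sigma>\<^sub>0 i) \<le> lambda_max (\<Sigma>\<^sub>0 i) \<and>
               lambda_max (\<Sigma>\<^sub>0 i) \<le> M\<^sub>1"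
    let ?\<tau> = "\<lambda>i. tau_adap M\<^sub>2 \<alpha> \<eta> (n i) (p i) (t\<^sub>0 i) (k\<^sub>u i) (k i) (\<Sigma>\<^sub>0 i) (\<xi> i)"
    have pr: "filterlim (\<lambda>i. real (p i)) at_top sequentially"
      using p by (rule filterlim_compose[OF filterlim_real_sequentially])
    \<comment> \<open>Since \<gamma> - 1 is negative, k_u / p tends to 0. The condition 2 k_u at
      most p relates the sparsity to the mesh of the grid.\<close>
    have half: "\<forall>\<^sub>F i in sequentially. 2 * k\<^sub>u i \<le> p i"
    proof -
      obtain D where D: "0 < D" "\<forall>\<^sub>F i in sequentially. ereal (real (k\<^sub>u i)) \<le> ereal D * ereal (real (p i) powr \<gamma>)"
        using kg unfolding lesssim_def by blast
      have "((\<lambda>x::real. 2 * D * x powr (\<gamma> - 1)) \<longlongrightarrow> 2 * D * 0) at_top"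
        using \<open>\<gamma> < 1 / 2\<close> by (intro tendsto_mult tendsto_const tendsto_neg_powr filterlim_ident) simp
      then have "((\<lambda>x::real. 2 * D * x powr (\<gamma> - 1)) \<longlongrightarrow> 0) at_top" by simp
      then have "\<forall>\<^sub>F x::real in at_top. 2 * D * x powr (\<gamma> - 1) < 1"
        by (rule order_tendstoD(2)) simp
      then have "\<forall>\<^sub>F i in sequentially. 2 * D * real (p i) powr (\<gamma> - 1) < 1"
        using pr by (rule eventually_compose_filterlim)
      moreover have "\<forall>\<^sub>F i in sequentially. 1 \<le> p i" using p by (simp add: filterlim_at_top)
      ultimately show ?thesis using D(2)
      proof eventually_elim
        case (elim i)
        have "2 * real (k\<^sub>u i) \<le> 2 * (D * real (p i) powr \<gamma>)" using elim(3) by simp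
        also have "real (p i) powr \<gamma> = real (p i) powr (\<gamma> - 1) * real (p i)"
          using elim(2) by (simp add: powr_diff)
        also have "2 * (D * (real (p i) powr (\<gamma> - 1) * real (p i))) = (2 * D * real (p i) powr (\<gamma> - 1)) * real (p i)"
          by simp
        also have "\<dots> \<le> 1 * real (p i)" using elim(1) by (intro mult_right_mono) auto
        finally show ?case by simp
      qed
    qed
    have ev: "\<forall>\<^sub>F i in sequentially. P \<le> real (p i) \<and> 3 \<le> p i \<and> 2 \<le> k\<^sub>u i \<and> 2 * k\<^sub>u i \<le> p i \<and>
        600 * real (k\<^sub>u i) * ln (real (p i)) \<le> real (n i)"
      using p ku pr half n by (auto simp: filterlim_at_top intro!: eventually_conj)
    have ln1: "1 \<le> ln (real q)" if "3 \<le> q" for q :: nat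
    proof -
      have "exp 1 \<le> (3::real)" using exp_le by simp
      also have "3 \<le> real q" using that by simp
      finally show ?thesis using that by (simp add: ln_ge_iff)
    qed
    have up: "\<forall>\<^sub>F i in sequentially. ?\<tau> i \<le> ereal C * ereal (upper_rate (n i) (p i) (k\<^sub>u i) (\<xi> i))"
      using ev
    proof eventually_elim
      case (elim i)
      then show ?case using H[rule_format, of i] by (simp add: upper)
    qed
    then show "?\<tau> \<lesssim> (\<lambda>i. ereal (upper_rate (n i) (p i) (k\<^sub>u i) (\<xi> i)))"
      unfolding lesssim_def using C by blast
    assume dg: "\<forall>i. diagonal_mat (\<Sigma>\<^sub>0 i)"
    let ?\<nu> = "\<lambda>i. ereal (nu1 (k\<^sub>u i) (\<xi> i) / sqrt (real (n i)))"
    \<comment> \<open>Any single m bounds the minimum, so the one from \<open>trade_le_nu1\<close>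
      is used; the logarithm comes from replacing sqrt (log p) by log p in
      \<open>rate_le_trade\<close>.\<close>
    have 1: "\<forall>\<^sub>F i in sequentially. ?\<tau> i \<le> ereal (2 * C) * (ereal (ln (real (p i)) powr 1) * ?\<nu> i)"
      using ev up
    proof eventually_elim
      case (elim i)
      have \<xi>: "is_loading (p i) (\<xi> i)" using H by blast
      have lp: "1 \<le> ln (real (p i))" using elim(1) by (intro ln1) simp
      obtain m where m: "m \<le> p i" "trade (k\<^sub>u i) (\<xi> i) m \<le> 2 * nu1 (k\<^sub>u i) (\<xi> i)" using trade_le_nu1[OF \<xi>] by blast
      have "upper_rate (n i) (p i) (k\<^sub>u i) (\<xi> i) \<le> rate (n i) (p i) (k\<^sub>u i) (\<xi> i) m" by (rule upper_rate_le[OF m(1)])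
      also have "\<dots> \<le> ln (real (p i)) * (trade (k\<^sub>u i) (\<xi> i) m / sqrt (real (n i)))" by (rule rate_le_trade[OF lp])
      also have "\<dots> \<le> ln (real (p i)) * (2 * nu1 (k\<^sub>u i) (\<xi> i) / sqrt (real (n i)))"
        using m(2) lp by (intro mult_left_mono divide_right_mono) auto
      finally have UT: "upper_rate (n i) (p i) (k\<^sub>u i) (\<xi> i) \<le> ln (real (p i)) * (2 * nu1 (k\<^sub>u i) (\<xi> i) / sqrt (real (n i)))" .
      have eq: "ereal (2 * C) * (ereal (ln (real (p i)) powr 1) * ?\<nu> i) =
          ereal (C * (ln (real (p i)) * (2 * nu1 (k\<^sub>u i) (\<xi> i) / sqrt (real (n i)))))"
        using lp by simp
      have "C * upper_rate (n i) (p i) (k\<^sub>u i) (\<xi> i) \<le> C * (ln (real (p i)) * (2 * nu1 (k\<^sub>u i) (\<xi> i) / sqrt (real (n i))))"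
        using UT C by (intro mult_left_mono) auto
      then have "ereal C * ereal (upper_rate (n i) (p i) (k\<^sub>u i) (\<xi> i)) \<le> ereal (C * (ln (real (p i)) * (2 * nu1 (k\<^sub>u i) (\<xi> i) / sqrt (real (n i)))))"
        by (simp only: times_ereal.simps ereal_less_eq)
      with elim(2) show ?case unfolding eq by (rule order_trans)
    qed
    \<comment> \<open>Two losses of sqrt (log p), with constants 5 and 3, make up the factor 15 log
      p.\<close>
    have 2: "\<forall>\<^sub>F i in sequentially. ?\<nu> i \<le> ereal (15 / c) * (ereal (ln (real (p i)) powr 1) * ?\<tau> i)"
      using ev
    proof eventually_elim
      case (elim i)
      have h: "is_loading (p i) (\<xi> i)" "1 \<le> k i" "\<Sigma>\<^sub>0 i \<in> carrier_mat (p i) (p i)" "transpose_mat (\<Sigma>\<^sub>0 i) = \<Sigma>\<^sub>0 i"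
        "1 / M\<^sub>1 \<le> lambda_min (\<Sigma>\<^sub>0 i)" "lambda_max (\<Sigma>\<^sub>0 i) \<le> M\<^sub>1" using H by blast+
      have lp: "1 \<le> ln (real (p i))" using elim by (intro ln1) simp
      have kn: "k\<^sub>u i \<le> n i"
      proof -
        have "real (k\<^sub>u i) * 1 \<le> real (k\<^sub>u i) * (600 * ln (real (p i)))" using lp by (intro mult_left_mono) auto
        also have "\<dots> = 600 * real (k\<^sub>u i) * ln (real (p i))" by simp
        also have "\<dots> \<le> real (n i)" using elim by blast
        finally have "real (k\<^sub>u i) \<le> real (n i)" by simp
        then show ?thesis by simp
      qed
      \<comment> \<open>The best level is attained at some \<open>m\<^sub>0\<close>, and the
        probabilistic lower bound is invoked at that index alone.\<close>
      define R where "R = Max (level (k\<^sub>u i) (\<xi> i) ` {1..p i})"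
      have p1: "1 \<le> p i" using elim by simp
      have "R \<in> level (k\<^sub>u i) (\<xi> i) ` {1..p i}" unfolding R_def using p1 by (intro Max_in) auto
      then obtain m\<^sub>0 where m0: "1 \<le> m\<^sub>0" "m\<^sub>0 \<le> p i" "R = level (k\<^sub>u i) (\<xi> i) m\<^sub>0" by auto
      have "level (k\<^sub>u i) (\<xi> i) m \<le> R" if "1 \<le> m" "m \<le> p i" for m
        unfolding R_def using that by (intro Max_ge) auto
      then obtain m where m: "m \<le> p i" "trade (k\<^sub>u i) (\<xi> i) m \<le> 3 * sqrt (ln (real (p i))) * R"
        using trade_le_levels[OF h(1) _ lp, of "k\<^sub>u i" R] elim by auto
      have "nu1 (k\<^sub>u i) (\<xi> i) \<le> 5 * sqrt (ln (real (p i))) * trade (k\<^sub>u i) (\<xi> i) m"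
        using elim lp m(1) by (intro nu1_le_trade[OF h(1)]) auto
      also have "\<dots> \<le> 5 * sqrt (ln (real (p i))) * (3 * sqrt (ln (real (p i))) * R)"
        using m(2) lp by (intro mult_left_mono) auto
      also have "\<dots> = 15 * (sqrt (ln (real (p i))) * sqrt (ln (real (p i)))) * R" by (simp only: mult_ac)
      also have "\<dots> = 15 * ln (real (p i)) * R" using lp by simp
      finally have "nu1 (k\<^sub>u i) (\<xi> i) / sqrt (real (n i)) \<le> 15 * ln (real (p i)) * R / sqrt (real (n i))"
        by (intro divide_right_mono) auto
      also have "\<dots> = 15 / c * (ln (real (p i)) * (c * (R / sqrt (real (n i)))))" using c by simp
      finally have "?\<nu> i \<le> ereal (15 / c) * (ereal (ln (real (p i))) * ereal (c * (R / sqrt (real (n i)))))" by simp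
      also have "\<dots> \<le> ereal (15 / c) * (ereal (ln (real (p i))) * ?\<tau> i)"
        using lower[OF _ h(2) kn h(1) h(3-6) dg[rule_format] m0(1,2), of "t\<^sub>0 i"] elim c lp unfolding m0(3)
        by (intro ereal_mult_left_mono) auto
      finally show ?case using lp by simp
    qed
    \<comment> \<open>One power of log p suffices in both directions.\<close>
    show "asymp_log p ?\<tau> ?\<nu>"
      unfolding asymp_log_def lesssim_def
      using 1 2 C c by (intro exI[of _ 1] conjI exI[of _ "2 * C"] exI[of _ "15 / c"]) auto
  qed
qed

end
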